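(* Let $k$ be a field of characteristic $p>0$, let $\mathcal{W}$ be a complete local commutative Noetherian ring with residue field $k$, let $\Gamma$ be a profinite group such that for every open subgroup $J$ of finite index in $\Gamma$ there are only finitely many continuous homomorphisms $J\to\mathbb{Z}/p$, and let $\rho:\Gamma\to\mathrm{GL}_n(k)$ be a continuous homomorphism, where $n$ is a positive integer and $\mathrm{GL}_n(k)$ has the discrete topology. Let $k'$ be a field extension of $k$, and let $\mathcal{W}'$ be a complete local commutative Noetherian ring with residue field $k'$ such that there is a local homomorphism $\mathcal{W}\to\mathcal{W}'$. Let $\rho':\Gamma\to\mathrm{GL}_n(k')$ be the composition of $\rho$ with the injection $\mathrm{GL}_n(k)\hookrightarrow\mathrm{GL}_n(k')$. Then the versal deformation ring $R_{\mathcal{W}'}(\Gamma,\rho')$ is the completion $R'$ of $\Omega=\mathcal{W}'\otimes_{\mathcal{W}}R_{\mathcal{W}}(\Gamma,\rho)$ with respect to the unique maximal ideal $\mathfrak{m}_\Omega$ of $\Omega$.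
   Context: For a complete local commutative Noetherian ring $\mathcal{W}$ with residue field $k$, let $\hat{\mathcal{C}}$ be the category of complete local commutative Noetherian $\mathcal{W}$-algebras with residue field $k$; morphisms are continuous $\mathcal{W}$-algebra homomorphisms inducing the identity on $k$. For $A\in\hat{\mathcal{C}}$ let $\mathfrak{m}_A$ be its maximal ideal and $\pi_A:A\to A/\mathfrak{m}_A=k$ the residue map; a morphism $\alpha:A\to A'$ induces a map $\mathrm{GL}_n(A)\to\mathrm{GL}_n(A')$ also denoted $\alpha$. A lift of $\rho$ over $A$ is a continuous homomorphism $\tau:\Gamma\to\mathrm{GL}_n(A)$ with $\pi_A\circ\tau=\rho$. Two lifts over $A$ are strictly equivalent if one is brought into the other by conjugation by a matrix in the kernel of $\pi_A:\mathrm{GL}_n(A)\to\mathrm{GL}_n(k)$; a deformation $[\tau]$ is a strict equivalence class of lifts, and $\mathrm{Def}_\rho(A)$ is the set of deformations of $\rho$ over $A$. A ring $R=R_{\mathcal{W}}(\Gamma,\rho)$ in $\hat{\mathcal{C}}$ is a versal deformation ring of $\rho$ if there is a lift $\nu:\Gamma\to\mathrm{GL}_n(R)$ of $\rho$ over $R$ such that (1) for every $A\in\hat{\mathcal{C}}$ the map $f_A:\mathrm{Hom}_{\hat{\mathcal{C}}}(R,A)\to\mathrm{Def}_\rho(A)$, $\alpha\mapsto[\alpha\circ\nu]$, is surjective, and (2) $f_{k[\epsilon]}$ is bijective, where $k[\epsilon]$, $\epsilon^2=0$, is the ring of dual numbers with the $\mathcal{W}$-algebra structure for which the maximal ideal of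 $\mathcal{W}$ annihilates $k[\epsilon]$. Under the stated finiteness condition on $\Gamma$ a versal deformation ring exists, and it is unique up to isomorphism. The same definitions are used for $(\mathcal{W}',k',\rho')$ in place of $(\mathcal{W},k,\rho)$.
   Formalization: Ω need not be local (k=F_p, k'=F_p(t), R=F_p[[x]]), so m_Ω is taken as the kernel of Ω→k', shown to be the only maximal ideal containing the images of the maximal ideals of W' and R; the local map W→W' is taken to induce the given inclusion k→k'. *)

theory Defs
  imports "HOL-Algebra.Algebra" "HOL-Analysis.Analysis"
begin

section \<open>Complete local Noetherian rings\<close>

definition char_is :: "('k, 'x) ring_scheme \<Rightarrow> nat \<Rightarrow> bool" where
  "char_is k p \<longleftrightarrow> (\<forall>m::nat. add_pow k m \<one>\<^bsub>k\<^esub> = \<zero>\<^bsub>k\<^esub> \<longleftrightarrow> p dvd m)"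

definition local_ring :: "('a, 'x) ring_scheme \<Rightarrow> bool" where
  "local_ring A \<longleftrightarrow> cring A \<and> (\<exists>!M. maximalideal M A)"

text \<open>Only meaningful for local rings.\<close>

definition max_ideal :: "('a, 'x) ring_scheme \<Rightarrow> 'a set" where
  "max_ideal A = (THE M. maximalideal M A)"

primrec ideal_pow :: "('a, 'x) ring_scheme \<Rightarrow> 'a set \<Rightarrow> nat \<Rightarrow> 'a set" where
  "ideal_pow A I 0 = carrier A"
| "ideal_pow A I (Suc i) = ideal_prod A I (ideal_pow A I i)"

definition adic_topology :: "('a, 'x) ring_scheme \<Rightarrow> 'a set \<Rightarrow> 'a topology" where
  "adic_topology A I =
     topology_generated_by {ideal_pow A I i +>\<^bsub>A\<^esub> a | i a. a \<in> carrier A}"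

text \<open>The inverse limit of the rings $A/I^i$. Elements of the quotients are cosets, so the transition
  map sends a coset of $I^{i+1}$ to the coset of $I^i$ that contains it.\<close>

definition adic_completion :: "('a, 'x) ring_scheme \<Rightarrow> 'a set \<Rightarrow> (nat \<Rightarrow> 'a set) ring" where
  "adic_completion A I =
     \<lparr>carrier = {f. \<forall>i. f i \<in> carrier (A Quot ideal_pow A I i) \<and> f (Suc i) \<subseteq> f i},
      monoid.mult = (\<lambda>f g i. f i \<otimes>\<^bsub>A Quot ideal_pow A I i\<^esub> g i),
      monoid.one = (\<lambda>i. \<one>\<^bsub>A Quot ideal_pow A I i\<^esub>),
      ring.zero = (\<lambda>i. \<zero>\<^bsub>A Quot ideal_pow A I i\<^esub>),
      ring.add = (\<lambda>f g i. f i \<oplus>\<^bsub>A Quot ideal_pow A I i\<^esub> g i)\<rparr>"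

definition to_completion :: "('a, 'x) ring_scheme \<Rightarrow> 'a set \<Rightarrow> 'a \<Rightarrow> nat \<Rightarrow> 'a set" where
  "to_completion A I a = (\<lambda>i. ideal_pow A I i +>\<^bsub>A\<^esub> a)"

definition adic_complete :: "('a, 'x) ring_scheme \<Rightarrow> 'a set \<Rightarrow> bool" where
  "adic_complete A I \<longleftrightarrow>
     bij_betw (to_completion A I) (carrier A) (carrier (adic_completion A I))"

text \<open>A ring together with the map onto its residue field.\<close>

record ('a, 'k) res_ring = "'a ring" +
  residue :: "'a \<Rightarrow> 'k"

text \<open>Complete local commutative Noetherian rings with residue field \<open>k\<close>. As \<open>k\<close> is a field and
  the residue map is surjective, its kernel is the maximal ideal.\<close>

definition complete_local_noetherian ::
    "('k, 'x) ring_scheme \<Rightarrow> ('a, 'k, 'y) res_ring_scheme \<Rightarrow> bool" where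
  "complete_local_noetherian k A \<longleftrightarrow>
     local_ring A \<and> noetherian_ring A \<and> adic_complete A (max_ideal A) \<and>
     residue A \<in> ring_hom A k \<and> residue A ` carrier A = carrier k"

definition local_hom :: "('a, 'x) ring_scheme \<Rightarrow> ('b, 'y) ring_scheme \<Rightarrow> ('a \<Rightarrow> 'b) set" where
  "local_hom A B = {h \<in> ring_hom A B. h ` max_ideal A \<subseteq> max_ideal B}"

section \<open>The category of coefficient algebras\<close>

record ('a, 'k, 'w) coef_alg = "('a, 'k) res_ring" +
  scalar :: "'w \<Rightarrow> 'a"

text \<open>Objects of the category $\hat{\mathcal{C}}$ attached to \<open>W\<close>. The last condition says that the
  residue field of the algebra is identified with that of \<open>W\<close> through the structure map.\<close>

definition coef_obj ::
    "('k, 'x) ring_scheme \<Rightarrow> ('w, 'k, 'y) res_ring_scheme \<Rightarrow> ('a, 'k, 'w) coef_alg \<Rightarrow> bool" where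
  "coef_obj k W A \<longleftrightarrow>
     complete_local_noetherian k A \<and> scalar A \<in> ring_hom W A \<and>
     (\<forall>w\<in>carrier W. residue A (scalar A w) = residue W w)"

text \<open>Morphisms are made extensional, so that two of them are equal iff they agree on the carrier.\<close>

definition coef_hom ::
    "('w, 'k, 'y) res_ring_scheme \<Rightarrow> ('a, 'k, 'w) coef_alg \<Rightarrow> ('b, 'k, 'w) coef_alg \<Rightarrow> ('a \<Rightarrow> 'b) set"
  where
  "coef_hom W A B =
     {\<alpha> \<in> extensional (carrier A).
        \<alpha> \<in> ring_hom A B \<and>
        (\<forall>w\<in>carrier W. \<alpha> (scalar A w) = scalar B w) \<and>
        continuous_map (adic_topology A (max_ideal A)) (adic_topology B (max_ideal B)) \<alpha> \<and>
        (\<forall>a\<in>carrier A. residue B (\<alpha> a) = residue A a)}"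

text \<open>The dual numbers $k[\epsilon]$: the pair $(a, b)$ stands for $a + b\epsilon$. The structure map
  factors through the residue map of \<open>W\<close>, i.e. the maximal ideal of \<open>W\<close> annihilates $k[\epsilon]$.\<close>

definition dual_numbers ::
    "('k, 'x) ring_scheme \<Rightarrow> ('w, 'k, 'y) res_ring_scheme \<Rightarrow> ('k \<times> 'k, 'k, 'w) coef_alg" where
  "dual_numbers k W =
     \<lparr>carrier = carrier k \<times> carrier k,
      monoid.mult = (\<lambda>(a, b) (c, d). (a \<otimes>\<^bsub>k\<^esub> c, (a \<otimes>\<^bsub>k\<^esub> d) \<oplus>\<^bsub>k\<^esub> (b \<otimes>\<^bsub>k\<^esub> c))),
      monoid.one = (\<one>\<^bsub>k\<^esub>, \<zero>\<^bsub>k\<^esub>),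
      ring.zero = (\<zero>\<^bsub>k\<^esub>, \<zero>\<^bsub>k\<^esub>),
      ring.add = (\<lambda>(a, b) (c, d). (a \<oplus>\<^bsub>k\<^esub> c, b \<oplus>\<^bsub>k\<^esub> d)),
      residue = fst,
      scalar = (\<lambda>w. (residue W w, \<zero>\<^bsub>k\<^esub>))\<rparr>"

section \<open>General linear groups\<close>

definition mat_monoid :: "nat \<Rightarrow> ('a, 'x) ring_scheme \<Rightarrow> (nat \<times> nat \<Rightarrow> 'a) monoid" where
  "mat_monoid n A =
     \<lparr>carrier = {..<n} \<times> {..<n} \<rightarrow>\<^sub>E carrier A,
      monoid.mult = (\<lambda>M N. restrict (\<lambda>(i, j). \<Oplus>\<^bsub>A\<^esub>l\<in>{..<n}. M (i, l) \<otimes>\<^bsub>A\<^esub> N (l, j))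
                        ({..<n} \<times> {..<n})),
      monoid.one = restrict (\<lambda>(i, j). if i = j then \<one>\<^bsub>A\<^esub> else \<zero>\<^bsub>A\<^esub>) ({..<n} \<times> {..<n})\<rparr>"

definition GL :: "nat \<Rightarrow> ('a, 'x) ring_scheme \<Rightarrow> (nat \<times> nat \<Rightarrow> 'a) monoid" where
  "GL n A = units_of (mat_monoid n A)"

definition GL_map :: "nat \<Rightarrow> ('a \<Rightarrow> 'b) \<Rightarrow> (nat \<times> nat \<Rightarrow> 'a) \<Rightarrow> (nat \<times> nat \<Rightarrow> 'b)" where
  "GL_map n \<alpha> M = (\<lambda>ij\<in>{..<n} \<times> {..<n}. \<alpha> (M ij))"

definition GL_topology :: "nat \<Rightarrow> ('a, 'x) ring_scheme \<Rightarrow> (nat \<times> nat \<Rightarrow> 'a) topology" where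
  "GL_topology n A =
     subtopology (product_topology (\<lambda>_. adic_topology A (max_ideal A)) ({..<n} \<times> {..<n}))
       (carrier (GL n A))"

section \<open>Profinite groups\<close>

definition profinite_group :: "('g, 'x) monoid_scheme \<Rightarrow> 'g topology \<Rightarrow> bool" where
  "profinite_group \<Gamma> T \<longleftrightarrow>
     group \<Gamma> \<and> topspace T = carrier \<Gamma> \<and>
     continuous_map (prod_topology T T) T (\<lambda>(x, y). x \<otimes>\<^bsub>\<Gamma>\<^esub> y) \<and>
     continuous_map T T (\<lambda>x. inv\<^bsub>\<Gamma>\<^esub> x) \<and>
     compact_space T \<and> Hausdorff_space T \<and>
     (\<forall>x\<in>topspace T. connected_component_of_set T x = {x})"

definition p_finite :: "('g, 'x) monoid_scheme \<Rightarrow> 'g topology \<Rightarrow> nat \<Rightarrow> bool" where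
  "p_finite \<Gamma> T p \<longleftrightarrow>
     (\<forall>J. subgroup J \<Gamma> \<and> openin T J \<and> finite (rcosets\<^bsub>\<Gamma>\<^esub> J) \<longrightarrow>
        finite {h \<in> extensional J.
                  h \<in> hom (\<Gamma>\<lparr>carrier := J\<rparr>) (integer_mod_group p) \<and>
                  continuous_map (subtopology T J)
                    (discrete_topology (carrier (integer_mod_group p))) h})"

section \<open>Lifts, deformations and versal deformation rings\<close>

definition lifts ::
    "('g, 'x) monoid_scheme \<Rightarrow> 'g topology \<Rightarrow> nat \<Rightarrow> ('g \<Rightarrow> nat \<times> nat \<Rightarrow> 'k) \<Rightarrow>
     ('a, 'k, 'y) res_ring_scheme \<Rightarrow> ('g \<Rightarrow> nat \<times> nat \<Rightarrow> 'a) set" where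
  "lifts \<Gamma> T n \<rho> A =
     {\<tau> \<in> hom \<Gamma> (GL n A).
        continuous_map T (GL_topology n A) \<tau> \<and>
        (\<forall>g\<in>carrier \<Gamma>. GL_map n (residue A) (\<tau> g) = \<rho> g)}"

definition strictly_equivalent ::
    "('k, 'z) ring_scheme \<Rightarrow> ('g, 'x) monoid_scheme \<Rightarrow> nat \<Rightarrow> ('a, 'k, 'y) res_ring_scheme \<Rightarrow>
     ('g \<Rightarrow> nat \<times> nat \<Rightarrow> 'a) \<Rightarrow> ('g \<Rightarrow> nat \<times> nat \<Rightarrow> 'a) \<Rightarrow> bool" where
  "strictly_equivalent k \<Gamma> n A \<tau> \<sigma> \<longleftrightarrow>
     (\<exists>M\<in>carrier (GL n A).
        GL_map n (residue A) M = \<one>\<^bsub>GL n k\<^esub> \<and>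
        (\<forall>g\<in>carrier \<Gamma>. \<sigma> g = M \<otimes>\<^bsub>GL n A\<^esub> \<tau> g \<otimes>\<^bsub>GL n A\<^esub> inv\<^bsub>GL n A\<^esub> M))"

definition deformation_class ::
    "('k, 'z) ring_scheme \<Rightarrow> ('g, 'x) monoid_scheme \<Rightarrow> 'g topology \<Rightarrow> nat \<Rightarrow>
     ('g \<Rightarrow> nat \<times> nat \<Rightarrow> 'k) \<Rightarrow> ('a, 'k, 'y) res_ring_scheme \<Rightarrow>
     ('g \<Rightarrow> nat \<times> nat \<Rightarrow> 'a) \<Rightarrow> ('g \<Rightarrow> nat \<times> nat \<Rightarrow> 'a) set" where
  "deformation_class k \<Gamma> T n \<rho> A \<tau> =
     {\<sigma> \<in> lifts \<Gamma> T n \<rho> A. strictly_equivalent k \<Gamma> n A \<tau> \<sigma>}"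

definition deformations ::
    "('k, 'z) ring_scheme \<Rightarrow> ('g, 'x) monoid_scheme \<Rightarrow> 'g topology \<Rightarrow> nat \<Rightarrow>
     ('g \<Rightarrow> nat \<times> nat \<Rightarrow> 'k) \<Rightarrow> ('a, 'k, 'y) res_ring_scheme \<Rightarrow>
     ('g \<Rightarrow> nat \<times> nat \<Rightarrow> 'a) set set" where
  "deformations k \<Gamma> T n \<rho> A = deformation_class k \<Gamma> T n \<rho> A ` lifts \<Gamma> T n \<rho> A"

definition push_lift ::
    "nat \<Rightarrow> ('a \<Rightarrow> 'b) \<Rightarrow> ('g \<Rightarrow> nat \<times> nat \<Rightarrow> 'a) \<Rightarrow> ('g \<Rightarrow> nat \<times> nat \<Rightarrow> 'b)" where
  "push_lift n \<alpha> \<tau> = (\<lambda>g. GL_map n \<alpha> (\<tau> g))"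

text \<open>HOL cannot quantify over all types inside a definition, so the type \<open>'u\<close> in which the test
  algebras \<open>A\<close> of condition (1) live is a parameter. The choice \<open>'u = nat \<Rightarrow> 'k\<close> loses nothing.
  Indeed, $A$ embeds into the product of the $A/\mathfrak{m}_A^i$, and each of these has finite length
  with composition factors $k$. So each is finite if $k$ is finite, and otherwise has cardinality at
  most $|k|$. Hence $|A| \le |k|^{\aleph_0}$, and $A$ is isomorphic to an algebra with carrier in
  \<open>nat \<Rightarrow> 'k\<close>.\<close>

definition versal_deformation_ring ::
    "'u itself \<Rightarrow> ('k, 'z) ring_scheme \<Rightarrow> ('w, 'k, 'y) res_ring_scheme \<Rightarrow>
     ('g, 'x) monoid_scheme \<Rightarrow> 'g topology \<Rightarrow> nat \<Rightarrow> ('g \<Rightarrow> nat \<times> nat \<Rightarrow> 'k) \<Rightarrow>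
     ('r, 'k, 'w) coef_alg \<Rightarrow> bool" where
  "versal_deformation_ring (_ :: 'u itself) k W \<Gamma> T n \<rho> R \<longleftrightarrow>
     coef_obj k W R \<and>
     (\<exists>\<nu>\<in>lifts \<Gamma> T n \<rho> R.
        (\<forall>A :: ('u, 'k, 'w) coef_alg. coef_obj k W A \<longrightarrow>
           (\<lambda>\<alpha>. deformation_class k \<Gamma> T n \<rho> A (push_lift n \<alpha> \<nu>)) ` coef_hom W R A
             = deformations k \<Gamma> T n \<rho> A) \<and>
        bij_betw
          (\<lambda>\<alpha>. deformation_class k \<Gamma> T n \<rho> (dual_numbers k W) (push_lift n \<alpha> \<nu>))
          (coef_hom W R (dual_numbers k W))
          (deformations k \<Gamma> T n \<rho> (dual_numbers k W)))"

section \<open>Completed tensor products\<close>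

text \<open>The ring $\mathbf{Z}[B \times C]$: the free abelian group on the set $B \times C$, with the biadditive
  multiplication extending $(b, c)(b', c') = (bb', cc')$.\<close>

definition pair_ring ::
    "('b, 'x) ring_scheme \<Rightarrow> ('c, 'y) ring_scheme \<Rightarrow> ('b \<times> 'c \<Rightarrow>\<^sub>0 int) ring" where
  "pair_ring B C =
     \<lparr>carrier = carrier (free_Abelian_group (carrier B \<times> carrier C)),
      monoid.mult = (\<lambda>u v. frag_extend (\<lambda>(b, c). frag_extend (\<lambda>(b', c').
                        frag_of (b \<otimes>\<^bsub>B\<^esub> b', c \<otimes>\<^bsub>C\<^esub> c')) v) u),
      monoid.one = frag_of (\<one>\<^bsub>B\<^esub>, \<one>\<^bsub>C\<^esub>),
      ring.zero = 0,
      ring.add = (+)\<rparr>"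

definition tensor_relations ::
    "('w, 'z) ring_scheme \<Rightarrow> ('b, 'x) ring_scheme \<Rightarrow> ('w \<Rightarrow> 'b) \<Rightarrow>
     ('c, 'y) ring_scheme \<Rightarrow> ('w \<Rightarrow> 'c) \<Rightarrow> ('b \<times> 'c \<Rightarrow>\<^sub>0 int) set" where
  "tensor_relations W B \<phi> C \<psi> =
     {frag_of (b \<oplus>\<^bsub>B\<^esub> b', c) - frag_of (b, c) - frag_of (b', c) | b b' c.
        b \<in> carrier B \<and> b' \<in> carrier B \<and> c \<in> carrier C} \<union>
     {frag_of (b, c \<oplus>\<^bsub>C\<^esub> c') - frag_of (b, c) - frag_of (b, c') | b c c'.
        b \<in> carrier B \<and> c \<in> carrier C \<and> c' \<in> carrier C} \<union>
     {frag_of (\<phi> w \<otimes>\<^bsub>B\<^esub> b, c) - frag_of (b, \<psi> w \<otimes>\<^bsub>C\<^esub> c) | w b c.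
        w \<in> carrier W \<and> b \<in> carrier B \<and> c \<in> carrier C}"

text \<open>The additive subgroup generated by the relations is already an ideal, so dividing by the ideal
  they generate yields the usual $B \otimes_W C$.\<close>

definition tensor_ideal ::
    "('w, 'z) ring_scheme \<Rightarrow> ('b, 'x) ring_scheme \<Rightarrow> ('w \<Rightarrow> 'b) \<Rightarrow>
     ('c, 'y) ring_scheme \<Rightarrow> ('w \<Rightarrow> 'c) \<Rightarrow> ('b \<times> 'c \<Rightarrow>\<^sub>0 int) set" where
  "tensor_ideal W B \<phi> C \<psi> = Idl\<^bsub>pair_ring B C\<^esub> (tensor_relations W B \<phi> C \<psi>)"

definition tensor_ring ::
    "('w, 'z) ring_scheme \<Rightarrow> ('b, 'x) ring_scheme \<Rightarrow> ('w \<Rightarrow> 'b) \<Rightarrow>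
     ('c, 'y) ring_scheme \<Rightarrow> ('w \<Rightarrow> 'c) \<Rightarrow> ('b \<times> 'c \<Rightarrow>\<^sub>0 int) set ring" where
  "tensor_ring W B \<phi> C \<psi> = pair_ring B C Quot tensor_ideal W B \<phi> C \<psi>"

definition pure_tensor ::
    "('w, 'z) ring_scheme \<Rightarrow> ('b, 'x) ring_scheme \<Rightarrow> ('w \<Rightarrow> 'b) \<Rightarrow>
     ('c, 'y) ring_scheme \<Rightarrow> ('w \<Rightarrow> 'c) \<Rightarrow> 'b \<Rightarrow> 'c \<Rightarrow> ('b \<times> 'c \<Rightarrow>\<^sub>0 int) set" where
  "pure_tensor W B \<phi> C \<psi> b c = tensor_ideal W B \<phi> C \<psi> +>\<^bsub>pair_ring B C\<^esub> frag_of (b, c)"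

text \<open>The map $W' \otimes_W R \to k'$, $b \otimes r \mapsto \pi_{W'}(b)\,\iota(\pi_R(r))$. It is
  defined on representatives and is constant on cosets.\<close>

definition tensor_residue ::
    "('l, 'x) ring_scheme \<Rightarrow> ('k \<Rightarrow> 'l) \<Rightarrow> ('v, 'l, 'y) res_ring_scheme \<Rightarrow>
     ('r, 'k, 'z) res_ring_scheme \<Rightarrow> ('v \<times> 'r \<Rightarrow>\<^sub>0 int) set \<Rightarrow> 'l" where
  "tensor_residue k' \<iota> W' R Z =
     the_elem ((\<lambda>u. \<Oplus>\<^bsub>k'\<^esub>p\<in>Poly_Mapping.keys u.
                  add_pow k' (Poly_Mapping.lookup u p)
                    (residue W' (fst p) \<otimes>\<^bsub>k'\<^esub> \<iota> (residue R (snd p)))) ` Z)"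

text \<open>The maximal ideal $\mathfrak{m}_\Omega$ of $\Omega = W' \otimes_W R$, as the kernel of
  $\Omega \to k'$. It is the unique maximal ideal containing the images of the maximal ideals of
  $W'$ and $R$. If \<open>k'\<close> is not algebraic over \<open>k\<close>, then $\Omega$ can have further maximal ideals:
  for \<open>W = k\<close>, \<open>W' = k(t)\<close> and \<open>R = k[[x]]\<close> the element $1 + t \otimes x$ is not a unit of $\Omega$.\<close>

definition tensor_max_ideal ::
    "('w, 'k, 'a) res_ring_scheme \<Rightarrow> ('l, 'x) ring_scheme \<Rightarrow> ('k \<Rightarrow> 'l) \<Rightarrow>
     ('v, 'l, 'y) res_ring_scheme \<Rightarrow> ('w \<Rightarrow> 'v) \<Rightarrow> ('r, 'k, 'w) coef_alg \<Rightarrow>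
     ('v \<times> 'r \<Rightarrow>\<^sub>0 int) set set" where
  "tensor_max_ideal W k' \<iota> W' \<phi> R =
     a_kernel (tensor_ring W W' \<phi> R (scalar R)) k' (tensor_residue k' \<iota> W' R)"

text \<open>The completion of $\Omega$ at $\mathfrak{m}_\Omega$ as a \<open>W'\<close>-algebra with residue field \<open>k'\<close>. The
  residue map is the projection to $\Omega/\mathfrak{m}_\Omega^1$ followed by the isomorphism of this
  quotient with \<open>k'\<close>.\<close>

definition completed_tensor ::
    "('w, 'k, 'a) res_ring_scheme \<Rightarrow> ('l, 'x) ring_scheme \<Rightarrow> ('k \<Rightarrow> 'l) \<Rightarrow>
     ('v, 'l, 'y) res_ring_scheme \<Rightarrow> ('w \<Rightarrow> 'v) \<Rightarrow> ('r, 'k, 'w) coef_alg \<Rightarrow>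
     (nat \<Rightarrow> ('v \<times> 'r \<Rightarrow>\<^sub>0 int) set set, 'l, 'v) coef_alg" where
  "completed_tensor W k' \<iota> W' \<phi> R =
     (let \<Omega> = tensor_ring W W' \<phi> R (scalar R);
          m = tensor_max_ideal W k' \<iota> W' \<phi> R;
          C = adic_completion \<Omega> m
      in \<lparr>carrier = carrier C,
          monoid.mult = monoid.mult C,
          monoid.one = monoid.one C,
          ring.zero = ring.zero C,
          ring.add = ring.add C,
          residue = (\<lambda>f. the_elem (tensor_residue k' \<iota> W' R ` f 1)),
          scalar = (\<lambda>x. to_completion \<Omega> m (pure_tensor W W' \<phi> R (scalar R) x \<one>\<^bsub>R\<^esub>))\<rparr>)"

end

theory Submission
  imports Defs
begin

text \<open>
  Write \<open>B\<close> for a coefficient algebra over \<open>W'\<close>. The map \<open>R \<rightarrow> R'\<close> turns the versal lift \<open>\<nu>\<close> of \<open>\<rho>\<close> into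
  a lift \<open>\<nu>'\<close> of \<open>\<rho>'\<close>. A morphism \<open>R' \<rightarrow> B\<close> is the same as a homomorphism of \<open>W\<close>-algebras \<open>R \<rightarrow> B\<close> that is
  compatible with the residue maps, because of the universal properties of the tensor product and of
  the completion (\<open>completed_tensor_extend\<close>). So there are two points to prove.

  Every lift \<open>\<tau>\<close> of \<open>\<rho>'\<close> over \<open>B\<close> is strictly equivalent to the image of \<open>\<nu>\<close> under some \<open>R \<rightarrow> B\<close>
  (\<open>lift_from_versal\<close>). The versality of \<open>R\<close> speaks about algebras with residue field \<open>k\<close>, and \<open>B\<close> has
  the residue field \<open>k'\<close>; the idea is that \<open>\<tau>\<close> has its entries in a subring \<open>A\<close> of \<open>B\<close> of the first kind.
  As \<open>R\<close> has a finite-dimensional tangent space, the lifts of \<open>\<rho>\<close> over \<open>k[\<epsilon>]\<close> are detected on a finite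
  set \<open>S\<close> of entries (\<open>separating_entries\<close>). Let \<open>A\<close> be the closure of the subring of \<open>B\<close> generated by the
  image of \<open>W\<close> and the entries of \<open>\<tau>\<close> in \<open>S\<close>. It is an image of the completion of a ring with finitely
  generated maximal ideal, hence complete local Noetherian, and by Chevalley's theorem its adic
  topology is induced from \<open>B\<close> (\<open>descent_ring\<close>). If \<open>A\<close> did not contain all entries of \<open>\<tau>\<close>, a linear
  functional would turn \<open>\<tau>\<close> into a lift over \<open>k[\<epsilon>]\<close> that is trivial on \<open>S\<close> but not everywhere
  (\<open>large_subspace\<close>, \<open>approximation\<close>). So \<open>\<tau>\<close> is a lift over \<open>A\<close>, and versality gives \<open>R \<rightarrow> A\<close>.

  Two morphisms \<open>R' \<rightarrow> k'[\<epsilon>]\<close> inducing the same deformation are equal. On \<open>R\<close> they differ by a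
  \<open>W\<close>-derivation \<open>R \<rightarrow> k'\<close> whose values on the entries of \<open>\<nu>\<close> are the entries of a commutator with a
  matrix over \<open>k'\<close>. Followed by a \<open>k\<close>-linear map \<open>k' \<rightarrow> k\<close> it becomes a tangent vector of \<open>R\<close> with
  trivial deformation, which is zero by assumption; this holds for all linear maps, so the
  derivation vanishes (\<open>inner_derivation_zero\<close>).

  Finally, \<open>m\<^sub>\<Omega>\<close> is generated by the images of the maximal ideals of \<open>W'\<close> and \<open>R\<close> (\<open>tensor_residual\<close>).
  This gives its uniqueness, and its finite generation is what makes \<open>R'\<close> Noetherian
  (\<open>completion_complete_local_noetherian\<close>, \<open>complete_fin_gen_maximal_imp_noetherian\<close>).
\<close>

section \<open>Complete filtrations and Noetherian rings\<close>

context cring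
begin

lemma ideal_simps:
  assumes "ideal I R"
  shows "\<zero> \<in> I" "x \<in> I ==> x \<in> carrier R"
    "x \<in> I ==> y \<in> I ==> x \<oplus> y \<in> I" "x \<in> I ==> y \<in> I ==> x \<ominus> y \<in> I" "x \<in> I ==> \<ominus> x \<in> I"
    "x \<in> I ==> y \<in> carrier R ==> x \<otimes> y \<in> I" "x \<in> I ==> y \<in> carrier R ==> y \<otimes> x \<in> I"
proof -
  interpret I: ideal I R by fact
  show "\<zero> \<in> I" "x \<in> I ==> x \<in> carrier R"
    "x \<in> I ==> y \<in> I ==> x \<oplus> y \<in> I" "x \<in> I ==> y \<in> I ==> x \<ominus> y \<in> I" "x \<in> I ==> \<ominus> x \<in> I"
    "x \<in> I ==> y \<in> carrier R ==> x \<otimes> y \<in> I" "x \<in> I ==> y \<in> carrier R ==> y \<otimes> x \<in> I"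
    by (auto simp: minus_eq I.I_r_closed I.I_l_closed)
qed

lemma ideal_intro:
  assumes "I \<subseteq> carrier R" "\<zero> \<in> I" "\<And>x y. x \<in> I ==> y \<in> I ==> x \<oplus> y \<in> I"
    "\<And>x y. x \<in> I ==> y \<in> carrier R ==> y \<otimes> x \<in> I"
  shows "ideal I R"
proof (rule idealI)
  show "ring R" ..
  have neg: "\<ominus> x \<in> I" if "x \<in> I" for x
  proof -
    have "\<ominus> \<one> \<otimes> x \<in> I" using assms(4) that by blast
    moreover have "\<ominus> \<one> \<otimes> x = \<ominus> x" using that assms(1) by (simp add: l_minus subset_iff)
    ultimately show ?thesis by simp
  qed
  show "subgroup I (add_monoid R)"
    using assms neg by (intro subgroup.intro) (auto simp flip: a_inv_def)
qed (use assms m_comm in \<open>auto simp: subset_iff\<close>)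

lemma ideal_finsum:
  assumes "ideal I R" "\<And>x. x \<in> F ==> f x \<in> I"
  shows "finsum R f F \<in> I"
  using assms(2)
proof (induction F rule: infinite_finite_induct)
  case (insert x F)
  have c: "f \<in> F \<rightarrow> carrier R" "f x \<in> carrier R"
    using insert.prems ideal_simps(2)[OF assms(1)] by auto
  have "finsum R f (insert x F) = f x \<oplus> finsum R f F"
    using insert.hyps c by (intro finsum_insert) auto
  thus ?case using insert ideal_simps(3)[OF assms(1)] by auto
qed (auto simp: ideal_simps(1)[OF assms(1)] finsum_infinite)

lemma finsum_scaled_add:
  assumes "F \<subseteq> carrier R" "f \<in> F \<rightarrow> carrier R" "g \<in> F \<rightarrow> carrier R"
  shows "(\<Oplus>x\<in>F. f x \<otimes> x) \<oplus> (\<Oplus>x\<in>F. g x \<otimes> x) = (\<Oplus>x\<in>F. (f x \<oplus> g x) \<otimes> x)"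
proof -
  have "(\<Oplus>x\<in>F. (f x \<oplus> g x) \<otimes> x) = (\<Oplus>x\<in>F. f x \<otimes> x \<oplus> g x \<otimes> x)"
    using assms by (intro finsum_cong') (auto simp: l_distr Pi_iff subset_iff)
  also have "\<dots> = (\<Oplus>x\<in>F. f x \<otimes> x) \<oplus> (\<Oplus>x\<in>F. g x \<otimes> x)"
    using assms by (intro finsum_addf) auto
  finally show ?thesis by simp
qed

lemma finsum_scaled_diff:
  assumes "F \<subseteq> carrier R" "f \<in> F \<rightarrow> carrier R" "g \<in> F \<rightarrow> carrier R"
  shows "(\<Oplus>x\<in>F. f x \<otimes> x) \<ominus> (\<Oplus>x\<in>F. g x \<otimes> x) = (\<Oplus>x\<in>F. (f x \<ominus> g x) \<otimes> x)"
proof -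
  have c: "h \<in> F \<rightarrow> carrier R ==> (\<Oplus>x\<in>F. h x \<otimes> x) \<in> carrier R" for h
    using assms(1) by (intro finsum_closed) auto
  have d: "(\<lambda>x. f x \<ominus> g x) \<in> F \<rightarrow> carrier R" using assms by auto
  have "(\<Oplus>x\<in>F. f x \<otimes> x) = (\<Oplus>x\<in>F. ((f x \<ominus> g x) \<oplus> g x) \<otimes> x)"
    using assms by (intro finsum_cong') (auto simp: minus_eq a_assoc l_neg Pi_iff subset_iff)
  also have "\<dots> = (\<Oplus>x\<in>F. (f x \<ominus> g x) \<otimes> x) \<oplus> (\<Oplus>x\<in>F. g x \<otimes> x)"
    by (rule finsum_scaled_add[symmetric, OF assms(1) d assms(3)])
  finally show ?thesis using c[OF d] c[OF assms(3)] by (simp add: minus_eq a_assoc r_neg)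
qed

lemma finsum_scaled_mult:
  assumes "F \<subseteq> carrier R" "f \<in> F \<rightarrow> carrier R" "c \<in> carrier R" "finite F"
  shows "c \<otimes> (\<Oplus>x\<in>F. f x \<otimes> x) = (\<Oplus>x\<in>F. (c \<otimes> f x) \<otimes> x)"
proof -
  have "c \<otimes> (\<Oplus>x\<in>F. f x \<otimes> x) = (\<Oplus>x\<in>F. c \<otimes> (f x \<otimes> x))"
    using assms by (intro finsum_rdistr) auto
  also have "\<dots> = (\<Oplus>x\<in>F. (c \<otimes> f x) \<otimes> x)"
    using assms by (intro finsum_cong') (auto simp: m_assoc Pi_iff subset_iff)
  finally show ?thesis .
qed

lemma finsum_single:
  assumes "F \<subseteq> carrier R" "y \<in> F" "c \<in> carrier R" "finite F"
  shows "(\<Oplus>x\<in>F. (if x = y then c else \<zero>) \<otimes> x) = c \<otimes> y"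
proof -
  have "(\<Oplus>x\<in>F. (if x = y then c else \<zero>) \<otimes> x) = (\<Oplus>x\<in>F. if y = x then c \<otimes> x else \<zero>)"
    using assms by (intro finsum_cong') auto
  also have "\<dots> = c \<otimes> y" using assms by (intro finsum_singleton) auto
  finally show ?thesis .
qed

lemma lincomb_ideal:
  assumes F: "F \<subseteq> carrier R" "finite F" and J: "ideal J R"
  shows "ideal {\<Oplus>x\<in>F. a x \<otimes> x | a. a \<in> F \<rightarrow> J} R"
proof (rule ideal_intro)
  have JC: "a \<in> F \<rightarrow> carrier R" if "a \<in> F \<rightarrow> J" for a
    using that ideal_simps(2)[OF J] by auto
  show "{\<Oplus>x\<in>F. a x \<otimes> x | a. a \<in> F \<rightarrow> J} \<subseteq> carrier R"
    using JC F by (auto intro!: finsum_closed)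
  have "(\<Oplus>x\<in>F. \<zero> \<otimes> x) = \<zero>"
    using F by (subst finsum_cong'[of F F "\<lambda>_. \<zero>"]) auto
  thus "\<zero> \<in> {\<Oplus>x\<in>F. a x \<otimes> x | a. a \<in> F \<rightarrow> J}"
    using ideal_simps(1)[OF J] by (intro CollectI exI[of _ "\<lambda>_. \<zero>"]) auto
  fix y z assume y: "y \<in> {\<Oplus>x\<in>F. a x \<otimes> x | a. a \<in> F \<rightarrow> J}"
  then obtain a where a: "a \<in> F \<rightarrow> J" "y = (\<Oplus>x\<in>F. a x \<otimes> x)" by auto
  show "y \<oplus> z \<in> {\<Oplus>x\<in>F. a x \<otimes> x | a. a \<in> F \<rightarrow> J}" if "z \<in> {\<Oplus>x\<in>F. a x \<otimes> x | a. a \<in> F \<rightarrow> J}"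
  proof -
    from that obtain b where b: "b \<in> F \<rightarrow> J" "z = (\<Oplus>x\<in>F. b x \<otimes> x)" by auto
    show ?thesis
      using a b JC F finsum_scaled_add[of F a b] ideal_simps(3)[OF J]
      by (intro CollectI exI[of _ "\<lambda>x. a x \<oplus> b x"]) (auto simp: Pi_iff)
  qed
  show "z \<otimes> y \<in> {\<Oplus>x\<in>F. a x \<otimes> x | a. a \<in> F \<rightarrow> J}" if z: "z \<in> carrier R"
    using a JC F finsum_scaled_mult[of F a z] z ideal_simps(7)[OF J]
    by (intro CollectI exI[of _ "\<lambda>x. z \<otimes> a x"]) (auto simp: Pi_iff)
qed

text \<open>The factors from \<open>Idl F\<close> are combinations of \<open>F\<close>, so a sum of products can be collected into one
  combination of \<open>F\<close> with coefficients in \<open>J\<close>.\<close>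

lemma ideal_prod_genideal:
  assumes F: "F \<subseteq> carrier R" "finite F" and J: "ideal J R"
  shows "ideal_prod R (Idl F) J = {\<Oplus>x\<in>F. a x \<otimes> x | a. a \<in> F \<rightarrow> J}" (is "_ = ?S")
proof
  have S: "ideal ?S R" by (rule lincomb_ideal[OF assms])
  have idF: "ideal (Idl F) R" by (rule genideal_ideal[OF F(1)])
  show "ideal_prod R (Idl F) J \<subseteq> ?S"
  proof
    fix y assume "y \<in> ideal_prod R (Idl F) J"
    thus "y \<in> ?S"
    proof induction
      case (prod i j)
      have jc: "j \<in> carrier R" using prod J ideal_simps(2) by blast
      have "ideal {q \<in> carrier R. j \<otimes> q \<in> ?S} R"
        by (rule ideal.helper_max_prime[OF S is_cring jc])
      moreover have "F \<subseteq> {q \<in> carrier R. j \<otimes> q \<in> ?S}"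
      proof
        fix y assume y: "y \<in> F"
        have "j \<otimes> y \<in> ?S"
          using finsum_single[OF F(1) y jc F(2)] prod(2) ideal_simps(1)[OF J]
          by (intro CollectI exI[of _ "\<lambda>x. if x = y then j else \<zero>"]) auto
        thus "y \<in> {q \<in> carrier R. j \<otimes> q \<in> ?S}" using y F by auto
      qed
      ultimately have "Idl F \<subseteq> {q \<in> carrier R. j \<otimes> q \<in> ?S}"
        by (rule genideal_minimal)
      hence "j \<otimes> i \<in> ?S" "i \<in> carrier R" using prod(1) by auto
      thus ?case using m_comm[of i j] jc by simp
    next
      case (sum s1 s2)
      thus ?case using ideal_simps(3)[OF S] by blast
    qed
  qed
  show "?S \<subseteq> ideal_prod R (Idl F) J"
  proof
    fix y assume "y \<in> ?S"
    then obtain a where a: "a \<in> F \<rightarrow> J" "y = (\<Oplus>x\<in>F. a x \<otimes> x)" by auto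
    have "a x \<otimes> x \<in> ideal_prod R (Idl F) J" if x: "x \<in> F" for x
    proof -
      have "x \<otimes> a x \<in> ideal_prod R (Idl F) J"
        using x a genideal_self[OF F(1)] by (intro ideal_prod.prod) auto
      moreover have "x \<otimes> a x = a x \<otimes> x" using x a F J ideal_simps(2) by (intro m_comm) auto
      ultimately show ?thesis by simp
    qed
    thus "y \<in> ideal_prod R (Idl F) J"
      unfolding a(2) by (intro ideal_finsum[OF ideal_prod_is_ideal[OF idF J]])
  qed
qed

lemma genideal_finite:
  assumes F: "F \<subseteq> carrier R" "finite F"
  shows "Idl F = {\<Oplus>x\<in>F. a x \<otimes> x | a. a \<in> F \<rightarrow> carrier R}"
  using ideal_prod_genideal[OF F oneideal] ideal_prod_one[OF genideal_ideal[OF F(1)]] by simp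

subsection \<open>Powers of an ideal\<close>

lemma ideal_pow_ideal: "ideal I R ==> ideal (ideal_pow R I i) R"
  by (induction i) (auto simp: oneideal ideal_prod_is_ideal)

lemma ideal_pow_Suc_subset: "ideal I R ==> ideal_pow R I (Suc i) \<subseteq> ideal_pow R I i"
  using ideal_prod_inter[OF _ ideal_pow_ideal] by auto

lemma ideal_pow_antimono: "ideal I R ==> i \<le> j ==> ideal_pow R I j \<subseteq> ideal_pow R I i"
  using lift_Suc_antimono_le[of "ideal_pow R I" i j] ideal_pow_Suc_subset by blast

lemma ideal_pow_1: "ideal I R ==> ideal_pow R I (Suc 0) = I"
  using ideal_prod_one by simp

lemma ideal_pow_add:
  assumes I: "ideal I R"
  shows "ideal_pow R I (i + j) = ideal_prod R (ideal_pow R I i) (ideal_pow R I j)"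
proof (induction i)
  case 0
  show ?case using ideal_prod_one[OF ideal_pow_ideal[OF I, of j]]
     ideal_prod_commute[OF oneideal ideal_pow_ideal[OF I, of j]] by simp
next
  case (Suc i)
  thus ?case using ideal_prod_assoc[OF I ideal_pow_ideal[OF I, of i] ideal_pow_ideal[OF I, of j]]
    by simp
qed

lemma ideal_pow_mult:
  assumes I: "ideal I R" and "a \<in> ideal_pow R I i" "b \<in> ideal_pow R I j"
  shows "a \<otimes> b \<in> ideal_pow R I (i + j)"
  unfolding ideal_pow_add[OF I] using assms by (intro ideal_prod.prod)

lemma pow_in_ideal_pow:
  assumes I: "ideal I R" and "a \<in> I"
  shows "a [^] i \<in> ideal_pow R I i"
proof (induction i)
  case (Suc i)
  have "a \<otimes> a [^] i \<in> ideal_pow R I (Suc i)"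
    using ideal_prod.prod[OF assms(2) Suc] by simp
  moreover have "a [^] Suc i = a \<otimes> a [^] i"
    using assms ideal_simps(2)[OF I] by (simp add: m_comm)
  ultimately show ?case by metis
qed auto

end

lemma ring_hom_cringI: "cring A ==> cring B ==> h \<in> ring_hom A B ==> ring_hom_cring A B h"
  by (intro ring_hom_cring.intro ring_hom_cring_axioms.intro)

lemma ring_hom_minus:
  assumes "cring A" "cring B" "h \<in> ring_hom A B" "a \<in> carrier A" "b \<in> carrier A"
  shows "h (a \<ominus>\<^bsub>A\<^esub> b) = h a \<ominus>\<^bsub>B\<^esub> h b"
proof -
  interpret ring_hom_cring A B h by (rule ring_hom_cringI[OF assms(1-3)])
  show ?thesis using assms(4,5) by (simp add: R.minus_eq S.minus_eq)
qed

lemma ideal_preimage: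
  assumes A: "cring A" and B: "cring B" and h: "h \<in> ring_hom A B" and J: "ideal J B"
  shows "ideal {a \<in> carrier A. h a \<in> J} A"
proof -
  interpret A: cring A by (rule A)
  interpret B: cring B by (rule B)
  note JJ = B.ideal_simps[OF J]
  show ?thesis
    using JJ(1,3,7) ring_hom_zero[OF h A.ring_axioms B.ring_axioms]
    by (intro A.ideal_intro) (auto simp: ring_hom_add[OF h] ring_hom_mult[OF h] ring_hom_closed[OF h])
qed

text \<open>Used to move a ring to another carrier type and to pass to images of homomorphisms.\<close>

lemma cring_image:
  assumes R: "cring R" and surj: "h ` carrier R = carrier S"
    and add: "\<And>x y. x \<in> carrier R ==> y \<in> carrier R ==> h (x \<oplus>\<^bsub>R\<^esub> y) = h x \<oplus>\<^bsub>S\<^esub> h y"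
    and mult: "\<And>x y. x \<in> carrier R ==> y \<in> carrier R ==> h (x \<otimes>\<^bsub>R\<^esub> y) = h x \<otimes>\<^bsub>S\<^esub> h y"
    and const: "h \<one>\<^bsub>R\<^esub> = \<one>\<^bsub>S\<^esub>" "h \<zero>\<^bsub>R\<^esub> = \<zero>\<^bsub>S\<^esub>"
  shows "cring S"
proof -
  interpret R: cring R by (rule R)
  have "\<exists>y\<in>carrier R. h y \<oplus>\<^bsub>S\<^esub> h x = \<zero>\<^bsub>S\<^esub>" if "x \<in> carrier R" for x
    using that by (intro bexI[of _ "\<ominus>\<^bsub>R\<^esub> x"]) (simp_all add: const(2)[symmetric] add[symmetric] R.l_neg)
  hence "abelian_group S"
    unfolding surj[symmetric] const[symmetric]
    by (intro abelian_groupI; unfold surj[symmetric] const[symmetric])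
      (auto simp flip: add const simp: R.a_ac)
  moreover have "comm_monoid S"
    by (intro comm_monoidI; unfold surj[symmetric] const[symmetric]) (auto simp flip: mult const simp: R.m_ac)
  ultimately show ?thesis
    by (intro cringI; (unfold surj[symmetric])?) (auto simp flip: add mult simp: R.l_distr)
qed

lemma ideal_pow_image:
  assumes "cring A" "cring B" "h \<in> ring_hom A B" "ideal I A" "ideal J B" "h ` I \<subseteq> J"
  shows "h ` ideal_pow A I i \<subseteq> ideal_pow B J i"
proof (induction i)
  case 0
  show ?case using ring_hom_closed[OF assms(3)] by auto
next
  case (Suc i)
  interpret A: cring A by fact
  interpret B: cring B by fact
  have "x \<in> carrier A \<and> h x \<in> ideal_pow B J (Suc i)" if "x \<in> ideal_prod A I (ideal_pow A I i)" for x
    using that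
  proof induction
    case (prod a b)
    hence c: "a \<in> carrier A" "b \<in> carrier A"
      using A.ideal_simps(2)[OF assms(4)] A.ideal_simps(2)[OF A.ideal_pow_ideal[OF assms(4)]] by auto
    have "h (a \<otimes>\<^bsub>A\<^esub> b) = h a \<otimes>\<^bsub>B\<^esub> h b" using ring_hom_mult[OF assms(3)] c by simp
    thus ?case using prod assms Suc c by (auto intro!: ideal_prod.prod)
  next
    case (sum a b)
    have "h (a \<oplus>\<^bsub>A\<^esub> b) = h a \<oplus>\<^bsub>B\<^esub> h b" using ring_hom_add[OF assms(3)] sum by simp
    thus ?case using sum by (auto intro!: ideal_prod.sum)
  qed
  thus ?case by auto
qed

lemma (in cring) regroup:
  assumes "a \<in> carrier R" "b \<in> carrier R" "c \<in> carrier R"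
  shows "(a \<ominus> b) \<oplus> (b \<oplus> c) = a \<oplus> c" "a \<ominus> (b \<ominus> c) = (a \<oplus> c) \<ominus> b"
  using assms by algebra+

subsection \<open>Complete filtrations\<close>

text \<open>Completeness with the rate of convergence built in: a limit is as close to the \<open>i\<close>-th term as
  the following term. This covers the powers of an ideal, shifts of such filtrations, and the
  kernels of the projections of a completion.\<close>

locale complete_filtration = cring R for R (structure) +
  fixes K :: "nat \<Rightarrow> 'a set"
  assumes K_ideal: "ideal (K i) R"
    and K_Suc: "K (Suc i) \<subseteq> K i"
    and K_separated: "a \<in> carrier R ==> (\<And>i. a \<in> K i) ==> a = \<zero>"
    and K_limit: "(\<And>i. s i \<in> carrier R) ==> (\<And>i. s (Suc i) \<ominus> s i \<in> K i) ==>
          \<exists>a\<in>carrier R. \<forall>i. a \<ominus> s i \<in> K i"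
begin

lemma K_antimono: "i \<le> j ==> K j \<subseteq> K i"
  using lift_Suc_antimono_le[of K i j] K_Suc by blast

lemma K_carrier: "a \<in> K i ==> a \<in> carrier R"
  using ideal_simps(2)[OF K_ideal] by blast

lemma K_series:
  assumes t: "\<And>i. t i \<in> K i"
  shows "\<exists>a\<in>K 0. \<forall>i. a \<ominus> (\<Oplus>j\<in>{..<i}. t j) \<in> K i"
proof -
  have tc: "t i \<in> carrier R" for i using t K_carrier by blast
  have "\<exists>a\<in>carrier R. \<forall>i. a \<ominus> (\<Oplus>j\<in>{..<i}. t j) \<in> K i"
  proof (rule K_limit)
    show "(\<Oplus>j\<in>{..<i}. t j) \<in> carrier R" for i using tc by (intro finsum_closed) auto
    note c = this
    have "(\<Oplus>j\<in>{..<Suc i}. t j) \<ominus> (\<Oplus>j\<in>{..<i}. t j) = t i" for i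
    proof -
      have "(\<Oplus>j\<in>{..<Suc i}. t j) = t i \<oplus> (\<Oplus>j\<in>{..<i}. t j)"
        unfolding lessThan_Suc using tc by (intro finsum_insert) auto
      thus ?thesis using tc[of i] c[of i] by algebra
    qed
    thus "(\<Oplus>j\<in>{..<Suc i}. t j) \<ominus> (\<Oplus>j\<in>{..<i}. t j) \<in> K i" for i using t by simp
  qed
  then obtain a where a: "a \<in> carrier R" "\<And>i. a \<ominus> (\<Oplus>j\<in>{..<i}. t j) \<in> K i" by auto
  have "a \<in> K 0" using a(2)[of 0] a(1) by (simp add: minus_eq)
  thus ?thesis using a by auto
qed

text \<open>Successive approximation: if the elements of \<open>N i\<close> are combinations of \<open>F\<close> with coefficients in \<open>K i\<close>
  up to an error in \<open>N (Suc i)\<close>, then the coefficients of all corrections add up to convergent series.\<close>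

lemma division:
  assumes F: "finite F" "F \<subseteq> carrier R" and N: "\<And>i. N i \<subseteq> K i"
    and step: "\<And>i c. c \<in> N i ==> \<exists>a. (\<forall>x\<in>F. a x \<in> K i) \<and> c \<ominus> (\<Oplus>x\<in>F. a x \<otimes> x) \<in> N (Suc i)"
    and c: "c \<in> N 0"
  shows "\<exists>a. (\<forall>x\<in>F. a x \<in> K 0) \<and> c = (\<Oplus>x\<in>F. a x \<otimes> x)"
proof -
  define A where "A i c = (SOME a. (\<forall>x\<in>F. a x \<in> K i) \<and> c \<ominus> (\<Oplus>x\<in>F. a x \<otimes> x) \<in> N (Suc i))" for i c
  have A: "(\<forall>x\<in>F. A i c x \<in> K i) \<and> c \<ominus> (\<Oplus>x\<in>F. A i c x \<otimes> x) \<in> N (Suc i)" if "c \<in> N i" for i c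
    unfolding A_def by (rule someI_ex[OF step[OF that]])
  define r where "r = rec_nat c (\<lambda>i c. c \<ominus> (\<Oplus>x\<in>F. A i c x \<otimes> x))"
  have r0: "r 0 = c" and rS: "r (Suc i) = r i \<ominus> (\<Oplus>x\<in>F. A i (r i) x \<otimes> x)" for i
    by (auto simp: r_def)
  have rN: "r i \<in> N i" for i
    by (induction i) (use c A in \<open>auto simp: r0 rS\<close>)
  have rc: "r i \<in> carrier R" for i using rN N K_carrier by blast
  have AK: "A i (r i) x \<in> K i" if "x \<in> F" for i x using A rN that by blast
  have Ac: "A i (r i) x \<in> carrier R" if "x \<in> F" for i x using AK that K_carrier by blast
  have "\<exists>b\<in>K 0. \<forall>i. b \<ominus> (\<Oplus>j\<in>{..<i}. A j (r j) x) \<in> K i" if "x \<in> F" for x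
    using AK[OF that] by (rule K_series)
  then obtain b where b: "\<And>x. x \<in> F ==> b x \<in> K 0"
     "\<And>x i. x \<in> F ==> b x \<ominus> (\<Oplus>j\<in>{..<i}. A j (r j) x) \<in> K i" by metis
  have bc: "b x \<in> carrier R" if "x \<in> F" for x using b(1) that K_carrier by blast
  define p where "p i x = (\<Oplus>j\<in>{..<i}. A j (r j) x)" for i x
  have pc: "p i x \<in> carrier R" if "x \<in> F" for i x unfolding p_def using Ac that by auto
  have pS: "p (Suc i) x = A i (r i) x \<oplus> p i x" if "x \<in> F" for i x
    unfolding p_def lessThan_Suc using Ac that by (intro finsum_insert) auto
  have sumc: "(\<Oplus>x\<in>F. f x \<otimes> x) \<in> carrier R" if "f \<in> F \<rightarrow> carrier R" for f
    using F that by (intro finsum_closed) auto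
  have partial: "r i \<oplus> (\<Oplus>x\<in>F. p i x \<otimes> x) = c" for i
  proof (induction i)
    case 0
    have "(\<Oplus>x\<in>F. p 0 x \<otimes> x) = (\<Oplus>x\<in>F. \<zero>)" using F by (intro finsum_cong') (auto simp: p_def)
    thus ?case using rc[of 0] r0 by simp
  next
    case (Suc i)
    have "(\<Oplus>x\<in>F. p (Suc i) x \<otimes> x) = (\<Oplus>x\<in>F. (A i (r i) x \<oplus> p i x) \<otimes> x)"
      using F Ac pc by (intro finsum_cong') (auto simp: pS)
    also have "\<dots> = (\<Oplus>x\<in>F. A i (r i) x \<otimes> x) \<oplus> (\<Oplus>x\<in>F. p i x \<otimes> x)"
      using F Ac pc by (intro finsum_scaled_add[symmetric]) auto
    finally have "r (Suc i) \<oplus> (\<Oplus>x\<in>F. p (Suc i) x \<otimes> x) =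
       (r i \<ominus> (\<Oplus>x\<in>F. A i (r i) x \<otimes> x)) \<oplus> ((\<Oplus>x\<in>F. A i (r i) x \<otimes> x) \<oplus> (\<Oplus>x\<in>F. p i x \<otimes> x))"
      by (simp add: rS)
    also have "\<dots> = r i \<oplus> (\<Oplus>x\<in>F. p i x \<otimes> x)"
      using rc[of i] sumc[of "A i (r i)"] sumc[of "p i"] Ac pc by (intro regroup(1)) auto
    finally show ?case using Suc by simp
  qed
  have "c \<ominus> (\<Oplus>x\<in>F. b x \<otimes> x) \<in> K i" for i
  proof -
    have e: "(\<Oplus>x\<in>F. b x \<otimes> x) \<ominus> (\<Oplus>x\<in>F. p i x \<otimes> x) = (\<Oplus>x\<in>F. (b x \<ominus> p i x) \<otimes> x)"
      using F bc pc by (intro finsum_scaled_diff) auto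
    have "(\<Oplus>x\<in>F. (b x \<ominus> p i x) \<otimes> x) \<in> K i"
    proof (intro ideal_finsum[OF K_ideal])
      fix x assume x: "x \<in> F"
      show "(b x \<ominus> p i x) \<otimes> x \<in> K i"
        using b(2)[OF x, of i] x F ideal_simps(6)[OF K_ideal] unfolding p_def by auto
    qed
    hence "(\<Oplus>x\<in>F. b x \<otimes> x) \<ominus> (\<Oplus>x\<in>F. p i x \<otimes> x) \<in> K i" by (simp only: e)
    moreover have "r i \<in> K i" using rN N by blast
    ultimately have "r i \<ominus> ((\<Oplus>x\<in>F. b x \<otimes> x) \<ominus> (\<Oplus>x\<in>F. p i x \<otimes> x)) \<in> K i"
      using ideal_simps(4)[OF K_ideal] by blast
    moreover have "r i \<ominus> ((\<Oplus>x\<in>F. b x \<otimes> x) \<ominus> (\<Oplus>x\<in>F. p i x \<otimes> x)) = c \<ominus> (\<Oplus>x\<in>F. b x \<otimes> x)"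
      using rc[of i] sumc[of b] sumc[of "p i"] bc pc
      by (subst partial[of i, symmetric], intro regroup(2)) auto
    ultimately show ?thesis by simp
  qed
  moreover have cc: "c \<in> carrier R" using rc[of 0] r0 by simp
  moreover have sc: "(\<Oplus>x\<in>F. b x \<otimes> x) \<in> carrier R" using sumc bc by auto
  ultimately have "c \<ominus> (\<Oplus>x\<in>F. b x \<otimes> x) = \<zero>" by (intro K_separated) auto
  hence "c = (\<Oplus>x\<in>F. b x \<otimes> x)" using cc sc by (simp add: r_right_minus_eq)
  thus ?thesis using b(1) by blast
qed

end

subsection \<open>A complete ring with finitely generated maximal ideal is Noetherian\<close>

definition (in ring) fin_gen :: "'a set \<Rightarrow> bool" where
  "fin_gen I \<longleftrightarrow> (\<exists>F\<subseteq>carrier R. finite F \<and> I = Idl F)"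

text \<open>A finite generating set of the union of a chain lies in a member of the chain, so Zorn's lemma
  applies.\<close>

lemma (in cring) maximal_non_fin_gen:
  assumes "ideal I R" "\<not> fin_gen I"
  shows "\<exists>P. ideal P R \<and> \<not> fin_gen P \<and> (\<forall>Q. ideal Q R \<longrightarrow> P \<subseteq> Q \<longrightarrow> \<not> fin_gen Q \<longrightarrow> Q = P)"
proof -
  define S where "S = {I. ideal I R \<and> \<not> fin_gen I}"
  have "\<exists>M\<in>S. \<forall>U\<in>S. M \<subseteq> U \<longrightarrow> U = M"
  proof (rule subset_Zorn_nonempty)
    show "S \<noteq> {}" using assms unfolding S_def by auto
    fix C assume C: "C \<noteq> {}" "subset.chain S C"
    hence chain: "subset.chain {I. ideal I R} C" unfolding pred_on.chain_def S_def by auto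
    have id: "ideal (\<Union>C) R" using chain_Union_is_ideal[OF chain] C(1) by simp
    have "\<not> fin_gen (\<Union>C)"
    proof
      assume "fin_gen (\<Union>C)"
      then obtain F where F: "F \<subseteq> carrier R" "finite F" "\<Union>C = Idl F" unfolding fin_gen_def by auto
      have "F \<subseteq> \<Union>C" using F genideal_self by blast
      then obtain J where J: "J \<in> C" "F \<subseteq> J"
        using finite_subset_Union_chain[OF F(2) _ C] by blast
      have iJ: "ideal J R" using J C unfolding pred_on.chain_def S_def by auto
      hence "Idl F \<subseteq> J" using J genideal_minimal by blast
      hence "J = Idl F" using F J by auto
      hence "fin_gen J" using F unfolding fin_gen_def by auto
      thus False using J C unfolding pred_on.chain_def S_def by auto
    qed
    thus "\<Union>C \<in> S" using id unfolding S_def by simp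
  qed
  thus ?thesis unfolding S_def by auto
qed

text \<open>Let \<open>P\<close> be maximal among the ideals that are not finitely generated, and let \<open>x\<close> be an element of \<open>m\<close>
  outside \<open>P\<close>. Then \<open>P + (x)\<close> is generated by \<open>x\<close> and a finite \<open>F1 \<subseteq> P\<close>, so that \<open>P = (F1) + xQ\<close> with
  \<open>Q = (P : x)\<close>. If \<open>Q\<close> is strictly larger than \<open>P\<close>, it is finitely generated, and so is \<open>P\<close>. If \<open>Q = P\<close>,
  iterating \<open>P = (F1) + xP\<close> leaves errors in \<open>x^i P\<close>, which tend to zero, and \<open>P = (F1)\<close> by completeness.\<close>

theorem (in cring) complete_fin_gen_maximal_imp_noetherian:
  assumes max: "maximalideal m R" and fg: "m = Idl F" "F \<subseteq> carrier R" "finite F"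
    and compl: "complete_filtration R (ideal_pow R m)"
  shows "noetherian_ring R"
proof (rule ccontr)
  assume "\<not> noetherian_ring R"
  then obtain I where "ideal I R" "\<not> fin_gen I"
    unfolding noetherian_ring_def noetherian_ring_axioms_def fin_gen_def using ring_axioms by auto
  from maximal_non_fin_gen[OF this] obtain P where
    P: "ideal P R" "\<not> fin_gen P" and Pmax: "\<And>Q. ideal Q R ==> P \<subseteq> Q ==> \<not> fin_gen Q ==> Q = P" by blast
  interpret m: maximalideal m R by fact
  interpret K: complete_filtration R "ideal_pow R m" by fact
  have m: "ideal m R" ..
  have "\<not> m \<subseteq> P"
  proof
    assume "m \<subseteq> P"
    hence "P = m \<or> P = carrier R" using m.I_maximal P(1) ideal_simps(2)[OF P(1)] by blast
    moreover have "fin_gen m" using fg unfolding fin_gen_def by auto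
    moreover have "fin_gen (carrier R)" using genideal_one unfolding fin_gen_def
      by (intro exI[of _ "{\<one>}"]) auto
    ultimately show False using P(2) by auto
  qed
  then obtain x where x: "x \<in> m" "x \<notin> P" by auto
  have xc: "x \<in> carrier R" using x m ideal_simps by blast
  define Q where "Q = {q \<in> carrier R. x \<otimes> q \<in> P}"
  have Q: "ideal Q R" unfolding Q_def by (rule ideal.helper_max_prime[OF P(1) is_cring xc])
  have PQ: "P \<subseteq> Q" unfolding Q_def using ideal_simps[OF P(1)] xc by auto
  have "\<exists>F1\<subseteq>P. finite F1 \<and> P \<subseteq> Idl F1 <+>\<^bsub>R\<^esub> PIdl x"
  proof -
    let ?J = "P <+>\<^bsub>R\<^esub> PIdl x"
    have J: "ideal ?J R" using add_ideals[OF P(1) cgenideal_ideal[OF xc]] .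
    have PJ: "P \<subseteq> ?J"
    proof
      fix y assume y: "y \<in> P"
      have "y = y \<oplus> \<zero>" "\<zero> \<in> PIdl x" using y ideal_simps[OF P(1)] ideal_simps[OF cgenideal_ideal[OF xc]] by auto
      thus "y \<in> ?J" using y unfolding set_add_def' by blast
    qed
    have "x = \<zero> \<oplus> x" "x \<in> PIdl x" "\<zero> \<in> P" using xc cgenideal_self ideal_simps[OF P(1)] by auto
    hence "x \<in> ?J" unfolding set_add_def' by blast
    hence "fin_gen ?J" using Pmax[OF J PJ] x by blast
    then obtain G where G: "G \<subseteq> carrier R" "finite G" "?J = Idl G" unfolding fin_gen_def by auto
    have "\<forall>g\<in>G. \<exists>p\<in>P. \<exists>c\<in>PIdl x. g = p \<oplus> c"
      using genideal_self[OF G(1)] G(3) unfolding set_add_def' by blast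
    then obtain p where p: "\<And>g. g \<in> G ==> p g \<in> P" "\<And>g. g \<in> G ==> \<exists>c\<in>PIdl x. g = p g \<oplus> c" by metis
    have pc: "p ` G \<subseteq> carrier R" using p ideal_simps[OF P(1)] by auto
    have id: "ideal (Idl (p ` G) <+>\<^bsub>R\<^esub> PIdl x) R"
      by (intro add_ideals genideal_ideal pc cgenideal_ideal xc)
    have "g \<in> Idl (p ` G) <+>\<^bsub>R\<^esub> PIdl x" if g: "g \<in> G" for g
    proof -
      from p(2)[OF g] obtain c where c: "c \<in> PIdl x" "g = p g \<oplus> c" by blast
      have "p g \<in> Idl (p ` G)" using genideal_self[OF pc] g by blast
      hence "p g \<oplus> c \<in> Idl (p ` G) <+>\<^bsub>R\<^esub> PIdl x" using c(1) unfolding set_add_def' by blast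
      thus ?thesis using c(2) by simp
    qed
    hence "G \<subseteq> Idl (p ` G) <+>\<^bsub>R\<^esub> PIdl x" by blast
    hence "Idl G \<subseteq> Idl (p ` G) <+>\<^bsub>R\<^esub> PIdl x" using id genideal_minimal by blast
    thus ?thesis using PJ G p by (intro exI[of _ "p ` G"]) auto
  qed
  then obtain F1 where F1: "F1 \<subseteq> P" "finite F1" "P \<subseteq> Idl F1 <+>\<^bsub>R\<^esub> PIdl x" by blast
  have F1c: "F1 \<subseteq> carrier R" using F1 ideal_simps[OF P(1)] by auto
  have IF1: "Idl F1 \<subseteq> P" using genideal_minimal[OF P(1)] F1 by blast
  have decomp: "\<exists>u\<in>Idl F1. \<exists>q\<in>Q. c = u \<oplus> x \<otimes> q" if c: "c \<in> P" for c
  proof -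
    obtain u q where u: "u \<in> Idl F1" "q \<in> carrier R" "c = u \<oplus> q \<otimes> x"
      using c F1(3) unfolding set_add_def' cgenideal_def by blast
    have uc: "u \<in> P" "u \<in> carrier R" using u IF1 ideal_simps[OF P(1)] by auto
    have "c \<ominus> u \<in> P" using c uc ideal_simps[OF P(1)] by auto
    moreover have "c \<ominus> u = x \<otimes> q" unfolding u(3) using uc u(2) xc by algebra
    ultimately have "q \<in> Q" using u unfolding Q_def by simp
    moreover have "c = u \<oplus> x \<otimes> q" using u(3) m_comm[OF u(2) xc] by simp
    ultimately show ?thesis using u(1) by blast
  qed
  have "P \<subseteq> Idl F1" if "Q = P"
  proof
    fix c assume c: "c \<in> P"
    define N where "N (i::nat) = {x [^] i \<otimes> q | q. q \<in> P}" for i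
    have xi: "x [^] i \<in> ideal_pow R m i" for i using pow_in_ideal_pow[OF m x(1)] .
    have "\<exists>a. (\<forall>y\<in>F1. a y \<in> ideal_pow R m 0) \<and> c = (\<Oplus>y\<in>F1. a y \<otimes> y)"
    proof (rule K.division[OF F1(2) F1c, of N])
      show "N i \<subseteq> ideal_pow R m i" for i
        using ideal_simps(6)[OF ideal_pow_ideal[OF m] xi] ideal_simps(2)[OF P(1)] unfolding N_def by blast
      have "c = x [^] (0::nat) \<otimes> c" using c ideal_simps(2)[OF P(1)] by simp
      thus "c \<in> N 0" using c unfolding N_def by blast
      fix i d assume "d \<in> N i"
      then obtain q where q: "q \<in> P" "d = x [^] i \<otimes> q" unfolding N_def by auto
      obtain u q' where u: "u \<in> Idl F1" "q' \<in> Q" "q = u \<oplus> x \<otimes> q'" using decomp[OF q(1)] by auto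
      obtain a where a: "a \<in> F1 \<rightarrow> carrier R" "u = (\<Oplus>y\<in>F1. a y \<otimes> y)"
        using u(1) genideal_finite[OF F1c F1(2)] by auto
      have e: "(\<Oplus>y\<in>F1. (x [^] i \<otimes> a y) \<otimes> y) = x [^] i \<otimes> u"
        unfolding a(2) using F1c F1(2) a xc by (intro finsum_scaled_mult[symmetric]) auto
      have c': "u \<in> carrier R" "q' \<in> carrier R" "x [^] i \<in> carrier R"
        using u IF1 ideal_simps[OF P(1)] xc unfolding Q_def by auto
      have "d \<ominus> x [^] i \<otimes> u = x [^] Suc i \<otimes> q'"
        unfolding q(2) u(3) nat_pow_Suc using c' xc by algebra
      hence "d \<ominus> (\<Oplus>y\<in>F1. (x [^] i \<otimes> a y) \<otimes> y) \<in> N (Suc i)"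
        unfolding e N_def using u(2) that by blast
      moreover have "\<forall>y\<in>F1. x [^] i \<otimes> a y \<in> ideal_pow R m i"
        using ideal_simps(6)[OF ideal_pow_ideal[OF m] xi] a by (simp add: Pi_iff)
      ultimately show "\<exists>a. (\<forall>y\<in>F1. a y \<in> ideal_pow R m i) \<and> d \<ominus> (\<Oplus>y\<in>F1. a y \<otimes> y) \<in> N (Suc i)"
        by (intro exI[of _ "\<lambda>y. x [^] i \<otimes> a y"]) auto
    qed
    thus "c \<in> Idl F1" unfolding genideal_finite[OF F1c F1(2)] by auto
  qed
  moreover have "\<exists>H\<subseteq>carrier R. finite H \<and> P \<subseteq> Idl H \<and> H \<subseteq> P" if "Q \<noteq> P"
  proof -
    have "fin_gen Q" using Pmax[OF Q PQ] that by blast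
    then obtain H where H: "H \<subseteq> carrier R" "finite H" "Q = Idl H" unfolding fin_gen_def by auto
    let ?H = "F1 \<union> (\<lambda>q. x \<otimes> q) ` H"
    have Hc: "?H \<subseteq> carrier R" using F1c H xc by auto
    have "H \<subseteq> Q" unfolding H(3) by (rule genideal_self[OF H(1)])
    hence HP: "?H \<subseteq> P" using F1(1) unfolding Q_def by auto
    have iH: "ideal (Idl ?H) R" using genideal_ideal[OF Hc] .
    have "H \<subseteq> {q \<in> carrier R. x \<otimes> q \<in> Idl ?H}" using genideal_self[OF Hc] H(1) by auto
    hence Qs: "Q \<subseteq> {q \<in> carrier R. x \<otimes> q \<in> Idl ?H}"
      unfolding H(3) by (intro genideal_minimal ideal.helper_max_prime[OF iH is_cring xc])
    have "Idl F1 \<subseteq> Idl ?H" using genideal_self[OF Hc] by (intro genideal_minimal[OF iH]) simp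
    have "c \<in> Idl ?H" if c: "c \<in> P" for c
    proof -
      from decomp[OF c] obtain u q where uq: "u \<in> Idl F1" "q \<in> Q" "c = u \<oplus> x \<otimes> q" by blast
      have "u \<in> Idl ?H" "x \<otimes> q \<in> Idl ?H"
        using uq \<open>Idl F1 \<subseteq> Idl ?H\<close> Qs by blast+
      thus ?thesis unfolding uq(3) by (rule ideal_simps(3)[OF iH])
    qed
    hence "P \<subseteq> Idl ?H" by blast
    moreover have "finite ?H" using F1(2) H(2) by simp
    ultimately show ?thesis using Hc HP by blast
  qed
  ultimately have "\<exists>H\<subseteq>carrier R. finite H \<and> P \<subseteq> Idl H \<and> H \<subseteq> P" using F1 F1c by metis
  then obtain H where H: "H \<subseteq> carrier R" "finite H" "P \<subseteq> Idl H" "H \<subseteq> P" by blast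
  have "P = Idl H" using H genideal_minimal[OF P(1)] by blast
  thus False using P(2) H unfolding fin_gen_def by auto
qed

section \<open>Complete local rings and adic completion\<close>

subsection \<open>Cosets\<close>

context cring
begin

lemma minus_self [simp]: "a \<in> carrier R ==> a \<ominus> a = \<zero>"
  by (simp add: r_right_minus_eq)

lemma coset_eq_iff:
  assumes "ideal I R" "a \<in> carrier R" "b \<in> carrier R"
  shows "I +> a = I +> b \<longleftrightarrow> a \<ominus> b \<in> I"
  using quotient_eq_iff_same_a_r_cos[OF assms] by simp

lemma mem_coset_iff:
  assumes "ideal I R" "a \<in> carrier R"
  shows "b \<in> I +> a \<longleftrightarrow> b \<in> carrier R \<and> b \<ominus> a \<in> I"
proof
  assume "b \<in> I +> a"
  then obtain h where h: "h \<in> I" "b = h \<oplus> a" unfolding a_r_coset_def' by auto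
  hence "h \<in> carrier R" using ideal_simps(2)[OF assms(1)] by auto
  moreover have "(h \<oplus> a) \<ominus> a = h" using calculation assms(2) by algebra
  ultimately show "b \<in> carrier R \<and> b \<ominus> a \<in> I" using h assms by auto
next
  assume b: "b \<in> carrier R \<and> b \<ominus> a \<in> I"
  hence "b = (b \<ominus> a) \<oplus> a" using assms(2) by algebra
  thus "b \<in> I +> a" using b unfolding a_r_coset_def' by blast
qed

lemma coset_subset_iff:
  assumes "ideal I R" "ideal J R" "J \<subseteq> I" "a \<in> carrier R" "b \<in> carrier R"
  shows "J +> b \<subseteq> I +> a \<longleftrightarrow> b \<ominus> a \<in> I"
proof
  have "b \<in> J +> b" using mem_coset_iff[OF assms(2,5)] assms(5) ideal_simps(1)[OF assms(2)]
    by simp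
  thus "J +> b \<subseteq> I +> a ==> b \<ominus> a \<in> I" using mem_coset_iff[OF assms(1,4)] by auto
next
  assume d: "b \<ominus> a \<in> I"
  show "J +> b \<subseteq> I +> a"
  proof
    fix c assume "c \<in> J +> b"
    hence c: "c \<in> carrier R" "c \<ominus> b \<in> I" using mem_coset_iff[OF assms(2,5)] assms(3) by auto
    have "(c \<ominus> b) \<oplus> (b \<ominus> a) \<in> I" using c d ideal_simps(3)[OF assms(1)] by blast
    moreover have "(c \<ominus> b) \<oplus> (b \<ominus> a) = c \<ominus> a" using c assms by algebra
    ultimately show "c \<in> I +> a" using mem_coset_iff[OF assms(1,4)] c by auto
  qed
qed

lemma carrier_Quot: "carrier (R Quot I) = (\<lambda>a. I +> a) ` carrier R"
  by (auto simp: FactRing_simps)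

lemma Quot_ops:
  assumes "ideal I R" "a \<in> carrier R" "b \<in> carrier R"
  shows "(I +> a) \<otimes>\<^bsub>R Quot I\<^esub> (I +> b) = I +> (a \<otimes> b)"
    "(I +> a) \<oplus>\<^bsub>R Quot I\<^esub> (I +> b) = I +> (a \<oplus> b)"
  using ideal.rcoset_mult_add[OF assms] abelian_subgroup.a_rcos_sum[OF _ assms(2,3), of I]
    ideal.axioms(1)[OF assms(1)] abelian_subgroupI3 is_abelian_group
  by (auto simp: FactRing_def)

end

subsection \<open>Adic completeness as completeness of a filtration\<close>

lemma (in complete_filtration) cauchy:
  assumes "\<And>i. s i \<in> carrier R" "\<And>i. s (Suc i) \<ominus> s i \<in> K (d + i)"
  shows "s (m + n) \<ominus> s m \<in> K (d + m)"
proof (induction n)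
  case 0
  show ?case using ideal_simps(1)[OF K_ideal] assms(1) by simp
next
  case (Suc n)
  have "s (Suc (m + n)) \<ominus> s (m + n) \<in> K (d + m)"
    using assms(2)[of "m + n"] K_antimono[of "d + m" "d + (m + n)"] by auto
  hence "(s (Suc (m + n)) \<ominus> s (m + n)) \<oplus> (s (m + n) \<ominus> s m) \<in> K (d + m)"
    using Suc ideal_simps(3)[OF K_ideal] by blast
  moreover have "(s (Suc (m + n)) \<ominus> s (m + n)) \<oplus> (s (m + n) \<ominus> s m) = s (Suc (m + n)) \<ominus> s m"
    using assms(1)[of "Suc (m + n)"] assms(1)[of "m + n"] assms(1)[of m] by algebra
  ultimately show ?case by simp
qed

lemma (in cring) complete_filtrationI:
  assumes "\<And>i. ideal (K i) R" "\<And>i. K (Suc i) \<subseteq> K i"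
    "\<And>a. a \<in> carrier R ==> (\<And>i. a \<in> K i) ==> a = \<zero>"
    "\<And>s. (\<And>i. s i \<in> carrier R) ==> (\<And>i. s (Suc i) \<ominus> s i \<in> K i) ==>
       \<exists>a\<in>carrier R. \<forall>i. a \<ominus> s i \<in> K i"
  shows "complete_filtration R K"
proof (intro complete_filtration.intro complete_filtration_axioms.intro is_cring)
qed (fact assms)+

lemma (in complete_filtration) shift: "complete_filtration R (\<lambda>i. K (d + i))"
proof (rule complete_filtrationI)
  show "ideal (K (d + i)) R" for i by (rule K_ideal)
  show "K (d + Suc i) \<subseteq> K (d + i)" for i using K_Suc by simp
  show "a = \<zero>" if "a \<in> carrier R" "\<And>i. a \<in> K (d + i)" for a
  proof (rule K_separated[OF that(1)])
    fix i show "a \<in> K i" using that(2)[of i] K_antimono[of i "d + i"] by auto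
  qed
  show "\<exists>a\<in>carrier R. \<forall>i. a \<ominus> s i \<in> K (d + i)"
    if s: "\<And>i. s i \<in> carrier R" "\<And>i. s (Suc i) \<ominus> s i \<in> K (d + i)" for s
  proof -
  have "s (Suc i) \<ominus> s i \<in> K i" for i using s(2)[of i] K_antimono[of i "d + i"] by auto
  then obtain a where a: "a \<in> carrier R" "\<And>i. a \<ominus> s i \<in> K i" using K_limit[of s] s(1) by blast
  have "a \<ominus> s i \<in> K (d + i)" for i
  proof -
    have "a \<ominus> s (i + d) \<in> K (d + i)" using a(2)[of "i + d"] by (simp add: add.commute)
    moreover have "s (i + d) \<ominus> s i \<in> K (d + i)" using cauchy[of s, OF s] by blast
    ultimately have "(a \<ominus> s (i + d)) \<oplus> (s (i + d) \<ominus> s i) \<in> K (d + i)"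
      using ideal_simps(3)[OF K_ideal] by blast
    moreover have "(a \<ominus> s (i + d)) \<oplus> (s (i + d) \<ominus> s i) = a \<ominus> s i"
      using a(1) s(1)[of "i + d"] s(1)[of i] by algebra
    ultimately show ?thesis by simp
  qed
  thus ?thesis using a(1) by blast
  qed
qed

text \<open>Sequences of representatives for the elements of the adic completion.\<close>

definition (in cring) coherent :: "'a set \<Rightarrow> (nat \<Rightarrow> 'a) \<Rightarrow> bool" where
  "coherent I s \<longleftrightarrow> (\<forall>i. s i \<in> carrier R \<and> s (Suc i) \<ominus> s i \<in> ideal_pow R I i)"

definition (in cring) coset_seq :: "'a set \<Rightarrow> (nat \<Rightarrow> 'a) \<Rightarrow> nat \<Rightarrow> 'a set" where
  "coset_seq I s = (\<lambda>i. ideal_pow R I i +> s i)"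

context cring
begin

lemma carrier_adic_completion:
  assumes I: "ideal I R"
  shows "carrier (adic_completion R I) = coset_seq I ` {s. coherent I s}"
proof (intro equalityI subsetI)
  note P = ideal_pow_ideal[OF I]
  fix f assume "f \<in> carrier (adic_completion R I)"
  hence f: "f i \<in> carrier (R Quot ideal_pow R I i)" "f (Suc i) \<subseteq> f i" for i
    by (auto simp: adic_completion_def)
  have "\<exists>a. a \<in> carrier R \<and> f i = ideal_pow R I i +> a" for i
    using f(1)[of i] by (auto simp: carrier_Quot)
  then obtain s where s: "\<And>i. s i \<in> carrier R \<and> f i = ideal_pow R I i +> s i" by metis
  have "s (Suc i) \<ominus> s i \<in> ideal_pow R I i" for i
    using f(2)[of i] s[of i] s[of "Suc i"] coset_subset_iff[OF P P ideal_pow_Suc_subset[OF I], of "s i" "s (Suc i)" i] by metis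
  hence "coherent I s" using s by (auto simp: coherent_def)
  moreover have "f = coset_seq I s" using s by (auto simp: coset_seq_def)
  ultimately show "f \<in> coset_seq I ` {s. coherent I s}" by blast
next
  note P = ideal_pow_ideal[OF I]
  fix f assume "f \<in> coset_seq I ` {s. coherent I s}"
  then obtain s where s: "coherent I s" "f = coset_seq I s" by auto
  have s': "s i \<in> carrier R" "s (Suc i) \<ominus> s i \<in> ideal_pow R I i" for i
    using s(1) unfolding coherent_def by auto
  have "f (Suc i) \<subseteq> f i" for i
    unfolding s(2) coset_seq_def
    using coset_subset_iff[OF P P ideal_pow_Suc_subset[OF I], of "s i" "s (Suc i)" i] s'(1)[of i]
       s'(1)[of "Suc i"] s'(2)[of i] by blast
  moreover have "f i \<in> carrier (R Quot ideal_pow R I i)" for i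
    unfolding s(2) coset_seq_def carrier_Quot using s'(1) by auto
  ultimately show "f \<in> carrier (adic_completion R I)" by (auto simp: adic_completion_def)
qed

lemma coset_seq_eq_iff:
  assumes "ideal I R" "\<And>i. s i \<in> carrier R" "\<And>i. t i \<in> carrier R"
  shows "coset_seq I s = coset_seq I t \<longleftrightarrow> (\<forall>i. s i \<ominus> t i \<in> ideal_pow R I i)"
  unfolding coset_seq_def fun_eq_iff
  using coset_eq_iff[OF ideal_pow_ideal[OF assms(1)] assms(2,3)] by blast

lemma coherent_const: "ideal I R ==> a \<in> carrier R ==> coherent I (\<lambda>_. a)"
  using ideal_simps(1)[OF ideal_pow_ideal] by (simp add: coherent_def)

lemma to_completion_coset_seq: "to_completion R I a = coset_seq I (\<lambda>_. a)"
  by (simp add: to_completion_def coset_seq_def)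

text \<open>The map to the completion is injective iff the filtration is separated, and surjective iff
  coherent sequences have limits.\<close>

theorem adic_complete_iff:
  assumes I: "ideal I R"
  shows "adic_complete R I \<longleftrightarrow> complete_filtration R (ideal_pow R I)"
proof
  assume "adic_complete R I"
  hence inj: "inj_on (to_completion R I) (carrier R)"
    and surj: "to_completion R I ` carrier R = carrier (adic_completion R I)"
    by (auto simp: adic_complete_def bij_betw_def)
  show "complete_filtration R (ideal_pow R I)"
  proof (rule complete_filtrationI)
    show "ideal (ideal_pow R I i) R" for i by (rule ideal_pow_ideal[OF I])
    show "ideal_pow R I (Suc i) \<subseteq> ideal_pow R I i" for i by (rule ideal_pow_Suc_subset[OF I])
    show "a = \<zero>" if a: "a \<in> carrier R" "\<And>i. a \<in> ideal_pow R I i" for a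
    proof -
      have "coset_seq I (\<lambda>_. a) = coset_seq I (\<lambda>_. \<zero>)"
        using a by (subst coset_seq_eq_iff[OF I]) (auto simp: minus_eq)
      thus ?thesis using inj a(1) unfolding inj_on_def to_completion_coset_seq by blast
    qed
    show "\<exists>a\<in>carrier R. \<forall>i. a \<ominus> s i \<in> ideal_pow R I i"
      if s: "\<And>i. s i \<in> carrier R" "\<And>i. s (Suc i) \<ominus> s i \<in> ideal_pow R I i" for s
    proof -
    from s have "coset_seq I s \<in> to_completion R I ` carrier R"
      unfolding surj carrier_adic_completion[OF I] coherent_def by blast
    then obtain a where a: "a \<in> carrier R" "coset_seq I s = coset_seq I (\<lambda>_. a)"
      unfolding to_completion_coset_seq by blast
    have "\<forall>i. a \<ominus> s i \<in> ideal_pow R I i"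
      using a(2)[symmetric] s(1) a(1) by (subst (asm) coset_seq_eq_iff[OF I]) auto
    thus ?thesis using a(1) by blast
    qed
  qed
next
  assume "complete_filtration R (ideal_pow R I)"
  then interpret F: complete_filtration R "ideal_pow R I" .
  have "inj_on (to_completion R I) (carrier R)"
  proof (rule inj_onI)
    fix a b assume ab: "a \<in> carrier R" "b \<in> carrier R" "to_completion R I a = to_completion R I b"
    hence "\<forall>i. a \<ominus> b \<in> ideal_pow R I i"
      unfolding to_completion_coset_seq by (subst (asm) coset_seq_eq_iff[OF I]) auto
    hence "a \<ominus> b = \<zero>" using F.K_separated[of "a \<ominus> b"] ab by simp
    thus "a = b" using ab by (simp add: r_right_minus_eq)
  qed
  moreover have "to_completion R I ` carrier R = carrier (adic_completion R I)"
  proof (intro equalityI subsetI)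
    fix f assume "f \<in> to_completion R I ` carrier R"
    thus "f \<in> carrier (adic_completion R I)"
      unfolding carrier_adic_completion[OF I] to_completion_coset_seq using coherent_const[OF I] by blast
  next
    fix f assume "f \<in> carrier (adic_completion R I)"
    then obtain s where s: "coherent I s" "f = coset_seq I s"
      unfolding carrier_adic_completion[OF I] by auto
    have s': "s i \<in> carrier R" "s (Suc i) \<ominus> s i \<in> ideal_pow R I i" for i
      using s(1) unfolding coherent_def by auto
    obtain a where a: "a \<in> carrier R" "\<forall>i. a \<ominus> s i \<in> ideal_pow R I i"
      using F.K_limit[of s] s' by blast
    have "to_completion R I a = f"
      unfolding to_completion_coset_seq s(2) using a s'(1) by (subst coset_seq_eq_iff[OF I]) auto
    thus "f \<in> to_completion R I ` carrier R" using a(1) by blast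
  qed
  ultimately show "adic_complete R I" by (simp add: adic_complete_def bij_betw_def)
qed

end

subsection \<open>Rings with a residue map\<close>

text \<open>The kernel of the residue map takes the place of the maximal ideal. The ring need not be local:
  the tensor product before completion is of this kind.\<close>

locale residual = A: cring A + k: field k
  for A :: "('a, 'x) ring_scheme" (structure) and k :: "('k, 'z) ring_scheme" +
  fixes \<pi> :: "'a \<Rightarrow> 'k"
  assumes \<pi>_hom: "\<pi> \<in> ring_hom A k" and \<pi>_surj: "\<pi> ` carrier A = carrier k"
begin

abbreviation m where "m \<equiv> a_kernel A k \<pi>"

lemma \<pi>_ring_hom_cring: "ring_hom_cring A k \<pi>"
  by (rule ring_hom_cringI[OF A.is_cring k.is_cring \<pi>_hom])

lemma \<pi>_simps [simp]:
  "a \<in> carrier A ==> \<pi> a \<in> carrier k"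
  "a \<in> carrier A ==> b \<in> carrier A ==> \<pi> (a \<oplus> b) = \<pi> a \<oplus>\<^bsub>k\<^esub> \<pi> b"
  "a \<in> carrier A ==> b \<in> carrier A ==> \<pi> (a \<otimes> b) = \<pi> a \<otimes>\<^bsub>k\<^esub> \<pi> b"
  "\<pi> \<one> = \<one>\<^bsub>k\<^esub>" "\<pi> \<zero> = \<zero>\<^bsub>k\<^esub>" "a \<in> carrier A ==> \<pi> (\<ominus> a) = \<ominus>\<^bsub>k\<^esub> \<pi> a"
  using \<pi>_hom ring_hom_cring.hom_zero[OF \<pi>_ring_hom_cring] ring_hom_cring.hom_a_inv[OF \<pi>_ring_hom_cring]
  by (auto simp: ring_hom_def)

lemma m_iff: "a \<in> m \<longleftrightarrow> a \<in> carrier A \<and> \<pi> a = \<zero>\<^bsub>k\<^esub>"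
  by (auto simp: a_kernel_def')

lemma \<pi>_minus: "a \<in> carrier A ==> b \<in> carrier A ==> \<pi> (a \<ominus> b) = \<pi> a \<ominus>\<^bsub>k\<^esub> \<pi> b"
  by (simp add: A.minus_eq k.minus_eq)

lemma m_ideal: "ideal m A"
  by (intro A.ideal_intro) (auto simp: m_iff)

lemma m_max: "maximalideal m A"
proof (rule maximalidealI[OF m_ideal])
  show "carrier A \<noteq> m" using m_iff[of \<one>] k.one_not_zero by auto
  fix J assume J: "ideal J A" "m \<subseteq> J" "J \<subseteq> carrier A"
  show "J = m \<or> J = carrier A"
  proof (cases "J = m")
    case False
    then obtain x where x: "x \<in> J" "x \<notin> m" using J by auto
    hence xc: "x \<in> carrier A" "\<pi> x \<noteq> \<zero>\<^bsub>k\<^esub>" using J m_iff by auto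
    hence "\<pi> x \<in> Units k" using k.field_Units by auto
    hence "inv\<^bsub>k\<^esub> \<pi> x \<in> carrier k" "\<pi> x \<otimes>\<^bsub>k\<^esub> inv\<^bsub>k\<^esub> \<pi> x = \<one>\<^bsub>k\<^esub>" by auto
    then obtain y where y: "y \<in> carrier A" "\<pi> x \<otimes>\<^bsub>k\<^esub> \<pi> y = \<one>\<^bsub>k\<^esub>" using \<pi>_surj by (metis (no_types, lifting) imageE)
    have "\<one> \<ominus> x \<otimes> y \<in> m" unfolding m_iff using xc y by (simp add: \<pi>_minus k.r_right_minus_eq)
    hence "\<one> \<ominus> x \<otimes> y \<in> J" using J by blast
    hence "(\<one> \<ominus> x \<otimes> y) \<oplus> x \<otimes> y \<in> J"
      using A.ideal_simps(6)[OF J(1) x(1) y(1)] by (rule A.ideal_simps(3)[OF J(1)])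
    moreover have "(\<one> \<ominus> x \<otimes> y) \<oplus> x \<otimes> y = \<one>" using xc y by algebra
    ultimately have "\<one> \<in> J" by simp
    thus ?thesis using ideal.one_imp_carrier[OF J(1)] by simp
  qed simp
qed

text \<open>If \<open>y\<close> is an inverse of \<open>a\<close> modulo \<open>m\<close>, then \<open>ay = 1 - x\<close> with \<open>x \<in> m\<close> is inverted by the geometric
  series.\<close>

lemma complete_unit:
  assumes "complete_filtration A (ideal_pow A m)" "a \<in> carrier A" "\<pi> a \<noteq> \<zero>\<^bsub>k\<^esub>"
  shows "\<exists>b\<in>carrier A. a \<otimes> b = \<one>"
proof -
  interpret F: complete_filtration A "ideal_pow A m" by fact
  have "\<pi> a \<in> Units k" using assms k.field_Units by auto
  hence "inv\<^bsub>k\<^esub> \<pi> a \<in> carrier k" "\<pi> a \<otimes>\<^bsub>k\<^esub> inv\<^bsub>k\<^esub> \<pi> a = \<one>\<^bsub>k\<^esub>" by auto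
  then obtain y where y: "y \<in> carrier A" "\<pi> a \<otimes>\<^bsub>k\<^esub> \<pi> y = \<one>\<^bsub>k\<^esub>" using \<pi>_surj by (metis (no_types, lifting) imageE)
  define x where "x = \<one> \<ominus> a \<otimes> y"
  have x: "x \<in> m" "x \<in> carrier A" unfolding x_def m_iff using assms y by (auto simp: \<pi>_minus k.r_right_minus_eq)
  have ay: "a \<otimes> y = \<one> \<ominus> x" unfolding x_def using assms y by algebra
  \<comment> \<open>the series is obtained by dividing \<open>1\<close> by \<open>1 - x\<close>, with remainder \<open>x^i\<close> after \<open>i\<close> steps\<close>
  have "\<exists>c. (\<forall>z\<in>{a \<otimes> y}. c z \<in> ideal_pow A m 0) \<and> \<one> = (\<Oplus>z\<in>{a \<otimes> y}. c z \<otimes> z)"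
  proof (rule F.division[of _ "\<lambda>i. {x [^] i}"])
    show "{x [^] i} \<subseteq> ideal_pow A m i" for i using A.pow_in_ideal_pow[OF m_ideal x(1)] by auto
    fix i :: nat and c assume "c \<in> {x [^] i}"
    hence c: "c = x [^] i" by simp
    have "x [^] i \<ominus> x [^] i \<otimes> (\<one> \<ominus> x) = x [^] i \<otimes> x"
      using x(2) A.nat_pow_closed[OF x(2), of i] by algebra
    hence "c \<ominus> (\<Oplus>z\<in>{a \<otimes> y}. x [^] i \<otimes> z) \<in> {x [^] Suc i}"
      using ay x assms y c by (simp add: A.finsum_insert[of "{}", simplified])
    thus "\<exists>b. (\<forall>z\<in>{a \<otimes> y}. b z \<in> ideal_pow A m i) \<and> c \<ominus> (\<Oplus>z\<in>{a \<otimes> y}. b z \<otimes> z) \<in> {x [^] Suc i}"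
      using A.pow_in_ideal_pow[OF m_ideal x(1)] by (intro exI[of _ "\<lambda>_. x [^] i"]) auto
  qed (use assms y in auto)
  then obtain c where c: "c (a \<otimes> y) \<in> carrier A" "\<one> = (\<Oplus>z\<in>{a \<otimes> y}. c z \<otimes> z)" by auto
  hence "\<one> = c (a \<otimes> y) \<otimes> (a \<otimes> y)" using assms y by (simp add: A.finsum_insert[of "{}", simplified])
  also have "\<dots> = a \<otimes> (y \<otimes> c (a \<otimes> y))" using assms y c(1) by algebra
  finally show ?thesis using assms y c(1) by (intro bexI[of _ "y \<otimes> c (a \<otimes> y)"]) auto
qed

lemma unique_maximal:
  assumes u: "\<And>a. a \<in> carrier A ==> \<pi> a \<noteq> \<zero>\<^bsub>k\<^esub> ==> \<exists>b\<in>carrier A. a \<otimes> b = \<one>" and M: "maximalideal M A"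
  shows "M = m"
proof -
  interpret M: maximalideal M A by fact
  have M: "ideal M A" ..
  have "M \<subseteq> m"
  proof
    fix a assume a: "a \<in> M"
    hence ac: "a \<in> carrier A" using A.ideal_simps(2)[OF M] by blast
    show "a \<in> m"
    proof (rule ccontr)
      assume "a \<notin> m"
      then obtain b where "b \<in> carrier A" "a \<otimes> b = \<one>" using u ac m_iff by blast
      hence "\<one> \<in> M" using A.ideal_simps(6)[OF M a] by metis
      thus False using M.one_imp_carrier M.I_notcarr by simp
    qed
  qed
  moreover have "m \<subseteq> carrier A" using m_iff by auto
  ultimately have "m = M \<or> m = carrier A" using M.I_maximal[OF m_ideal] by blast
  thus ?thesis using maximalideal.I_notcarr[OF m_max] by auto
qed

lemma max_ideal_eq:
  assumes "\<exists>!M. maximalideal M A"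
  shows "max_ideal A = m"
  unfolding max_ideal_def using the1_equality[OF assms m_max] .

theorem complete_local_noetherianI:
  assumes compl: "complete_filtration A (ideal_pow A m)"
    and fg: "m = Idl F" "F \<subseteq> carrier A" "finite F"
  shows "local_ring A" "noetherian_ring A" "adic_complete A (max_ideal A)" "max_ideal A = m"
proof -
  have ex1: "\<exists>!M. maximalideal M A"
    using m_max unique_maximal complete_unit[OF compl] by blast
  thus "local_ring A" unfolding local_ring_def using A.is_cring by simp
  show mx: "max_ideal A = m" by (rule max_ideal_eq[OF ex1])
  show "noetherian_ring A"
    by (rule A.complete_fin_gen_maximal_imp_noetherian[OF m_max fg compl])
  show "adic_complete A (max_ideal A)"
    unfolding mx using compl A.adic_complete_iff[OF m_ideal] by simp
qed

end

abbreviation mpow :: "('a, 'x) ring_scheme \<Rightarrow> nat \<Rightarrow> 'a set" where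
  "mpow A \<equiv> ideal_pow A (max_ideal A)"

text \<open>The prefix \<open>cln\<close> stands for complete local Noetherian rings.\<close>

lemma cln_intro:
  assumes "residual A k (residue A)" "complete_filtration A (ideal_pow A (a_kernel A k (residue A)))"
    "a_kernel A k (residue A) = Idl\<^bsub>A\<^esub> F" "F \<subseteq> carrier A" "finite F"
  shows "complete_local_noetherian k A" "max_ideal A = a_kernel A k (residue A)"
  using residual.complete_local_noetherianI[OF assms] residual.\<pi>_hom[OF assms(1)]
     residual.\<pi>_surj[OF assms(1)]
  by (auto simp: complete_local_noetherian_def)

lemma cln_elim:
  assumes "field k" "complete_local_noetherian k A"
  shows "residual A k (residue A)" "max_ideal A = a_kernel A k (residue A)"
    "complete_filtration A (mpow A)"
    "\<exists>F\<subseteq>carrier A. finite F \<and> max_ideal A = Idl\<^bsub>A\<^esub> F"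
    "cring A" "ideal (max_ideal A) A"
proof -
  have *: "cring A" "\<exists>!M. maximalideal M A" "noetherian_ring A" "adic_complete A (max_ideal A)"
     "residue A \<in> ring_hom A k" "residue A ` carrier A = carrier k"
    using assms(2) by (auto simp: complete_local_noetherian_def local_ring_def)
  show r: "residual A k (residue A)"
    using * assms(1) by (simp add: residual_def residual_axioms_def)
  then interpret residual A k "residue A" .
  show mx: "max_ideal A = a_kernel A k (residue A)" by (rule max_ideal_eq[OF *(2)])
  show i: "ideal (max_ideal A) A" unfolding mx by (rule m_ideal)
  show "complete_filtration A (mpow A)"
    using *(4) A.adic_complete_iff[OF i] by simp
  show "\<exists>F\<subseteq>carrier A. finite F \<and> max_ideal A = Idl\<^bsub>A\<^esub> F"
    using noetherian_ring.finetely_gen[OF *(3) i] by blast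
qed (use assms in \<open>simp add: complete_local_noetherian_def local_ring_def\<close>)

lemma a_kernel_mem: "f \<in> a_kernel A B h \<longleftrightarrow> f \<in> carrier A \<and> h f = \<zero>\<^bsub>B\<^esub>"
  by (simp add: a_kernel_def')

lemma (in cring) minus_minus_cancel:
  "a \<in> carrier R ==> b \<in> carrier R ==> a \<ominus> (a \<ominus> b) = b"
  by algebra

subsection \<open>The completion of a ring at the kernel of a residue map\<close>

text \<open>The construction of \<open>completed_tensor\<close> for an arbitrary ring with a residue map.\<close>

definition completion_alg ::
    "('a, 'x) ring_scheme \<Rightarrow> 'a set \<Rightarrow> ('a \<Rightarrow> 'k) \<Rightarrow> ('w \<Rightarrow> 'a) \<Rightarrow> (nat \<Rightarrow> 'a set, 'k, 'w) coef_alg" where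
  "completion_alg A I \<pi> sc =
     \<lparr>carrier = carrier (adic_completion A I),
      monoid.mult = monoid.mult (adic_completion A I),
      monoid.one = monoid.one (adic_completion A I),
      ring.zero = ring.zero (adic_completion A I),
      ring.add = ring.add (adic_completion A I),
      residue = (\<lambda>f. the_elem (\<pi> ` f 1)),
      scalar = (\<lambda>x. to_completion A I (sc x))\<rparr>"

context residual
begin

abbreviation coh where "coh \<equiv> A.coherent m"
abbreviation cs where "cs \<equiv> A.coset_seq m"
abbreviation P where "P \<equiv> ideal_pow A m"

lemmas P_ideal = A.ideal_pow_ideal[OF m_ideal]
lemmas P_simps = A.ideal_simps[OF P_ideal]

lemma coh_iff: "coh s \<longleftrightarrow> (\<forall>i. s i \<in> carrier A \<and> s (Suc i) \<ominus> s i \<in> P i)"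
  by (rule A.coherent_def)

lemma coh_closed: "coh s ==> s i \<in> carrier A" by (simp add: coh_iff)

lemma coh_const: "a \<in> carrier A ==> coh (\<lambda>_. a)"
  by (rule A.coherent_const[OF m_ideal])

lemma coh_add: assumes "coh s" "coh t" shows "coh (\<lambda>i. s i \<oplus> t i)"
  unfolding coh_iff
proof (intro allI conjI)
  fix i
  note c = coh_closed[OF assms(1), of i] coh_closed[OF assms(1), of "Suc i"]
    coh_closed[OF assms(2), of i] coh_closed[OF assms(2), of "Suc i"]
  show "s i \<oplus> t i \<in> carrier A" using c by simp
  have "(s (Suc i) \<ominus> s i) \<oplus> (t (Suc i) \<ominus> t i) \<in> P i"
    using assms unfolding coh_iff by (intro P_simps(3)) auto
  moreover have "(s (Suc i) \<ominus> s i) \<oplus> (t (Suc i) \<ominus> t i) = s (Suc i) \<oplus> t (Suc i) \<ominus> (s i \<oplus> t i)"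
    using c by algebra
  ultimately show "s (Suc i) \<oplus> t (Suc i) \<ominus> (s i \<oplus> t i) \<in> P i" by simp
qed

lemma coh_mult: assumes "coh s" "coh t" shows "coh (\<lambda>i. s i \<otimes> t i)"
  unfolding coh_iff
proof (intro allI conjI)
  fix i
  note c = coh_closed[OF assms(1), of i] coh_closed[OF assms(1), of "Suc i"]
    coh_closed[OF assms(2), of i] coh_closed[OF assms(2), of "Suc i"]
  show "s i \<otimes> t i \<in> carrier A" using c by simp
  have "(s (Suc i) \<ominus> s i) \<otimes> t (Suc i) \<oplus> (t (Suc i) \<ominus> t i) \<otimes> s i \<in> P i"
    using assms c unfolding coh_iff by (intro P_simps(3) P_simps(6)) auto
  moreover have "(s (Suc i) \<ominus> s i) \<otimes> t (Suc i) \<oplus> (t (Suc i) \<ominus> t i) \<otimes> s i = s (Suc i) \<otimes> t (Suc i) \<ominus> s i \<otimes> t i"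
    using c by algebra
  ultimately show "s (Suc i) \<otimes> t (Suc i) \<ominus> s i \<otimes> t i \<in> P i" by simp
qed

lemma coh_minus: assumes "coh s" shows "coh (\<lambda>i. \<ominus> s i)"
  unfolding coh_iff
proof (intro allI conjI)
  fix i
  note c = coh_closed[OF assms(1), of i] coh_closed[OF assms(1), of "Suc i"]
  show "\<ominus> s i \<in> carrier A" using c by simp
  have "\<ominus> (s (Suc i) \<ominus> s i) \<in> P i"
    using assms unfolding coh_iff by (intro P_simps(5)) auto
  moreover have "\<ominus> (s (Suc i) \<ominus> s i) = \<ominus> s (Suc i) \<ominus> \<ominus> s i" using c by algebra
  ultimately show "\<ominus> s (Suc i) \<ominus> \<ominus> s i \<in> P i" by simp
qed

lemma cs_eq_iff: "coh s ==> coh t ==> cs s = cs t \<longleftrightarrow> (\<forall>i. s i \<ominus> t i \<in> P i)"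
  by (rule A.coset_seq_eq_iff[OF m_ideal]) (auto simp: coh_closed)

end

locale residual_completion = residual A k \<pi>
  for A :: "('a, 'x) ring_scheme" (structure) and k :: "('k, 'z) ring_scheme" and \<pi> +
  fixes F :: "'a set" and sc :: "'w \<Rightarrow> 'a"
  assumes F: "m = Idl F" "F \<subseteq> carrier A" "finite F"
begin

definition C where "C = completion_alg A m \<pi> sc"

definition j where "j = to_completion A m"

lemma j_eq: "j a = cs (\<lambda>_. a)" by (simp add: j_def A.to_completion_coset_seq)

lemma C_carrier: "carrier C = cs ` {s. coh s}"
  by (simp add: C_def completion_alg_def A.carrier_adic_completion[OF m_ideal])

lemma cs_in_C: "coh s ==> cs s \<in> carrier C" by (auto simp: C_carrier)

lemma C_cases: assumes "f \<in> carrier C" obtains s where "coh s" "f = cs s"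
  using assms by (auto simp: C_carrier)

lemma C_mult: "coh s ==> coh t ==> cs s \<otimes>\<^bsub>C\<^esub> cs t = cs (\<lambda>i. s i \<otimes> t i)"
  by (simp add: C_def completion_alg_def adic_completion_def A.coset_seq_def A.Quot_ops[OF P_ideal] coh_closed)

lemma C_add: "coh s ==> coh t ==> cs s \<oplus>\<^bsub>C\<^esub> cs t = cs (\<lambda>i. s i \<oplus> t i)"
  by (simp add: C_def completion_alg_def adic_completion_def A.coset_seq_def A.Quot_ops[OF P_ideal] coh_closed)

lemma C_one: "\<one>\<^bsub>C\<^esub> = cs (\<lambda>_. \<one>)"
  by (simp add: C_def completion_alg_def adic_completion_def A.coset_seq_def FactRing_def)

lemma C_zero: "\<zero>\<^bsub>C\<^esub> = cs (\<lambda>_. \<zero>)"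
proof -
  have "P i +> \<zero> = P i" for i
    using P_simps(2) by (intro A.a_coset_add_zero) auto
  thus ?thesis by (simp add: C_def completion_alg_def adic_completion_def A.coset_seq_def FactRing_def)
qed

lemmas coh_intros = coh_add coh_mult coh_minus coh_const[OF A.zero_closed] coh_const[OF A.one_closed]

lemma C_cring: "cring C"
proof (rule cringI)
  show "abelian_group C"
  proof (rule abelian_groupI)
    show "\<exists>y\<in>carrier C. y \<oplus>\<^bsub>C\<^esub> x = \<zero>\<^bsub>C\<^esub>" if "x \<in> carrier C" for x
      using that
    proof (rule C_cases)
      fix s assume "coh s" "x = cs s"
      thus ?thesis using coh_intros by (intro bexI[of _ "cs (\<lambda>i. \<ominus> s i)"]) (simp_all add: C_zero C_add coh_closed A.l_neg cs_in_C)
    qed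
  qed (auto elim!: C_cases simp: C_zero C_add cs_in_C coh_intros coh_closed A.a_ac)
  show "comm_monoid C"
    by (rule comm_monoidI) (auto elim!: C_cases simp: C_one C_mult cs_in_C coh_intros coh_closed A.m_ac)
qed (auto elim!: C_cases simp: C_mult C_add coh_intros coh_closed A.l_distr)

sublocale C: cring C by (rule C_cring)

lemma C_uminus: assumes "coh s" shows "\<ominus>\<^bsub>C\<^esub> cs s = cs (\<lambda>i. \<ominus> s i)"
  using assms coh_intros
  by (intro C.minus_equality) (simp_all add: C_zero C_add coh_closed A.l_neg cs_in_C)

lemma C_minus: assumes "coh s" "coh t" shows "cs s \<ominus>\<^bsub>C\<^esub> cs t = cs (\<lambda>i. s i \<ominus> t i)"
  using assms coh_intros by (simp add: C.minus_eq A.minus_eq C_uminus C_add)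

lemma coh_diff: "coh s ==> coh t ==> coh (\<lambda>i. s i \<ominus> t i)"
  using coh_add[OF _ coh_minus] by (simp add: A.minus_eq)

lemma j_hom: "j \<in> ring_hom A C"
  by (rule ring_hom_memI) (simp_all add: j_eq cs_in_C coh_const C_mult C_add C_one)

text \<open>The kernel of the projection to \<open>A/m^i\<close>.\<close>

definition K where "K i = cs ` {s. coh s \<and> s i \<in> P i}"

lemma K_iff: assumes "coh s" shows "cs s \<in> K i \<longleftrightarrow> s i \<in> P i"
proof
  assume "cs s \<in> K i"
  then obtain t where t: "coh t" "t i \<in> P i" "cs s = cs t" by (auto simp: K_def)
  hence "s i \<ominus> t i \<in> P i" using assms cs_eq_iff by blast
  hence "(s i \<ominus> t i) \<oplus> t i \<in> P i" using t(2) by (rule P_simps(3))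
  moreover have "(s i \<ominus> t i) \<oplus> t i = s i" using coh_closed[OF assms, of i] coh_closed[OF t(1), of i] by algebra
  ultimately show "s i \<in> P i" by simp
qed (use assms in \<open>auto simp: K_def\<close>)

lemma j_K_iff: "a \<in> carrier A ==> j a \<in> K i \<longleftrightarrow> a \<in> P i"
  by (simp add: j_eq K_iff coh_const)

lemma K_cases: assumes "f \<in> K i" obtains s where "coh s" "f = cs s" "s i \<in> P i"
  using assms by (auto simp: K_def)

lemma coh_le: assumes "coh s" "i \<le> n" shows "s n \<ominus> s i \<in> P i"
  using assms(2)
proof (induction n rule: dec_induct)
  case base
  show ?case using coh_closed[OF assms(1)] P_simps(1) by simp
next
  case (step n)
  have "s (Suc n) \<ominus> s n \<in> P i"
    using assms(1) A.ideal_pow_antimono[OF m_ideal step(1)] by (auto simp: coh_iff)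
  hence "(s (Suc n) \<ominus> s n) \<oplus> (s n \<ominus> s i) \<in> P i" using step by (intro P_simps(3))
  moreover have "(s (Suc n) \<ominus> s n) \<oplus> (s n \<ominus> s i) = s (Suc n) \<ominus> s i"
    using coh_closed[OF assms(1), of "Suc n"] coh_closed[OF assms(1), of n] coh_closed[OF assms(1), of i]
    by algebra
  ultimately show ?case by simp
qed

lemma coh_P_le: assumes "coh s" "i \<le> n" shows "s n \<in> P i \<longleftrightarrow> s i \<in> P i"
proof -
  have d: "s n \<ominus> s i \<in> P i" by (rule coh_le[OF assms])
  note c = coh_closed[OF assms(1), of n] coh_closed[OF assms(1), of i]
  have e: "(s n \<ominus> s i) \<oplus> s i = s n" "s n \<ominus> (s n \<ominus> s i) = s i" using c by algebra+
  show ?thesis using P_simps(3)[OF d, of "s i"] P_simps(4)[of "s n" i, OF _ d] e by auto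
qed

lemma K_ideal: "ideal (K i) C"
proof (rule C.ideal_intro)
  show "K i \<subseteq> carrier C" by (auto simp: K_def cs_in_C)
  show "\<zero>\<^bsub>C\<^esub> \<in> K i" using P_simps(1) by (simp add: C_zero K_iff coh_intros)
  fix x y assume x: "x \<in> K i"
  then obtain s where s: "coh s" "x = cs s" "s i \<in> P i" by (rule K_cases)
  show "x \<oplus>\<^bsub>C\<^esub> y \<in> K i" if "y \<in> K i"
  proof -
    from that obtain t where t: "coh t" "y = cs t" "t i \<in> P i" by (rule K_cases)
    show ?thesis using s t P_simps(3) by (simp add: C_add K_iff coh_intros)
  qed
  show "y \<otimes>\<^bsub>C\<^esub> x \<in> K i" if "y \<in> carrier C"
  proof -
    from that obtain t where t: "coh t" "y = cs t" by (rule C_cases)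
    show ?thesis using s t P_simps(7) by (simp add: C_mult K_iff coh_intros coh_closed)
  qed
qed

text \<open>A sequence of coherent sequences converges to its diagonal.\<close>

lemma K_complete: "complete_filtration C K"
proof (rule C.complete_filtrationI)
  show "ideal (K i) C" for i by (rule K_ideal)
  show "K (Suc i) \<subseteq> K i" for i
  proof
    fix x assume "x \<in> K (Suc i)"
    then obtain s where s: "coh s" "x = cs s" "s (Suc i) \<in> P (Suc i)" by (rule K_cases)
    hence "s (Suc i) \<in> P i" using A.ideal_pow_Suc_subset[OF m_ideal] by blast
    thus "x \<in> K i" using s coh_P_le[OF s(1), of i "Suc i"] K_iff by simp
  qed
  show "a = \<zero>\<^bsub>C\<^esub>" if a: "a \<in> carrier C" "\<And>i. a \<in> K i" for a
  proof -
    obtain s where s: "coh s" "a = cs s" using a(1) by (rule C_cases)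
    have "s i \<in> P i" for i using a(2)[of i] s K_iff by simp
    thus ?thesis using s coh_intros coh_closed[OF s(1)] by (simp add: C_zero cs_eq_iff A.minus_eq)
  qed
  show "\<exists>a\<in>carrier C. \<forall>i. a \<ominus>\<^bsub>C\<^esub> f i \<in> K i"
    if f: "\<And>i. f i \<in> carrier C" "\<And>i. f (Suc i) \<ominus>\<^bsub>C\<^esub> f i \<in> K i" for f
  proof -
    have "\<exists>s. coh s \<and> f n = cs s" for n using f(1)[of n] by (auto simp: C_carrier)
    then obtain S where S: "\<And>n. coh (S n)" "\<And>n. f n = cs (S n)" by metis
    have c: "S n i \<in> carrier A" for n i using S coh_closed by blast
    have d: "S (Suc n) n \<ominus> S n n \<in> P n" for n
      using f(2)[of n] S K_iff[OF coh_diff[OF S(1)[of "Suc n"] S(1)[of n]]] by (simp add: C_minus)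
    define g where "g n = S n n" for n
    have g: "coh g" unfolding coh_iff
    proof (intro allI conjI)
      fix i show "g i \<in> carrier A" using c by (simp add: g_def)
      have "S (Suc i) (Suc i) \<ominus> S (Suc i) i \<in> P i" using S(1) by (auto simp: coh_iff)
      hence "(S (Suc i) (Suc i) \<ominus> S (Suc i) i) \<oplus> (S (Suc i) i \<ominus> S i i) \<in> P i" using d by (rule P_simps(3))
      moreover have "(S (Suc i) (Suc i) \<ominus> S (Suc i) i) \<oplus> (S (Suc i) i \<ominus> S i i) = g (Suc i) \<ominus> g i"
        unfolding g_def using c[of "Suc i" "Suc i"] c[of "Suc i" i] c[of i i] by algebra
      ultimately show "g (Suc i) \<ominus> g i \<in> P i" by simp
    qed
    have "cs g \<ominus>\<^bsub>C\<^esub> f i \<in> K i" for i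
    proof -
      have "cs (\<lambda>n. g n \<ominus> S i n) \<in> K i"
        unfolding K_iff[OF coh_diff[OF g S(1)]] using c[of i i] P_simps(1) by (simp add: g_def)
      thus ?thesis unfolding S(2) C_minus[OF g S(1)] .
    qed
    thus ?thesis using cs_in_C[OF g] by blast
  qed
qed

interpretation K: complete_filtration C K by (rule K_complete)

lemma j_dense: assumes "f \<in> carrier C" shows "\<exists>a\<in>carrier A. f \<ominus>\<^bsub>C\<^esub> j a \<in> K i"
proof -
  obtain s where s: "coh s" "f = cs s" using assms by (rule C_cases)
  have "f \<ominus>\<^bsub>C\<^esub> j (s i) \<in> K i"
    using s coh_closed[OF s(1)] P_simps(1) by (simp add: j_eq C_minus coh_const K_iff coh_diff)
  thus ?thesis using coh_closed[OF s(1)] by blast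
qed

lemma K_0: "K 0 = carrier C" by (auto simp: K_def C_carrier coh_closed)

lemma jF: "j ` F \<subseteq> carrier C" "finite (j ` F)"
  using F ring_hom_closed[OF j_hom] by auto

lemma j_ideal_prod:
  assumes "a \<in> ideal_prod A (Idl F) (P n)"
  shows "j a \<in> ideal_prod C (Idl\<^bsub>C\<^esub> (j ` F)) (K n) \<and> a \<in> carrier A"
  using assms
proof induction
  case (prod x y)
  have c: "y \<in> carrier A" using prod P_simps(2) by blast
  have "ideal {a \<in> carrier A. j a \<in> Idl\<^bsub>C\<^esub> (j ` F)} A"
    by (rule ideal_preimage[OF A.is_cring C_cring j_hom C.genideal_ideal[OF jF(1)]])
  moreover have "F \<subseteq> {a \<in> carrier A. j a \<in> Idl\<^bsub>C\<^esub> (j ` F)}"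
    using F C.genideal_self[OF jF(1)] by auto
  ultimately have "Idl F \<subseteq> {a \<in> carrier A. j a \<in> Idl\<^bsub>C\<^esub> (j ` F)}" by (rule A.genideal_minimal)
  hence x: "x \<in> carrier A" "j x \<in> Idl\<^bsub>C\<^esub> (j ` F)" using prod by auto
  moreover have "j y \<in> K n" using prod c j_K_iff by simp
  ultimately have "j x \<otimes>\<^bsub>C\<^esub> j y \<in> ideal_prod C (Idl\<^bsub>C\<^esub> (j ` F)) (K n)" by (intro ideal_prod.prod)
  thus ?case using x c ring_hom_mult[OF j_hom] by simp
next
  case (sum a b)
  thus ?case using ring_hom_add[OF j_hom] ideal_prod.sum[of "j a" C] by simp
qed

text \<open>An element of \<open>K (Suc i)\<close> is a limit of elements of \<open>m^(i+1)\<close>. These are combinations of the finite set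
  \<open>F\<close> with coefficients in \<open>m^i\<close>, so by successive approximation the limit is a combination with
  coefficients in \<open>K i\<close>. Hence \<open>K i\<close> is the \<open>i\<close>-th power of \<open>K 1\<close>.\<close>

lemma K_Suc_eq: "K (Suc i) = ideal_prod C (Idl\<^bsub>C\<^esub> (j ` F)) (K i)"
proof
  show "K (Suc i) \<subseteq> ideal_prod C (Idl\<^bsub>C\<^esub> (j ` F)) (K i)"
  proof
    fix c assume c: "c \<in> K (Suc i)"
    interpret Ki: complete_filtration C "\<lambda>n. K (i + n)" by (rule K.shift)
    have "\<exists>a. (\<forall>x\<in>j ` F. a x \<in> K (i + 0)) \<and> c = (\<Oplus>\<^bsub>C\<^esub>x\<in>j ` F. a x \<otimes>\<^bsub>C\<^esub> x)"
    proof (rule Ki.division[OF jF(2,1), of "\<lambda>n. K (Suc i + n)"])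
      show "K (Suc i + n) \<subseteq> K (i + n)" for n using K.K_Suc by simp
      show "c \<in> K (Suc i + 0)" using c by simp
      fix n d assume d: "d \<in> K (Suc i + n)"
      then obtain a where a: "a \<in> carrier A" "d \<ominus>\<^bsub>C\<^esub> j a \<in> K (Suc (Suc i + n))"
        using j_dense K.K_carrier by blast
      have dc: "d \<in> carrier C" "j a \<in> carrier C" using d K.K_carrier a ring_hom_closed[OF j_hom] by blast+
      have "d \<ominus>\<^bsub>C\<^esub> j a \<in> K (Suc i + n)" using a(2) K.K_Suc[of "Suc i + n"] by blast
      with d have "d \<ominus>\<^bsub>C\<^esub> (d \<ominus>\<^bsub>C\<^esub> j a) \<in> K (Suc i + n)" by (rule C.ideal_simps(4)[OF K_ideal])
      moreover have "d \<ominus>\<^bsub>C\<^esub> (d \<ominus>\<^bsub>C\<^esub> j a) = j a" using dc by (rule C.minus_minus_cancel)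
      ultimately have "a \<in> P (Suc (i + n))" using a j_K_iff by simp
      hence "a \<in> ideal_prod A (Idl F) (P (i + n))" unfolding F(1)[symmetric] by simp
      hence "j a \<in> ideal_prod C (Idl\<^bsub>C\<^esub> (j ` F)) (K (i + n))" using j_ideal_prod by blast
      then obtain b where b: "b \<in> j ` F \<rightarrow> K (i + n)" "j a = (\<Oplus>\<^bsub>C\<^esub>x\<in>j ` F. b x \<otimes>\<^bsub>C\<^esub> x)"
        unfolding C.ideal_prod_genideal[OF jF K_ideal] by blast
      thus "\<exists>b. (\<forall>x\<in>j ` F. b x \<in> K (i + n)) \<and> d \<ominus>\<^bsub>C\<^esub> (\<Oplus>\<^bsub>C\<^esub>x\<in>j ` F. b x \<otimes>\<^bsub>C\<^esub> x) \<in> K (Suc i + Suc n)"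
        using a(2) by (intro exI[of _ b]) (auto simp flip: b(2))
    qed
    then obtain a where "\<forall>x\<in>j ` F. a x \<in> K i" "c = (\<Oplus>\<^bsub>C\<^esub>x\<in>j ` F. a x \<otimes>\<^bsub>C\<^esub> x)" by auto
    thus "c \<in> ideal_prod C (Idl\<^bsub>C\<^esub> (j ` F)) (K i)"
      unfolding C.ideal_prod_genideal[OF jF K_ideal] by blast
  qed
  have F1: "Idl\<^bsub>C\<^esub> (j ` F) \<subseteq> K (Suc 0)"
  proof (intro C.genideal_minimal K_ideal image_subsetI)
    fix x assume "x \<in> F"
    hence "x \<in> m" "x \<in> carrier A" using A.genideal_self[OF F(2)] F by auto
    thus "j x \<in> K (Suc 0)" using j_K_iff A.ideal_pow_1[OF m_ideal] by simp
  qed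
  show "ideal_prod C (Idl\<^bsub>C\<^esub> (j ` F)) (K i) \<subseteq> K (Suc i)"
  proof
    fix c assume "c \<in> ideal_prod C (Idl\<^bsub>C\<^esub> (j ` F)) (K i)"
    thus "c \<in> K (Suc i)"
    proof induction
      case (prod x y)
      have "x \<in> K (Suc 0)" using prod F1 by blast
      then obtain s where s: "coh s" "x = cs s" "s (Suc 0) \<in> P (Suc 0)" by (rule K_cases)
      obtain t where t: "coh t" "y = cs t" "t i \<in> P i" using prod(2) by (rule K_cases)
      have "s (Suc i) \<in> m" using coh_P_le[OF s(1), of "Suc 0" "Suc i"] s(3) A.ideal_pow_1[OF m_ideal] by simp
      moreover have "t (Suc i) \<in> P i" using coh_P_le[OF t(1), of i "Suc i"] t(3) by simp
      ultimately have "s (Suc i) \<otimes> t (Suc i) \<in> P (Suc i)" by (auto intro: ideal_prod.prod)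
      thus ?case using s t by (simp add: C_mult K_iff coh_intros)
    next
      case (sum a b)
      thus ?case using C.ideal_simps(3)[OF K_ideal] by blast
    qed
  qed
qed

lemma K_1: "K 1 = Idl\<^bsub>C\<^esub> (j ` F)"
  using K_Suc_eq[of 0] C.ideal_prod_one[OF C.genideal_ideal[OF jF(1)]] by (simp add: K_0)

lemma K_eq_pow: "ideal_pow C (K 1) i = K i"
proof (induction i)
  case (Suc i)
  thus ?case using K_Suc_eq[of i] K_1 by simp
qed (simp add: K_0)

lemma C_residue: assumes "coh s" shows "residue C (cs s) = \<pi> (s 1)"
proof -
  have "\<pi> ` (cs s 1) = {\<pi> (s 1)}"
  proof -
    have e: "cs s 1 = m +> s 1" by (simp add: A.coset_seq_def A.ideal_prod_one[OF m_ideal])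
    have "\<pi> x = \<pi> (s 1)" if "x \<in> m +> s 1" for x
    proof -
      have "x \<in> carrier A" "x \<ominus> s 1 \<in> m" using that A.mem_coset_iff[OF m_ideal coh_closed[OF assms]] by auto
      hence "\<pi> x \<ominus>\<^bsub>k\<^esub> \<pi> (s 1) = \<zero>\<^bsub>k\<^esub>" using coh_closed[OF assms] by (simp add: m_iff \<pi>_minus)
      thus ?thesis using \<open>x \<in> carrier A\<close> coh_closed[OF assms] by (simp add: k.r_right_minus_eq)
    qed
    moreover have "s 1 \<in> m +> s 1" using A.mem_coset_iff[OF m_ideal coh_closed[OF assms]] coh_closed[OF assms]
      A.ideal_simps(1)[OF m_ideal] by simp
    ultimately show ?thesis unfolding e by blast
  qed
  thus ?thesis by (simp add: C_def completion_alg_def)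
qed

lemma C_residue_j: "a \<in> carrier A ==> residue C (j a) = \<pi> a"
  by (simp add: j_eq C_residue coh_const)

lemma C_residual: "residual C k (residue C)"
proof -
  have h: "residue C \<in> ring_hom C k"
  proof (rule ring_hom_memI)
    fix x y assume "x \<in> carrier C"
    then obtain s where s: "coh s" "x = cs s" by (rule C_cases)
    show "residue C x \<in> carrier k" using s by (simp add: C_residue coh_closed)
    assume "y \<in> carrier C"
    then obtain t where t: "coh t" "y = cs t" by (rule C_cases)
    show "residue C (x \<otimes>\<^bsub>C\<^esub> y) = residue C x \<otimes>\<^bsub>k\<^esub> residue C y"
      "residue C (x \<oplus>\<^bsub>C\<^esub> y) = residue C x \<oplus>\<^bsub>k\<^esub> residue C y"
      using s t by (simp_all add: C_residue C_mult C_add coh_intros coh_closed)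
  next
    show "residue C \<one>\<^bsub>C\<^esub> = \<one>\<^bsub>k\<^esub>" by (simp add: C_one C_residue coh_intros)
  qed
  have "residue C ` carrier C = carrier k"
  proof
    show "residue C ` carrier C \<subseteq> carrier k" using ring_hom_closed[OF h] by auto
    show "carrier k \<subseteq> residue C ` carrier C"
    proof
      fix x assume "x \<in> carrier k"
      then obtain a where a: "a \<in> carrier A" "\<pi> a = x" using \<pi>_surj by (metis (no_types, lifting) imageE)
      hence "residue C (j a) = x" "j a \<in> carrier C" using C_residue_j ring_hom_closed[OF j_hom] by auto
      thus "x \<in> residue C ` carrier C" by blast
    qed
  qed
  with h show ?thesis
    by (simp add: residual_def residual_axioms_def C_cring k.field_axioms)
qed

lemma C_kernel: "a_kernel C k (residue C) = K 1"
proof -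
  have p1: "P 1 = m" by (simp only: One_nat_def A.ideal_pow_1[OF m_ideal])
  have e: "cs s \<in> a_kernel C k (residue C) \<longleftrightarrow> cs s \<in> K 1" if s: "coh s" for s
  proof -
    have "cs s \<in> a_kernel C k (residue C) \<longleftrightarrow> \<pi> (s 1) = \<zero>\<^bsub>k\<^esub>"
      unfolding a_kernel_mem C_residue[OF s] using cs_in_C[OF s] by blast
    also have "\<dots> \<longleftrightarrow> s 1 \<in> m" unfolding m_iff using coh_closed[OF s] by blast
    finally show ?thesis unfolding K_iff[OF s] p1 .
  qed
  show ?thesis
  proof (intro equalityI subsetI)
    fix f assume f: "f \<in> a_kernel C k (residue C)"
    hence "f \<in> carrier C" unfolding a_kernel_mem by blast
    then obtain s where "coh s" "f = cs s" by (rule C_cases)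
    thus "f \<in> K 1" using e f by blast
  next
    fix f assume f: "f \<in> K 1"
    then obtain s where "coh s" "f = cs s" by (rule K_cases)
    thus "f \<in> a_kernel C k (residue C)" using e f by blast
  qed
qed

theorem completion_complete_local_noetherian:
  "complete_local_noetherian k C" "max_ideal C = K 1" "mpow C i = K i"
proof -
  have "ideal_pow C (K 1) = K" using K_eq_pow by (rule ext)
  hence "complete_filtration C (ideal_pow C (a_kernel C k (residue C)))"
    unfolding C_kernel using K_complete by metis
  note * = cln_intro[OF C_residual this _ jF, unfolded C_kernel, OF K_1]
  show "complete_local_noetherian k C" by (rule *(1))
  show mx: "max_ideal C = K 1" by (rule *(2))
  show "mpow C i = K i" unfolding mx by (rule K_eq_pow)
qed

text \<open>The extension maps the class of a coherent sequence \<open>s\<close> to the limit of \<open>h (s i)\<close>.\<close>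

theorem completion_extend:
  assumes "complete_filtration B L" "h \<in> ring_hom A B" "\<And>i. h ` P i \<subseteq> L i"
  shows "\<exists>H\<in>ring_hom C B. (\<forall>a\<in>carrier A. H (j a) = h a) \<and> (\<forall>i. H ` K i \<subseteq> L i)"
proof -
  interpret B: complete_filtration B L by fact
  have hc: "h a \<in> carrier B" if "a \<in> carrier A" for a using ring_hom_closed[OF assms(2) that] .
  note hm = ring_hom_minus[OF A.is_cring B.is_cring assms(2)]
  have ex: "\<exists>b\<in>carrier B. \<forall>i. b \<ominus>\<^bsub>B\<^esub> h (s i) \<in> L i" if s: "coh s" for s
  proof (rule B.K_limit)
    show "h (s i) \<in> carrier B" for i using hc coh_closed[OF s] by blast
    show "h (s (Suc i)) \<ominus>\<^bsub>B\<^esub> h (s i) \<in> L i" for i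
      using s assms(3)[of i] unfolding coh_iff by (auto simp: hm[symmetric])
  qed
  define S where "S f = (SOME s. coh s \<and> f = cs s)" for f
  have S: "coh (S f)" "f = cs (S f)" if "f \<in> carrier C" for f
    using someI_ex[of "\<lambda>s. coh s \<and> f = cs s"] that unfolding S_def by (auto simp: C_carrier)
  define H where "H f = (SOME b. b \<in> carrier B \<and> (\<forall>i. b \<ominus>\<^bsub>B\<^esub> h (S f i) \<in> L i))" for f
  have H0: "H f \<in> carrier B" "H f \<ominus>\<^bsub>B\<^esub> h (S f i) \<in> L i" if "f \<in> carrier C" for f i
    using someI_ex[of "\<lambda>b. b \<in> carrier B \<and> (\<forall>i. b \<ominus>\<^bsub>B\<^esub> h (S f i) \<in> L i)"] ex[OF S(1)[OF that]] that
    unfolding H_def by blast+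
  have H1: "H (cs s) \<ominus>\<^bsub>B\<^esub> h (s i) \<in> L i" if s: "coh s" for s i
  proof -
    have c: "cs s \<in> carrier C" using cs_in_C[OF s] .
    have "S (cs s) i \<ominus> s i \<in> P i" using S(2)[OF c] cs_eq_iff[OF S(1)[OF c] s] by simp
    hence "h (S (cs s) i \<ominus> s i) \<in> L i" using assms(3)[of i] by blast
    hence "h (S (cs s) i) \<ominus>\<^bsub>B\<^esub> h (s i) \<in> L i" using coh_closed[OF S(1)[OF c]] coh_closed[OF s] by (simp add: hm)
    hence "(H (cs s) \<ominus>\<^bsub>B\<^esub> h (S (cs s) i)) \<oplus>\<^bsub>B\<^esub> (h (S (cs s) i) \<ominus>\<^bsub>B\<^esub> h (s i)) \<in> L i"
      using H0(2)[OF c] by (intro B.ideal_simps(3)[OF B.K_ideal])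
    moreover have "(H (cs s) \<ominus>\<^bsub>B\<^esub> h (S (cs s) i)) \<oplus>\<^bsub>B\<^esub> (h (S (cs s) i) \<ominus>\<^bsub>B\<^esub> h (s i)) = H (cs s) \<ominus>\<^bsub>B\<^esub> h (s i)"
      using H0(1)[OF c] hc[OF coh_closed[OF S(1)[OF c]], of i] hc[OF coh_closed[OF s], of i] by algebra
    ultimately show ?thesis by simp
  qed
  have uniq: "H (cs s) = b" if s: "coh s" and b: "b \<in> carrier B" "\<And>i. b \<ominus>\<^bsub>B\<^esub> h (s i) \<in> L i" for s b
  proof -
    have c: "H (cs s) \<in> carrier B" using H0(1) cs_in_C[OF s] by blast
    have "H (cs s) \<ominus>\<^bsub>B\<^esub> b \<in> L i" for i
    proof -
      have "(H (cs s) \<ominus>\<^bsub>B\<^esub> h (s i)) \<ominus>\<^bsub>B\<^esub> (b \<ominus>\<^bsub>B\<^esub> h (s i)) \<in> L i"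
        by (rule B.ideal_simps(4)[OF B.K_ideal H1[OF s] b(2)])
      moreover have "(H (cs s) \<ominus>\<^bsub>B\<^esub> h (s i)) \<ominus>\<^bsub>B\<^esub> (b \<ominus>\<^bsub>B\<^esub> h (s i)) = H (cs s) \<ominus>\<^bsub>B\<^esub> b"
        using c b(1) hc[OF coh_closed[OF s], of i] by algebra
      ultimately show ?thesis by simp
    qed
    hence "H (cs s) \<ominus>\<^bsub>B\<^esub> b = \<zero>\<^bsub>B\<^esub>" using c b by (intro B.K_separated) auto
    thus ?thesis using c b by (simp add: B.r_right_minus_eq)
  qed
  have Hj: "H (j a) = h a" if "a \<in> carrier A" for a
    unfolding j_eq using that hc B.ideal_simps(1)[OF B.K_ideal] by (intro uniq coh_const) auto
  have "H \<in> ring_hom C B"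
  proof (rule ring_hom_memI)
    show "H x \<in> carrier B" if "x \<in> carrier C" for x using H0 that by blast
    have "\<one>\<^bsub>C\<^esub> = j \<one>" by (simp add: j_eq C_one)
    thus "H \<one>\<^bsub>C\<^esub> = \<one>\<^bsub>B\<^esub>" using Hj[of \<one>] ring_hom_one[OF assms(2)] by simp
    fix x y assume xy: "x \<in> carrier C" "y \<in> carrier C"
    obtain s where s: "coh s" "x = cs s" using xy(1) by (rule C_cases)
    obtain t where t: "coh t" "y = cs t" using xy(2) by (rule C_cases)
    note c = H0(1)[OF xy(1)] H0(1)[OF xy(2)]
    note d = hc[OF coh_closed[OF s(1)]] hc[OF coh_closed[OF t(1)]]
    have "H (cs (\<lambda>i. s i \<oplus> t i)) = H x \<oplus>\<^bsub>B\<^esub> H y"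
    proof (rule uniq)
      fix i
      have "(H x \<ominus>\<^bsub>B\<^esub> h (s i)) \<oplus>\<^bsub>B\<^esub> (H y \<ominus>\<^bsub>B\<^esub> h (t i)) \<in> L i"
        unfolding s(2) t(2) by (intro B.ideal_simps(3)[OF B.K_ideal] H1 s t)
      moreover have "(H x \<ominus>\<^bsub>B\<^esub> h (s i)) \<oplus>\<^bsub>B\<^esub> (H y \<ominus>\<^bsub>B\<^esub> h (t i)) = H x \<oplus>\<^bsub>B\<^esub> H y \<ominus>\<^bsub>B\<^esub> (h (s i) \<oplus>\<^bsub>B\<^esub> h (t i))"
        using c d[of i] by algebra
      ultimately show "H x \<oplus>\<^bsub>B\<^esub> H y \<ominus>\<^bsub>B\<^esub> h (s i \<oplus> t i) \<in> L i"
        using ring_hom_add[OF assms(2)] coh_closed[OF s(1)] coh_closed[OF t(1)] by simp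
    qed (use c s t coh_intros in auto)
    thus "H (x \<oplus>\<^bsub>C\<^esub> y) = H x \<oplus>\<^bsub>B\<^esub> H y" using s t by (simp add: C_add)
    have "H (cs (\<lambda>i. s i \<otimes> t i)) = H x \<otimes>\<^bsub>B\<^esub> H y"
    proof (rule uniq)
      fix i
      have "(H x \<ominus>\<^bsub>B\<^esub> h (s i)) \<otimes>\<^bsub>B\<^esub> H y \<oplus>\<^bsub>B\<^esub> (H y \<ominus>\<^bsub>B\<^esub> h (t i)) \<otimes>\<^bsub>B\<^esub> h (s i) \<in> L i"
        using H1[OF s(1), of i] H1[OF t(1), of i] c d[of i] unfolding s(2)[symmetric] t(2)[symmetric]
        by (intro B.ideal_simps(3)[OF B.K_ideal] B.ideal_simps(6)[OF B.K_ideal])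
      moreover have "(H x \<ominus>\<^bsub>B\<^esub> h (s i)) \<otimes>\<^bsub>B\<^esub> H y \<oplus>\<^bsub>B\<^esub> (H y \<ominus>\<^bsub>B\<^esub> h (t i)) \<otimes>\<^bsub>B\<^esub> h (s i) = H x \<otimes>\<^bsub>B\<^esub> H y \<ominus>\<^bsub>B\<^esub> (h (s i) \<otimes>\<^bsub>B\<^esub> h (t i))"
        using c d[of i] by algebra
      ultimately show "H x \<otimes>\<^bsub>B\<^esub> H y \<ominus>\<^bsub>B\<^esub> h (s i \<otimes> t i) \<in> L i"
        using ring_hom_mult[OF assms(2)] coh_closed[OF s(1)] coh_closed[OF t(1)] by simp
    qed (use c s t coh_intros in auto)
    thus "H (x \<otimes>\<^bsub>C\<^esub> y) = H x \<otimes>\<^bsub>B\<^esub> H y" using s t by (simp add: C_mult)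
  qed
  moreover have "H f \<in> L i" if f: "f \<in> K i" for f i
  proof -
    obtain s where s: "coh s" "f = cs s" "s i \<in> P i" using f by (rule K_cases)
    have "h (s i) \<in> L i" using s(3) assms(3)[of i] by blast
    hence "(H f \<ominus>\<^bsub>B\<^esub> h (s i)) \<oplus>\<^bsub>B\<^esub> h (s i) \<in> L i"
      unfolding s(2) by (intro B.ideal_simps(3)[OF B.K_ideal] H1 s)
    moreover have "(H f \<ominus>\<^bsub>B\<^esub> h (s i)) \<oplus>\<^bsub>B\<^esub> h (s i) = H f"
      using H0(1)[OF cs_in_C[OF s(1)]] s(2) hc[OF coh_closed[OF s(1)], of i] by algebra
    ultimately show ?thesis by simp
  qed
  ultimately show ?thesis using Hj by blast
qed

lemma completion_hom_unique:
  assumes "complete_filtration B L" "H1 \<in> ring_hom C B" "H2 \<in> ring_hom C B"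
    "\<And>i. H1 ` K i \<subseteq> L i" "\<And>i. H2 ` K i \<subseteq> L i"
    "\<And>a. a \<in> carrier A ==> H1 (j a) = H2 (j a)" "f \<in> carrier C"
  shows "H1 f = H2 f"
proof -
  interpret B: complete_filtration B L by fact
  have c: "H1 g \<in> carrier B" "H2 g \<in> carrier B" if "g \<in> carrier C" for g
    using ring_hom_closed[OF assms(2) that] ring_hom_closed[OF assms(3) that] by auto
  have "H1 f \<ominus>\<^bsub>B\<^esub> H2 f \<in> L i" for i
  proof -
    obtain a where a: "a \<in> carrier A" "f \<ominus>\<^bsub>C\<^esub> j a \<in> K i" using j_dense[OF assms(7)] by blast
    let ?d = "f \<ominus>\<^bsub>C\<^esub> j a"
    have ja: "j a \<in> carrier C" using ring_hom_closed[OF j_hom a(1)] .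
    have d: "?d \<in> carrier C" "f = ?d \<oplus>\<^bsub>C\<^esub> j a" using assms(7) ja by (simp, algebra)
    have "H1 f = H1 ?d \<oplus>\<^bsub>B\<^esub> H1 (j a)" "H2 f = H2 ?d \<oplus>\<^bsub>B\<^esub> H1 (j a)"
      using ring_hom_add[OF assms(2) d(1) ja] ring_hom_add[OF assms(3) d(1) ja] d(2) assms(6)[OF a(1)] by auto
    hence "H1 f \<ominus>\<^bsub>B\<^esub> H2 f = H1 ?d \<ominus>\<^bsub>B\<^esub> H2 ?d"
      using c[OF d(1)] c[OF ja] by (simp only:) algebra
    moreover have "H1 ?d \<ominus>\<^bsub>B\<^esub> H2 ?d \<in> L i"
      using a(2) assms(4,5) by (intro B.ideal_simps(4)[OF B.K_ideal]) blast+
    ultimately show ?thesis by simp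
  qed
  hence "H1 f \<ominus>\<^bsub>B\<^esub> H2 f = \<zero>\<^bsub>B\<^esub>" using c[OF assms(7)] by (intro B.K_separated) auto
  thus ?thesis using c[OF assms(7)] by (simp add: B.r_right_minus_eq)
qed

end

subsection \<open>Images of complete local rings\<close>

lemma ideal_surj_image:
  assumes "h \<in> ring_hom A B" "h ` carrier A = carrier B" "cring A" "cring B" "ideal I A"
  shows "ideal (h ` I) B"
proof -
  interpret A: cring A by fact
  interpret B: cring B by fact
  note I = A.ideal_simps[OF assms(5)]
  show ?thesis
  proof (rule B.ideal_intro)
    show "h ` I \<subseteq> carrier B" using I(2) assms(2) by auto
    show "\<zero>\<^bsub>B\<^esub> \<in> h ` I" using I(1) ring_hom_zero[OF assms(1) A.ring_axioms B.ring_axioms] by (metis imageI)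
    fix x y assume "x \<in> h ` I"
    then obtain a where a: "a \<in> I" "x = h a" "a \<in> carrier A" using I(2) by blast
    show "x \<oplus>\<^bsub>B\<^esub> y \<in> h ` I" if "y \<in> h ` I"
    proof -
      from that obtain b where b: "b \<in> I" "y = h b" "b \<in> carrier A" using I(2) by blast
      have "h (a \<oplus>\<^bsub>A\<^esub> b) = x \<oplus>\<^bsub>B\<^esub> y" using a b ring_hom_add[OF assms(1)] by simp
      thus ?thesis using I(3)[OF a(1) b(1)] by (metis imageI)
    qed
    show "y \<otimes>\<^bsub>B\<^esub> x \<in> h ` I" if "y \<in> carrier B"
    proof -
      from that obtain b where b: "y = h b" "b \<in> carrier A" using assms(2) by auto
      have "h (b \<otimes>\<^bsub>A\<^esub> a) = y \<otimes>\<^bsub>B\<^esub> x" using a b ring_hom_mult[OF assms(1)] by simp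
      thus ?thesis using I(7)[OF a(1) b(2)] by (metis imageI)
    qed
  qed
qed

lemma ideal_pow_surj_image:
  assumes h: "h \<in> ring_hom A B" "h ` carrier A = carrier B" "cring A" "cring B" and I: "ideal I A"
  shows "ideal_pow B (h ` I) i = h ` ideal_pow A I i"
proof
  interpret A: cring A by fact
  interpret B: cring B by fact
  show "h ` ideal_pow A I i \<subseteq> ideal_pow B (h ` I) i"
    by (rule ideal_pow_image[OF h(3,4,1) I ideal_surj_image[OF h I] subset_refl])
  show "ideal_pow B (h ` I) i \<subseteq> h ` ideal_pow A I i"
  proof (induction i)
    case (Suc i)
    have J: "ideal (h ` ideal_prod A I (ideal_pow A I i)) B"
      using ideal_surj_image[OF h A.ideal_pow_ideal[OF I, of "Suc i"]] by simp
    have "y \<in> h ` ideal_prod A I (ideal_pow A I i)" if "y \<in> ideal_prod B (h ` I) (ideal_pow B (h ` I) i)" for y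
      using that
    proof induction
      case (prod s t)
      then obtain a b where ab: "a \<in> I" "s = h a" "b \<in> ideal_pow A I i" "t = h b" using Suc by blast
      hence "h (a \<otimes>\<^bsub>A\<^esub> b) = s \<otimes>\<^bsub>B\<^esub> t"
        using ring_hom_mult[OF h(1)] A.ideal_simps(2)[OF I] A.ideal_simps(2)[OF A.ideal_pow_ideal[OF I]] by simp
      thus ?case using ideal_prod.prod[OF ab(1,3)] by (metis imageI)
    next
      case (sum s t)
      thus ?case using B.ideal_simps(3)[OF J] by blast
    qed
    thus ?case by auto
  qed (use h(2) in simp)
qed

lemma genideal_surj_image:
  assumes "h \<in> ring_hom A B" "h ` carrier A = carrier B" "cring A" "cring B" "F \<subseteq> carrier A"
  shows "h ` (Idl\<^bsub>A\<^esub> F) = Idl\<^bsub>B\<^esub> (h ` F)"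
proof
  interpret A: cring A by fact
  interpret B: cring B by fact
  have hF: "h ` F \<subseteq> carrier B" using assms(2,5) by auto
  have "ideal {a \<in> carrier A. h a \<in> Idl\<^bsub>B\<^esub> (h ` F)} A"
    by (rule ideal_preimage[OF assms(3,4,1) B.genideal_ideal[OF hF]])
  moreover have "F \<subseteq> {a \<in> carrier A. h a \<in> Idl\<^bsub>B\<^esub> (h ` F)}"
    using assms(5) B.genideal_self[OF hF] by auto
  ultimately have "Idl\<^bsub>A\<^esub> F \<subseteq> {a \<in> carrier A. h a \<in> Idl\<^bsub>B\<^esub> (h ` F)}" by (rule A.genideal_minimal)
  thus "h ` (Idl\<^bsub>A\<^esub> F) \<subseteq> Idl\<^bsub>B\<^esub> (h ` F)" by auto
  have "h ` F \<subseteq> h ` (Idl\<^bsub>A\<^esub> F)" using A.genideal_self[OF assms(5)] by auto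
  thus "Idl\<^bsub>B\<^esub> (h ` F) \<subseteq> h ` (Idl\<^bsub>A\<^esub> F)"
    by (intro B.genideal_minimal ideal_surj_image[OF assms(1-4)] A.genideal_ideal assms(5))
qed

text \<open>The differences of a Cauchy sequence in \<open>B\<close> lift to the same powers of the maximal ideal of \<open>A\<close>, and
  the limit of the lifted sequence maps to a limit.\<close>

theorem cln_image:
  assumes k: "field k" and A: "complete_local_noetherian k A" and B: "cring B"
    and h: "h \<in> ring_hom A B" "h ` carrier A = carrier B"
    and res: "residue B \<in> ring_hom B k" "\<And>a. a \<in> carrier A ==> residue B (h a) = residue A a"
    and sep: "\<And>b. b \<in> carrier B ==> (\<And>i. b \<in> h ` mpow A i) ==> b = \<zero>\<^bsub>B\<^esub>"
  shows "complete_local_noetherian k B" "max_ideal B = h ` max_ideal A"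
    "mpow B i = h ` mpow A i"
proof -
  note e = cln_elim[OF k A]
  interpret A: residual A k "residue A" by (rule e(1))
  interpret B: cring B by (rule B)
  let ?m = "max_ideal A"
  interpret K: complete_filtration A "ideal_pow A ?m" by (rule e(3))
  have hc: "h a \<in> carrier B" if "a \<in> carrier A" for a using ring_hom_closed[OF h(1) that] .
  have hz: "h \<zero>\<^bsub>A\<^esub> = \<zero>\<^bsub>B\<^esub>" by (rule ring_hom_zero[OF h(1) A.A.ring_axioms B.ring_axioms])
  note hm = ring_hom_minus[OF A.A.is_cring B h(1)]
  have surj: "residue B ` carrier B = carrier k"
  proof -
    have "residue B ` h ` carrier A = residue A ` carrier A" using res(2) by (force simp: image_iff)
    thus ?thesis using h(2) A.\<pi>_surj by simp
  qed
  have resB: "residual B k (residue B)"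
    using B k res(1) surj by (simp add: residual_def residual_axioms_def)
  have ker: "a_kernel B k (residue B) = h ` ?m"
  proof (intro equalityI subsetI)
    fix b assume "b \<in> a_kernel B k (residue B)"
    hence b: "b \<in> carrier B" "residue B b = \<zero>\<^bsub>k\<^esub>" unfolding a_kernel_mem by auto
    then obtain a where a: "a \<in> carrier A" "b = h a" using h(2) by auto
    hence "a \<in> ?m" unfolding e(2) a_kernel_mem using b(2) res(2) by simp
    thus "b \<in> h ` ?m" using a by blast
  next
    fix b assume "b \<in> h ` ?m"
    then obtain a where a: "a \<in> ?m" "b = h a" by blast
    hence "a \<in> carrier A" "residue A a = \<zero>\<^bsub>k\<^esub>" unfolding e(2) a_kernel_mem by auto
    thus "b \<in> a_kernel B k (residue B)" unfolding a_kernel_mem using a(2) res(2) hc by simp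
  qed
  have pow: "ideal_pow B (h ` ?m) i = h ` ideal_pow A ?m i" for i
    by (rule ideal_pow_surj_image[OF h e(5) B e(6)])
  obtain F where F: "F \<subseteq> carrier A" "finite F" "?m = Idl\<^bsub>A\<^esub> F" using e(4) by blast
  have gen: "h ` ?m = Idl\<^bsub>B\<^esub> (h ` F)" unfolding F(3) by (rule genideal_surj_image[OF h e(5) B F(1)])
  have idm: "ideal (h ` ?m) B" by (rule ideal_surj_image[OF h e(5) B e(6)])
  have compl: "complete_filtration B (ideal_pow B (h ` ?m))"
  proof (rule B.complete_filtrationI)
    show "ideal (ideal_pow B (h ` ?m) i) B" for i by (rule B.ideal_pow_ideal[OF idm])
    show "ideal_pow B (h ` ?m) (Suc i) \<subseteq> ideal_pow B (h ` ?m) i" for i by (rule B.ideal_pow_Suc_subset[OF idm])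
    show "a = \<zero>\<^bsub>B\<^esub>" if "a \<in> carrier B" "\<And>i. a \<in> ideal_pow B (h ` ?m) i" for a
      using that sep unfolding pow by blast
    show "\<exists>a\<in>carrier B. \<forall>i. a \<ominus>\<^bsub>B\<^esub> s i \<in> ideal_pow B (h ` ?m) i"
      if s: "\<And>i. s i \<in> carrier B" "\<And>i. s (Suc i) \<ominus>\<^bsub>B\<^esub> s i \<in> ideal_pow B (h ` ?m) i" for s
    proof -
      have "\<exists>d. d \<in> ideal_pow A ?m i \<and> s (Suc i) \<ominus>\<^bsub>B\<^esub> s i = h d" for i using s(2)[of i] unfolding pow by blast
      then obtain d where d: "\<And>i. d i \<in> ideal_pow A ?m i" "\<And>i. s (Suc i) \<ominus>\<^bsub>B\<^esub> s i = h (d i)" by metis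
      have dc: "d i \<in> carrier A" for i using d(1) K.K_carrier by blast
      obtain c where c: "c \<in> carrier A" "s 0 = h c" using s(1)[of 0] h(2) by auto
      define t where "t = rec_nat c (\<lambda>i x. x \<oplus>\<^bsub>A\<^esub> d i)"
      have t0: "t 0 = c" and tS: "t (Suc i) = t i \<oplus>\<^bsub>A\<^esub> d i" for i by (simp_all add: t_def)
      have tc: "t i \<in> carrier A" for i by (induction i) (simp_all add: t0 tS c dc)
      have ht: "h (t i) = s i" for i
      proof (induction i)
        case (Suc i)
        have "h (t (Suc i)) = s i \<oplus>\<^bsub>B\<^esub> (s (Suc i) \<ominus>\<^bsub>B\<^esub> s i)"
          unfolding tS ring_hom_add[OF h(1) tc dc] Suc d(2) ..
        also have "\<dots> = s (Suc i)" using s(1)[of i] s(1)[of "Suc i"] by algebra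
        finally show ?case .
      qed (simp add: t0 c)
      have "t (Suc i) \<ominus>\<^bsub>A\<^esub> t i \<in> mpow A i" for i
      proof -
        have "t (Suc i) \<ominus>\<^bsub>A\<^esub> t i = d i" unfolding tS using tc[of i] dc[of i] by algebra
        thus ?thesis using d(1) by simp
      qed
      then obtain a where a: "a \<in> carrier A" "\<And>i. a \<ominus>\<^bsub>A\<^esub> t i \<in> mpow A i" using K.K_limit[of t, OF tc] by blast
      have "h a \<ominus>\<^bsub>B\<^esub> s i \<in> ideal_pow B (h ` ?m) i" for i
        unfolding pow using a(2)[of i] hm[OF a(1) tc[of i]] by (simp add: ht image_iff) metis
      thus ?thesis using hc[OF a(1)] by blast
    qed
  qed
  have hF: "h ` F \<subseteq> carrier B" "finite (h ` F)" using F hc by auto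
  note * = cln_intro[OF resB _ _ hF, unfolded ker, OF compl gen]
  show "complete_local_noetherian k B" by (rule *(1))
  show mx: "max_ideal B = h ` ?m" by (rule *(2))
  show "mpow B i = h ` ideal_pow A ?m i" unfolding mx by (rule pow)
qed

subsection \<open>Chevalley's theorem\<close>

context residual
begin

text \<open>Since \<open>my \<subseteq> S\<close>, the quotient of \<open>S + Ay\<close> by \<open>S\<close> is a vector space of dimension at most one over the
  residue field. So either some \<open>U i\<close> lies in \<open>S\<close>, or every \<open>U i\<close> maps onto this quotient and is
  determined by its intersection with \<open>S\<close>; in both cases the chains between \<open>H\<close> and \<open>S\<close> decide.\<close>

lemma chain_step:
  assumes unit: "\<And>a. a \<in> carrier A ==> a \<notin> m ==> \<exists>b\<in>carrier A. a \<otimes> b = \<one>"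
    and S: "ideal S A" and y: "y \<in> carrier A" "\<And>c. c \<in> m ==> c \<otimes> y \<in> S"
    and IH: "\<And>U. (\<And>i. ideal (U i) A) ==> (\<And>i. U (Suc i) \<subseteq> U i) ==> (\<And>i. H \<subseteq> U i) ==> (\<And>i. U i \<subseteq> S) ==>
        \<exists>n. \<forall>i\<ge>n. U n \<subseteq> U i"
    and HS: "H \<subseteq> S"
    and U: "\<And>i. ideal (U i) A" "\<And>i. U (Suc i) \<subseteq> U i" "\<And>i. H \<subseteq> U i"
      "\<And>i u. u \<in> U i ==> \<exists>s\<in>S. \<exists>d\<in>carrier A. u = s \<oplus> d \<otimes> y"
  shows "\<exists>n::nat. \<forall>i\<ge>n. U n \<subseteq> U i"
proof -
  have mono: "U i' \<subseteq> U i" if "i \<le> i'" for i i' using lift_Suc_antimono_le[of U, OF U(2) that] .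
  have "\<exists>n. \<forall>i\<ge>n. U n \<inter> S \<subseteq> U i \<inter> S"
    using A.i_intersect[OF U(1) S] U(2,3) HS by (intro IH[of "\<lambda>i. U i \<inter> S"]) blast+
  then obtain n where n: "\<And>i. i \<ge> n ==> U n \<inter> S \<subseteq> U i \<inter> S" by blast
  show ?thesis
  proof (cases "\<exists>n'. U n' \<subseteq> S")
    case True
    then obtain n' where n': "U n' \<subseteq> S" by blast
    have "U (max n n') \<subseteq> U i" if "i \<ge> max n n'" for i
    proof -
      have "U (max n n') \<subseteq> U n \<inter> S" using mono[of n "max n n'"] mono[of n' "max n n'"] n' by auto
      thus ?thesis using n[of i] that by auto
    qed
    thus ?thesis by blast
  next
    case False
    have "U n \<subseteq> U i" if i: "i \<ge> n" for i
    proof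
      fix u assume u: "u \<in> U n"
      obtain v where v: "v \<in> U i" "v \<notin> S" using False by blast
      obtain s c where sc: "s \<in> S" "c \<in> carrier A" "v = s \<oplus> c \<otimes> y" using U(4)[OF v(1)] by blast
      obtain t d where td: "t \<in> S" "d \<in> carrier A" "u = t \<oplus> d \<otimes> y" using U(4)[OF u] by blast
      note SC = A.ideal_simps[OF S]
      have stc: "s \<in> carrier A" "t \<in> carrier A" using sc td SC(2) by auto
      have "c \<notin> m"
      proof
        assume "c \<in> m"
        hence "v \<in> S" unfolding sc(3) using SC(3)[OF sc(1) y(2)] by blast
        thus False using v by simp
      qed
      then obtain b where b: "b \<in> carrier A" "c \<otimes> b = \<one>" using unit[OF sc(2)] by blast
      have vc: "v \<in> carrier A" using sc stc y by simp
      have 1: "d \<otimes> b \<otimes> v \<in> U i" using A.ideal_simps(7)[OF U(1) v(1)] td b by simp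
      have 2: "u \<ominus> d \<otimes> b \<otimes> v \<in> U n"
        using u 1 mono[OF i] by (intro A.ideal_simps(4)[OF U(1)]) auto
      have "d \<otimes> b \<otimes> (s \<oplus> c \<otimes> y) = d \<otimes> b \<otimes> s \<oplus> (c \<otimes> b) \<otimes> (d \<otimes> y)"
        using stc b(1) sc(2) td(2) y(1) by algebra
      hence "d \<otimes> b \<otimes> v = d \<otimes> b \<otimes> s \<oplus> d \<otimes> y" unfolding sc(3) b(2) using td y by simp
      hence "u \<ominus> d \<otimes> b \<otimes> v = (t \<oplus> d \<otimes> y) \<ominus> (d \<otimes> b \<otimes> s \<oplus> d \<otimes> y)" unfolding td(3) by simp
      also have "\<dots> = t \<ominus> d \<otimes> b \<otimes> s"
        using stc b(1) td(2) y(1) by algebra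
      also have "\<dots> \<in> S" using SC(4)[OF td(1)] SC(7)[OF sc(1)] td b by simp
      finally have "u \<ominus> d \<otimes> b \<otimes> v \<in> U i" using 2 n[OF i] by blast
      hence "(u \<ominus> d \<otimes> b \<otimes> v) \<oplus> d \<otimes> b \<otimes> v \<in> U i" using 1 by (rule A.ideal_simps(3)[OF U(1)])
      moreover have "(u \<ominus> d \<otimes> b \<otimes> v) \<oplus> d \<otimes> b \<otimes> v = u"
        using td stc y vc b(1) unfolding td(3) by algebra
      ultimately show "u \<in> U i" by simp
    qed
    thus ?thesis by blast
  qed
qed

lemma chain_fin_gen:
  assumes unit: "\<And>a. a \<in> carrier A ==> a \<notin> m ==> \<exists>b\<in>carrier A. a \<otimes> b = \<one>"
    and H: "ideal H A" and G: "finite G" "G \<subseteq> carrier A" "\<And>c y. c \<in> m ==> y \<in> G ==> c \<otimes> y \<in> H"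
    and U: "\<And>i. ideal (U i) A" "\<And>i. U (Suc i) \<subseteq> U i" "\<And>i. H \<subseteq> U i" "\<And>i. U i \<subseteq> H <+>\<^bsub>A\<^esub> Idl G"
  shows "\<exists>n::nat. \<forall>i\<ge>n. U n \<subseteq> U i"
  using G U
proof (induction G arbitrary: U rule: finite_induct)
  case empty
  have "Idl {} \<subseteq> {\<zero>}" by (rule A.genideal_minimal[OF A.zeroideal]) simp
  hence "H <+>\<^bsub>A\<^esub> Idl {} \<subseteq> H" using A.ideal_simps(2)[OF H] unfolding set_add_def' by auto
  hence "U i = H" for i using empty(5,6) by blast
  thus ?case by auto
next
  case (insert y G)
  have Gc: "G \<subseteq> carrier A" "y \<in> carrier A" using insert.prems(1) by auto
  have S: "ideal (H <+>\<^bsub>A\<^esub> Idl G) A" by (intro A.add_ideals H A.genideal_ideal Gc)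
  have HS: "H \<subseteq> H <+>\<^bsub>A\<^esub> Idl G"
  proof
    fix x assume x: "x \<in> H"
    hence "x \<oplus> \<zero> \<in> H <+>\<^bsub>A\<^esub> Idl G"
      using A.ideal_simps(1)[OF A.genideal_ideal[OF Gc(1)]] unfolding set_add_def' by blast
    thus "x \<in> H <+>\<^bsub>A\<^esub> Idl G" using x A.ideal_simps(2)[OF H] by simp
  qed
  show ?case
  proof (rule chain_step[OF unit S Gc(2) _ _ HS])
    show "c \<otimes> y \<in> H <+>\<^bsub>A\<^esub> Idl G" if "c \<in> m" for c using insert.prems(2)[OF that] HS by blast
    show "\<exists>n. \<forall>i\<ge>n. U n \<subseteq> U i" if "\<And>i. ideal (U i) A" "\<And>i. U (Suc i) \<subseteq> U i" "\<And>i. H \<subseteq> U i" "\<And>i. U i \<subseteq> H <+>\<^bsub>A\<^esub> Idl G" for U :: "nat \<Rightarrow> 'a set"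
      using insert.IH[of U, OF Gc(1) _ that] insert.prems(2) by blast
    show "ideal (U i) A" "U (Suc i) \<subseteq> U i" "H \<subseteq> U i" for i using insert.prems by auto
    fix i u assume "u \<in> U i"
    hence "u \<in> H <+>\<^bsub>A\<^esub> Idl (insert y G)" using insert.prems(6) by blast
    then obtain z w where zw: "z \<in> H" "w \<in> Idl (insert y G)" "u = z \<oplus> w" unfolding set_add_def' by blast
    obtain a where a: "a \<in> insert y G \<rightarrow> carrier A" "w = (\<Oplus>x\<in>insert y G. a x \<otimes> x)"
      using zw(2) A.genideal_finite[OF insert.prems(1)] insert.hyps by auto
    let ?w = "\<Oplus>x\<in>G. a x \<otimes> x"
    have "w = a y \<otimes> y \<oplus> ?w"
      unfolding a(2) using insert.hyps Gc a(1) by (intro A.finsum_insert) auto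
    moreover have w: "?w \<in> Idl G" using A.genideal_finite[OF Gc(1) insert.hyps(1)] a(1) by auto
    moreover have c: "?w \<in> carrier A" "a y \<in> carrier A" "z \<in> carrier A"
      using w A.ideal_simps(2)[OF A.genideal_ideal[OF Gc(1)]] a(1) zw(1) A.ideal_simps(2)[OF H] by auto
    ultimately have "u = (z \<oplus> ?w) \<oplus> a y \<otimes> y" unfolding zw(3) using Gc(2) by (simp add: A.a_ac)
    moreover have "z \<oplus> ?w \<in> H <+>\<^bsub>A\<^esub> Idl G" using zw(1) w unfolding set_add_def' by blast
    ultimately show "\<exists>s\<in>H <+>\<^bsub>A\<^esub> Idl G. \<exists>d\<in>carrier A. u = s \<oplus> d \<otimes> y" using c(2) by blast
  qed
qed

text \<open>The ring \<open>A/m^n\<close> has finite length, so the images of the ideals \<open>b i\<close> in it stabilise. The induction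
  adds one layer \<open>m^n/m^(n+1)\<close> at a time.\<close>

lemma chain_stable_mod_pow:
  assumes unit: "\<And>a. a \<in> carrier A ==> a \<notin> m ==> \<exists>b\<in>carrier A. a \<otimes> b = \<one>"
    and noeth: "noetherian_ring A"
    and b: "\<And>i. ideal (b i) A" "\<And>i. b (Suc i) \<subseteq> b i"
  shows "\<exists>N::nat. \<forall>i\<ge>N. \<forall>x\<in>b N. \<exists>y\<in>b i. x \<ominus> y \<in> P n"
proof (induction n)
  case 0
  have "\<forall>i\<ge>0. \<forall>x\<in>b 0. \<exists>y\<in>b i. x \<ominus> y \<in> P 0"
    using A.ideal_simps(1,2)[OF b(1)] by (intro allI impI ballI bexI[of _ \<zero>]) (auto simp: A.minus_eq)
  thus ?case by blast
next
  case (Suc n)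
  have mono: "b i' \<subseteq> b i" if "i \<le> i'" for i i' using lift_Suc_antimono_le[of b, OF b(2) that] .
  from Suc obtain N0 where N0: "\<And>i x. i \<ge> N0 ==> x \<in> b N0 ==> \<exists>y\<in>b i. x \<ominus> y \<in> P n" by blast
  obtain G where G: "G \<subseteq> carrier A" "finite G" "P n = Idl G"
    using noetherian_ring.finetely_gen[OF noeth P_ideal] by blast
  define U where "U i = P (Suc n) <+>\<^bsub>A\<^esub> (b i \<inter> P n)" for i
  have in_U: "x \<in> U i" if "x \<in> b i" "x \<in> P n" for x i
  proof -
    have "\<zero> \<oplus> x \<in> U i" unfolding U_def set_add_def' using that P_simps(1) by blast
    thus ?thesis using P_simps(2)[OF that(2)] by simp
  qed
  have "\<exists>N. \<forall>i\<ge>N. U N \<subseteq> U i"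
  proof (rule chain_fin_gen[OF unit P_ideal G(2,1)])
    show "c \<otimes> y \<in> P (Suc n)" if "c \<in> m" "y \<in> G" for c y
      using that A.genideal_self[OF G(1)] G(3) by (auto intro: ideal_prod.prod)
    show "ideal (U i) A" for i unfolding U_def by (intro A.add_ideals P_ideal A.i_intersect b(1))
    show "U (Suc i) \<subseteq> U i" for i unfolding U_def set_add_def' using b(2) by blast
    show "P (Suc n) \<subseteq> U i" for i
    proof
      fix x assume x: "x \<in> P (Suc n)"
      have "x \<oplus> \<zero> \<in> U i" unfolding U_def set_add_def'
        using x P_simps(1) A.ideal_simps(1)[OF b(1)] by blast
      thus "x \<in> U i" using P_simps(2)[OF x] by simp
    qed
    show "U i \<subseteq> P (Suc n) <+>\<^bsub>A\<^esub> Idl G" for i unfolding U_def set_add_def' G(3)[symmetric] by blast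
  qed
  then obtain N1 where N1: "\<And>i. i \<ge> N1 ==> U N1 \<subseteq> U i" by blast
  have "\<exists>y\<in>b i. x \<ominus> y \<in> P (Suc n)" if i: "i \<ge> max N0 N1" and x: "x \<in> b (max N0 N1)" for i x
  proof -
    have "x \<in> b N0" using x mono[of N0 "max N0 N1"] by auto
    then obtain y where y: "y \<in> b i" "x \<ominus> y \<in> P n" using N0[of i x] i by auto
    have "y \<in> b (max N0 N1)" using y(1) mono[OF i] by blast
    hence "x \<ominus> y \<in> b (max N0 N1)" using x by (intro A.ideal_simps(4)[OF b(1)])
    hence "x \<ominus> y \<in> b N1" using mono[of N1 "max N0 N1"] by auto
    hence "x \<ominus> y \<in> U i" using in_U y(2) N1[of i] i by auto
    then obtain w z where wz: "w \<in> P (Suc n)" "z \<in> b i" "x \<ominus> y = w \<oplus> z" unfolding U_def set_add_def' by blast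
    have c: "x \<in> carrier A" "y \<in> carrier A" "w \<in> carrier A" "z \<in> carrier A"
      using A.ideal_simps(2)[OF b(1)] x y wz P_simps(2) by blast+
    have "x \<ominus> (y \<oplus> z) = (x \<ominus> y) \<ominus> z" using c by algebra
    also have "\<dots> = (w \<oplus> z) \<ominus> z" unfolding wz(3) ..
    also have "\<dots> = w" using c by algebra
    finally show ?thesis using wz(1,2) y(1) A.ideal_simps(3)[OF b(1)] by metis
  qed
  thus ?case by blast
qed

text \<open>Suppose that \<open>x0\<close> lies in \<open>b i\<close> for a large \<open>i\<close>, but not in \<open>P n\<close>. As the \<open>b i\<close> are stable modulo each
  power of \<open>m\<close>, there is a sequence starting with \<open>x0\<close> that runs through smaller and smaller \<open>b i\<close> and
  converges, with steps in \<open>P n\<close>. Its limit lies in every \<open>b i\<close>, because these contain powers of \<open>m\<close>. So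
  the limit is zero, and \<open>x0 \<in> P n\<close>.\<close>

theorem chevalley:
  assumes compl: "complete_filtration A P" and noeth: "noetherian_ring A"
    and b: "\<And>i. ideal (b i) A" "\<And>i. b (Suc i) \<subseteq> b i" "\<And>i. P i \<subseteq> b i"
    and sep: "\<And>x. x \<in> carrier A ==> (\<And>i. x \<in> b i) ==> x = \<zero>"
  shows "\<exists>i. b i \<subseteq> P n"
proof (rule ccontr)
  assume no: "\<nexists>i. b i \<subseteq> P n"
  interpret K: complete_filtration A P by (rule compl)
  have unit: "\<exists>b\<in>carrier A. a \<otimes> b = \<one>" if "a \<in> carrier A" "a \<notin> m" for a
    using complete_unit[OF compl that(1)] that by (auto simp: m_iff)
  have mono: "b i' \<subseteq> b i" if "i \<le> i'" for i i' using lift_Suc_antimono_le[of b, OF b(2) that] .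
  have "\<exists>N. \<forall>i\<ge>N. \<forall>x\<in>b N. \<exists>y\<in>b i. x \<ominus> y \<in> P l" for l
    using chain_stable_mod_pow[where b = b, OF unit noeth b(1,2)] by blast
  then obtain N where N: "\<And>l i x. i \<ge> N l ==> x \<in> b (N l) ==> \<exists>y\<in>b i. x \<ominus> y \<in> P l" by metis
  \<comment> \<open>an increasing bound for \<open>N\<close> and the identity\<close>
  define M where "M l = (\<Sum>i\<le>l. N i) + l" for l
  have MN: "N l \<le> M l" for l unfolding M_def by (rule trans_le_add1) (rule member_le_sum, auto)
  have MS: "M l \<le> M (Suc l)" "l \<le> M l" for l by (auto simp: M_def)
  have step: "\<exists>y. y \<in> b (M (Suc l)) \<and> y \<ominus> x \<in> P l" if x: "x \<in> b (M l)" for l x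
  proof -
    have "x \<in> b (N l)" using x mono[OF MN] by blast
    moreover have "M (Suc l) \<ge> N l" using MN[of l] MS(1)[of l] by simp
    ultimately obtain y where y: "y \<in> b (M (Suc l))" "x \<ominus> y \<in> P l" using N by blast
    have c: "x \<in> carrier A" "y \<in> carrier A" using A.ideal_simps(2)[OF b(1)] x y by blast+
    have "\<ominus> (x \<ominus> y) \<in> P l" using y(2) by (rule P_simps(5))
    moreover have "\<ominus> (x \<ominus> y) = y \<ominus> x" using c by algebra
    ultimately show ?thesis using y(1) by auto
  qed
  obtain x0 where x0: "x0 \<in> b (M n)" "x0 \<notin> P n" using no by blast
  define s where "s = rec_nat x0 (\<lambda>j x. SOME y. y \<in> b (M (Suc (n + j))) \<and> y \<ominus> x \<in> P (n + j))"
  have s0: "s 0 = x0" and sS: "s (Suc j) = (SOME y. y \<in> b (M (Suc (n + j))) \<and> y \<ominus> s j \<in> P (n + j))" for j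
    by (auto simp: s_def)
  have sb: "s j \<in> b (M (n + j))" for j
  proof (induction j)
    case (Suc j)
    show ?case using someI_ex[OF step[OF Suc]] unfolding sS by simp
  qed (use x0 s0 in simp)
  have sd: "s (Suc j) \<ominus> s j \<in> P (n + j)" for j
    using someI_ex[OF step[OF sb]] unfolding sS by simp
  have sc: "s j \<in> carrier A" for j using sb A.ideal_simps(2)[OF b(1)] by blast
  interpret Kn: complete_filtration A "\<lambda>i. P (n + i)" by (rule K.shift)
  obtain x where x: "x \<in> carrier A" "\<And>j. x \<ominus> s j \<in> P (n + j)" using Kn.K_limit[of s, OF sc sd] by blast
  have "x \<in> b i" for i
  proof -
    have "x \<ominus> s i \<in> b i" using x(2)[of i] b(3)[of "n + i"] mono[of i "n + i"] by auto
    moreover have "s i \<in> b i" using sb[of i] mono[of i "M (n + i)"] MS(2)[of "n + i"] by auto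
    ultimately have "(x \<ominus> s i) \<oplus> s i \<in> b i" by (rule A.ideal_simps(3)[OF b(1)])
    moreover have "(x \<ominus> s i) \<oplus> s i = x" using x(1) sc[of i] by algebra
    ultimately show ?thesis by simp
  qed
  hence "x = \<zero>" using sep x(1) by blast
  hence "\<zero> \<ominus> x0 \<in> P n" using x(2)[of 0] s0 by simp
  hence "\<ominus> (\<zero> \<ominus> x0) \<in> P n" by (rule P_simps(5))
  moreover have "\<ominus> (\<zero> \<ominus> x0) = x0" using sc[of 0] s0 by (simp add: A.minus_eq)
  ultimately show False using x0(2) by simp
qed

end

subsection \<open>Coefficient algebras as sets of sequences in the residue field\<close>

text \<open>An element of \<open>P i\<close> is determined modulo \<open>P (Suc i)\<close> by the residues of its coefficients with respect
  to the finite set \<open>G\<close> of generators. These digits become functions of an arbitrary \<open>a\<close> after subtracting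
  a representative that only depends on the coset of \<open>a\<close>.\<close>

lemma (in residual) graded_digits:
  assumes G: "G \<subseteq> carrier A" "finite G" "P i = Idl G"
  shows "\<exists>g::'a \<Rightarrow> nat \<Rightarrow> 'k. \<forall>a\<in>carrier A. \<forall>b\<in>carrier A. a \<ominus> b \<in> P i \<longrightarrow> g a = g b \<longrightarrow> a \<ominus> b \<in> P (Suc i)"
proof -
  define r where "r a = (SOME b. b \<in> P i +> a)" for a
  have r: "r a \<in> carrier A" "a \<ominus> r a \<in> P i" if a: "a \<in> carrier A" for a
  proof -
    have "a \<in> P i +> a" using A.mem_coset_iff[OF P_ideal a, of a i] P_simps(1) A.minus_self[OF a] a by metis
    hence "r a \<in> P i +> a" unfolding r_def by (rule someI)
    hence *: "r a \<in> carrier A" "r a \<ominus> a \<in> P i" using A.mem_coset_iff[OF P_ideal a] by blast+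
    have "\<ominus> (r a \<ominus> a) \<in> P i" using *(2) by (rule P_simps(5))
    moreover have "\<ominus> (r a \<ominus> a) = a \<ominus> r a" using *(1) a by algebra
    ultimately show "r a \<in> carrier A" "a \<ominus> r a \<in> P i" using * by auto
  qed
  define c where "c a = (SOME c. c \<in> G \<rightarrow> carrier A \<and> a \<ominus> r a = (\<Oplus>x\<in>G. c x \<otimes> x))" for a
  have c: "c a \<in> G \<rightarrow> carrier A" "a \<ominus> r a = (\<Oplus>x\<in>G. c a x \<otimes> x)" if a: "a \<in> carrier A" for a
  proof -
    have "\<exists>c. c \<in> G \<rightarrow> carrier A \<and> a \<ominus> r a = (\<Oplus>x\<in>G. c x \<otimes> x)"
      using r(2)[OF a] unfolding G(3) A.genideal_finite[OF G(1,2)] by blast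
    from someI_ex[OF this] show "c a \<in> G \<rightarrow> carrier A" "a \<ominus> r a = (\<Oplus>x\<in>G. c a x \<otimes> x)"
      unfolding c_def by auto
  qed
  obtain e :: "'a \<Rightarrow> nat" where e: "inj_on e G" using finite_imp_inj_to_nat_seg[OF G(2)] by metis
  define g where "g a l = \<pi> (c a (inv_into G e l))" for a l
  have "a \<ominus> b \<in> P (Suc i)" if a: "a \<in> carrier A" and b: "b \<in> carrier A" and ab: "a \<ominus> b \<in> P i" "g a = g b" for a b
  proof -
    have "P i +> a = P i +> b" using A.coset_eq_iff[OF P_ideal a b] ab(1) by blast
    hence rr: "r a = r b" unfolding r_def by simp
    have "a \<ominus> b = (a \<ominus> r a) \<ominus> (b \<ominus> r b)" unfolding rr using a b r(1)[OF b] by algebra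
    also have "\<dots> = (\<Oplus>x\<in>G. c a x \<otimes> x) \<ominus> (\<Oplus>x\<in>G. c b x \<otimes> x)" using c(2)[OF a] c(2)[OF b] by simp
    also have "\<dots> = (\<Oplus>x\<in>G. (c a x \<ominus> c b x) \<otimes> x)" by (rule A.finsum_scaled_diff[OF G(1) c(1)[OF a] c(1)[OF b]])
    also have "\<dots> \<in> P (Suc i)"
    proof (rule A.ideal_finsum[OF P_ideal])
      fix x assume x: "x \<in> G"
      have cc: "c a x \<in> carrier A" "c b x \<in> carrier A" using c(1)[OF a] c(1)[OF b] x by auto
      have "g a (e x) = g b (e x)" using ab(2) by simp
      hence "\<pi> (c a x) = \<pi> (c b x)" unfolding g_def using e x by simp
      hence "\<pi> (c a x \<ominus> c b x) = \<zero>\<^bsub>k\<^esub>" using cc by (simp add: \<pi>_minus k.r_right_minus_eq)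
      hence "c a x \<ominus> c b x \<in> m" unfolding m_iff using cc by simp
      moreover have "x \<in> P i" unfolding G(3) using A.genideal_self[OF G(1)] x by blast
      ultimately show "(c a x \<ominus> c b x) \<otimes> x \<in> P (Suc i)" by (auto intro: ideal_prod.prod)
    qed
    finally show ?thesis .
  qed
  thus ?thesis by blast
qed

lemma (in residual) inj_into_sequences:
  assumes noeth: "noetherian_ring A" and compl: "complete_filtration A P"
  shows "\<exists>f::'a \<Rightarrow> nat \<Rightarrow> 'k. inj_on f (carrier A)"
proof -
  interpret F: complete_filtration A P by (rule compl)
  have "\<exists>g::'a \<Rightarrow> nat \<Rightarrow> 'k. \<forall>a\<in>carrier A. \<forall>b\<in>carrier A. a \<ominus> b \<in> P i \<longrightarrow> g a = g b \<longrightarrow> a \<ominus> b \<in> P (Suc i)" for i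
    using noetherian_ring.finetely_gen[OF noeth P_ideal, of i] graded_digits by blast
  then obtain g :: "nat \<Rightarrow> 'a \<Rightarrow> nat \<Rightarrow> 'k" where
    g: "\<And>i. \<forall>a\<in>carrier A. \<forall>b\<in>carrier A. a \<ominus> b \<in> P i \<longrightarrow> g i a = g i b \<longrightarrow> a \<ominus> b \<in> P (Suc i)"
    by metis
  define f where "f a l = (case prod_decode l of (i, j) \<Rightarrow> g i a j)" for a l
  have "inj_on f (carrier A)"
  proof (rule inj_onI)
    fix a b assume ab: "a \<in> carrier A" "b \<in> carrier A" "f a = f b"
    have gg: "g i a = g i b" for i
    proof
      fix j have "f a (prod_encode (i, j)) = f b (prod_encode (i, j))" using ab(3) by simp
      thus "g i a j = g i b j" by (simp add: f_def)
    qed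
    have "a \<ominus> b \<in> P i" for i
      by (induction i) (use g gg ab in auto)
    hence "a \<ominus> b = \<zero>" using ab by (intro F.K_separated) auto
    thus "a = b" using ab by (simp add: A.r_right_minus_eq)
  qed
  thus ?thesis by blast
qed

text \<open>An element is determined by its digits at all levels, so every coefficient algebra over \<open>k\<close> has an
  isomorphic copy among the test algebras with carrier in \<open>nat \<Rightarrow> 'k\<close>.\<close>

theorem coef_obj_transport:
  fixes A :: "('a, 'k, 'w) coef_alg"
  assumes k: "field k" and A: "coef_obj k W A"
  shows "\<exists>(B :: (nat \<Rightarrow> 'k, 'k, 'w) coef_alg) h. coef_obj k W B \<and> h \<in> ring_hom B A \<and> inj_on h (carrier B) \<and>
     h ` carrier B = carrier A \<and> (\<forall>i. h ` mpow B i = mpow A i) \<and>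
     (\<forall>b\<in>carrier B. residue A (h b) = residue B b) \<and> (\<forall>w\<in>carrier W. h (scalar B w) = scalar A w)"
proof -
  have A': "complete_local_noetherian k A" "scalar A \<in> ring_hom W A"
    "\<And>w. w \<in> carrier W ==> residue A (scalar A w) = residue W w" using A by (auto simp: coef_obj_def)
  note e = cln_elim[OF k A'(1)]
  interpret A: residual A k "residue A" by (rule e(1))
  interpret F: complete_filtration A "mpow A" by (rule e(3))
  obtain f :: "'a \<Rightarrow> nat \<Rightarrow> 'k" where f: "inj_on f (carrier A)"
    using A.inj_into_sequences e(3) A'(1) unfolding e(2) complete_local_noetherian_def by blast
  define h where "h = inv_into (carrier A) f"
  have hf [simp]: "h (f a) = a" if "a \<in> carrier A" for a using f that by (simp add: h_def)
  define B :: "(nat \<Rightarrow> 'k, 'k, 'w) coef_alg" where "B = \<lparr>carrier = f ` carrier A,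
     monoid.mult = (\<lambda>x y. f (h x \<otimes>\<^bsub>A\<^esub> h y)), monoid.one = f \<one>\<^bsub>A\<^esub>, ring.zero = f \<zero>\<^bsub>A\<^esub>,
     ring.add = (\<lambda>x y. f (h x \<oplus>\<^bsub>A\<^esub> h y)), residue = (\<lambda>x. residue A (h x)), scalar = (\<lambda>w. f (scalar A w))\<rparr>"
  have ops: "carrier B = f ` carrier A" "f a \<otimes>\<^bsub>B\<^esub> f b = f (a \<otimes>\<^bsub>A\<^esub> b)" "f a \<oplus>\<^bsub>B\<^esub> f b = f (a \<oplus>\<^bsub>A\<^esub> b)"
     "\<one>\<^bsub>B\<^esub> = f \<one>\<^bsub>A\<^esub>" "\<zero>\<^bsub>B\<^esub> = f \<zero>\<^bsub>A\<^esub>" "residue B (f a) = residue A a"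
     if "a \<in> carrier A" "b \<in> carrier A" for a b using that by (simp_all add: B_def)
  note ops = ops(1)[OF e(5)[THEN cring.cring_simprules(2)] e(5)[THEN cring.cring_simprules(2)]]
     ops(2,3) ops(4,5)[OF e(5)[THEN cring.cring_simprules(2)] e(5)[THEN cring.cring_simprules(2)]] ops(6)[OF _ e(5)[THEN cring.cring_simprules(2)]]
  have B: "cring B" by (rule cring_image[OF e(5), of f]) (simp_all add: ops)
  have fh: "f \<in> ring_hom A B" by (rule ring_hom_memI) (simp_all add: ops)
  have fs: "f ` carrier A = carrier B" by (simp add: ops)
  have rB: "residue B \<in> ring_hom B k"
  proof (rule ring_hom_memI)
    fix x y assume "x \<in> carrier B" "y \<in> carrier B"
    then obtain a b where "a \<in> carrier A" "x = f a" "b \<in> carrier A" "y = f b" unfolding ops(1) by blast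
    thus "residue B (x \<otimes>\<^bsub>B\<^esub> y) = residue B x \<otimes>\<^bsub>k\<^esub> residue B y" "residue B (x \<oplus>\<^bsub>B\<^esub> y) = residue B x \<oplus>\<^bsub>k\<^esub> residue B y"
      by (simp_all add: ops)
  qed (auto simp: ops)
  have sep: "b = \<zero>\<^bsub>B\<^esub>" if b: "b \<in> carrier B" "\<And>i. b \<in> f ` mpow A i" for b
  proof -
    from b(1) obtain a where a: "a \<in> carrier A" "b = f a" unfolding ops(1) by blast
    have "a \<in> mpow A i" for i
    proof -
      obtain a' where a': "f a = f a'" "a' \<in> mpow A i"
        using imageE[OF b(2)[of i, unfolded a(2)]] .
      have "a = a'" by (rule inj_onD[OF f a'(1) a(1) F.K_carrier[OF a'(2)]])
      thus ?thesis using a'(2) by simp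
    qed
    hence "a = \<zero>\<^bsub>A\<^esub>" by (rule F.K_separated[OF a(1)])
    thus ?thesis using a by (simp add: ops)
  qed
  have res: "\<And>a. a \<in> carrier A ==> residue B (f a) = residue A a" by (rule ops(6))
  have im: "complete_local_noetherian k B" "mpow B i = f ` mpow A i" for i
    by (rule cln_image[OF k A'(1) B fh fs rB]; fact res sep)+
  have scB: "scalar B w = f (scalar A w)" for w by (simp add: B_def)
  have sc: "scalar A w \<in> carrier A" if "w \<in> carrier W" for w using ring_hom_closed[OF A'(2) that] .
  have "scalar B \<in> ring_hom W B"
  proof (rule ring_hom_memI)
    fix x y assume xy: "x \<in> carrier W" "y \<in> carrier W"
    show "scalar B x \<in> carrier B" using sc xy by (simp add: scB ops)
    show "scalar B (x \<otimes>\<^bsub>W\<^esub> y) = scalar B x \<otimes>\<^bsub>B\<^esub> scalar B y" "scalar B (x \<oplus>\<^bsub>W\<^esub> y) = scalar B x \<oplus>\<^bsub>B\<^esub> scalar B y"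
      using sc xy ring_hom_mult[OF A'(2) xy] ring_hom_add[OF A'(2) xy] by (simp_all add: scB ops)
  qed (simp add: scB ops ring_hom_one[OF A'(2)])
  moreover have "residue B (scalar B w) = residue W w" if w: "w \<in> carrier W" for w
    using ops(6)[OF sc[OF w]] A'(3)[OF w] unfolding scB by simp
  ultimately have "coef_obj k W B" unfolding coef_obj_def using im(1) by blast
  moreover have "h \<in> ring_hom B A"
  proof (rule ring_hom_memI)
    fix x y assume "x \<in> carrier B" "y \<in> carrier B"
    then obtain a b where "a \<in> carrier A" "x = f a" "b \<in> carrier A" "y = f b" unfolding ops(1) by blast
    thus "h x \<in> carrier A" "h (x \<otimes>\<^bsub>B\<^esub> y) = h x \<otimes>\<^bsub>A\<^esub> h y" "h (x \<oplus>\<^bsub>B\<^esub> y) = h x \<oplus>\<^bsub>A\<^esub> h y" by (simp_all add: ops)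
  qed (simp add: ops)
  moreover have "inj_on h (carrier B)" unfolding ops(1) by (rule inj_onI) auto
  moreover have "h ` carrier B = carrier A" unfolding ops(1) image_image by simp
  moreover have "h ` mpow B i = mpow A i" for i
  proof -
    have "(\<lambda>x. h (f x)) ` mpow A i = (\<lambda>x. x) ` mpow A i"
      using F.K_carrier by (intro image_cong) auto
    thus ?thesis unfolding im(2) image_image by simp
  qed
  moreover have "residue A (h b) = residue B b" for b by (simp add: B_def)
  moreover have "h (scalar B w) = scalar A w" if "w \<in> carrier W" for w using sc[OF that] by (simp add: scB)
  ultimately show ?thesis by blast
qed

section \<open>Linear algebra over the residue field\<close>

text \<open>The \<open>W\<close>-submodules of \<open>B\<close>, where \<open>W\<close> acts through \<open>f\<close>.\<close>

definition scaled_subgroup :: "('b, 'x) ring_scheme \<Rightarrow> ('w, 'y) ring_scheme \<Rightarrow> ('w \<Rightarrow> 'b) \<Rightarrow> 'b set \<Rightarrow> bool" where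
  "scaled_subgroup B W f U \<longleftrightarrow> U \<subseteq> carrier B \<and> \<zero>\<^bsub>B\<^esub> \<in> U \<and> (\<forall>x\<in>U. \<forall>y\<in>U. x \<oplus>\<^bsub>B\<^esub> y \<in> U) \<and>
     (\<forall>w\<in>carrier W. \<forall>x\<in>U. f w \<otimes>\<^bsub>B\<^esub> x \<in> U)"

text \<open>The quotient of \<open>N\<close> by \<open>H\<close> is a vector space over \<open>k\<close>, the quotient of \<open>W\<close> by the kernel of \<open>\<pi>\<close>. A
  submodule \<open>U \<supseteq> H\<close> that is maximal among those avoiding \<open>v\<close> is a complement of the line through \<open>v\<close>,
  and the functional is the coefficient of \<open>v\<close>.\<close>

theorem exists_functional:
  fixes B :: "('b, 'x) ring_scheme" (structure) and W :: "('w, 'y) ring_scheme" and k :: "('k, 'z) ring_scheme"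
  assumes "cring B" "cring W" "field k"
    and f: "f \<in> ring_hom W B" and \<pi>: "\<pi> \<in> ring_hom W k" "\<pi> ` carrier W = carrier k"
    and N: "scaled_subgroup B W f N" and H: "scaled_subgroup B W f H" "H \<subseteq> N"
    and kill: "\<And>w x. w \<in> carrier W ==> \<pi> w = \<zero>\<^bsub>k\<^esub> ==> x \<in> N ==> f w \<otimes> x \<in> H"
    and v: "v \<in> N" "v \<notin> H"
  shows "\<exists>l. (\<forall>x\<in>N. l x \<in> carrier k) \<and> (\<forall>x\<in>N. \<forall>y\<in>N. l (x \<oplus> y) = l x \<oplus>\<^bsub>k\<^esub> l y) \<and>
     (\<forall>w\<in>carrier W. \<forall>x\<in>N. l (f w \<otimes> x) = \<pi> w \<otimes>\<^bsub>k\<^esub> l x) \<and> (\<forall>x\<in>H. l x = \<zero>\<^bsub>k\<^esub>) \<and> l v = \<one>\<^bsub>k\<^esub>"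
proof -
  interpret B: cring B by fact
  interpret W: cring W by fact
  interpret k: field k by fact
  have fh: "f w \<in> carrier B" if "w \<in> carrier W" for w using ring_hom_closed[OF f that] .
  have f1: "f \<one>\<^bsub>W\<^esub> = \<one>" by (rule ring_hom_one[OF f])
  have rhf: "ring_hom_cring W B f"
    by (rule ring_hom_cringI[OF W.is_cring B.is_cring f])
  have rhp: "ring_hom_cring W k \<pi>"
    by (rule ring_hom_cringI[OF W.is_cring k.is_cring \<pi>(1)])
  have fm: "f (\<ominus>\<^bsub>W\<^esub> w) = \<ominus> f w" if "w \<in> carrier W" for w
    using ring_hom_cring.hom_a_inv[OF rhf that] .
  have pm: "\<pi> (\<ominus>\<^bsub>W\<^esub> w) = \<ominus>\<^bsub>k\<^esub> \<pi> w" if "w \<in> carrier W" for w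
    using ring_hom_cring.hom_a_inv[OF rhp that] .
  have sg: "U \<subseteq> carrier B" "\<zero> \<in> U" "\<And>x y. x \<in> U ==> y \<in> U ==> x \<oplus> y \<in> U"
    "\<And>w x. w \<in> carrier W ==> x \<in> U ==> f w \<otimes> x \<in> U"
    "\<And>x y. x \<in> U ==> y \<in> U ==> x \<ominus> y \<in> U" if U: "scaled_subgroup B W f U" for U
  proof -
    show 1: "U \<subseteq> carrier B" "\<zero> \<in> U" and add: "\<And>x y. x \<in> U ==> y \<in> U ==> x \<oplus> y \<in> U"
      and mul: "\<And>w x. w \<in> carrier W ==> x \<in> U ==> f w \<otimes> x \<in> U"
      using U unfolding scaled_subgroup_def by auto
    fix x y assume xy: "x \<in> U" "y \<in> U"
    have "f (\<ominus>\<^bsub>W\<^esub> \<one>\<^bsub>W\<^esub>) \<otimes> y \<in> U" using mul[of "\<ominus>\<^bsub>W\<^esub> \<one>\<^bsub>W\<^esub>" y] xy by simp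
    moreover have "y \<in> carrier B" "x \<in> carrier B" using xy 1 by auto
    ultimately have "\<ominus> y \<in> U" using fm[of "\<one>\<^bsub>W\<^esub>"] f1 by (simp add: B.l_minus)
    thus "x \<ominus> y \<in> U" using add[OF xy(1)] by (simp add: B.minus_eq)
  qed
  note N' = sg[OF N]
  define S where "S = {U. scaled_subgroup B W f U \<and> H \<subseteq> U \<and> U \<subseteq> N \<and> v \<notin> U}"
  have "\<exists>M\<in>S. \<forall>U\<in>S. M \<subseteq> U \<longrightarrow> U = M"
  proof (rule subset_Zorn_nonempty)
    show "S \<noteq> {}" using H v by (auto simp: S_def)
    fix C assume C: "C \<noteq> {}" "subset.chain S C"
    hence CS: "C \<subseteq> S" and ch: "\<And>x y. x \<in> C ==> y \<in> C ==> x \<subseteq> y \<or> y \<subseteq> x"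
      unfolding pred_on.chain_def by blast+
    have U: "scaled_subgroup B W f U" if "U \<in> C" for U using that CS by (auto simp: S_def)
    have "scaled_subgroup B W f (\<Union>C)"
      unfolding scaled_subgroup_def
    proof (intro conjI ballI)
      show "\<Union>C \<subseteq> carrier B" using sg(1)[OF U] by blast
      show "\<zero> \<in> \<Union>C" using sg(2)[OF U] C(1) by blast
      show "f w \<otimes> x \<in> \<Union>C" if "w \<in> carrier W" "x \<in> \<Union>C" for w x using sg(4)[OF U] that by blast
      fix x y assume "x \<in> \<Union>C" "y \<in> \<Union>C"
      then obtain U1 U2 where u: "U1 \<in> C" "x \<in> U1" "U2 \<in> C" "y \<in> U2" by blast
      hence "\<exists>U3\<in>C. x \<in> U3 \<and> y \<in> U3" using ch[of U1 U2] by blast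
      then obtain U3 where "U3 \<in> C" "x \<in> U3" "y \<in> U3" by blast
      thus "x \<oplus> y \<in> \<Union>C" using sg(3)[OF U] by blast
    qed
    moreover have "H \<subseteq> \<Union>C" "\<Union>C \<subseteq> N" "v \<notin> \<Union>C" using C(1) CS by (auto simp: S_def)
    ultimately show "\<Union>C \<in> S" by (simp add: S_def)
  qed
  then obtain U where U: "scaled_subgroup B W f U" "H \<subseteq> U" "U \<subseteq> N" "v \<notin> U"
    and Umax: "\<And>V. scaled_subgroup B W f V ==> H \<subseteq> V ==> V \<subseteq> N ==> v \<notin> V ==> U \<subseteq> V ==> V = U"
    by (auto simp: S_def)
  note U' = sg[OF U(1)]
  have vc: "v \<in> carrier B" using v N'(1) by blast
  have inv_ex: "\<exists>w'\<in>carrier W. \<exists>z\<in>carrier W. \<pi> z = \<zero>\<^bsub>k\<^esub> \<and> w' \<otimes>\<^bsub>W\<^esub> w = \<one>\<^bsub>W\<^esub> \<oplus>\<^bsub>W\<^esub> z \<and> \<pi> w' \<otimes>\<^bsub>k\<^esub> \<pi> w = \<one>\<^bsub>k\<^esub>"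
    if w: "w \<in> carrier W" "\<pi> w \<noteq> \<zero>\<^bsub>k\<^esub>" for w
  proof -
    have "\<pi> w \<in> Units k" using w ring_hom_closed[OF \<pi>(1)] k.field_Units by auto
    hence "inv\<^bsub>k\<^esub> \<pi> w \<in> carrier k" "inv\<^bsub>k\<^esub> \<pi> w \<otimes>\<^bsub>k\<^esub> \<pi> w = \<one>\<^bsub>k\<^esub>" by auto
    then obtain w' where w': "w' \<in> carrier W" "\<pi> w' \<otimes>\<^bsub>k\<^esub> \<pi> w = \<one>\<^bsub>k\<^esub>" using \<pi>(2) by (metis (no_types, lifting) imageE)
    have "\<pi> (w' \<otimes>\<^bsub>W\<^esub> w \<ominus>\<^bsub>W\<^esub> \<one>\<^bsub>W\<^esub>) = \<zero>\<^bsub>k\<^esub>"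
      using w w' ring_hom_add[OF \<pi>(1)] ring_hom_mult[OF \<pi>(1)] ring_hom_one[OF \<pi>(1)] pm
      by (simp add: W.minus_eq k.r_neg)
    moreover have "w' \<otimes>\<^bsub>W\<^esub> w = \<one>\<^bsub>W\<^esub> \<oplus>\<^bsub>W\<^esub> (w' \<otimes>\<^bsub>W\<^esub> w \<ominus>\<^bsub>W\<^esub> \<one>\<^bsub>W\<^esub>)" using w w' by algebra
    ultimately show ?thesis using w w' by blast
  qed
  have uniq0: "\<pi> w = \<zero>\<^bsub>k\<^esub>" if w: "w \<in> carrier W" "f w \<otimes> v \<in> U" for w
  proof (rule ccontr)
    assume "\<pi> w \<noteq> \<zero>\<^bsub>k\<^esub>"
    then obtain w' z where w': "w' \<in> carrier W" "z \<in> carrier W" "\<pi> z = \<zero>\<^bsub>k\<^esub>" "w' \<otimes>\<^bsub>W\<^esub> w = \<one>\<^bsub>W\<^esub> \<oplus>\<^bsub>W\<^esub> z"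
      using inv_ex w by blast
    have "f w' \<otimes> (f w \<otimes> v) \<in> U" using U'(4) w w' by blast
    moreover have "f w' \<otimes> (f w \<otimes> v) = f (w' \<otimes>\<^bsub>W\<^esub> w) \<otimes> v"
      unfolding ring_hom_mult[OF f w'(1) w(1)] using fh[OF w'(1)] fh[OF w(1)] vc by (simp add: B.m_assoc)
    moreover have "f (w' \<otimes>\<^bsub>W\<^esub> w) \<otimes> v = v \<oplus> f z \<otimes> v"
      unfolding w'(4) using w' vc fh ring_hom_add[OF f] f1 by (simp add: B.l_distr)
    ultimately have "v \<oplus> f z \<otimes> v \<in> U" by simp
    moreover have fz: "f z \<otimes> v \<in> U" using kill w' v U by blast
    ultimately have "(v \<oplus> f z \<otimes> v) \<ominus> f z \<otimes> v \<in> U" by (rule U'(5))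
    moreover have "(v \<oplus> f z \<otimes> v) \<ominus> f z \<otimes> v = v" using vc fh[OF w'(2)] by algebra
    ultimately show False using U by simp
  qed
  have ex: "\<exists>w\<in>carrier W. x \<ominus> f w \<otimes> v \<in> U" if x: "x \<in> N" for x
  proof -
    have xc: "x \<in> carrier B" using x N' by blast
    define V where "V = {u \<oplus> f w \<otimes> x | u w. u \<in> U \<and> w \<in> carrier W}"
    have V1: "u \<in> V" if "u \<in> U" for u
    proof -
      have "u \<oplus> f \<zero>\<^bsub>W\<^esub> \<otimes> x \<in> V" unfolding V_def using that by blast
      moreover have "f \<zero>\<^bsub>W\<^esub> = \<zero>" using ring_hom_cring.hom_zero[OF rhf] .
      ultimately show ?thesis using that U'(1) xc by (simp add: subset_iff)
    qed
    have sV: "scaled_subgroup B W f V"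
      unfolding scaled_subgroup_def
    proof (intro conjI ballI)
      show "V \<subseteq> carrier B" using U'(1) xc fh by (auto simp: V_def)
      show "\<zero> \<in> V" using V1 U'(2) by blast
    next
      fix y z assume "y \<in> V" "z \<in> V"
      then obtain u1 w1 u2 w2 where uw: "u1 \<in> U" "w1 \<in> carrier W" "y = u1 \<oplus> f w1 \<otimes> x"
        "u2 \<in> U" "w2 \<in> carrier W" "z = u2 \<oplus> f w2 \<otimes> x" unfolding V_def by blast
      have c: "u1 \<in> carrier B" "u2 \<in> carrier B" using uw U'(1) by auto
      have "y \<oplus> z = (u1 \<oplus> u2) \<oplus> f (w1 \<oplus>\<^bsub>W\<^esub> w2) \<otimes> x"
        unfolding uw(3,6) ring_hom_add[OF f uw(2,5)] using c xc fh[OF uw(2)] fh[OF uw(5)] by algebra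
      thus "y \<oplus> z \<in> V" unfolding V_def using U'(3)[OF uw(1,4)] W.a_closed[OF uw(2,5)] by blast
    next
      fix w y assume w: "w \<in> carrier W" and "y \<in> V"
      then obtain u1 w1 where uw: "u1 \<in> U" "w1 \<in> carrier W" "y = u1 \<oplus> f w1 \<otimes> x" unfolding V_def by blast
      have c: "u1 \<in> carrier B" using uw U'(1) by auto
      have "f w \<otimes> y = f w \<otimes> u1 \<oplus> f (w \<otimes>\<^bsub>W\<^esub> w1) \<otimes> x"
        unfolding uw(3) ring_hom_mult[OF f w uw(2)] using c xc fh[OF uw(2)] fh[OF w] by algebra
      thus "f w \<otimes> y \<in> V" unfolding V_def using U'(4)[OF w uw(1)] W.m_closed[OF w uw(2)] by blast
    qed
    have VN: "V \<subseteq> N"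
    proof
      fix y assume "y \<in> V"
      then obtain u w where "u \<in> U" "w \<in> carrier W" "y = u \<oplus> f w \<otimes> x" unfolding V_def by blast
      thus "y \<in> N" using U(3) N'(3)[of u "f w \<otimes> x"] N'(4)[OF _ x] by blast
    qed
    show ?thesis
    proof (cases "v \<in> V")
      case False
      have "V = U" using Umax[OF sV _ VN False] V1 U(2) by blast
      moreover have "x \<in> V"
      proof -
        have "\<zero> \<oplus> f \<one>\<^bsub>W\<^esub> \<otimes> x \<in> V" unfolding V_def using U'(2) by blast
        thus ?thesis using f1 xc by simp
      qed
      moreover have "x \<ominus> f \<zero>\<^bsub>W\<^esub> \<otimes> v = x"
        using ring_hom_cring.hom_zero[OF rhf] xc vc by (simp add: B.minus_eq)
      ultimately show ?thesis by (intro bexI[of _ "\<zero>\<^bsub>W\<^esub>"]) auto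
    next
      case True
      then obtain u w where uw: "u \<in> U" "w \<in> carrier W" "v = u \<oplus> f w \<otimes> x" unfolding V_def by blast
      have uc: "u \<in> carrier B" using uw U' by blast
      have "\<pi> w \<noteq> \<zero>\<^bsub>k\<^esub>"
      proof
        assume "\<pi> w = \<zero>\<^bsub>k\<^esub>"
        hence "f w \<otimes> x \<in> U" using kill[OF uw(2) _ x] U(2) by blast
        hence "v \<in> U" unfolding uw(3) using uw(1) U'(3) by blast
        thus False using U by simp
      qed
      then obtain w' z where w': "w' \<in> carrier W" "z \<in> carrier W" "\<pi> z = \<zero>\<^bsub>k\<^esub>" "w' \<otimes>\<^bsub>W\<^esub> w = \<one>\<^bsub>W\<^esub> \<oplus>\<^bsub>W\<^esub> z"
        using inv_ex uw by blast
      have "f w' \<otimes> v = f w' \<otimes> u \<oplus> f (w' \<otimes>\<^bsub>W\<^esub> w) \<otimes> x"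
        unfolding uw(3) ring_hom_mult[OF f w'(1) uw(2)] using uc xc fh[OF w'(1)] fh[OF uw(2)] by algebra
      also have "f (w' \<otimes>\<^bsub>W\<^esub> w) = \<one> \<oplus> f z"
        unfolding w'(4) using ring_hom_add[OF f W.one_closed w'(2)] f1 by simp
      finally have e: "f w' \<otimes> v = f w' \<otimes> u \<oplus> (\<one> \<oplus> f z) \<otimes> x" .
      have "x \<ominus> f w' \<otimes> v = \<zero> \<ominus> (f w' \<otimes> u \<oplus> f z \<otimes> x)"
        unfolding e using uc xc fh[OF w'(1)] fh[OF w'(2)] by algebra
      moreover have "f z \<otimes> x \<in> U" using kill[OF w'(2,3) x] U(2) by blast
      hence "\<zero> \<ominus> (f w' \<otimes> u \<oplus> f z \<otimes> x) \<in> U"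
        using U'(5)[OF U'(2) U'(3)[OF U'(4)[OF w'(1) uw(1)]]] by blast
      ultimately show ?thesis using w'(1) by metis
    qed
  qed
  define g where "g x = (SOME w. w \<in> carrier W \<and> x \<ominus> f w \<otimes> v \<in> U)" for x
  have g: "g x \<in> carrier W" "x \<ominus> f (g x) \<otimes> v \<in> U" if "x \<in> N" for x
    using someI_ex[of "\<lambda>w. w \<in> carrier W \<and> x \<ominus> f w \<otimes> v \<in> U"] ex[OF that] unfolding g_def by blast+
  have uniq: "\<pi> (g x) = \<pi> w" if x: "x \<in> N" and w: "w \<in> carrier W" "x \<ominus> f w \<otimes> v \<in> U" for x w
  proof -
    have xc: "x \<in> carrier B" using x N' by blast
    have "(x \<ominus> f w \<otimes> v) \<ominus> (x \<ominus> f (g x) \<otimes> v) \<in> U" using U'(5)[OF w(2) g(2)[OF x]] .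
    moreover have "(x \<ominus> f w \<otimes> v) \<ominus> (x \<ominus> f (g x) \<otimes> v) = (f (g x) \<oplus> \<ominus> f w) \<otimes> v"
      using xc vc fh[OF w(1)] fh[OF g(1)[OF x]] by algebra
    moreover have "f (g x) \<oplus> \<ominus> f w = f (g x \<oplus>\<^bsub>W\<^esub> \<ominus>\<^bsub>W\<^esub> w)"
      using ring_hom_add[OF f g(1)[OF x] W.a_inv_closed[OF w(1)]] fm[OF w(1)] by simp
    ultimately have "\<pi> (g x \<oplus>\<^bsub>W\<^esub> \<ominus>\<^bsub>W\<^esub> w) = \<zero>\<^bsub>k\<^esub>" using uniq0[of "g x \<oplus>\<^bsub>W\<^esub> \<ominus>\<^bsub>W\<^esub> w"] g(1)[OF x] w(1) by simp
    hence "\<pi> (g x) \<oplus>\<^bsub>k\<^esub> \<ominus>\<^bsub>k\<^esub> \<pi> w = \<zero>\<^bsub>k\<^esub>"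
      using ring_hom_add[OF \<pi>(1) g(1)[OF x] W.a_inv_closed[OF w(1)]] pm[OF w(1)] by simp
    thus ?thesis using ring_hom_closed[OF \<pi>(1)] g(1)[OF x] w(1) k.r_right_minus_eq by (simp add: k.minus_eq)
  qed
  show ?thesis
  proof (intro exI[of _ "\<lambda>x. \<pi> (g x)"] conjI ballI)
    show "\<pi> (g x) \<in> carrier k" if "x \<in> N" for x using ring_hom_closed[OF \<pi>(1) g(1)[OF that]] .
    show "\<pi> (g x) = \<zero>\<^bsub>k\<^esub>" if x: "x \<in> H" for x
    proof -
      have "x \<in> N" "x \<in> U" "x \<in> carrier B" using x H U N' by blast+
      moreover have "x \<ominus> f \<zero>\<^bsub>W\<^esub> \<otimes> v = x"
        using ring_hom_cring.hom_zero[OF rhf] calculation vc by (simp add: B.minus_eq)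
      ultimately have "\<pi> (g x) = \<pi> \<zero>\<^bsub>W\<^esub>" by (intro uniq) auto
      thus ?thesis using ring_hom_cring.hom_zero[OF rhp] by simp
    qed
    have "v \<ominus> f \<one>\<^bsub>W\<^esub> \<otimes> v = \<zero>" using f1 vc by (simp add: B.r_right_minus_eq)
    hence "\<pi> (g v) = \<pi> \<one>\<^bsub>W\<^esub>" using v U'(2) by (intro uniq) auto
    thus "\<pi> (g v) = \<one>\<^bsub>k\<^esub>" using ring_hom_one[OF \<pi>(1)] by simp
  next
    fix x y assume xy: "x \<in> N" "y \<in> N"
    have c: "x \<in> carrier B" "y \<in> carrier B" using xy N' by auto
    have "(x \<ominus> f (g x) \<otimes> v) \<oplus> (y \<ominus> f (g y) \<otimes> v) \<in> U" by (intro U'(3) g xy)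
    moreover have "(x \<ominus> f (g x) \<otimes> v) \<oplus> (y \<ominus> f (g y) \<otimes> v) = (x \<oplus> y) \<ominus> f (g x \<oplus>\<^bsub>W\<^esub> g y) \<otimes> v"
      unfolding ring_hom_add[OF f g(1)[OF xy(1)] g(1)[OF xy(2)]]
      using c vc fh[OF g(1)[OF xy(1)]] fh[OF g(1)[OF xy(2)]] by algebra
    ultimately have "\<pi> (g (x \<oplus> y)) = \<pi> (g x \<oplus>\<^bsub>W\<^esub> g y)"
      using g(1) xy N'(3)[OF xy] by (intro uniq) auto
    thus "\<pi> (g (x \<oplus> y)) = \<pi> (g x) \<oplus>\<^bsub>k\<^esub> \<pi> (g y)" using ring_hom_add[OF \<pi>(1) g(1)[OF xy(1)] g(1)[OF xy(2)]] by simp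
  next
    fix w x assume wx: "w \<in> carrier W" "x \<in> N"
    have c: "x \<in> carrier B" using wx N' by auto
    have "f w \<otimes> (x \<ominus> f (g x) \<otimes> v) \<in> U" by (intro U'(4) g wx)
    moreover have "f w \<otimes> (x \<ominus> f (g x) \<otimes> v) = f w \<otimes> x \<ominus> f (w \<otimes>\<^bsub>W\<^esub> g x) \<otimes> v"
      unfolding ring_hom_mult[OF f wx(1) g(1)[OF wx(2)]]
      using c vc fh[OF g(1)[OF wx(2)]] fh[OF wx(1)] by algebra
    ultimately have "\<pi> (g (f w \<otimes> x)) = \<pi> (w \<otimes>\<^bsub>W\<^esub> g x)"
      using g(1) wx N'(4)[OF wx] by (intro uniq) auto
    thus "\<pi> (g (f w \<otimes> x)) = \<pi> w \<otimes>\<^bsub>k\<^esub> \<pi> (g x)" using ring_hom_mult[OF \<pi>(1) wx(1) g(1)[OF wx(2)]] by simp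
  qed
qed

text \<open>Induction on the number of functions. If a combination with coefficients \<open>c\<close> vanishes on the set \<open>S\<close>
  for \<open>I\<close> but not at \<open>x0\<close>, then \<open>x0\<close> is added to \<open>S\<close>: as \<open>c j \<noteq> 0\<close>, the function \<open>u j\<close> can be eliminated
  from any other combination by subtracting a multiple of the first one.\<close>

lemma (in field) finite_separating_set:
  assumes "finite I" "\<And>i x. i \<in> I ==> x \<in> D ==> u i x \<in> carrier R"
  shows "\<exists>S\<subseteq>D. finite S \<and> (\<forall>c\<in>I \<rightarrow> carrier R. (\<forall>x\<in>S. (\<Oplus>i\<in>I. c i \<otimes> u i x) = \<zero>) \<longrightarrow>
      (\<forall>x\<in>D. (\<Oplus>i\<in>I. c i \<otimes> u i x) = \<zero>))"
  using assms
proof (induction I rule: finite_induct)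
  case empty
  show ?case by (intro exI[of _ "{}"]) auto
next
  case (insert j I)
  have ins: "(\<Oplus>i\<in>insert j I. c i \<otimes> u i x) = c j \<otimes> u j x \<oplus> (\<Oplus>i\<in>I. c i \<otimes> u i x)"
    if "c \<in> insert j I \<rightarrow> carrier R" "x \<in> D" for c x
    using insert.hyps insert.prems that by (intro finsum_insert) auto
  have cl: "(\<Oplus>i\<in>I. c i \<otimes> u i x) \<in> carrier R" if "c \<in> I \<rightarrow> carrier R" "x \<in> D" for c x
    using insert.prems that by (intro finsum_closed) auto
  have "\<exists>S\<subseteq>D. finite S \<and> (\<forall>c\<in>I \<rightarrow> carrier R. (\<forall>x\<in>S. (\<Oplus>i\<in>I. c i \<otimes> u i x) = \<zero>) \<longrightarrow>
      (\<forall>x\<in>D. (\<Oplus>i\<in>I. c i \<otimes> u i x) = \<zero>))"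
    by (rule insert.IH) (use insert.prems in auto)
  then obtain S where S: "S \<subseteq> D" "finite S" "\<And>c x. c \<in> I \<rightarrow> carrier R ==> (\<forall>x\<in>S. (\<Oplus>i\<in>I. c i \<otimes> u i x) = \<zero>) ==>
      x \<in> D ==> (\<Oplus>i\<in>I. c i \<otimes> u i x) = \<zero>" by blast
  show ?case
  proof (cases "\<forall>c\<in>insert j I \<rightarrow> carrier R. (\<forall>x\<in>S. (\<Oplus>i\<in>insert j I. c i \<otimes> u i x) = \<zero>) \<longrightarrow>
      (\<forall>x\<in>D. (\<Oplus>i\<in>insert j I. c i \<otimes> u i x) = \<zero>)")
    case True
    thus ?thesis using S(1,2) by blast
  next
    case False
    then obtain c x0 where c: "c \<in> insert j I \<rightarrow> carrier R" "\<forall>x\<in>S. (\<Oplus>i\<in>insert j I. c i \<otimes> u i x) = \<zero>"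
      and x0: "x0 \<in> D" "(\<Oplus>i\<in>insert j I. c i \<otimes> u i x0) \<noteq> \<zero>" by blast
    let ?f = "\<lambda>c x. (\<Oplus>i\<in>insert j I. c i \<otimes> u i x)"
    have fc: "?f c x \<in> carrier R" if "c \<in> insert j I \<rightarrow> carrier R" "x \<in> D" for c x
      using insert.prems that by (intro finsum_closed) auto
    have cj: "c j \<in> carrier R" using c by auto
    have lin: "?f (\<lambda>i. c j \<otimes> d i \<ominus> d j \<otimes> c i) x = c j \<otimes> ?f d x \<ominus> d j \<otimes> ?f c x"
       "?f (\<lambda>i. c j \<otimes> d i \<ominus> d j \<otimes> c i) x = (\<Oplus>i\<in>I. (c j \<otimes> d i \<ominus> d j \<otimes> c i) \<otimes> u i x)"
      if d: "d \<in> insert j I \<rightarrow> carrier R" and x: "x \<in> D" for d x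
    proof -
      have dj: "d j \<in> carrier R" using d by auto
      have uc: "i \<in> insert j I ==> u i x \<in> carrier R \<and> c i \<in> carrier R \<and> d i \<in> carrier R" for i
        using insert.prems x c d by auto
      have "?f (\<lambda>i. c j \<otimes> d i \<ominus> d j \<otimes> c i) x = (\<Oplus>i\<in>insert j I. c j \<otimes> (d i \<otimes> u i x) \<oplus> (\<ominus> d j) \<otimes> (c i \<otimes> u i x))"
      proof (rule finsum_cong'[OF refl])
        show "(c j \<otimes> d i \<ominus> d j \<otimes> c i) \<otimes> u i x = c j \<otimes> (d i \<otimes> u i x) \<oplus> (\<ominus> d j) \<otimes> (c i \<otimes> u i x)" if "i \<in> insert j I" for i
          using uc[OF that] cj dj by algebra
      qed (use uc cj dj in auto)
      also have "\<dots> = (\<Oplus>i\<in>insert j I. c j \<otimes> (d i \<otimes> u i x)) \<oplus> (\<Oplus>i\<in>insert j I. (\<ominus> d j) \<otimes> (c i \<otimes> u i x))"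
        using uc cj dj by (intro finsum_addf) auto
      also have "(\<Oplus>i\<in>insert j I. c j \<otimes> (d i \<otimes> u i x)) = c j \<otimes> ?f d x"
        using uc cj insert.hyps by (intro finsum_rdistr[symmetric]) auto
      also have "(\<Oplus>i\<in>insert j I. (\<ominus> d j) \<otimes> (c i \<otimes> u i x)) = (\<ominus> d j) \<otimes> ?f c x"
        using uc dj insert.hyps by (intro finsum_rdistr[symmetric]) auto
      also have "c j \<otimes> ?f d x \<oplus> (\<ominus> d j) \<otimes> ?f c x = c j \<otimes> ?f d x \<ominus> d j \<otimes> ?f c x"
        using dj fc[OF c(1) x] by (simp add: minus_eq l_minus)
      finally show "?f (\<lambda>i. c j \<otimes> d i \<ominus> d j \<otimes> c i) x = c j \<otimes> ?f d x \<ominus> d j \<otimes> ?f c x" .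
      have "?f (\<lambda>i. c j \<otimes> d i \<ominus> d j \<otimes> c i) x = (c j \<otimes> d j \<ominus> d j \<otimes> c j) \<otimes> u j x \<oplus> (\<Oplus>i\<in>I. (c j \<otimes> d i \<ominus> d j \<otimes> c i) \<otimes> u i x)"
        using uc cj dj by (intro ins x) auto
      also have "c j \<otimes> d j \<ominus> d j \<otimes> c j = \<zero>" using cj dj by algebra
      also have "\<zero> \<otimes> u j x \<oplus> (\<Oplus>i\<in>I. (c j \<otimes> d i \<ominus> d j \<otimes> c i) \<otimes> u i x) = (\<Oplus>i\<in>I. (c j \<otimes> d i \<ominus> d j \<otimes> c i) \<otimes> u i x)"
        using uc cj dj by (simp add: finsum_closed)
      finally show "?f (\<lambda>i. c j \<otimes> d i \<ominus> d j \<otimes> c i) x = (\<Oplus>i\<in>I. (c j \<otimes> d i \<ominus> d j \<otimes> c i) \<otimes> u i x)" .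
    qed
    have cj0: "c j \<noteq> \<zero>"
    proof
      assume z: "c j = \<zero>"
      have e: "?f c x = (\<Oplus>i\<in>I. c i \<otimes> u i x)" if "x \<in> D" for x
        using ins[OF c(1) that] z cl[of c x] c(1) that insert.prems by simp
      have "(\<Oplus>i\<in>I. c i \<otimes> u i x) = \<zero>" if "x \<in> S" for x
        using e[of x] c(2) S(1) that by (metis subsetD)
      hence "(\<Oplus>i\<in>I. c i \<otimes> u i x0) = \<zero>"
        using c(1) by (intro S(3)[OF _ _ x0(1)]) auto
      thus False using e[OF x0(1)] x0(2) by simp
    qed
    have sep: "?f d x = \<zero>" if d: "d \<in> insert j I \<rightarrow> carrier R" "\<forall>x\<in>insert x0 S. ?f d x = \<zero>" and x: "x \<in> D" for d x
    proof -
      have dj: "d j \<in> carrier R" using d by auto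
      define d' where "d' i = c j \<otimes> d i \<ominus> d j \<otimes> c i" for i
      have d'c: "d' \<in> I \<rightarrow> carrier R" using c(1) d(1) by (auto simp: d'_def Pi_iff)
      have "(\<Oplus>i\<in>I. d' i \<otimes> u i y) = \<zero>" if y: "y \<in> S" for y
      proof -
        have yD: "y \<in> D" using y S(1) by blast
        have "(\<Oplus>i\<in>I. d' i \<otimes> u i y) = c j \<otimes> ?f d y \<ominus> d j \<otimes> ?f c y"
          unfolding d'_def lin(2)[OF d(1) yD, symmetric] by (rule lin(1)[OF d(1) yD])
        also have "\<dots> = \<zero>" using d(2) c(2) y cj dj by simp
        finally show ?thesis .
      qed
      hence z: "(\<Oplus>i\<in>I. d' i \<otimes> u i y) = \<zero>" if "y \<in> D" for y using S(3)[OF d'c _ that] by blast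
      have eq: "c j \<otimes> ?f d y \<ominus> d j \<otimes> ?f c y = \<zero>" if "y \<in> D" for y
        using z[OF that] lin[OF d(1) that] unfolding d'_def by simp
      have "c j \<otimes> \<zero> \<ominus> d j \<otimes> ?f c x0 = \<zero>" using eq[OF x0(1)] d(2) by simp
      hence "d j \<otimes> ?f c x0 = \<zero>" using cj dj fc[OF c(1) x0(1)] by (simp add: minus_eq)
      hence "d j = \<zero>" using x0(2) fc[OF c(1) x0(1)] dj integral by blast
      hence "c j \<otimes> ?f d x = \<zero>" using eq[OF x] cj fc[OF d(1) x] fc[OF c(1) x] by (simp add: minus_eq)
      thus ?thesis using cj0 cj fc[OF d(1) x] integral by blast
    qed
    show ?thesis
    proof (intro exI conjI ballI impI)
      show "insert x0 S \<subseteq> D" "finite (insert x0 S)" using S(1,2) x0(1) by auto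
      show "?f d x = \<zero>" if "d \<in> insert j I \<rightarrow> carrier R" "\<forall>x\<in>insert x0 S. ?f d x = \<zero>" "x \<in> D" for d x
        by (rule sep[OF that])
    qed
  qed
qed

section \<open>Matrix groups and lifts\<close>

lemma (in cring) finsum_swap:
  assumes "finite U" "finite V" "\<And>a b. a \<in> U ==> b \<in> V ==> f a b \<in> carrier R"
  shows "(\<Oplus>a\<in>U. \<Oplus>b\<in>V. f a b) = (\<Oplus>b\<in>V. \<Oplus>a\<in>U. f a b)"
  using assms(1,3)
proof (induction U rule: finite_induct)
  case empty
  have "(\<Oplus>b\<in>V. \<zero>) = \<zero>" by simp
  thus ?case by simp
next
  case (insert a U)
  have "(\<Oplus>a\<in>insert a U. \<Oplus>b\<in>V. f a b) = (\<Oplus>b\<in>V. f a b) \<oplus> (\<Oplus>a\<in>U. \<Oplus>b\<in>V. f a b)"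
    using insert.hyps insert.prems by (intro finsum_insert) (auto intro!: finsum_closed)
  also have "(\<Oplus>a\<in>U. \<Oplus>b\<in>V. f a b) = (\<Oplus>b\<in>V. \<Oplus>a\<in>U. f a b)" using insert by auto
  also have "(\<Oplus>b\<in>V. f a b) \<oplus> (\<Oplus>b\<in>V. \<Oplus>a\<in>U. f a b) = (\<Oplus>b\<in>V. f a b \<oplus> (\<Oplus>a\<in>U. f a b))"
    using insert.prems by (intro finsum_addf[symmetric]) (auto intro!: finsum_closed)
  also have "\<dots> = (\<Oplus>b\<in>V. \<Oplus>a\<in>insert a U. f a b)"
    using insert.hyps insert.prems by (intro finsum_cong' finsum_insert[symmetric]) (auto intro!: finsum_closed)
  finally show ?case .
qed

subsection \<open>The group of invertible matrices\<close>

lemma mat_carrier: "carrier (mat_monoid n A) = {..<n} \<times> {..<n} \<rightarrow>\<^sub>E carrier A"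
  by (simp add: mat_monoid_def)

lemma mat_mult_entry:
  "a < n ==> b < n ==> (M \<otimes>\<^bsub>mat_monoid n A\<^esub> N) (a, b) = (\<Oplus>\<^bsub>A\<^esub>l\<in>{..<n}. M (a, l) \<otimes>\<^bsub>A\<^esub> N (l, b))"
  by (simp add: mat_monoid_def)

lemma mat_one_entry: "a < n ==> b < n ==> \<one>\<^bsub>mat_monoid n A\<^esub> (a, b) = (if a = b then \<one>\<^bsub>A\<^esub> else \<zero>\<^bsub>A\<^esub>)"
  by (simp add: mat_monoid_def)

lemma mat_eqI:
  assumes "M \<in> extensional ({..<n} \<times> {..<n})" "N \<in> extensional ({..<n} \<times> {..<n})"
    "\<And>a b. a < n ==> b < n ==> M (a, b) = N (a, b)"
  shows "M = N"
  using assms by (intro extensionalityI) auto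

lemma mat_mult_ext: "M \<otimes>\<^bsub>mat_monoid n A\<^esub> N \<in> extensional ({..<n} \<times> {..<n})"
  and mat_one_ext: "\<one>\<^bsub>mat_monoid n A\<^esub> \<in> extensional ({..<n} \<times> {..<n})"
  by (simp_all add: mat_monoid_def)

context cring
begin

lemma mat_entry_closed: "M \<in> carrier (mat_monoid n R) ==> a < n ==> b < n ==> M (a, b) \<in> carrier R"
  by (auto simp: mat_carrier PiE_iff)

lemma mat_mult_closed:
  assumes "M \<in> carrier (mat_monoid n R)" "N \<in> carrier (mat_monoid n R)"
  shows "M \<otimes>\<^bsub>mat_monoid n R\<^esub> N \<in> carrier (mat_monoid n R)"
  unfolding mat_carrier PiE_iff
proof (intro conjI ballI mat_mult_ext)
  fix p assume "p \<in> {..<n} \<times> {..<n}"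
  then obtain a b where "p = (a, b)" "a < n" "b < n" by auto
  thus "(M \<otimes>\<^bsub>mat_monoid n R\<^esub> N) p \<in> carrier R"
    using assms mat_entry_closed by (auto simp: mat_mult_entry intro!: finsum_closed)
qed

lemma mat_one_closed: "\<one>\<^bsub>mat_monoid n R\<^esub> \<in> carrier (mat_monoid n R)"
  unfolding mat_carrier PiE_iff by (auto simp: mat_one_entry mat_one_ext)

lemma mat_ext: "M \<in> carrier (mat_monoid n R) ==> M \<in> extensional ({..<n} \<times> {..<n})"
  by (auto simp: mat_carrier PiE_iff)

theorem mat_monoid_monoid: "monoid (mat_monoid n R)"
proof (rule monoidI)
  fix M N L assume M: "M \<in> carrier (mat_monoid n R)" "N \<in> carrier (mat_monoid n R)" "L \<in> carrier (mat_monoid n R)"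
  note cl = mat_entry_closed[OF M(1)] mat_entry_closed[OF M(2)] mat_entry_closed[OF M(3)]
  show "M \<otimes>\<^bsub>mat_monoid n R\<^esub> N \<otimes>\<^bsub>mat_monoid n R\<^esub> L = M \<otimes>\<^bsub>mat_monoid n R\<^esub> (N \<otimes>\<^bsub>mat_monoid n R\<^esub> L)"
  proof (rule mat_eqI[OF mat_mult_ext mat_mult_ext])
    fix a b assume ab: "a < n" "b < n"
    have "(M \<otimes>\<^bsub>mat_monoid n R\<^esub> N \<otimes>\<^bsub>mat_monoid n R\<^esub> L) (a, b) = (\<Oplus>l\<in>{..<n}. (\<Oplus>m\<in>{..<n}. M (a, m) \<otimes> N (m, l)) \<otimes> L (l, b))"
      unfolding mat_mult_entry[OF ab] using ab cl by (intro finsum_cong') (auto simp: mat_mult_entry intro!: finsum_closed)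
    also have "\<dots> = (\<Oplus>l\<in>{..<n}. \<Oplus>m\<in>{..<n}. M (a, m) \<otimes> N (m, l) \<otimes> L (l, b))"
      using ab cl by (intro finsum_cong' finsum_ldistr) (auto intro!: finsum_closed)
    also have "\<dots> = (\<Oplus>m\<in>{..<n}. \<Oplus>l\<in>{..<n}. M (a, m) \<otimes> N (m, l) \<otimes> L (l, b))"
      using ab cl by (intro finsum_swap) auto
    also have "\<dots> = (\<Oplus>m\<in>{..<n}. \<Oplus>l\<in>{..<n}. M (a, m) \<otimes> (N (m, l) \<otimes> L (l, b)))"
      using ab cl by (intro finsum_cong') (auto simp: m_assoc intro!: finsum_closed)
    also have "\<dots> = (\<Oplus>m\<in>{..<n}. M (a, m) \<otimes> (\<Oplus>l\<in>{..<n}. N (m, l) \<otimes> L (l, b)))"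
      using ab cl by (intro finsum_cong' finsum_rdistr[symmetric]) (auto intro!: finsum_closed)
    also have "\<dots> = (M \<otimes>\<^bsub>mat_monoid n R\<^esub> (N \<otimes>\<^bsub>mat_monoid n R\<^esub> L)) (a, b)"
      unfolding mat_mult_entry[OF ab] using ab cl by (intro finsum_cong') (auto simp: mat_mult_entry intro!: finsum_closed)
    finally show "(M \<otimes>\<^bsub>mat_monoid n R\<^esub> N \<otimes>\<^bsub>mat_monoid n R\<^esub> L) (a, b) = (M \<otimes>\<^bsub>mat_monoid n R\<^esub> (N \<otimes>\<^bsub>mat_monoid n R\<^esub> L)) (a, b)" .
  qed
next
  fix M assume M: "M \<in> carrier (mat_monoid n R)"
  note cl = mat_entry_closed[OF M]
  show "\<one>\<^bsub>mat_monoid n R\<^esub> \<otimes>\<^bsub>mat_monoid n R\<^esub> M = M"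
  proof (rule mat_eqI[OF mat_mult_ext mat_ext[OF M]])
    fix a b assume ab: "a < n" "b < n"
    have "(\<one>\<^bsub>mat_monoid n R\<^esub> \<otimes>\<^bsub>mat_monoid n R\<^esub> M) (a, b) = (\<Oplus>l\<in>{..<n}. if a = l then M (l, b) else \<zero>)"
      unfolding mat_mult_entry[OF ab] using ab cl by (intro finsum_cong') (auto simp: mat_one_entry)
    also have "\<dots> = M (a, b)" using ab cl by (intro finsum_singleton) auto
    finally show "(\<one>\<^bsub>mat_monoid n R\<^esub> \<otimes>\<^bsub>mat_monoid n R\<^esub> M) (a, b) = M (a, b)" .
  qed
  show "M \<otimes>\<^bsub>mat_monoid n R\<^esub> \<one>\<^bsub>mat_monoid n R\<^esub> = M"
  proof (rule mat_eqI[OF mat_mult_ext mat_ext[OF M]])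
    fix a b assume ab: "a < n" "b < n"
    have "(M \<otimes>\<^bsub>mat_monoid n R\<^esub> \<one>\<^bsub>mat_monoid n R\<^esub>) (a, b) = (\<Oplus>l\<in>{..<n}. if b = l then M (a, l) else \<zero>)"
      unfolding mat_mult_entry[OF ab] using ab cl by (intro finsum_cong') (auto simp: mat_one_entry)
    also have "\<dots> = M (a, b)" using ab cl by (intro finsum_singleton) auto
    finally show "(M \<otimes>\<^bsub>mat_monoid n R\<^esub> \<one>\<^bsub>mat_monoid n R\<^esub>) (a, b) = M (a, b)" .
  qed
qed (use mat_mult_closed mat_one_closed in auto)

lemma GL_group: "group (GL n R)"
  unfolding GL_def by (rule monoid.units_group[OF mat_monoid_monoid])

lemma GL_carrier_iff:
  "M \<in> carrier (GL n R) \<longleftrightarrow> M \<in> carrier (mat_monoid n R) \<and>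
    (\<exists>N\<in>carrier (mat_monoid n R). N \<otimes>\<^bsub>mat_monoid n R\<^esub> M = \<one>\<^bsub>mat_monoid n R\<^esub> \<and> M \<otimes>\<^bsub>mat_monoid n R\<^esub> N = \<one>\<^bsub>mat_monoid n R\<^esub>)"
  by (simp add: GL_def units_of_def Units_def)

end

lemma GL_mult: "monoid.mult (GL n A) = monoid.mult (mat_monoid n A)"
  and GL_one: "\<one>\<^bsub>GL n A\<^esub> = \<one>\<^bsub>mat_monoid n A\<^esub>"
  by (simp_all add: GL_def units_of_def)

lemma GL_one_entry: "a < n ==> b < n ==> \<one>\<^bsub>GL n A\<^esub> (a, b) = (if a = b then \<one>\<^bsub>A\<^esub> else \<zero>\<^bsub>A\<^esub>)"
  by (simp add: GL_one mat_one_entry)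

lemma (in cring) GL_entry_closed: "M \<in> carrier (GL n R) ==> a < n ==> b < n ==> M (a, b) \<in> carrier R"
  using mat_entry_closed GL_carrier_iff by blast

lemma (in cring) GL_ext: "M \<in> carrier (GL n R) ==> M \<in> extensional ({..<n} \<times> {..<n})"
  using mat_ext GL_carrier_iff by blast

lemma GL_map_entry: "a < n ==> b < n ==> GL_map n h M (a, b) = h (M (a, b))"
  by (simp add: GL_map_def)

lemma GL_map_ext: "GL_map n h M \<in> extensional ({..<n} \<times> {..<n})"
  by (simp add: GL_map_def)

lemma GL_map_comp: "GL_map n g (GL_map n h M) = GL_map n (\<lambda>x. g (h x)) M"
  by (rule mat_eqI[OF GL_map_ext GL_map_ext]) (simp add: GL_map_entry)

lemma GL_map_cong:
  assumes "\<And>a b. a < n ==> b < n ==> g (M (a, b)) = h (M (a, b))"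
  shows "GL_map n g M = GL_map n h M"
  by (rule mat_eqI[OF GL_map_ext GL_map_ext]) (simp add: GL_map_entry assms)

context
  fixes A :: "('a, 'x) ring_scheme" and B :: "('b, 'y) ring_scheme" and h :: "'a \<Rightarrow> 'b" and n :: nat
  assumes A: "cring A" and B: "cring B" and h: "h \<in> ring_hom A B"
begin

interpretation A: cring A by (rule A)
interpretation B: cring B by (rule B)

lemma GL_map_mat_closed: "M \<in> carrier (mat_monoid n A) ==> GL_map n h M \<in> carrier (mat_monoid n B)"
  using ring_hom_closed[OF h] by (auto simp: mat_carrier PiE_iff GL_map_entry GL_map_ext)

lemma GL_map_mult:
  assumes "M \<in> carrier (mat_monoid n A)" "N \<in> carrier (mat_monoid n A)"
  shows "GL_map n h (M \<otimes>\<^bsub>mat_monoid n A\<^esub> N) = GL_map n h M \<otimes>\<^bsub>mat_monoid n B\<^esub> GL_map n h N"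
proof (rule mat_eqI[OF GL_map_ext mat_mult_ext])
  fix a b assume ab: "a < n" "b < n"
  note cl = A.mat_entry_closed[OF assms(1)] A.mat_entry_closed[OF assms(2)]
  have "h (\<Oplus>\<^bsub>A\<^esub>l\<in>{..<n}. M (a, l) \<otimes>\<^bsub>A\<^esub> N (l, b)) = (\<Oplus>\<^bsub>B\<^esub>l\<in>{..<n}. (h \<circ> (\<lambda>l. M (a, l) \<otimes>\<^bsub>A\<^esub> N (l, b))) l)"
    using ab cl by (intro ring_hom_cring.hom_finsum[OF ring_hom_cringI[OF A B h]]) auto
  also have "\<dots> = (\<Oplus>\<^bsub>B\<^esub>l\<in>{..<n}. GL_map n h M (a, l) \<otimes>\<^bsub>B\<^esub> GL_map n h N (l, b))"
    using ab cl ring_hom_closed[OF h] by (intro B.finsum_cong') (auto simp: GL_map_entry ring_hom_mult[OF h])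
  finally show "GL_map n h (M \<otimes>\<^bsub>mat_monoid n A\<^esub> N) (a, b) = (GL_map n h M \<otimes>\<^bsub>mat_monoid n B\<^esub> GL_map n h N) (a, b)"
    using ab by (simp add: GL_map_entry mat_mult_entry)
qed

lemma GL_map_one: "GL_map n h \<one>\<^bsub>GL n A\<^esub> = \<one>\<^bsub>GL n B\<^esub>"
  unfolding GL_one
  by (rule mat_eqI[OF GL_map_ext mat_one_ext])
     (simp add: GL_map_entry mat_one_entry ring_hom_one[OF h] ring_hom_zero[OF h A.ring_axioms B.ring_axioms])

lemma GL_map_closed:
  assumes "M \<in> carrier (GL n A)"
  shows "GL_map n h M \<in> carrier (GL n B)"
proof -
  obtain N where N: "N \<in> carrier (mat_monoid n A)" "N \<otimes>\<^bsub>mat_monoid n A\<^esub> M = \<one>\<^bsub>mat_monoid n A\<^esub>"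
     "M \<otimes>\<^bsub>mat_monoid n A\<^esub> N = \<one>\<^bsub>mat_monoid n A\<^esub>" and M: "M \<in> carrier (mat_monoid n A)"
    using assms A.GL_carrier_iff by blast
  have "GL_map n h N \<otimes>\<^bsub>mat_monoid n B\<^esub> GL_map n h M = \<one>\<^bsub>mat_monoid n B\<^esub>"
    "GL_map n h M \<otimes>\<^bsub>mat_monoid n B\<^esub> GL_map n h N = \<one>\<^bsub>mat_monoid n B\<^esub>"
    using GL_map_mult[OF N(1) M] GL_map_mult[OF M N(1)] GL_map_one N(2,3) unfolding GL_one by auto
  thus ?thesis using GL_map_mat_closed M N(1) B.GL_carrier_iff by blast
qed

lemma GL_map_hom: "GL_map n h \<in> hom (GL n A) (GL n B)"
proof (rule homI)
  show "GL_map n h M \<in> carrier (GL n B)" if "M \<in> carrier (GL n A)" for M by (rule GL_map_closed[OF that])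
  show "GL_map n h (M \<otimes>\<^bsub>GL n A\<^esub> N) = GL_map n h M \<otimes>\<^bsub>GL n B\<^esub> GL_map n h N"
    if "M \<in> carrier (GL n A)" "N \<in> carrier (GL n A)" for M N
    using that A.GL_carrier_iff unfolding GL_mult by (intro GL_map_mult) auto
qed

lemma GL_map_inv:
  assumes "M \<in> carrier (GL n A)"
  shows "GL_map n h (inv\<^bsub>GL n A\<^esub> M) = inv\<^bsub>GL n B\<^esub> (GL_map n h M)"
proof -
  interpret group_hom "GL n A" "GL n B" "GL_map n h"
    using A.GL_group B.GL_group GL_map_hom by (simp add: group_hom_def group_hom_axioms_def)
  show ?thesis using hom_inv[OF assms] .
qed

end

lemma GL_map_inj:
  assumes A: "cring A" and h: "inj_on h (carrier A)"
    and M: "M \<in> carrier (mat_monoid n A)" "N \<in> carrier (mat_monoid n A)" "GL_map n h M = GL_map n h N"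
  shows "M = N"
proof (rule mat_eqI[OF cring.mat_ext[OF A M(1)] cring.mat_ext[OF A M(2)]])
  fix a b assume ab: "a < n" "b < n"
  show "M (a, b) = N (a, b)"
    using fun_cong[OF M(3), of "(a, b)"] ab
    by (intro inj_onD[OF h _ cring.mat_entry_closed[OF A M(1) ab] cring.mat_entry_closed[OF A M(2) ab]])
       (simp add: GL_map_entry)
qed
text \<open>The inverse \<open>N\<close> over \<open>B\<close> has its entries in \<open>A\<close>, and both products can be computed over \<open>B\<close>.\<close>

lemma GL_transfer:
  assumes A: "cring A" and B: "cring B" and h: "h \<in> ring_hom A B" and inj: "inj_on h (carrier A)"
    and M: "M \<in> carrier (mat_monoid n A)" "N \<in> carrier (mat_monoid n A)"
      "GL_map n h M \<otimes>\<^bsub>mat_monoid n B\<^esub> GL_map n h N = \<one>\<^bsub>mat_monoid n B\<^esub>"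
      "GL_map n h N \<otimes>\<^bsub>mat_monoid n B\<^esub> GL_map n h M = \<one>\<^bsub>mat_monoid n B\<^esub>"
  shows "M \<in> carrier (GL n A)"
proof -
  interpret A: cring A by (rule A)
  note eq = GL_map_inj[OF A inj, where n = n]
  have "M \<otimes>\<^bsub>mat_monoid n A\<^esub> N = \<one>\<^bsub>mat_monoid n A\<^esub>"
    using GL_map_mult[OF A B h M(1,2)] M(3) GL_map_one[OF A B h, of n] unfolding GL_one
    by (intro eq A.mat_mult_closed A.mat_one_closed M) auto
  moreover have "N \<otimes>\<^bsub>mat_monoid n A\<^esub> M = \<one>\<^bsub>mat_monoid n A\<^esub>"
    using GL_map_mult[OF A B h M(2,1)] M(4) GL_map_one[OF A B h, of n] unfolding GL_one
    by (intro eq A.mat_mult_closed A.mat_one_closed M) auto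
  ultimately show ?thesis using M(1,2) A.GL_carrier_iff by blast
qed

subsection \<open>Continuity for adic topologies\<close>

lemma (in cring) continuous_map_adic_iff:
  assumes I: "ideal I R"
  shows "continuous_map T (adic_topology R I) f \<longleftrightarrow> (\<forall>x\<in>topspace T. f x \<in> carrier R) \<and>
    (\<forall>i. \<forall>x\<in>topspace T. \<exists>U. openin T U \<and> x \<in> U \<and> (\<forall>y\<in>U. f y \<ominus> f x \<in> ideal_pow R I i))" (is "?L \<longleftrightarrow> ?R")
proof
  note P = ideal_pow_ideal[OF I]
  let ?S = "{ideal_pow R I i +> a | i a. a \<in> carrier R}"
  assume ?L
  hence o: "\<And>U. U \<in> ?S ==> openin T (f -` U \<inter> topspace T)" and im: "f ` topspace T \<subseteq> \<Union>?S"
    unfolding adic_topology_def continuous_on_generated_topo_iff by blast+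
  have cl: "f x \<in> carrier R" if x: "x \<in> topspace T" for x
  proof -
    obtain i a where "a \<in> carrier R" "f x \<in> ideal_pow R I i +> a" using im x by blast
    thus ?thesis using mem_coset_iff[OF P] by blast
  qed
  have "\<exists>U. openin T U \<and> x \<in> U \<and> (\<forall>y\<in>U. f y \<ominus> f x \<in> ideal_pow R I i)" if x: "x \<in> topspace T" for i x
  proof (intro exI conjI ballI)
    let ?U = "f -` (ideal_pow R I i +> f x) \<inter> topspace T"
    show "openin T ?U" using cl[OF x] by (intro o) blast
    show "x \<in> ?U" using x mem_coset_iff[OF P cl[OF x]] cl[OF x] ideal_simps(1)[OF P] by simp
    fix y assume "y \<in> ?U"
    thus "f y \<ominus> f x \<in> ideal_pow R I i" using mem_coset_iff[OF P cl[OF x]] by blast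
  qed
  thus ?R using cl by blast
next
  note P = ideal_pow_ideal[OF I]
  let ?S = "{ideal_pow R I i +> a | i a. a \<in> carrier R}"
  assume R: ?R
  show ?L unfolding adic_topology_def continuous_on_generated_topo_iff
  proof (intro conjI allI impI)
    show "f ` topspace T \<subseteq> \<Union>?S"
    proof (rule image_subsetI)
      fix x assume x: "x \<in> topspace T"
      hence c: "f x \<in> carrier R" using conjunct1[OF R] by blast
      have "f x \<in> ideal_pow R I 0 +> f x"
        using mem_coset_iff[OF P c, of "f x" 0] ideal_simps(1)[OF P, of 0] minus_self[OF c] c by metis
      thus "f x \<in> \<Union>?S" using c by blast
    qed
    have "openin T (f -` (ideal_pow R I i +> a) \<inter> topspace T)" if a: "a \<in> carrier R" for i a
    proof (subst openin_subopen, intro ballI)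
      fix x assume x: "x \<in> f -` (ideal_pow R I i +> a) \<inter> topspace T"
      hence fx: "f x \<in> carrier R" "f x \<ominus> a \<in> ideal_pow R I i" using mem_coset_iff[OF P a] by blast+
      have "\<exists>U. openin T U \<and> x \<in> U \<and> (\<forall>y\<in>U. f y \<ominus> f x \<in> ideal_pow R I i)"
        using conjunct2[OF R, rule_format, of x i] x by simp
      then obtain U where U: "openin T U" "x \<in> U" "\<And>y. y \<in> U ==> f y \<ominus> f x \<in> ideal_pow R I i"
        by blast
      have "y \<in> f -` (ideal_pow R I i +> a) \<inter> topspace T" if y: "y \<in> U" for y
      proof -
        have yt: "y \<in> topspace T" using y openin_subset[OF U(1)] by blast
        hence fy: "f y \<in> carrier R" using conjunct1[OF R] by blast
        have "(f y \<ominus> f x) \<oplus> (f x \<ominus> a) \<in> ideal_pow R I i" using U(3)[OF y] fx(2) by (rule ideal_simps(3)[OF P])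
        moreover have "(f y \<ominus> f x) \<oplus> (f x \<ominus> a) = f y \<ominus> a" using fy fx(1) a by algebra
        ultimately show ?thesis using mem_coset_iff[OF P a] fy yt by simp
      qed
      thus "\<exists>U. openin T U \<and> x \<in> U \<and> U \<subseteq> f -` (ideal_pow R I i +> a) \<inter> topspace T" using U by blast
    qed
    thus "openin T (f -` U \<inter> topspace T)" if "U \<in> ?S" for U using that by blast
  qed
qed

text \<open>Continuity of a matrix-valued map for the adic topology, in terms of congruences of entries.\<close>

definition adic_locally_constant ::
    "'g topology \<Rightarrow> nat \<Rightarrow> ('a, 'x) ring_scheme \<Rightarrow> ('g \<Rightarrow> nat \<times> nat \<Rightarrow> 'a) \<Rightarrow> bool" where
  "adic_locally_constant T n A \<tau> \<longleftrightarrow> (\<forall>i. \<forall>x\<in>topspace T. \<exists>U. openin T U \<and> x \<in> U \<and>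
     (\<forall>y\<in>U. \<forall>a<n. \<forall>b<n. \<tau> y (a, b) \<ominus>\<^bsub>A\<^esub> \<tau> x (a, b) \<in> mpow A i))"

lemma adic_locally_constantD:
  assumes "adic_locally_constant T n A \<tau>" "x \<in> topspace T"
  shows "\<exists>U. openin T U \<and> x \<in> U \<and> (\<forall>y\<in>U. \<forall>a<n. \<forall>b<n. \<tau> y (a, b) \<ominus>\<^bsub>A\<^esub> \<tau> x (a, b) \<in> mpow A i)"
  using assms unfolding adic_locally_constant_def by (elim allE[of _ i] ballE[of _ _ x]) auto

lemma continuous_map_GL_iff:
  assumes A: "cring A" and m: "ideal (max_ideal A) A" and \<tau>: "\<And>x. x \<in> topspace T ==> \<tau> x \<in> carrier (GL n A)"
  shows "continuous_map T (GL_topology n A) \<tau> \<longleftrightarrow> adic_locally_constant T n A \<tau>"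
proof -
  interpret A: cring A by (rule A)
  let ?I = "{..<n} \<times> {..<n}"
  have ext: "\<tau> ` topspace T \<subseteq> extensional ?I" using \<tau> A.GL_ext by blast
  have cl: "\<tau> x p \<in> carrier A" if "x \<in> topspace T" "p \<in> ?I" for x p
    using A.GL_entry_closed[OF \<tau>[OF that(1)]] that(2) by auto
  have "continuous_map T (GL_topology n A) \<tau> \<longleftrightarrow>
      (\<forall>p\<in>?I. continuous_map T (adic_topology A (max_ideal A)) (\<lambda>x. \<tau> x p))"
    unfolding GL_topology_def continuous_map_in_subtopology continuous_map_componentwise
    using ext \<tau> by (auto simp: image_subset_iff)
  also have "\<dots> \<longleftrightarrow> (\<forall>p\<in>?I. \<forall>i. \<forall>x\<in>topspace T. \<exists>U. openin T U \<and> x \<in> U \<and>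
     (\<forall>y\<in>U. \<tau> y p \<ominus>\<^bsub>A\<^esub> \<tau> x p \<in> mpow A i))"
    unfolding A.continuous_map_adic_iff[OF m] using cl by blast
  also have "\<dots> \<longleftrightarrow> adic_locally_constant T n A \<tau>" (is "?l \<longleftrightarrow> _")
  proof
    assume l: ?l
    show "adic_locally_constant T n A \<tau>" unfolding adic_locally_constant_def
    proof (intro allI ballI)
      fix i x assume x: "x \<in> topspace T"
      have "\<forall>p\<in>?I. \<exists>U. openin T U \<and> x \<in> U \<and> (\<forall>y\<in>U. \<tau> y p \<ominus>\<^bsub>A\<^esub> \<tau> x p \<in> mpow A i)"
        using l x by blast
      then obtain U where U: "\<And>p. p \<in> ?I ==> openin T (U p) \<and> x \<in> U p \<and> (\<forall>y\<in>U p. \<tau> y p \<ominus>\<^bsub>A\<^esub> \<tau> x p \<in> mpow A i)"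
        by metis
      let ?V = "topspace T \<inter> (\<Inter>p\<in>?I. U p)"
      have "openin T ?V"
        by (cases "?I = {}") (use U in \<open>auto intro!: openin_Int openin_INT2\<close>)
      moreover have "x \<in> ?V" using U x by blast
      moreover have "\<forall>y\<in>?V. \<forall>a<n. \<forall>b<n. \<tau> y (a, b) \<ominus>\<^bsub>A\<^esub> \<tau> x (a, b) \<in> mpow A i"
        using U by auto
      ultimately show "\<exists>U. openin T U \<and> x \<in> U \<and> (\<forall>y\<in>U. \<forall>a<n. \<forall>b<n. \<tau> y (a, b) \<ominus>\<^bsub>A\<^esub> \<tau> x (a, b) \<in> mpow A i)"
        by blast
    qed
  next
    assume *: "adic_locally_constant T n A \<tau>"
    show ?l
    proof (intro ballI allI)
      fix p i x assume p: "p \<in> ?I" and x: "x \<in> topspace T"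
      obtain U where U: "openin T U" "x \<in> U"
        "\<And>y a b. y \<in> U ==> a < n ==> b < n ==> \<tau> y (a, b) \<ominus>\<^bsub>A\<^esub> \<tau> x (a, b) \<in> mpow A i"
        using adic_locally_constantD[OF * x, of i] by blast
      obtain a b where "p = (a, b)" "a < n" "b < n" using p by auto
      hence "\<forall>y\<in>U. \<tau> y p \<ominus>\<^bsub>A\<^esub> \<tau> x p \<in> mpow A i" using U(3) by simp
      thus "\<exists>U. openin T U \<and> x \<in> U \<and> (\<forall>y\<in>U. \<tau> y p \<ominus>\<^bsub>A\<^esub> \<tau> x p \<in> mpow A i)"
        using U(1,2) by blast
    qed
  qed
  finally show ?thesis .
qed

subsection \<open>Lifts and strict equivalence\<close>

lemma lifts_iff:
  assumes "cring A" "ideal (max_ideal A) A" "topspace T = carrier \<Gamma>"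
  shows "\<tau> \<in> lifts \<Gamma> T n \<rho> A \<longleftrightarrow> \<tau> \<in> hom \<Gamma> (GL n A) \<and> adic_locally_constant T n A \<tau> \<and>
     (\<forall>g\<in>carrier \<Gamma>. GL_map n (residue A) (\<tau> g) = \<rho> g)"
  unfolding lifts_def using continuous_map_GL_iff[OF assms(1,2), of T \<tau> n] assms(3)
  by (auto simp: hom_def)

lemma lifts_push:
  assumes A: "cring A" "ideal (max_ideal A) A" and B: "cring B" "ideal (max_ideal B) B"
    and T: "topspace T = carrier \<Gamma>" and h: "h \<in> ring_hom A B" "h ` max_ideal A \<subseteq> max_ideal B"
    and res: "\<And>a. a \<in> carrier A ==> residue B (h a) = \<iota> (residue A a)"
    and \<tau>: "\<tau> \<in> lifts \<Gamma> T n \<rho> A"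
  shows "push_lift n h \<tau> \<in> lifts \<Gamma> T n (push_lift n \<iota> \<rho>) B"
proof -
  interpret A: cring A by (rule A)
  note \<tau>' = \<tau>[unfolded lifts_iff[OF A T]]
  have \<tau>h: "\<tau> \<in> hom \<Gamma> (GL n A)" using \<tau>' by blast
  have cl: "\<tau> g (a, b) \<in> carrier A" if "g \<in> carrier \<Gamma>" "a < n" "b < n" for g a b
    by (rule A.GL_entry_closed[OF hom_in_carrier[OF \<tau>h that(1)] that(2,3)])
  have "push_lift n h \<tau> \<in> hom \<Gamma> (GL n B)"
    using hom_compose[OF _ GL_map_hom[OF A(1) B(1) h(1)], of \<tau> \<Gamma> n] \<tau>' by (simp add: push_lift_def o_def)
  moreover have "GL_map n (residue B) (push_lift n h \<tau> g) = push_lift n \<iota> \<rho> g" if g: "g \<in> carrier \<Gamma>" for g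
  proof -
    have "GL_map n (residue B) (push_lift n h \<tau> g) = GL_map n (\<lambda>x. \<iota> (residue A x)) (\<tau> g)"
      unfolding push_lift_def GL_map_comp using cl[OF g] res by (intro GL_map_cong) auto
    also have "\<dots> = push_lift n \<iota> \<rho> g" using \<tau>' g unfolding push_lift_def GL_map_comp[symmetric] by simp
    finally show ?thesis .
  qed
  moreover have "adic_locally_constant T n B (push_lift n h \<tau>)"
    unfolding adic_locally_constant_def
  proof (intro allI ballI)
    fix i x assume x: "x \<in> topspace T"
    have lc: "adic_locally_constant T n A \<tau>" using \<tau>' by blast
    obtain U where U: "openin T U" "x \<in> U"
        "\<And>y a b. y \<in> U ==> a < n ==> b < n ==> \<tau> y (a, b) \<ominus>\<^bsub>A\<^esub> \<tau> x (a, b) \<in> mpow A i"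
      using adic_locally_constantD[OF lc x, of i] by blast
    have "push_lift n h \<tau> y (a, b) \<ominus>\<^bsub>B\<^esub> push_lift n h \<tau> x (a, b) \<in> mpow B i"
      if y: "y \<in> U" and ab: "a < n" "b < n" for y a b
    proof -
      have yx: "y \<in> carrier \<Gamma>" "x \<in> carrier \<Gamma>" using y x openin_subset[OF U(1)] T by auto
      have "push_lift n h \<tau> y (a, b) \<ominus>\<^bsub>B\<^esub> push_lift n h \<tau> x (a, b) = h (\<tau> y (a, b) \<ominus>\<^bsub>A\<^esub> \<tau> x (a, b))"
        using ring_hom_minus[OF A(1) B(1) h(1) cl[OF yx(1) ab] cl[OF yx(2) ab]] ab
        by (simp add: push_lift_def GL_map_entry)
      also have "\<dots> \<in> mpow B i"
        using ideal_pow_image[OF A(1) B(1) h(1) A(2) B(2) h(2), of i] U(3)[OF y ab] by blast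
      finally show ?thesis .
    qed
    thus "\<exists>U. openin T U \<and> x \<in> U \<and> (\<forall>y\<in>U. \<forall>a<n. \<forall>b<n. push_lift n h \<tau> y (a, b) \<ominus>\<^bsub>B\<^esub> push_lift n h \<tau> x (a, b) \<in> mpow B i)"
      using U(1,2) by blast
  qed
  ultimately show ?thesis unfolding lifts_iff[OF B T] by blast
qed

lemma strictly_equivalent_push:
  assumes A: "cring A" and B: "cring B" and h: "h \<in> ring_hom A B"
    and res: "\<And>a. a \<in> carrier A ==> residue B (h a) = \<iota> (residue A a)"
    and k: "cring k" "cring k'" "\<iota> \<in> ring_hom k k'"
    and \<tau>: "\<And>g. g \<in> carrier \<Gamma> ==> \<tau> g \<in> carrier (GL n A)"
    and eq: "strictly_equivalent k \<Gamma> n A \<tau> \<sigma>"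
  shows "strictly_equivalent k' \<Gamma> n B (push_lift n h \<tau>) (push_lift n h \<sigma>)"
proof -
  interpret A: cring A by (rule A)
  interpret G: group "GL n A" by (rule A.GL_group)
  obtain M where M: "M \<in> carrier (GL n A)" "GL_map n (residue A) M = \<one>\<^bsub>GL n k\<^esub>"
    "\<And>g. g \<in> carrier \<Gamma> ==> \<sigma> g = M \<otimes>\<^bsub>GL n A\<^esub> \<tau> g \<otimes>\<^bsub>GL n A\<^esub> inv\<^bsub>GL n A\<^esub> M"
    using eq unfolding strictly_equivalent_def by blast
  have "GL_map n (residue B) (GL_map n h M) = GL_map n (\<lambda>x. \<iota> (residue A x)) M"
    unfolding GL_map_comp using A.GL_entry_closed[OF M(1)] res by (intro GL_map_cong) auto
  also have "\<dots> = GL_map n \<iota> \<one>\<^bsub>GL n k\<^esub>" unfolding GL_map_comp[symmetric] M(2) ..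
  also have "\<dots> = \<one>\<^bsub>GL n k'\<^esub>" by (rule GL_map_one[OF k])
  finally have 1: "GL_map n (residue B) (GL_map n h M) = \<one>\<^bsub>GL n k'\<^esub>" .
  have "push_lift n h \<sigma> g = GL_map n h M \<otimes>\<^bsub>GL n B\<^esub> push_lift n h \<tau> g \<otimes>\<^bsub>GL n B\<^esub> inv\<^bsub>GL n B\<^esub> (GL_map n h M)"
    if g: "g \<in> carrier \<Gamma>" for g
    unfolding push_lift_def M(3)[OF g] using M(1) \<tau>[OF g] GL_map_hom[OF A B h, of n]
    by (simp add: hom_mult[OF GL_map_hom[OF A B h]] GL_map_inv[OF A B h])
  thus ?thesis unfolding strictly_equivalent_def using GL_map_closed[OF A B h M(1)] 1 by blast
qed

context
  fixes k :: "('k, 'z) ring_scheme" and A :: "('a, 'k, 'y) res_ring_scheme" and \<Gamma> :: "('g, 'x) monoid_scheme" and n :: nat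
  assumes k: "cring k" and A: "cring A" and res: "residue A \<in> ring_hom A k"
begin

interpretation A: cring A by (rule A)
interpretation k: cring k by (rule k)
interpretation G: group "GL n A" by (rule A.GL_group)
interpretation Gk: group "GL n k" by (rule k.GL_group)

lemma strictly_equivalent_refl:
  assumes "\<And>g. g \<in> carrier \<Gamma> ==> \<tau> g \<in> carrier (GL n A)"
  shows "strictly_equivalent k \<Gamma> n A \<tau> \<tau>"
  unfolding strictly_equivalent_def
proof (intro bexI[of _ "\<one>\<^bsub>GL n A\<^esub>"] conjI ballI)
  show "GL_map n (residue A) \<one>\<^bsub>GL n A\<^esub> = \<one>\<^bsub>GL n k\<^esub>" by (rule GL_map_one[OF A k res])
  show "\<tau> g = \<one>\<^bsub>GL n A\<^esub> \<otimes>\<^bsub>GL n A\<^esub> \<tau> g \<otimes>\<^bsub>GL n A\<^esub> inv\<^bsub>GL n A\<^esub> \<one>\<^bsub>GL n A\<^esub>" if "g \<in> carrier \<Gamma>" for g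
    using assms[OF that] by simp
qed simp

lemma strictly_equivalent_sym:
  assumes "\<And>g. g \<in> carrier \<Gamma> ==> \<tau> g \<in> carrier (GL n A)" "strictly_equivalent k \<Gamma> n A \<tau> \<sigma>"
  shows "strictly_equivalent k \<Gamma> n A \<sigma> \<tau>"
proof -
  obtain M where M: "M \<in> carrier (GL n A)" "GL_map n (residue A) M = \<one>\<^bsub>GL n k\<^esub>"
    "\<And>g. g \<in> carrier \<Gamma> ==> \<sigma> g = M \<otimes>\<^bsub>GL n A\<^esub> \<tau> g \<otimes>\<^bsub>GL n A\<^esub> inv\<^bsub>GL n A\<^esub> M"
    using assms(2) unfolding strictly_equivalent_def by blast
  show ?thesis unfolding strictly_equivalent_def
  proof (intro bexI[of _ "inv\<^bsub>GL n A\<^esub> M"] conjI ballI)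
    show "GL_map n (residue A) (inv\<^bsub>GL n A\<^esub> M) = \<one>\<^bsub>GL n k\<^esub>"
      unfolding GL_map_inv[OF A k res M(1)] M(2) by simp
    fix g assume g: "g \<in> carrier \<Gamma>"
    show "\<tau> g = inv\<^bsub>GL n A\<^esub> M \<otimes>\<^bsub>GL n A\<^esub> \<sigma> g \<otimes>\<^bsub>GL n A\<^esub> inv\<^bsub>GL n A\<^esub> (inv\<^bsub>GL n A\<^esub> M)"
    proof -
      have "inv\<^bsub>GL n A\<^esub> M \<otimes>\<^bsub>GL n A\<^esub> (M \<otimes>\<^bsub>GL n A\<^esub> \<tau> g) = \<tau> g"
        using assms(1)[OF g] M(1) by (simp add: G.m_assoc[symmetric])
      thus ?thesis unfolding M(3)[OF g] using assms(1)[OF g] M(1) by (simp add: G.m_assoc)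
    qed
  qed (use M in simp)
qed

lemma strictly_equivalent_trans:
  assumes "\<And>g. g \<in> carrier \<Gamma> ==> \<tau> g \<in> carrier (GL n A)"
    "strictly_equivalent k \<Gamma> n A \<tau> \<sigma>" "strictly_equivalent k \<Gamma> n A \<sigma> \<upsilon>"
  shows "strictly_equivalent k \<Gamma> n A \<tau> \<upsilon>"
proof -
  obtain M where M: "M \<in> carrier (GL n A)" "GL_map n (residue A) M = \<one>\<^bsub>GL n k\<^esub>"
    "\<And>g. g \<in> carrier \<Gamma> ==> \<sigma> g = M \<otimes>\<^bsub>GL n A\<^esub> \<tau> g \<otimes>\<^bsub>GL n A\<^esub> inv\<^bsub>GL n A\<^esub> M"
    using assms(2) unfolding strictly_equivalent_def by blast
  obtain N where N: "N \<in> carrier (GL n A)" "GL_map n (residue A) N = \<one>\<^bsub>GL n k\<^esub>"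
    "\<And>g. g \<in> carrier \<Gamma> ==> \<upsilon> g = N \<otimes>\<^bsub>GL n A\<^esub> \<sigma> g \<otimes>\<^bsub>GL n A\<^esub> inv\<^bsub>GL n A\<^esub> N"
    using assms(3) unfolding strictly_equivalent_def by blast
  show ?thesis unfolding strictly_equivalent_def
  proof (intro bexI[of _ "N \<otimes>\<^bsub>GL n A\<^esub> M"] conjI ballI)
    show "GL_map n (residue A) (N \<otimes>\<^bsub>GL n A\<^esub> M) = \<one>\<^bsub>GL n k\<^esub>"
      unfolding hom_mult[OF GL_map_hom[OF A k res] N(1) M(1)] M(2) N(2) by simp
    fix g assume g: "g \<in> carrier \<Gamma>"
    show "\<upsilon> g = N \<otimes>\<^bsub>GL n A\<^esub> M \<otimes>\<^bsub>GL n A\<^esub> \<tau> g \<otimes>\<^bsub>GL n A\<^esub> inv\<^bsub>GL n A\<^esub> (N \<otimes>\<^bsub>GL n A\<^esub> M)"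
      unfolding N(3)[OF g] M(3)[OF g] using assms(1)[OF g] M(1) N(1) by (simp add: G.m_assoc G.inv_mult_group)
  qed (use M N in simp)
qed

lemma deformation_class_eq_iff:
  assumes "\<tau> \<in> lifts \<Gamma> T n \<rho> A" "\<sigma> \<in> lifts \<Gamma> T n \<rho> A"
  shows "deformation_class k \<Gamma> T n \<rho> A \<tau> = deformation_class k \<Gamma> T n \<rho> A \<sigma> \<longleftrightarrow> strictly_equivalent k \<Gamma> n A \<tau> \<sigma>"
proof -
  have c: "\<tau> g \<in> carrier (GL n A)" "\<sigma> g \<in> carrier (GL n A)" if "g \<in> carrier \<Gamma>" for g
    using assms that by (auto simp: lifts_def hom_def)
  show ?thesis
  proof
    assume "deformation_class k \<Gamma> T n \<rho> A \<tau> = deformation_class k \<Gamma> T n \<rho> A \<sigma>"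
    moreover have "\<sigma> \<in> deformation_class k \<Gamma> T n \<rho> A \<sigma>"
      using assms(2) strictly_equivalent_refl[of \<sigma>, OF c(2)] by (simp add: deformation_class_def)
    ultimately have "\<sigma> \<in> deformation_class k \<Gamma> T n \<rho> A \<tau>" by simp
    thus "strictly_equivalent k \<Gamma> n A \<tau> \<sigma>" by (simp add: deformation_class_def)
  next
    assume e: "strictly_equivalent k \<Gamma> n A \<tau> \<sigma>"
    have "strictly_equivalent k \<Gamma> n A \<tau> \<upsilon> \<longleftrightarrow> strictly_equivalent k \<Gamma> n A \<sigma> \<upsilon>" for \<upsilon>
      using strictly_equivalent_trans[of \<tau> \<sigma> \<upsilon>, OF c(1) e]
        strictly_equivalent_trans[of \<sigma> \<tau> \<upsilon>, OF c(2) strictly_equivalent_sym[of \<tau> \<sigma>, OF c(1) e]] by blast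
    thus "deformation_class k \<Gamma> T n \<rho> A \<tau> = deformation_class k \<Gamma> T n \<rho> A \<sigma>"
      by (simp add: deformation_class_def)
  qed
qed

end

section \<open>Tensor products\<close>

lemma frag_extend_diff_fun:
  "frag_extend (\<lambda>x. f x - g x) u = frag_extend f u - frag_extend g u"
proof -
  have "Poly_Mapping.keys u \<subseteq> UNIV" by simp
  thus ?thesis by (induction rule: frag_induction) (auto simp: frag_extend_diff)
qed

lemma pair_ring_carrier: "u \<in> carrier (pair_ring B C) \<longleftrightarrow> Poly_Mapping.keys u \<subseteq> carrier B \<times> carrier C"
  by (simp add: pair_ring_def)

lemma pair_ring_ops: "u \<oplus>\<^bsub>pair_ring B C\<^esub> v = u + v" "\<zero>\<^bsub>pair_ring B C\<^esub> = 0" "\<one>\<^bsub>pair_ring B C\<^esub> = frag_of (\<one>\<^bsub>B\<^esub>, \<one>\<^bsub>C\<^esub>)"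
  by (simp_all add: pair_ring_def)

lemma pair_mult_diff:
  "(u - v) \<otimes>\<^bsub>pair_ring B C\<^esub> w = u \<otimes>\<^bsub>pair_ring B C\<^esub> w - v \<otimes>\<^bsub>pair_ring B C\<^esub> w"
  "u \<otimes>\<^bsub>pair_ring B C\<^esub> (v - w) = u \<otimes>\<^bsub>pair_ring B C\<^esub> v - u \<otimes>\<^bsub>pair_ring B C\<^esub> w"
proof -
  show "(u - v) \<otimes>\<^bsub>pair_ring B C\<^esub> w = u \<otimes>\<^bsub>pair_ring B C\<^esub> w - v \<otimes>\<^bsub>pair_ring B C\<^esub> w"
    by (simp add: pair_ring_def frag_extend_diff)
  show "u \<otimes>\<^bsub>pair_ring B C\<^esub> (v - w) = u \<otimes>\<^bsub>pair_ring B C\<^esub> v - u \<otimes>\<^bsub>pair_ring B C\<^esub> w"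
    by (simp add: pair_ring_def split_def frag_extend_diff frag_extend_diff_fun)
qed

lemma pair_mult_zero: "0 \<otimes>\<^bsub>pair_ring B C\<^esub> w = 0" "u \<otimes>\<^bsub>pair_ring B C\<^esub> 0 = 0"
  using pair_mult_diff(1)[where u = w and v = w and w = w] pair_mult_diff(2)[where u = u and v = u and w = u] by simp_all

lemma pair_mult_uminus: "(- u) \<otimes>\<^bsub>pair_ring B C\<^esub> w = - (u \<otimes>\<^bsub>pair_ring B C\<^esub> w)"
  using pair_mult_diff(1)[where u = 0 and v = u and w = w] by (simp add: pair_mult_zero)

lemma pair_mult_add:
  "(u + v) \<otimes>\<^bsub>pair_ring B C\<^esub> w = u \<otimes>\<^bsub>pair_ring B C\<^esub> w + v \<otimes>\<^bsub>pair_ring B C\<^esub> w"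
  using pair_mult_diff(1)[where u = u and v = "- v" and w = w] by (simp add: pair_mult_uminus)

lemma pair_mult_of: "frag_of (b, c) \<otimes>\<^bsub>pair_ring B C\<^esub> frag_of (b', c') = frag_of (b \<otimes>\<^bsub>B\<^esub> b', c \<otimes>\<^bsub>C\<^esub> c')"
  by (simp add: pair_ring_def)

lemma pair_ring_induct [consumes 1, case_names zero of diff]:
  assumes "u \<in> carrier (pair_ring B C)" "Q 0"
    "\<And>b c. b \<in> carrier B ==> c \<in> carrier C ==> Q (frag_of (b, c))"
    "\<And>u v. Q u ==> Q v ==> Q (u - v)"
  shows "Q u"
  using assms(1)[unfolded pair_ring_carrier]
proof (induction rule: frag_induction)
  case (one p)
  thus ?case using assms(3) by (cases p) auto
qed (use assms in auto)

lemma pair_ring_carrier_of: "b \<in> carrier B ==> c \<in> carrier C ==> frag_of (b, c) \<in> carrier (pair_ring B C)"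
  by (simp add: pair_ring_carrier)

lemma pair_ring_carrier_diff:
  "u \<in> carrier (pair_ring B C) ==> v \<in> carrier (pair_ring B C) ==> u - v \<in> carrier (pair_ring B C)"
  unfolding pair_ring_carrier using keys_diff[of u v] by blast

lemma pair_ring_carrier_zero: "0 \<in> carrier (pair_ring B C)"
  by (simp add: pair_ring_carrier)

lemma pair_ring_carrier_add:
  "u \<in> carrier (pair_ring B C) ==> v \<in> carrier (pair_ring B C) ==> u + v \<in> carrier (pair_ring B C)"
  using pair_ring_carrier_diff[of u B C "0 - v"] pair_ring_carrier_diff[of 0 B C v] by (simp add: pair_ring_carrier_zero)

context
  fixes B :: "('b, 'x) ring_scheme" and C :: "('c, 'y) ring_scheme"
  assumes B: "cring B" and C: "cring C"
begin

interpretation B: cring B by (rule B)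
interpretation C: cring C by (rule C)

lemma pair_mult_closed:
  assumes "u \<in> carrier (pair_ring B C)" "v \<in> carrier (pair_ring B C)"
  shows "u \<otimes>\<^bsub>pair_ring B C\<^esub> v \<in> carrier (pair_ring B C)"
  using assms(1)
proof (induction rule: pair_ring_induct)
  case (of b c)
  show ?case using assms(2)
  proof (induction rule: pair_ring_induct)
    case (of b' c')
    thus ?case using \<open>b \<in> carrier B\<close> \<open>c \<in> carrier C\<close> by (simp add: pair_mult_of pair_ring_carrier_of)
  qed (simp_all add: pair_mult_zero pair_mult_diff pair_ring_carrier_zero pair_ring_carrier_diff)
qed (simp_all add: pair_mult_zero pair_mult_diff pair_ring_carrier_zero pair_ring_carrier_diff)

lemma pair_mult_comm:
  assumes "u \<in> carrier (pair_ring B C)" "v \<in> carrier (pair_ring B C)"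
  shows "u \<otimes>\<^bsub>pair_ring B C\<^esub> v = v \<otimes>\<^bsub>pair_ring B C\<^esub> u"
  using assms(1)
proof (induction rule: pair_ring_induct)
  case (of b c)
  show ?case using assms(2)
  proof (induction rule: pair_ring_induct)
    case (of b' c')
    thus ?case using \<open>b \<in> carrier B\<close> \<open>c \<in> carrier C\<close> by (simp add: pair_mult_of B.m_comm C.m_comm)
  qed (simp_all add: pair_mult_zero pair_mult_diff)
qed (simp_all add: pair_mult_zero pair_mult_diff)

lemma pair_mult_assoc:
  assumes "u \<in> carrier (pair_ring B C)" "v \<in> carrier (pair_ring B C)" "w \<in> carrier (pair_ring B C)"
  shows "u \<otimes>\<^bsub>pair_ring B C\<^esub> v \<otimes>\<^bsub>pair_ring B C\<^esub> w = u \<otimes>\<^bsub>pair_ring B C\<^esub> (v \<otimes>\<^bsub>pair_ring B C\<^esub> w)"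
  using assms(1)
proof (induction rule: pair_ring_induct)
  case (of b1 c1)
  show ?case using assms(2)
  proof (induction rule: pair_ring_induct)
    case (of b2 c2)
    show ?case using assms(3)
    proof (induction rule: pair_ring_induct)
      case (of b3 c3)
      thus ?case using \<open>b1 \<in> carrier B\<close> \<open>c1 \<in> carrier C\<close> \<open>b2 \<in> carrier B\<close> \<open>c2 \<in> carrier C\<close>
        by (simp add: pair_mult_of B.m_assoc C.m_assoc)
    qed (simp_all add: pair_mult_zero pair_mult_diff)
  qed (simp_all add: pair_mult_zero pair_mult_diff)
qed (simp_all add: pair_mult_zero pair_mult_diff)

lemma pair_mult_one:
  assumes "u \<in> carrier (pair_ring B C)"
  shows "\<one>\<^bsub>pair_ring B C\<^esub> \<otimes>\<^bsub>pair_ring B C\<^esub> u = u"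
  using assms
proof (induction rule: pair_ring_induct)
  case (of b c)
  thus ?case by (simp add: pair_ring_ops pair_mult_of)
qed (simp_all add: pair_mult_zero pair_mult_diff)

theorem pair_ring_cring: "cring (pair_ring B C)"
proof (rule cringI)
  show "abelian_group (pair_ring B C)"
  proof (rule abelian_groupI)
    show "\<exists>v\<in>carrier (pair_ring B C). v \<oplus>\<^bsub>pair_ring B C\<^esub> u = \<zero>\<^bsub>pair_ring B C\<^esub>" if "u \<in> carrier (pair_ring B C)" for u
      using pair_ring_carrier_diff[OF pair_ring_carrier_zero that] by (intro bexI[of _ "0 - u"]) (simp_all add: pair_ring_ops)
  qed (simp_all add: pair_ring_ops pair_ring_carrier_add pair_ring_carrier_zero add.commute add.assoc)
  show "comm_monoid (pair_ring B C)"
  proof (rule comm_monoidI)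
    show "\<one>\<^bsub>pair_ring B C\<^esub> \<in> carrier (pair_ring B C)" by (simp add: pair_ring_ops pair_ring_carrier_of)
  qed (fact pair_mult_closed pair_mult_comm pair_mult_assoc pair_mult_one)+
  show "(x \<oplus>\<^bsub>pair_ring B C\<^esub> y) \<otimes>\<^bsub>pair_ring B C\<^esub> z = x \<otimes>\<^bsub>pair_ring B C\<^esub> z \<oplus>\<^bsub>pair_ring B C\<^esub> y \<otimes>\<^bsub>pair_ring B C\<^esub> z" for x y z
    by (simp add: pair_ring_ops pair_mult_add)
qed

lemma pair_ring_minus:
  assumes "u \<in> carrier (pair_ring B C)" "v \<in> carrier (pair_ring B C)"
  shows "u \<ominus>\<^bsub>pair_ring B C\<^esub> v = u - v"
proof -
  interpret P: cring "pair_ring B C" by (rule pair_ring_cring)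
  have "- v \<in> carrier (pair_ring B C)" using pair_ring_carrier_diff[OF pair_ring_carrier_zero assms(2)] by simp
  hence "\<ominus>\<^bsub>pair_ring B C\<^esub> v = - v" using assms(2) by (intro P.minus_equality) (simp_all add: pair_ring_ops)
  thus ?thesis by (simp add: P.minus_eq pair_ring_ops)
qed

end

subsection \<open>The universal property\<close>

text \<open>The homomorphism from the ring of formal pairs to \<open>A\<close> with \<open>(b, c) \<mapsto> f b \<cdot> g c\<close>, and the map that it
  induces on cosets. The residue map of the tensor product is of this form.\<close>

definition pair_lift ::
    "('a, 'x) ring_scheme \<Rightarrow> ('b \<Rightarrow> 'a) \<Rightarrow> ('c \<Rightarrow> 'a) \<Rightarrow> ('b \<times> 'c \<Rightarrow>\<^sub>0 int) \<Rightarrow> 'a" where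
  "pair_lift A f g u = (\<Oplus>\<^bsub>A\<^esub>p\<in>Poly_Mapping.keys u. add_pow A (Poly_Mapping.lookup u p) (f (fst p) \<otimes>\<^bsub>A\<^esub> g (snd p)))"

definition tensor_lift ::
    "('a, 'x) ring_scheme \<Rightarrow> ('b \<Rightarrow> 'a) \<Rightarrow> ('c \<Rightarrow> 'a) \<Rightarrow> ('b \<times> 'c \<Rightarrow>\<^sub>0 int) set \<Rightarrow> 'a" where
  "tensor_lift A f g Z = the_elem (pair_lift A f g ` Z)"

lemma tensor_residue_eq: "tensor_residue k' \<iota> W' R = tensor_lift k' (residue W') (\<lambda>r. \<iota> (residue R r))"
  by (simp add: fun_eq_iff tensor_residue_def tensor_lift_def pair_lift_def)

context
  fixes A :: "('a, 'z) ring_scheme" and B :: "('b, 'x) ring_scheme" and C :: "('c, 'y) ring_scheme" and f g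
  assumes A: "cring A" and B: "cring B" and C: "cring C"
    and f: "f \<in> ring_hom B A" and g: "g \<in> ring_hom C A"
begin

interpretation A: cring A by (rule A)
interpretation B: cring B by (rule B)
interpretation C: cring C by (rule C)

private lemma e_closed: "p \<in> carrier B \<times> carrier C ==> f (fst p) \<otimes>\<^bsub>A\<^esub> g (snd p) \<in> carrier A"
  using ring_hom_closed[OF f] ring_hom_closed[OF g] by auto

lemma pair_lift_superset:
  assumes "finite S" "Poly_Mapping.keys u \<subseteq> S" "S \<subseteq> carrier B \<times> carrier C"
  shows "pair_lift A f g u = (\<Oplus>\<^bsub>A\<^esub>p\<in>S. add_pow A (Poly_Mapping.lookup u p) (f (fst p) \<otimes>\<^bsub>A\<^esub> g (snd p)))"
  unfolding pair_lift_def
proof (rule A.add.finprod_mono_neutral_cong_left[OF assms(1,2)])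
  show "add_pow A (Poly_Mapping.lookup u i) (f (fst i) \<otimes>\<^bsub>A\<^esub> g (snd i)) = \<zero>\<^bsub>A\<^esub>" if "i \<in> S - Poly_Mapping.keys u" for i
  proof -
    have "Poly_Mapping.lookup u i = 0" using that by (simp add: in_keys_iff)
    thus ?thesis by (simp add: add_pow_def int_pow_def nat_pow_def)
  qed
  show "(\<lambda>i. add_pow A (Poly_Mapping.lookup u i) (f (fst i) \<otimes>\<^bsub>A\<^esub> g (snd i))) \<in> S \<rightarrow> carrier A"
    using e_closed assms(3) A.add.int_pow_closed by blast
qed simp

lemma pair_lift_closed: "u \<in> carrier (pair_ring B C) ==> pair_lift A f g u \<in> carrier A"
  unfolding pair_lift_def pair_ring_carrier
  by (intro A.finsum_closed) (use e_closed A.add.int_pow_closed in blast)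

lemma pair_lift_add:
  assumes "u \<in> carrier (pair_ring B C)" "v \<in> carrier (pair_ring B C)"
  shows "pair_lift A f g (u + v) = pair_lift A f g u \<oplus>\<^bsub>A\<^esub> pair_lift A f g v"
proof -
  let ?S = "Poly_Mapping.keys u \<union> Poly_Mapping.keys v"
  let ?e = "\<lambda>p. f (fst p) \<otimes>\<^bsub>A\<^esub> g (snd p)"
  have S: "finite ?S" "?S \<subseteq> carrier B \<times> carrier C" using assms by (auto simp: pair_ring_carrier)
  have cl: "?e p \<in> carrier A" if "p \<in> ?S" for p using e_closed S(2) that by blast
  have "pair_lift A f g (u + v) = (\<Oplus>\<^bsub>A\<^esub>p\<in>?S. add_pow A (Poly_Mapping.lookup (u + v) p) (?e p))"
    using S Poly_Mapping.keys_add[of u v] by (intro pair_lift_superset) auto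
  also have "\<dots> = (\<Oplus>\<^bsub>A\<^esub>p\<in>?S. add_pow A (Poly_Mapping.lookup u p) (?e p) \<oplus>\<^bsub>A\<^esub> add_pow A (Poly_Mapping.lookup v p) (?e p))"
    using cl by (intro A.finsum_cong') (auto simp: lookup_add A.add.int_pow_mult)
  also have "\<dots> = (\<Oplus>\<^bsub>A\<^esub>p\<in>?S. add_pow A (Poly_Mapping.lookup u p) (?e p)) \<oplus>\<^bsub>A\<^esub> (\<Oplus>\<^bsub>A\<^esub>p\<in>?S. add_pow A (Poly_Mapping.lookup v p) (?e p))"
    using cl by (intro A.finsum_addf) auto
  also have "(\<Oplus>\<^bsub>A\<^esub>p\<in>?S. add_pow A (Poly_Mapping.lookup u p) (?e p)) = pair_lift A f g u"
    using S by (intro pair_lift_superset[symmetric]) auto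
  also have "(\<Oplus>\<^bsub>A\<^esub>p\<in>?S. add_pow A (Poly_Mapping.lookup v p) (?e p)) = pair_lift A f g v"
    using S by (intro pair_lift_superset[symmetric]) auto
  finally show ?thesis .
qed

lemma pair_lift_of: "b \<in> carrier B ==> c \<in> carrier C ==> pair_lift A f g (frag_of (b, c)) = f b \<otimes>\<^bsub>A\<^esub> g c"
  using e_closed[of "(b, c)"] by (simp add: pair_lift_def A.add.int_pow_1 A.finsum_insert[of "{}", simplified])

lemma pair_lift_zero: "pair_lift A f g 0 = \<zero>\<^bsub>A\<^esub>"
  by (simp add: pair_lift_def)

lemma pair_lift_diff:
  assumes "u \<in> carrier (pair_ring B C)" "v \<in> carrier (pair_ring B C)"
  shows "pair_lift A f g (u - v) = pair_lift A f g u \<ominus>\<^bsub>A\<^esub> pair_lift A f g v"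
proof -
  have d: "u - v \<in> carrier (pair_ring B C)" by (rule pair_ring_carrier_diff[OF assms])
  have "pair_lift A f g (u - v) \<oplus>\<^bsub>A\<^esub> pair_lift A f g v = pair_lift A f g u"
    using pair_lift_add[OF d assms(2)] by simp
  moreover have "x = (x \<oplus>\<^bsub>A\<^esub> y) \<ominus>\<^bsub>A\<^esub> y" if "x \<in> carrier A" "y \<in> carrier A" for x y using that by algebra
  ultimately show ?thesis using pair_lift_closed[OF d] pair_lift_closed[OF assms(2)] by metis
qed

lemma pair_lift_mult:
  assumes "u \<in> carrier (pair_ring B C)" "v \<in> carrier (pair_ring B C)"
  shows "pair_lift A f g (u \<otimes>\<^bsub>pair_ring B C\<^esub> v) = pair_lift A f g u \<otimes>\<^bsub>A\<^esub> pair_lift A f g v"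
proof -
  interpret P: cring "pair_ring B C" by (rule pair_ring_cring[OF B C])
  have *: "(x \<ominus>\<^bsub>A\<^esub> y) \<otimes>\<^bsub>A\<^esub> z = x \<otimes>\<^bsub>A\<^esub> z \<ominus>\<^bsub>A\<^esub> y \<otimes>\<^bsub>A\<^esub> z" "z \<otimes>\<^bsub>A\<^esub> (x \<ominus>\<^bsub>A\<^esub> y) = z \<otimes>\<^bsub>A\<^esub> x \<ominus>\<^bsub>A\<^esub> z \<otimes>\<^bsub>A\<^esub> y"
    if "x \<in> carrier A" "y \<in> carrier A" "z \<in> carrier A" for x y z using that by algebra+
  have "u \<in> carrier (pair_ring B C) \<and> pair_lift A f g (u \<otimes>\<^bsub>pair_ring B C\<^esub> v) = pair_lift A f g u \<otimes>\<^bsub>A\<^esub> pair_lift A f g v"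
    using assms(1)
  proof (induction rule: pair_ring_induct)
    case zero
    thus ?case using pair_lift_closed[OF assms(2)] by (simp add: pair_mult_zero pair_lift_zero pair_ring_carrier_zero)
  next
    case (of b c)
    note bc = pair_ring_carrier_of[OF of]
    have "v \<in> carrier (pair_ring B C) \<and> pair_lift A f g (frag_of (b, c) \<otimes>\<^bsub>pair_ring B C\<^esub> v) = pair_lift A f g (frag_of (b, c)) \<otimes>\<^bsub>A\<^esub> pair_lift A f g v"
      using assms(2)
    proof (induction rule: pair_ring_induct)
      case zero
      show ?case using pair_lift_closed[OF bc] by (simp add: pair_mult_zero pair_lift_zero pair_ring_carrier_zero)
    next
      case (of b' c')
      have "f (b \<otimes>\<^bsub>B\<^esub> b') \<otimes>\<^bsub>A\<^esub> g (c \<otimes>\<^bsub>C\<^esub> c') = (f b \<otimes>\<^bsub>A\<^esub> g c) \<otimes>\<^bsub>A\<^esub> (f b' \<otimes>\<^bsub>A\<^esub> g c')"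
        using ring_hom_mult[OF f] ring_hom_mult[OF g] ring_hom_closed[OF f] ring_hom_closed[OF g] of \<open>b \<in> carrier B\<close> \<open>c \<in> carrier C\<close>
        by (simp add: A.m_ac)
      thus ?case using of \<open>b \<in> carrier B\<close> \<open>c \<in> carrier C\<close> by (simp add: pair_mult_of pair_lift_of pair_ring_carrier_of)
    next
      case (diff x y)
      thus ?case using bc pair_lift_closed
        by (simp add: pair_mult_diff pair_lift_diff pair_mult_closed[OF B C] pair_ring_carrier_diff *)
    qed
    thus ?case using bc by blast
  next
    case (diff x y)
    thus ?case using assms(2) pair_lift_closed
      by (simp add: pair_mult_diff pair_lift_diff pair_mult_closed[OF B C] pair_ring_carrier_diff *)
  qed
  thus ?thesis by blast
qed

lemma pair_lift_one: "pair_lift A f g \<one>\<^bsub>pair_ring B C\<^esub> = \<one>\<^bsub>A\<^esub>"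
  by (simp add: pair_ring_ops pair_lift_of ring_hom_one[OF f] ring_hom_one[OF g])

end

locale tensor = W: cring W + B: cring B + C: cring C
  for W :: "('w, 'z) ring_scheme" and B :: "('b, 'x) ring_scheme" and C :: "('c, 'y) ring_scheme" +
  fixes \<phi> \<psi>
  assumes \<phi>: "\<phi> \<in> ring_hom W B" and \<psi>: "\<psi> \<in> ring_hom W C"
begin

abbreviation PR where "PR \<equiv> pair_ring B C"
abbreviation I where "I \<equiv> tensor_ideal W B \<phi> C \<psi>"
abbreviation \<Omega> where "\<Omega> \<equiv> tensor_ring W B \<phi> C \<psi>"
abbreviation pure where "pure \<equiv> pure_tensor W B \<phi> C \<psi>"

lemma PR_cring: "cring PR" by (rule pair_ring_cring) unfold_locales

sublocale PR: cring PR by (rule PR_cring)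

lemma \<phi>_closed: "w \<in> carrier W ==> \<phi> w \<in> carrier B" using ring_hom_closed[OF \<phi>] .
lemma \<psi>_closed: "w \<in> carrier W ==> \<psi> w \<in> carrier C" using ring_hom_closed[OF \<psi>] .

lemma relations_closed: "tensor_relations W B \<phi> C \<psi> \<subseteq> carrier PR"
  unfolding tensor_relations_def
  by (auto intro!: pair_ring_carrier_diff pair_ring_carrier_of \<phi>_closed \<psi>_closed)

lemma I_ideal: "ideal I PR" unfolding tensor_ideal_def by (rule PR.genideal_ideal[OF relations_closed])

lemma \<Omega>_cring: "cring \<Omega>"
  unfolding tensor_ring_def by (rule ideal.quotient_is_cring[OF I_ideal PR.is_cring])

lemma coset_eq: "u \<in> carrier PR ==> v \<in> carrier PR ==> I +>\<^bsub>PR\<^esub> u = I +>\<^bsub>PR\<^esub> v \<longleftrightarrow> u - v \<in> I"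
  using PR.coset_eq_iff[OF I_ideal] pair_ring_minus[OF B.is_cring C.is_cring] by simp

lemma \<Omega>_carrier: "carrier \<Omega> = (\<lambda>u. I +>\<^bsub>PR\<^esub> u) ` carrier PR"
  unfolding tensor_ring_def by (rule PR.carrier_Quot)

lemma \<Omega>_ops:
  assumes "u \<in> carrier PR" "v \<in> carrier PR"
  shows "(I +>\<^bsub>PR\<^esub> u) \<oplus>\<^bsub>\<Omega>\<^esub> (I +>\<^bsub>PR\<^esub> v) = I +>\<^bsub>PR\<^esub> (u + v)"
    "(I +>\<^bsub>PR\<^esub> u) \<otimes>\<^bsub>\<Omega>\<^esub> (I +>\<^bsub>PR\<^esub> v) = I +>\<^bsub>PR\<^esub> (u \<otimes>\<^bsub>PR\<^esub> v)"
  using PR.Quot_ops[OF I_ideal assms] by (simp_all add: tensor_ring_def pair_ring_ops)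

lemma relation_coset: "u \<in> tensor_relations W B \<phi> C \<psi> ==> u \<in> I"
  unfolding tensor_ideal_def using PR.genideal_self[OF relations_closed] by blast

lemma pure_closed: "b \<in> carrier B ==> c \<in> carrier C ==> pure b c \<in> carrier \<Omega>"
  unfolding \<Omega>_carrier pure_tensor_def by (blast intro: pair_ring_carrier_of)

lemma pure_add_left:
  assumes "b \<in> carrier B" "b' \<in> carrier B" "c \<in> carrier C"
  shows "pure (b \<oplus>\<^bsub>B\<^esub> b') c = pure b c \<oplus>\<^bsub>\<Omega>\<^esub> pure b' c"
proof -
  have "frag_of (b \<oplus>\<^bsub>B\<^esub> b', c) - frag_of (b, c) - frag_of (b', c) \<in> I"
    by (rule relation_coset) (use assms in \<open>auto simp: tensor_relations_def\<close>)
  hence "frag_of (b \<oplus>\<^bsub>B\<^esub> b', c) - (frag_of (b, c) + frag_of (b', c)) \<in> I" by (simp add: diff_diff_eq)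
  thus ?thesis unfolding pure_tensor_def using assms
    by (simp add: \<Omega>_ops pair_ring_carrier_of coset_eq pair_ring_carrier_add)
qed

lemma pure_add_right:
  assumes "b \<in> carrier B" "c \<in> carrier C" "c' \<in> carrier C"
  shows "pure b (c \<oplus>\<^bsub>C\<^esub> c') = pure b c \<oplus>\<^bsub>\<Omega>\<^esub> pure b c'"
proof -
  have "frag_of (b, c \<oplus>\<^bsub>C\<^esub> c') - frag_of (b, c) - frag_of (b, c') \<in> I"
    by (rule relation_coset) (use assms in \<open>auto simp: tensor_relations_def\<close>)
  hence "frag_of (b, c \<oplus>\<^bsub>C\<^esub> c') - (frag_of (b, c) + frag_of (b, c')) \<in> I" by (simp add: diff_diff_eq)
  thus ?thesis unfolding pure_tensor_def using assms
    by (simp add: \<Omega>_ops pair_ring_carrier_of coset_eq pair_ring_carrier_add)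
qed

lemma pure_balanced:
  assumes "w \<in> carrier W" "b \<in> carrier B" "c \<in> carrier C"
  shows "pure (\<phi> w \<otimes>\<^bsub>B\<^esub> b) c = pure b (\<psi> w \<otimes>\<^bsub>C\<^esub> c)"
proof -
  have "frag_of (\<phi> w \<otimes>\<^bsub>B\<^esub> b, c) - frag_of (b, \<psi> w \<otimes>\<^bsub>C\<^esub> c) \<in> I"
    by (rule relation_coset) (use assms in \<open>auto simp: tensor_relations_def\<close>)
  thus ?thesis unfolding pure_tensor_def using assms
    by (simp add: pair_ring_carrier_of coset_eq \<phi>_closed \<psi>_closed)
qed

lemma pure_mult:
  assumes "b \<in> carrier B" "b' \<in> carrier B" "c \<in> carrier C" "c' \<in> carrier C"
  shows "pure b c \<otimes>\<^bsub>\<Omega>\<^esub> pure b' c' = pure (b \<otimes>\<^bsub>B\<^esub> b') (c \<otimes>\<^bsub>C\<^esub> c')"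
  unfolding pure_tensor_def using assms by (simp add: \<Omega>_ops pair_ring_carrier_of pair_mult_of)

lemma pure_one: "\<one>\<^bsub>\<Omega>\<^esub> = pure \<one>\<^bsub>B\<^esub> \<one>\<^bsub>C\<^esub>"
  by (simp add: tensor_ring_def FactRing_def pure_tensor_def pair_ring_ops)

lemma left_hom: "(\<lambda>b. pure b \<one>\<^bsub>C\<^esub>) \<in> ring_hom B \<Omega>"
  by (rule ring_hom_memI) (simp_all add: pure_closed pure_mult pure_add_left pure_one)

lemma right_hom: "(\<lambda>c. pure \<one>\<^bsub>B\<^esub> c) \<in> ring_hom C \<Omega>"
  by (rule ring_hom_memI) (simp_all add: pure_closed pure_mult pure_add_right pure_one)

lemma left_right: "b \<in> carrier B ==> c \<in> carrier C ==> pure b c = pure b \<one>\<^bsub>C\<^esub> \<otimes>\<^bsub>\<Omega>\<^esub> pure \<one>\<^bsub>B\<^esub> c"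
  by (simp add: pure_mult)

lemma left_right_scalar: "w \<in> carrier W ==> pure (\<phi> w) \<one>\<^bsub>C\<^esub> = pure \<one>\<^bsub>B\<^esub> (\<psi> w)"
  using pure_balanced[of w "\<one>\<^bsub>B\<^esub>" "\<one>\<^bsub>C\<^esub>"] \<phi>_closed \<psi>_closed by simp

lemma \<Omega>_induct [consumes 1, case_names zero pure diff]:
  assumes "z \<in> carrier \<Omega>" "Q \<zero>\<^bsub>\<Omega>\<^esub>"
    "\<And>b c. b \<in> carrier B ==> c \<in> carrier C ==> Q (pure b c)"
    "\<And>x y. x \<in> carrier \<Omega> ==> y \<in> carrier \<Omega> ==> Q x ==> Q y ==> Q (x \<ominus>\<^bsub>\<Omega>\<^esub> y)"
  shows "Q z"
proof -
  interpret \<Omega>: cring \<Omega> by (rule \<Omega>_cring)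
  obtain u where u: "u \<in> carrier PR" "z = I +>\<^bsub>PR\<^esub> u" using assms(1) unfolding \<Omega>_carrier by blast
  have zero: "I +>\<^bsub>PR\<^esub> 0 = \<zero>\<^bsub>\<Omega>\<^esub>"
    using PR.a_coset_add_zero[of I] PR.ideal_simps(2)[OF I_ideal]
    by (auto simp: tensor_ring_def FactRing_def pair_ring_ops)
  have "u \<in> carrier PR \<and> Q (I +>\<^bsub>PR\<^esub> u)"
    using u(1)
  proof (induction rule: pair_ring_induct)
    case zero
    show ?case using assms(2) \<open>I +>\<^bsub>PR\<^esub> 0 = \<zero>\<^bsub>\<Omega>\<^esub>\<close> pair_ring_carrier_zero by simp
  next
    case (of b c)
    show ?case using assms(3)[OF of] pair_ring_carrier_of[OF of] by (simp add: pure_tensor_def)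
  next
    case (diff x y)
    have c: "I +>\<^bsub>PR\<^esub> x \<in> carrier \<Omega>" "I +>\<^bsub>PR\<^esub> y \<in> carrier \<Omega>" "I +>\<^bsub>PR\<^esub> (x - y) \<in> carrier \<Omega>"
      using diff pair_ring_carrier_diff[of x B C y] unfolding \<Omega>_carrier by blast+
    have "(I +>\<^bsub>PR\<^esub> (x - y)) \<oplus>\<^bsub>\<Omega>\<^esub> (I +>\<^bsub>PR\<^esub> y) = I +>\<^bsub>PR\<^esub> x"
      using diff pair_ring_carrier_diff[of x B C y] by (simp add: \<Omega>_ops)
    moreover have "z = (z \<oplus>\<^bsub>\<Omega>\<^esub> y) \<ominus>\<^bsub>\<Omega>\<^esub> y" if "z \<in> carrier \<Omega>" "y \<in> carrier \<Omega>" for z y using that by algebra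
    ultimately have "I +>\<^bsub>PR\<^esub> (x - y) = (I +>\<^bsub>PR\<^esub> x) \<ominus>\<^bsub>\<Omega>\<^esub> (I +>\<^bsub>PR\<^esub> y)" using c by metis
    thus ?case using assms(4) c diff pair_ring_carrier_diff[of x B C y] by simp
  qed
  thus ?thesis using u by blast
qed

text \<open>The relations are mapped to zero, so \<open>pair_lift\<close> is constant on cosets.\<close>

theorem tensor_lift_hom:
  assumes A: "cring A" and f: "f \<in> ring_hom B A" and g: "g \<in> ring_hom C A"
    and fg: "\<And>w. w \<in> carrier W ==> f (\<phi> w) = g (\<psi> w)"
  shows "tensor_lift A f g \<in> ring_hom \<Omega> A"
    "\<And>b c. b \<in> carrier B ==> c \<in> carrier C ==> tensor_lift A f g (pure b c) = f b \<otimes>\<^bsub>A\<^esub> g c"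
proof -
  interpret A: cring A by (rule A)
  note PL = pair_lift_add[OF A B.is_cring C.is_cring f g] pair_lift_mult[OF A B.is_cring C.is_cring f g]
    pair_lift_diff[OF A B.is_cring C.is_cring f g] pair_lift_closed[OF A B.is_cring C.is_cring f g]
    pair_lift_of[OF A B.is_cring C.is_cring f g] pair_lift_zero[OF A B.is_cring C.is_cring f g]
    pair_lift_one[OF A B.is_cring C.is_cring f g]
  let ?H = "pair_lift A f g"
  note fc = ring_hom_closed[OF f] note gc = ring_hom_closed[OF g]
  have "ideal {u \<in> carrier PR. ?H u = \<zero>\<^bsub>A\<^esub>} PR"
    by (rule PR.ideal_intro) (auto simp: pair_ring_ops PL pair_ring_carrier_zero pair_ring_carrier_add pair_mult_closed[OF B.is_cring C.is_cring])
  moreover have "tensor_relations W B \<phi> C \<psi> \<subseteq> {u \<in> carrier PR. ?H u = \<zero>\<^bsub>A\<^esub>}"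
  proof
    fix u assume u: "u \<in> tensor_relations W B \<phi> C \<psi>"
    hence uc: "u \<in> carrier PR" using relations_closed by blast
    have s1: "(x \<oplus>\<^bsub>A\<^esub> y) \<otimes>\<^bsub>A\<^esub> z \<ominus>\<^bsub>A\<^esub> x \<otimes>\<^bsub>A\<^esub> z \<ominus>\<^bsub>A\<^esub> y \<otimes>\<^bsub>A\<^esub> z = \<zero>\<^bsub>A\<^esub>" "z \<otimes>\<^bsub>A\<^esub> (x \<oplus>\<^bsub>A\<^esub> y) \<ominus>\<^bsub>A\<^esub> z \<otimes>\<^bsub>A\<^esub> x \<ominus>\<^bsub>A\<^esub> z \<otimes>\<^bsub>A\<^esub> y = \<zero>\<^bsub>A\<^esub>"
      if "x \<in> carrier A" "y \<in> carrier A" "z \<in> carrier A" for x y z using that by algebra+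
    consider b b' c where "u = frag_of (b \<oplus>\<^bsub>B\<^esub> b', c) - frag_of (b, c) - frag_of (b', c)" "b \<in> carrier B" "b' \<in> carrier B" "c \<in> carrier C"
      | b c c' where "u = frag_of (b, c \<oplus>\<^bsub>C\<^esub> c') - frag_of (b, c) - frag_of (b, c')" "b \<in> carrier B" "c \<in> carrier C" "c' \<in> carrier C"
      | w b c where "u = frag_of (\<phi> w \<otimes>\<^bsub>B\<^esub> b, c) - frag_of (b, \<psi> w \<otimes>\<^bsub>C\<^esub> c)" "w \<in> carrier W" "b \<in> carrier B" "c \<in> carrier C"
      using u unfolding tensor_relations_def by blast
    hence "?H u = \<zero>\<^bsub>A\<^esub>"
    proof cases
      case 1
      thus ?thesis using fc gc by (simp add: PL pair_ring_carrier_of pair_ring_carrier_diff ring_hom_add[OF f] s1)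
    next
      case 2
      thus ?thesis using fc gc by (simp add: PL pair_ring_carrier_of pair_ring_carrier_diff ring_hom_add[OF g] s1)
    next
      case 3
      have "?H u = f (\<phi> w) \<otimes>\<^bsub>A\<^esub> f b \<otimes>\<^bsub>A\<^esub> g c \<ominus>\<^bsub>A\<^esub> f b \<otimes>\<^bsub>A\<^esub> (g (\<psi> w) \<otimes>\<^bsub>A\<^esub> g c)"
        unfolding 3(1) using 3 \<phi>_closed \<psi>_closed
        by (simp add: PL pair_ring_carrier_of ring_hom_mult[OF f] ring_hom_mult[OF g])
      also have "\<dots> = \<zero>\<^bsub>A\<^esub>"
        using fg[OF 3(2)] fc[OF 3(3)] gc[OF 3(4)] gc[OF \<psi>_closed[OF 3(2)]]
        by (simp add: A.m_ac A.r_right_minus_eq)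
      finally show ?thesis .
    qed
    thus "u \<in> {u \<in> carrier PR. ?H u = \<zero>\<^bsub>A\<^esub>}" using uc by blast
  qed
  ultimately have I0: "I \<subseteq> {u \<in> carrier PR. ?H u = \<zero>\<^bsub>A\<^esub>}"
    unfolding tensor_ideal_def by (rule PR.genideal_minimal)
  have TL: "tensor_lift A f g (I +>\<^bsub>PR\<^esub> u) = ?H u" if u: "u \<in> carrier PR" for u
  proof -
    have "?H v = ?H u" if "v \<in> I +>\<^bsub>PR\<^esub> u" for v
    proof -
      have v: "v \<in> carrier PR" "v - u \<in> I"
        using that PR.mem_coset_iff[OF I_ideal u] pair_ring_minus[OF B.is_cring C.is_cring _ u] by auto
      hence "?H (v - u) = \<zero>\<^bsub>A\<^esub>" using I0 by blast
      hence "?H v \<ominus>\<^bsub>A\<^esub> ?H u = \<zero>\<^bsub>A\<^esub>" using PL(3)[OF v(1) u] by simp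
      thus ?thesis using PL(4) v(1) u by (simp add: A.r_right_minus_eq)
    qed
    moreover have "u \<in> I +>\<^bsub>PR\<^esub> u"
      using PR.mem_coset_iff[OF I_ideal u, of u] PR.minus_self[OF u] PR.ideal_simps(1)[OF I_ideal] u by metis
    ultimately have "?H ` (I +>\<^bsub>PR\<^esub> u) = {?H u}" by blast
    thus ?thesis by (simp add: tensor_lift_def)
  qed
  show "tensor_lift A f g \<in> ring_hom \<Omega> A"
  proof (rule ring_hom_memI)
    fix x y assume "x \<in> carrier \<Omega>" "y \<in> carrier \<Omega>"
    then obtain u v where uv: "u \<in> carrier PR" "x = I +>\<^bsub>PR\<^esub> u" "v \<in> carrier PR" "y = I +>\<^bsub>PR\<^esub> v"
      unfolding \<Omega>_carrier by blast
    thus "tensor_lift A f g x \<in> carrier A" by (simp add: TL PL)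
    show "tensor_lift A f g (x \<otimes>\<^bsub>\<Omega>\<^esub> y) = tensor_lift A f g x \<otimes>\<^bsub>A\<^esub> tensor_lift A f g y"
      "tensor_lift A f g (x \<oplus>\<^bsub>\<Omega>\<^esub> y) = tensor_lift A f g x \<oplus>\<^bsub>A\<^esub> tensor_lift A f g y"
      using uv by (simp_all add: TL PL \<Omega>_ops pair_ring_carrier_add pair_mult_closed[OF B.is_cring C.is_cring])
  next
    have "\<one>\<^bsub>\<Omega>\<^esub> = I +>\<^bsub>PR\<^esub> \<one>\<^bsub>PR\<^esub>" by (simp add: tensor_ring_def FactRing_def)
    thus "tensor_lift A f g \<one>\<^bsub>\<Omega>\<^esub> = \<one>\<^bsub>A\<^esub>" by (simp add: TL PL)
  qed
  show "tensor_lift A f g (pure b c) = f b \<otimes>\<^bsub>A\<^esub> g c" if "b \<in> carrier B" "c \<in> carrier C" for b c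
    using that by (simp add: pure_tensor_def TL PL pair_ring_carrier_of)
qed

end

subsection \<open>The maximal ideal of the tensor product\<close>

text \<open>Modulo an ideal that contains the image of the maximal ideal of \<open>R\<close>, every tensor comes from \<open>W'\<close>,
  since \<open>W\<close> maps onto the residue field of \<open>R\<close>. If the tensor lies in the kernel of the residue map,
  then this element of \<open>W'\<close> lies in the maximal ideal of \<open>W'\<close>. Hence the kernel is the smallest ideal
  that contains the images of both maximal ideals.\<close>

lemma tensor_residual:
  fixes W :: "('w, 'k) res_ring" and W' :: "('v, 'l) res_ring" and R :: "('r, 'k, 'w) coef_alg"
  assumes k: "field k" and k': "field k'" and W: "complete_local_noetherian k W"
    and W': "complete_local_noetherian k' W'" and R: "coef_obj k W R"
    and \<iota>: "\<iota> \<in> ring_hom k k'" and \<phi>: "\<phi> \<in> ring_hom W W'"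
    and compat: "\<And>w. w \<in> carrier W ==> residue W' (\<phi> w) = \<iota> (residue W w)"
  shows "tensor W W' R \<phi> (scalar R)"
    "residual (tensor_ring W W' \<phi> R (scalar R)) k' (tensor_residue k' \<iota> W' R)"
    "\<And>x r. x \<in> carrier W' ==> r \<in> carrier R ==>
       tensor_residue k' \<iota> W' R (pure_tensor W W' \<phi> R (scalar R) x r) = residue W' x \<otimes>\<^bsub>k'\<^esub> \<iota> (residue R r)"
    "\<exists>F \<subseteq> carrier (tensor_ring W W' \<phi> R (scalar R)). finite F \<and> tensor_max_ideal W k' \<iota> W' \<phi> R = Idl\<^bsub>tensor_ring W W' \<phi> R (scalar R)\<^esub> F"
    "\<And>J. ideal J (tensor_ring W W' \<phi> R (scalar R)) ==>
        (\<And>x. x \<in> max_ideal W' ==> pure_tensor W W' \<phi> R (scalar R) x \<one>\<^bsub>R\<^esub> \<in> J) ==>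
        (\<And>r. r \<in> max_ideal R ==> pure_tensor W W' \<phi> R (scalar R) \<one>\<^bsub>W'\<^esub> r \<in> J) ==>
        tensor_max_ideal W k' \<iota> W' \<phi> R \<subseteq> J"
proof -
  have R': "complete_local_noetherian k R" "scalar R \<in> ring_hom W R"
    "\<And>w. w \<in> carrier W ==> residue R (scalar R w) = residue W w" using R by (auto simp: coef_obj_def)
  note eW = cln_elim[OF k W]
  note eW' = cln_elim[OF k' W']
  note eR = cln_elim[OF k R'(1)]
  interpret k: field k by (rule k)
  interpret k': field k' by (rule k')
  interpret rW: residual W k "residue W" by (rule eW(1))
  interpret rW': residual W' k' "residue W'" by (rule eW'(1))
  interpret rR: residual R k "residue R" by (rule eR(1))
  show T: "tensor W W' R \<phi> (scalar R)"
    using eW(5) eW'(5) eR(5) \<phi> R'(2) by (simp add: tensor_def tensor_axioms_def)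
  then interpret T: tensor W W' R \<phi> "scalar R" .
  interpret \<Omega>: cring T.\<Omega> by (rule T.\<Omega>_cring)
  let ?\<pi> = "tensor_residue k' \<iota> W' R"
  have g: "(\<lambda>r. \<iota> (residue R r)) \<in> ring_hom R k'"
    using ring_hom_trans[OF rR.\<pi>_hom \<iota>] by (simp add: o_def)
  have fg: "residue W' (\<phi> w) = \<iota> (residue R (scalar R w))" if "w \<in> carrier W" for w
    using compat[OF that] R'(3)[OF that] by simp
  note TL = T.tensor_lift_hom[OF k'.is_cring rW'.\<pi>_hom g fg, folded tensor_residue_eq]
  show pr: "?\<pi> (T.pure x r) = residue W' x \<otimes>\<^bsub>k'\<^esub> \<iota> (residue R r)" if "x \<in> carrier W'" "r \<in> carrier R" for x r
    using TL(2) that by simp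
  have h: "?\<pi> \<in> ring_hom T.\<Omega> k'" using TL(1) by simp
  have i1: "\<iota> \<one>\<^bsub>k\<^esub> = \<one>\<^bsub>k'\<^esub>" by (rule ring_hom_one[OF \<iota>])
  have left: "?\<pi> (T.pure x \<one>\<^bsub>R\<^esub>) = residue W' x" if "x \<in> carrier W'" for x
    using pr[OF that, of "\<one>\<^bsub>R\<^esub>"] that by (simp add: i1)
  have "?\<pi> ` carrier T.\<Omega> = carrier k'"
  proof
    show "?\<pi> ` carrier T.\<Omega> \<subseteq> carrier k'" using ring_hom_closed[OF h] by auto
    show "carrier k' \<subseteq> ?\<pi> ` carrier T.\<Omega>"
    proof
      fix y assume "y \<in> carrier k'"
      then obtain x where "x \<in> carrier W'" "y = residue W' x" using rW'.\<pi>_surj by (metis (no_types, lifting) imageE)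
      thus "y \<in> ?\<pi> ` carrier T.\<Omega>" using left T.pure_closed[of x "\<one>\<^bsub>R\<^esub>"] by (metis imageI rR.A.one_closed)
    qed
  qed
  thus res: "residual T.\<Omega> k' ?\<pi>"
    using h k' T.\<Omega>_cring by (simp add: residual_def residual_axioms_def)
  have m\<Omega>: "tensor_max_ideal W k' \<iota> W' \<phi> R = a_kernel T.\<Omega> k' ?\<pi>" by (simp add: tensor_max_ideal_def)
  have dec: "\<exists>b\<in>carrier W'. z \<ominus>\<^bsub>T.\<Omega>\<^esub> T.pure b \<one>\<^bsub>R\<^esub> \<in> J"
    if J: "ideal J T.\<Omega>" "\<And>r. r \<in> max_ideal R ==> T.pure \<one>\<^bsub>W'\<^esub> r \<in> J" and z: "z \<in> carrier T.\<Omega>" for J z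
  proof -
    note JJ = \<Omega>.ideal_simps[OF J(1)]
    show ?thesis using z
    proof (induction rule: T.\<Omega>_induct)
      case zero
      have "T.pure \<zero>\<^bsub>W'\<^esub> \<one>\<^bsub>R\<^esub> = \<zero>\<^bsub>T.\<Omega>\<^esub>"
        by (rule ring_hom_zero[OF T.left_hom rW'.A.ring_axioms \<Omega>.ring_axioms])
      thus ?case using JJ(1) by (intro bexI[of _ "\<zero>\<^bsub>W'\<^esub>"]) auto
    next
      case (pure b c)
      obtain w where w: "w \<in> carrier W" "residue W w = residue R c"
        using rW.\<pi>_surj rR.\<pi>_simps(1)[OF pure(2)] by (metis (no_types, lifting) imageE)
      have sw: "scalar R w \<in> carrier R" using T.\<psi>_closed w by blast
      define r where "r = c \<ominus>\<^bsub>R\<^esub> scalar R w"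
      have r: "r \<in> carrier R" "residue R r = \<zero>\<^bsub>k\<^esub>"
        unfolding r_def using pure sw w R'(3)[OF w(1)] by (auto simp: rR.\<pi>_minus k.r_right_minus_eq)
      hence "r \<in> max_ideal R" unfolding eR(2) rR.m_iff by simp
      hence "T.pure \<one>\<^bsub>W'\<^esub> r \<in> J" using J(2) by blast
      hence "T.pure b \<one>\<^bsub>R\<^esub> \<otimes>\<^bsub>T.\<Omega>\<^esub> T.pure \<one>\<^bsub>W'\<^esub> r \<in> J" using JJ(7) T.pure_closed pure(1) by simp
      hence br: "T.pure b r \<in> J" using T.left_right[OF pure(1) r(1)] by simp
      have "c = scalar R w \<oplus>\<^bsub>R\<^esub> r" unfolding r_def using pure(2) sw by algebra
      hence "T.pure b c = T.pure b (scalar R w) \<oplus>\<^bsub>T.\<Omega>\<^esub> T.pure b r" using T.pure_add_right[OF pure(1) sw r(1)] by simp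
      also have "T.pure b (scalar R w) = T.pure (\<phi> w \<otimes>\<^bsub>W'\<^esub> b) \<one>\<^bsub>R\<^esub>"
        using T.pure_balanced[OF w(1) pure(1) rR.A.one_closed] sw by simp
      finally have e: "T.pure b c = T.pure (\<phi> w \<otimes>\<^bsub>W'\<^esub> b) \<one>\<^bsub>R\<^esub> \<oplus>\<^bsub>T.\<Omega>\<^esub> T.pure b r" .
      have bc: "\<phi> w \<otimes>\<^bsub>W'\<^esub> b \<in> carrier W'" using T.\<phi>_closed[OF w(1)] pure(1) by simp
      have "(x \<oplus>\<^bsub>T.\<Omega>\<^esub> y) \<ominus>\<^bsub>T.\<Omega>\<^esub> x = y" if "x \<in> carrier T.\<Omega>" "y \<in> carrier T.\<Omega>" for x y using that by algebra
      hence "T.pure b c \<ominus>\<^bsub>T.\<Omega>\<^esub> T.pure (\<phi> w \<otimes>\<^bsub>W'\<^esub> b) \<one>\<^bsub>R\<^esub> = T.pure b r"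
        unfolding e using T.pure_closed[OF bc rR.A.one_closed] JJ(2)[OF br] by blast
      thus ?case using br bc by (intro bexI[of _ "\<phi> w \<otimes>\<^bsub>W'\<^esub> b"]) auto
    next
      case (diff x y)
      then obtain b b' where b: "b \<in> carrier W'" "x \<ominus>\<^bsub>T.\<Omega>\<^esub> T.pure b \<one>\<^bsub>R\<^esub> \<in> J" "b' \<in> carrier W'" "y \<ominus>\<^bsub>T.\<Omega>\<^esub> T.pure b' \<one>\<^bsub>R\<^esub> \<in> J" by blast
      note m = ring_hom_minus[OF rW'.A.is_cring \<Omega>.is_cring T.left_hom b(1,3)]
      have "(x \<ominus>\<^bsub>T.\<Omega>\<^esub> T.pure b \<one>\<^bsub>R\<^esub>) \<ominus>\<^bsub>T.\<Omega>\<^esub> (y \<ominus>\<^bsub>T.\<Omega>\<^esub> T.pure b' \<one>\<^bsub>R\<^esub>) \<in> J" by (rule JJ(4)[OF b(2,4)])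
      moreover have "(x \<ominus>\<^bsub>T.\<Omega>\<^esub> p) \<ominus>\<^bsub>T.\<Omega>\<^esub> (y \<ominus>\<^bsub>T.\<Omega>\<^esub> q) = (x \<ominus>\<^bsub>T.\<Omega>\<^esub> y) \<ominus>\<^bsub>T.\<Omega>\<^esub> (p \<ominus>\<^bsub>T.\<Omega>\<^esub> q)"
        if "p \<in> carrier T.\<Omega>" "q \<in> carrier T.\<Omega>" for p q using that diff(1,2) by algebra
      ultimately have "(x \<ominus>\<^bsub>T.\<Omega>\<^esub> y) \<ominus>\<^bsub>T.\<Omega>\<^esub> T.pure (b \<ominus>\<^bsub>W'\<^esub> b') \<one>\<^bsub>R\<^esub> \<in> J"
        unfolding m using T.pure_closed[OF b(1) rR.A.one_closed] T.pure_closed[OF b(3) rR.A.one_closed] by metis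
      thus ?case using b by (intro bexI[of _ "b \<ominus>\<^bsub>W'\<^esub> b'"]) auto
    qed
  qed
  interpret r\<Omega>: residual T.\<Omega> k' ?\<pi> by (rule res)
  have right0: "?\<pi> (T.pure \<one>\<^bsub>W'\<^esub> r) = \<zero>\<^bsub>k'\<^esub>" if "r \<in> max_ideal R" for r
  proof -
    have r: "r \<in> carrier R" "residue R r = \<zero>\<^bsub>k\<^esub>" using that unfolding eR(2) rR.m_iff by auto
    have "\<iota> \<zero>\<^bsub>k\<^esub> = \<zero>\<^bsub>k'\<^esub>" by (rule ring_hom_zero[OF \<iota> k.ring_axioms k'.ring_axioms])
    thus ?thesis using pr[OF rW'.A.one_closed r(1)] r(2) by simp
  qed
  show sub: "tensor_max_ideal W k' \<iota> W' \<phi> R \<subseteq> J" if J: "ideal J T.\<Omega>"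
    "\<And>x. x \<in> max_ideal W' ==> T.pure x \<one>\<^bsub>R\<^esub> \<in> J" "\<And>r. r \<in> max_ideal R ==> T.pure \<one>\<^bsub>W'\<^esub> r \<in> J" for J
  proof
    fix z assume "z \<in> tensor_max_ideal W k' \<iota> W' \<phi> R"
    hence z: "z \<in> carrier T.\<Omega>" "?\<pi> z = \<zero>\<^bsub>k'\<^esub>" unfolding m\<Omega> a_kernel_mem by auto
    have J': "ideal (J \<inter> r\<Omega>.m) T.\<Omega>" by (rule \<Omega>.i_intersect[OF J(1) r\<Omega>.m_ideal])
    have "T.pure \<one>\<^bsub>W'\<^esub> r \<in> J \<inter> r\<Omega>.m" if r: "r \<in> max_ideal R" for r
    proof -
      have "r \<in> carrier R" using r unfolding eR(2) rR.m_iff by auto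
      thus ?thesis unfolding Int_iff r\<Omega>.m_iff using J(3)[OF r] right0[OF r] T.pure_closed[OF rW'.A.one_closed] by blast
    qed
    from dec[OF J' this z(1)] obtain b where b: "b \<in> carrier W'" "z \<ominus>\<^bsub>T.\<Omega>\<^esub> T.pure b \<one>\<^bsub>R\<^esub> \<in> J"
      "z \<ominus>\<^bsub>T.\<Omega>\<^esub> T.pure b \<one>\<^bsub>R\<^esub> \<in> r\<Omega>.m" by blast
    have pc: "T.pure b \<one>\<^bsub>R\<^esub> \<in> carrier T.\<Omega>" by (rule T.pure_closed[OF b(1) rR.A.one_closed])
    have "?\<pi> (z \<ominus>\<^bsub>T.\<Omega>\<^esub> T.pure b \<one>\<^bsub>R\<^esub>) = \<zero>\<^bsub>k'\<^esub>" using b(3) unfolding r\<Omega>.m_iff by blast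
    hence "\<zero>\<^bsub>k'\<^esub> \<ominus>\<^bsub>k'\<^esub> residue W' b = \<zero>\<^bsub>k'\<^esub>" using r\<Omega>.\<pi>_minus[OF z(1) pc] z(2) left[OF b(1)] by simp
    hence "residue W' b = \<zero>\<^bsub>k'\<^esub>" using rW'.\<pi>_simps(1)[OF b(1)] k'.r_right_minus_eq[of "\<zero>\<^bsub>k'\<^esub>" "residue W' b"] by simp
    hence "b \<in> max_ideal W'" unfolding eW'(2) rW'.m_iff using b(1) by simp
    hence "(z \<ominus>\<^bsub>T.\<Omega>\<^esub> T.pure b \<one>\<^bsub>R\<^esub>) \<oplus>\<^bsub>T.\<Omega>\<^esub> T.pure b \<one>\<^bsub>R\<^esub> \<in> J"
      using b(2) J(2) \<Omega>.ideal_simps(3)[OF J(1)] by simp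
    moreover have "(z \<ominus>\<^bsub>T.\<Omega>\<^esub> T.pure b \<one>\<^bsub>R\<^esub>) \<oplus>\<^bsub>T.\<Omega>\<^esub> T.pure b \<one>\<^bsub>R\<^esub> = z"
      using z(1) pc by (simp add: \<Omega>.minus_eq \<Omega>.a_assoc \<Omega>.l_neg)
    ultimately show "z \<in> J" by simp
  qed
  obtain G where G: "G \<subseteq> carrier W'" "finite G" "max_ideal W' = Idl\<^bsub>W'\<^esub> G" using eW'(4) by blast
  obtain H where H: "H \<subseteq> carrier R" "finite H" "max_ideal R = Idl\<^bsub>R\<^esub> H" using eR(4) by blast
  define F where "F = (\<lambda>b. T.pure b \<one>\<^bsub>R\<^esub>) ` G \<union> (\<lambda>r. T.pure \<one>\<^bsub>W'\<^esub> r) ` H"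
  have F: "F \<subseteq> carrier T.\<Omega>" "finite F"
    using G(1,2) H(1,2) T.pure_closed by (auto simp: F_def)
  have iF: "ideal (Idl\<^bsub>T.\<Omega>\<^esub> F) T.\<Omega>" by (rule \<Omega>.genideal_ideal[OF F(1)])
  have FF: "F \<subseteq> Idl\<^bsub>T.\<Omega>\<^esub> F" by (rule \<Omega>.genideal_self[OF F(1)])
  have "tensor_max_ideal W k' \<iota> W' \<phi> R \<subseteq> Idl\<^bsub>T.\<Omega>\<^esub> F"
  proof (rule sub[OF iF])
    have "Idl\<^bsub>W'\<^esub> G \<subseteq> {b \<in> carrier W'. T.pure b \<one>\<^bsub>R\<^esub> \<in> Idl\<^bsub>T.\<Omega>\<^esub> F}"
      using FF G(1) by (intro rW'.A.genideal_minimal ideal_preimage[OF rW'.A.is_cring \<Omega>.is_cring T.left_hom iF]) (auto simp: F_def)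
    thus "T.pure x \<one>\<^bsub>R\<^esub> \<in> Idl\<^bsub>T.\<Omega>\<^esub> F" if "x \<in> max_ideal W'" for x using that G(3) by blast
    have "Idl\<^bsub>R\<^esub> H \<subseteq> {r \<in> carrier R. T.pure \<one>\<^bsub>W'\<^esub> r \<in> Idl\<^bsub>T.\<Omega>\<^esub> F}"
      using FF H(1) by (intro rR.A.genideal_minimal ideal_preimage[OF rR.A.is_cring \<Omega>.is_cring T.right_hom iF]) (auto simp: F_def)
    thus "T.pure \<one>\<^bsub>W'\<^esub> r \<in> Idl\<^bsub>T.\<Omega>\<^esub> F" if "r \<in> max_ideal R" for r using that H(3) by blast
  qed
  moreover have "Idl\<^bsub>T.\<Omega>\<^esub> F \<subseteq> tensor_max_ideal W k' \<iota> W' \<phi> R"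
    unfolding m\<Omega>
  proof (rule \<Omega>.genideal_minimal[OF r\<Omega>.m_ideal], rule subsetI)
    fix z assume "z \<in> F"
    then consider b where "b \<in> G" "z = T.pure b \<one>\<^bsub>R\<^esub>" | r where "r \<in> H" "z = T.pure \<one>\<^bsub>W'\<^esub> r" unfolding F_def by blast
    hence "?\<pi> z = \<zero>\<^bsub>k'\<^esub>"
    proof cases
      case 1
      hence "b \<in> max_ideal W'" using rW'.A.genideal_self[OF G(1)] G(3) by blast
      thus ?thesis using 1 left unfolding eW'(2) rW'.m_iff by simp
    next
      case 2
      hence "r \<in> max_ideal R" using rR.A.genideal_self[OF H(1)] H(3) by blast
      thus ?thesis using 2 right0 by simp
    qed
    thus "z \<in> r\<Omega>.m" unfolding r\<Omega>.m_iff using F(1) \<open>z \<in> F\<close> by blast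
  qed
  ultimately show "\<exists>F \<subseteq> carrier T.\<Omega>. finite F \<and> tensor_max_ideal W k' \<iota> W' \<phi> R = Idl\<^bsub>T.\<Omega>\<^esub> F"
    using F by blast
qed

section \<open>Dual numbers\<close>

lemma dual_simps:
  "carrier (dual_numbers k W) = carrier k \<times> carrier k"
  "(a, b) \<otimes>\<^bsub>dual_numbers k W\<^esub> (c, d) = (a \<otimes>\<^bsub>k\<^esub> c, (a \<otimes>\<^bsub>k\<^esub> d) \<oplus>\<^bsub>k\<^esub> (b \<otimes>\<^bsub>k\<^esub> c))"
  "(a, b) \<oplus>\<^bsub>dual_numbers k W\<^esub> (c, d) = (a \<oplus>\<^bsub>k\<^esub> c, b \<oplus>\<^bsub>k\<^esub> d)"
  "\<one>\<^bsub>dual_numbers k W\<^esub> = (\<one>\<^bsub>k\<^esub>, \<zero>\<^bsub>k\<^esub>)" "\<zero>\<^bsub>dual_numbers k W\<^esub> = (\<zero>\<^bsub>k\<^esub>, \<zero>\<^bsub>k\<^esub>)"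
  "residue (dual_numbers k W) = fst" "scalar (dual_numbers k W) w = (residue W w, \<zero>\<^bsub>k\<^esub>)"
  by (simp_all add: dual_numbers_def)

context
  fixes k :: "('k, 'z) ring_scheme" (structure) and W :: "('w, 'k, 'y) res_ring_scheme"
  assumes k: "field k" and W: "complete_local_noetherian k W"
begin

interpretation k: field k by (rule k)

abbreviation (input) D where "D \<equiv> dual_numbers k W"

lemma dual_cring: "cring D"
proof (rule cringI)
  show "abelian_group D"
  proof (rule abelian_groupI)
    show "\<exists>y\<in>carrier D. y \<oplus>\<^bsub>D\<^esub> x = \<zero>\<^bsub>D\<^esub>" if "x \<in> carrier D" for x
      using that by (intro bexI[of _ "(\<ominus> fst x, \<ominus> snd x)"]) (auto simp: dual_simps k.l_neg)
  qed (auto simp: dual_simps k.a_ac)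
  show "comm_monoid D"
    by (rule comm_monoidI) (auto simp: dual_simps k.l_distr k.r_distr k.m_ac k.a_ac)
qed (auto simp: dual_simps k.l_distr k.a_ac)

interpretation D: cring D by (rule dual_cring)

lemma dual_residual: "residual D k (residue D)"
proof -
  have "residue D \<in> ring_hom D k" by (rule ring_hom_memI) (auto simp: dual_simps)
  moreover have "residue D ` carrier D = carrier k"
    using k.zero_closed by (auto simp: dual_simps)
  ultimately show ?thesis using dual_cring k by (simp add: residual_def residual_axioms_def)
qed

lemma dual_kernel: "a_kernel D k (residue D) = {\<zero>} \<times> carrier k"
  by (auto simp: a_kernel_def' dual_simps)

lemma dual_kernel_ideal: "ideal ({\<zero>} \<times> carrier k) D"
  using residual.m_ideal[OF dual_residual] by (simp add: dual_kernel)

lemma dual_pow: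
  "ideal_pow D ({\<zero>} \<times> carrier k) (Suc 0) = {\<zero>} \<times> carrier k"
  "ideal_pow D ({\<zero>} \<times> carrier k) (Suc (Suc i)) = {\<zero>\<^bsub>D\<^esub>}"
proof -
  let ?m = "{\<zero>} \<times> carrier k"
  show 1: "ideal_pow D ?m (Suc 0) = ?m" by (rule D.ideal_pow_1[OF dual_kernel_ideal])
  have "x = \<zero>\<^bsub>D\<^esub>" if "x \<in> ideal_prod D ?m ?m" for x
    using that by induction (auto simp: dual_simps)
  hence "ideal_pow D ?m (Suc (Suc 0)) \<subseteq> {\<zero>\<^bsub>D\<^esub>}"
    using 1 by auto
  moreover have "ideal_pow D ?m (Suc (Suc i)) \<subseteq> ideal_pow D ?m (Suc (Suc 0))"
    by (rule D.ideal_pow_antimono[OF dual_kernel_ideal]) simp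
  moreover have "\<zero>\<^bsub>D\<^esub> \<in> ideal_pow D ?m (Suc (Suc i))"
    by (rule D.ideal_simps(1)[OF D.ideal_pow_ideal[OF dual_kernel_ideal]])
  ultimately show "ideal_pow D ?m (Suc (Suc i)) = {\<zero>\<^bsub>D\<^esub>}" by blast
qed

lemma dual_coef: "coef_obj k W D" "max_ideal D = {\<zero>} \<times> carrier k"
proof -
  let ?m = "{\<zero>} \<times> carrier k"
  have compl: "complete_filtration D (ideal_pow D ?m)"
  proof (rule D.complete_filtrationI)
    show "ideal (ideal_pow D ?m i) D" for i by (rule D.ideal_pow_ideal[OF dual_kernel_ideal])
    show "ideal_pow D ?m (Suc i) \<subseteq> ideal_pow D ?m i" for i by (rule D.ideal_pow_Suc_subset[OF dual_kernel_ideal])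
    show "a = \<zero>\<^bsub>D\<^esub>" if a: "\<And>i. a \<in> ideal_pow D ?m i" for a
      using a[of "Suc (Suc 0)"] unfolding dual_pow(2) by blast
    show "\<exists>a\<in>carrier D. \<forall>i. a \<ominus>\<^bsub>D\<^esub> s i \<in> ideal_pow D ?m i"
      if s: "\<And>i. s i \<in> carrier D" "\<And>i. s (Suc i) \<ominus>\<^bsub>D\<^esub> s i \<in> ideal_pow D ?m i" for s
    proof (intro bexI allI)
      let ?a = "s (Suc (Suc 0))"
      show "?a \<in> carrier D" by (rule s)
      have st: "s (Suc (Suc i)) = ?a" for i
      proof (induction i)
        case (Suc i)
        have "s (Suc (Suc (Suc i))) \<ominus>\<^bsub>D\<^esub> s (Suc (Suc i)) = \<zero>\<^bsub>D\<^esub>"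
          using s(2)[of "Suc (Suc i)"] unfolding dual_pow(2) by blast
        hence "s (Suc (Suc (Suc i))) = s (Suc (Suc i))" using s(1) D.r_right_minus_eq by blast
        thus ?case using Suc by simp
      qed simp
      fix i show "?a \<ominus>\<^bsub>D\<^esub> s i \<in> ideal_pow D ?m i"
      proof (cases i)
        case 0
        thus ?thesis using s(1)[of 0] s(1)[of "Suc (Suc 0)"] by simp
      next
        case (Suc i')
        show ?thesis
        proof (cases i')
          case 0
          thus ?thesis using s(2)[of "Suc 0"] Suc by simp
        next
          case (Suc i'')
          thus ?thesis using \<open>i = Suc i'\<close> st[of i''] dual_pow(2)[of i''] s(1)[of "Suc (Suc 0)"] by (simp del: ideal_pow.simps)
        qed
      qed
    qed
  qed
  have gen: "?m = Idl\<^bsub>D\<^esub> {(\<zero>, \<one>)}"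
  proof
    have e: "(\<zero>, \<one>) \<in> carrier D" by (simp add: dual_simps)
    show "?m \<subseteq> Idl\<^bsub>D\<^esub> {(\<zero>, \<one>)}"
    proof
      fix x assume "x \<in> ?m"
      then obtain b where b: "b \<in> carrier k" "x = (b, \<zero>) \<otimes>\<^bsub>D\<^esub> (\<zero>, \<one>)" by (auto simp: dual_simps)
      show "x \<in> Idl\<^bsub>D\<^esub> {(\<zero>, \<one>)}"
        unfolding b(2) using b(1)
        by (intro D.ideal_simps(7)[OF D.genideal_ideal] D.genideal_self') (auto simp: dual_simps)
    qed
    show "Idl\<^bsub>D\<^esub> {(\<zero>, \<one>)} \<subseteq> ?m" by (rule D.genideal_minimal[OF dual_kernel_ideal]) simp
  qed
  note * = cln_intro[OF dual_residual, unfolded dual_kernel, OF compl gen]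
  have "{(\<zero>, \<one>)} \<subseteq> carrier D" by (simp add: dual_simps)
  from *[OF this] show "max_ideal D = ?m" by simp
  have "complete_local_noetherian k D" using *[OF \<open>{(\<zero>, \<one>)} \<subseteq> carrier D\<close>] by simp
  moreover have "residue W \<in> ring_hom W k" using W by (simp add: complete_local_noetherian_def)
  hence "scalar D \<in> ring_hom W D"
    by (intro ring_hom_memI) (auto simp: dual_simps ring_hom_closed ring_hom_mult ring_hom_add ring_hom_one)
  ultimately show "coef_obj k W D" by (simp add: coef_obj_def dual_simps)
qed

lemma dual_finsum:
  assumes "f \<in> F \<rightarrow> carrier D" "finite F"
  shows "fst (finsum D f F) = finsum k (\<lambda>x. fst (f x)) F" "snd (finsum D f F) = finsum k (\<lambda>x. snd (f x)) F"
proof -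
  have "finsum D f F = (finsum k (\<lambda>x. fst (f x)) F, finsum k (\<lambda>x. snd (f x)) F)"
    using assms(2,1)
  proof (induction F rule: finite_induct)
    case (insert x F)
    obtain a b where ab: "f x = (a, b)" "a \<in> carrier k" "b \<in> carrier k" using insert.prems by (cases "f x") (auto simp: dual_simps)
    have c: "(\<lambda>x. fst (f x)) \<in> F \<rightarrow> carrier k" "(\<lambda>x. snd (f x)) \<in> F \<rightarrow> carrier k"
      using insert.prems by (auto simp: dual_simps Pi_iff mem_Times_iff)
    have "finsum D f (insert x F) = f x \<oplus>\<^bsub>D\<^esub> finsum D f F"
      using insert.hyps insert.prems by (intro D.finsum_insert) auto
    thus ?case using insert ab c by (simp add: dual_simps k.finsum_insert)
  qed (simp add: dual_simps)
  thus "fst (finsum D f F) = finsum k (\<lambda>x. fst (f x)) F" "snd (finsum D f F) = finsum k (\<lambda>x. snd (f x)) F" by simp_all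
qed

lemma dual_mat_mult:
  assumes "M \<in> carrier (mat_monoid n D)" "N \<in> carrier (mat_monoid n D)" "a < n" "b < n"
  shows "fst ((M \<otimes>\<^bsub>mat_monoid n D\<^esub> N) (a, b)) = (\<Oplus>l\<in>{..<n}. fst (M (a, l)) \<otimes> fst (N (l, b)))"
    "snd ((M \<otimes>\<^bsub>mat_monoid n D\<^esub> N) (a, b)) =
      (\<Oplus>l\<in>{..<n}. fst (M (a, l)) \<otimes> snd (N (l, b))) \<oplus> (\<Oplus>l\<in>{..<n}. snd (M (a, l)) \<otimes> fst (N (l, b)))"
proof -
  have c: "fst (M (i, j)) \<in> carrier k" "snd (M (i, j)) \<in> carrier k" "fst (N (i, j)) \<in> carrier k" "snd (N (i, j)) \<in> carrier k"
    if "i < n" "j < n" for i j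
    using D.mat_entry_closed[OF assms(1) that] D.mat_entry_closed[OF assms(2) that] by (auto simp: dual_simps mem_Times_iff)
  have cl: "(\<lambda>l. M (a, l) \<otimes>\<^bsub>D\<^esub> N (l, b)) \<in> {..<n} \<rightarrow> carrier D"
    using D.mat_entry_closed[OF assms(1)] D.mat_entry_closed[OF assms(2)] assms(3,4) by auto
  have m: "fst (x \<otimes>\<^bsub>D\<^esub> y) = fst x \<otimes> fst y" "snd (x \<otimes>\<^bsub>D\<^esub> y) = fst x \<otimes> snd y \<oplus> snd x \<otimes> fst y" for x y
    by (cases x; cases y; simp add: dual_simps)+
  show "fst ((M \<otimes>\<^bsub>mat_monoid n D\<^esub> N) (a, b)) = (\<Oplus>l\<in>{..<n}. fst (M (a, l)) \<otimes> fst (N (l, b)))"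
    unfolding mat_mult_entry[OF assms(3,4)] dual_finsum(1)[OF cl finite_lessThan] m ..
  show "snd ((M \<otimes>\<^bsub>mat_monoid n D\<^esub> N) (a, b)) =
      (\<Oplus>l\<in>{..<n}. fst (M (a, l)) \<otimes> snd (N (l, b))) \<oplus> (\<Oplus>l\<in>{..<n}. snd (M (a, l)) \<otimes> fst (N (l, b)))"
    unfolding mat_mult_entry[OF assms(3,4)] dual_finsum(2)[OF cl finite_lessThan] m
    using c assms(3,4) by (intro k.finsum_addf) auto
qed

lemma id_sum:
  fixes n :: nat
  assumes "b < n" "\<And>l. l < n ==> f l \<in> carrier k" "\<And>l. l < n ==> d l = (if l = b then \<one> else \<zero>)"
  shows "(\<Oplus>l\<in>{..<n}. d l \<otimes> f l) = f b" "(\<Oplus>l\<in>{..<n}. f l \<otimes> d l) = f b"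
proof -
  have "(\<Oplus>l\<in>{..<n}. d l \<otimes> f l) = (\<Oplus>l\<in>{..<n}. if b = l then f l else \<zero>)"
    "(\<Oplus>l\<in>{..<n}. f l \<otimes> d l) = (\<Oplus>l\<in>{..<n}. if b = l then f l else \<zero>)"
    using assms by (auto intro!: k.finsum_cong')
  thus "(\<Oplus>l\<in>{..<n}. d l \<otimes> f l) = f b" "(\<Oplus>l\<in>{..<n}. f l \<otimes> d l) = f b"
    using assms k.finsum_singleton[of b "{..<n}" f] by simp_all
qed

text \<open>Multiplication by \<open>M = 1 + \<epsilon>V\<close>, where \<open>V\<close> consists of the second components of \<open>M\<close>.\<close>

lemma dual_unipotent_mult:
  assumes M: "M \<in> carrier (mat_monoid n D)" "\<And>a b. a < n ==> b < n ==> fst (M (a, b)) = (if a = b then \<one> else \<zero>)"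
    and N: "N \<in> carrier (mat_monoid n D)" "\<And>a b. a < n ==> b < n ==> fst (N (a, b)) = r (a, b)"
    and ab: "a < n" "b < n"
  shows "(N \<otimes>\<^bsub>mat_monoid n D\<^esub> M) (a, b) = (r (a, b), (\<Oplus>l\<in>{..<n}. r (a, l) \<otimes> snd (M (l, b))) \<oplus> snd (N (a, b)))"
    "(M \<otimes>\<^bsub>mat_monoid n D\<^esub> N) (a, b) = (r (a, b), snd (N (a, b)) \<oplus> (\<Oplus>l\<in>{..<n}. snd (M (a, l)) \<otimes> r (l, b)))"
proof -
  have c: "fst (N (i, j)) \<in> carrier k" "snd (N (i, j)) \<in> carrier k" "snd (M (i, j)) \<in> carrier k"
    if "i < n" "j < n" for i j
    using D.mat_entry_closed[OF M(1) that] D.mat_entry_closed[OF N(1) that] by (auto simp: dual_simps mem_Times_iff)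
  have rc: "r (i, j) \<in> carrier k" if "i < n" "j < n" for i j using c(1)[OF that] N(2)[OF that] by simp
  have id: "(\<Oplus>l\<in>{..<n}. fst (N (a, l)) \<otimes> fst (M (l, b))) = fst (N (a, b))"
    "(\<Oplus>l\<in>{..<n}. snd (N (a, l)) \<otimes> fst (M (l, b))) = snd (N (a, b))"
    "(\<Oplus>l\<in>{..<n}. fst (M (a, l)) \<otimes> fst (N (l, b))) = fst (N (a, b))"
    "(\<Oplus>l\<in>{..<n}. fst (M (a, l)) \<otimes> snd (N (l, b))) = snd (N (a, b))"
    using ab c by (auto intro!: id_sum(2)[where f = "\<lambda>l. fst (N (a, l))"] id_sum(2)[where f = "\<lambda>l. snd (N (a, l))"]
        id_sum(1)[where f = "\<lambda>l. fst (N (l, b))"] id_sum(1)[where f = "\<lambda>l. snd (N (l, b))"] simp: M(2))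
  have r: "(\<Oplus>l\<in>{..<n}. fst (N (a, l)) \<otimes> snd (M (l, b))) = (\<Oplus>l\<in>{..<n}. r (a, l) \<otimes> snd (M (l, b)))"
    "(\<Oplus>l\<in>{..<n}. snd (M (a, l)) \<otimes> fst (N (l, b))) = (\<Oplus>l\<in>{..<n}. snd (M (a, l)) \<otimes> r (l, b))"
    using ab c rc by (auto intro!: k.finsum_cong' simp: N(2))
  show "(N \<otimes>\<^bsub>mat_monoid n D\<^esub> M) (a, b) = (r (a, b), (\<Oplus>l\<in>{..<n}. r (a, l) \<otimes> snd (M (l, b))) \<oplus> snd (N (a, b)))"
    by (rule prod_eqI) (simp_all only: dual_mat_mult[OF N(1) M(1) ab] id r N(2)[OF ab] fst_conv snd_conv)
  show "(M \<otimes>\<^bsub>mat_monoid n D\<^esub> N) (a, b) = (r (a, b), snd (N (a, b)) \<oplus> (\<Oplus>l\<in>{..<n}. snd (M (a, l)) \<otimes> r (l, b)))"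
    by (rule prod_eqI) (simp_all only: dual_mat_mult[OF M(1) N(1) ab] id r N(2)[OF ab] fst_conv snd_conv)
qed

text \<open>A matrix with trivial residue is \<open>1 + \<epsilon>V\<close>, and conjugation by it changes the \<open>\<epsilon>\<close>-part of a matrix by
  the commutator of \<open>V\<close> with the residue.\<close>

theorem dual_strictly_equivalent_iff:
  assumes \<tau>: "\<And>g. g \<in> carrier \<Gamma> ==> \<tau> g \<in> carrier (GL n D)" and \<sigma>: "\<And>g. g \<in> carrier \<Gamma> ==> \<sigma> g \<in> carrier (GL n D)"
    and fst: "\<And>g a b. g \<in> carrier \<Gamma> ==> a < n ==> b < n ==> fst (\<tau> g (a, b)) = \<rho> g (a, b)"
      "\<And>g a b. g \<in> carrier \<Gamma> ==> a < n ==> b < n ==> fst (\<sigma> g (a, b)) = \<rho> g (a, b)"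
  shows "strictly_equivalent k \<Gamma> n D \<tau> \<sigma> \<longleftrightarrow>
    (\<exists>V\<in>{..<n} \<times> {..<n} \<rightarrow> carrier k. \<forall>g\<in>carrier \<Gamma>. \<forall>a<n. \<forall>b<n.
       snd (\<sigma> g (a, b)) \<oplus> (\<Oplus>l\<in>{..<n}. \<rho> g (a, l) \<otimes> V (l, b)) =
       snd (\<tau> g (a, b)) \<oplus> (\<Oplus>l\<in>{..<n}. V (a, l) \<otimes> \<rho> g (l, b)))" (is "_ \<longleftrightarrow> (\<exists>V\<in>?S. \<forall>g\<in>_. \<forall>a<n. \<forall>b<n. ?C V g a b)")
proof -
  interpret G: group "GL n D" by (rule D.GL_group)
  have mat: "M \<in> carrier (mat_monoid n D)" if "M \<in> carrier (GL n D)" for M using that D.GL_carrier_iff by blast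
  have comp: "fst (M (a, b)) \<in> carrier k" "snd (M (a, b)) \<in> carrier k" if "M \<in> carrier (mat_monoid n D)" "a < n" "b < n" for M a b
    using D.mat_entry_closed[OF that] by (auto simp: dual_simps mem_Times_iff)
  have \<rho>: "\<rho> g (a, b) \<in> carrier k" if "g \<in> carrier \<Gamma>" "a < n" "b < n" for g a b
    using comp(1)[OF mat[OF \<tau>[OF that(1)]] that(2,3)] fst(1)[OF that] by simp
  have key: "\<sigma> g \<otimes>\<^bsub>GL n D\<^esub> M = M \<otimes>\<^bsub>GL n D\<^esub> \<tau> g \<longleftrightarrow> (\<forall>a<n. \<forall>b<n. ?C (\<lambda>p. snd (M p)) g a b)"
    if M: "M \<in> carrier (mat_monoid n D)" and M1: "\<And>a b. a < n ==> b < n ==> fst (M (a, b)) = (if a = b then \<one> else \<zero>)"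
      and g: "g \<in> carrier \<Gamma>" for M g
  proof -
    note s = mat[OF \<sigma>[OF g]] note t = mat[OF \<tau>[OF g]]
    note l = dual_unipotent_mult(1)[OF M M1 s fst(2)[OF g]] note r = dual_unipotent_mult(2)[OF M M1 t fst(1)[OF g]]
    have sumc: "(\<Oplus>l\<in>{..<n}. \<rho> g (a, l) \<otimes> snd (M (l, b))) \<in> carrier k" if "a < n" "b < n" for a b
      using that \<rho> g comp(2)[OF M] by (intro k.finsum_closed) auto
    have "\<sigma> g \<otimes>\<^bsub>GL n D\<^esub> M = M \<otimes>\<^bsub>GL n D\<^esub> \<tau> g \<longleftrightarrow>
       (\<forall>a<n. \<forall>b<n. (\<sigma> g \<otimes>\<^bsub>mat_monoid n D\<^esub> M) (a, b) = (M \<otimes>\<^bsub>mat_monoid n D\<^esub> \<tau> g) (a, b))"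
      unfolding GL_mult using mat_eqI[OF mat_mult_ext mat_mult_ext] by metis
    also have "\<dots> \<longleftrightarrow> (\<forall>a<n. \<forall>b<n. ?C (\<lambda>p. snd (M p)) g a b)"
      using l r sumc comp(2)[OF s] by (simp add: k.a_comm)
    finally show ?thesis .
  qed
  have conj: "(s = M \<otimes>\<^bsub>GL n D\<^esub> t \<otimes>\<^bsub>GL n D\<^esub> inv\<^bsub>GL n D\<^esub> M) \<longleftrightarrow> s \<otimes>\<^bsub>GL n D\<^esub> M = M \<otimes>\<^bsub>GL n D\<^esub> t"
    if "s \<in> carrier (GL n D)" "t \<in> carrier (GL n D)" "M \<in> carrier (GL n D)" for s t M
    using that G.inv_solve_right[of s "M \<otimes>\<^bsub>GL n D\<^esub> t" M] by auto
  show ?thesis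
  proof
    assume "strictly_equivalent k \<Gamma> n D \<tau> \<sigma>"
    then obtain M where M: "M \<in> carrier (GL n D)" "GL_map n (residue D) M = \<one>\<^bsub>GL n k\<^esub>"
      "\<And>g. g \<in> carrier \<Gamma> ==> \<sigma> g = M \<otimes>\<^bsub>GL n D\<^esub> \<tau> g \<otimes>\<^bsub>GL n D\<^esub> inv\<^bsub>GL n D\<^esub> M"
      unfolding strictly_equivalent_def by blast
    have M1: "fst (M (a, b)) = (if a = b then \<one> else \<zero>)" if "a < n" "b < n" for a b
      using fun_cong[OF M(2), of "(a, b)"] that by (simp add: GL_map_entry GL_one_entry dual_simps)
    show "\<exists>V\<in>?S. \<forall>g\<in>carrier \<Gamma>. \<forall>a<n. \<forall>b<n. ?C V g a b"
    proof (intro bexI[of _ "\<lambda>p. snd (M p)"] ballI)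
      show "(\<lambda>p. snd (M p)) \<in> {..<n} \<times> {..<n} \<rightarrow> carrier k" using comp(2)[OF mat[OF M(1)]] by auto
      fix g assume g: "g \<in> carrier \<Gamma>"
      have "\<sigma> g \<otimes>\<^bsub>GL n D\<^esub> M = M \<otimes>\<^bsub>GL n D\<^esub> \<tau> g" using conj[OF \<sigma>[OF g] \<tau>[OF g] M(1)] M(3)[OF g] by blast
      thus "\<forall>a<n. \<forall>b<n. ?C (\<lambda>p. snd (M p)) g a b"
        using key[OF mat[OF M(1)] M1 g] by blast
    qed
  next
    assume "\<exists>V\<in>?S. \<forall>g\<in>carrier \<Gamma>. \<forall>a<n. \<forall>b<n. ?C V g a b"
    then obtain V where V: "V \<in> {..<n} \<times> {..<n} \<rightarrow> carrier k" "\<And>g. g \<in> carrier \<Gamma> ==> \<forall>a<n. \<forall>b<n. ?C V g a b" by blast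
    have Vc: "V (a, b) \<in> carrier k" if "a < n" "b < n" for a b using V(1) that by auto
    define E where "E Y = (\<lambda>(a, b)\<in>{..<n} \<times> {..<n}. (if a = b then \<one> else \<zero>, Y (a, b)))" for Y :: "nat \<times> nat \<Rightarrow> 'k"
    have E: "E Y (a, b) = (if a = b then \<one> else \<zero>, Y (a, b))" if "a < n" "b < n" for Y a b using that by (simp add: E_def)
    have Ec: "E Y \<in> carrier (mat_monoid n D)" if "\<And>a b. a < n ==> b < n ==> Y (a, b) \<in> carrier k" for Y
      unfolding mat_carrier using that by (auto simp: E_def dual_simps)
    have Emul: "E Y \<otimes>\<^bsub>mat_monoid n D\<^esub> E Z = \<one>\<^bsub>mat_monoid n D\<^esub>"
      if "\<And>a b. a < n ==> b < n ==> Y (a, b) \<in> carrier k" "\<And>a b. a < n ==> b < n ==> Z (a, b) \<in> carrier k"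
        "\<And>a b. a < n ==> b < n ==> Z (a, b) \<oplus> Y (a, b) = \<zero>" for Y Z
    proof (rule mat_eqI[OF mat_mult_ext mat_one_ext])
      fix a b assume ab: "a < n" "b < n"
      have "(E Y \<otimes>\<^bsub>mat_monoid n D\<^esub> E Z) (a, b) = (if a = b then \<one> else \<zero>,
          (\<Oplus>l\<in>{..<n}. (if a = l then \<one> else \<zero>) \<otimes> snd (E Z (l, b))) \<oplus> snd (E Y (a, b)))"
        using dual_unipotent_mult(1)[of "E Z" n "E Y" "\<lambda>p. if fst p = snd p then \<one> else \<zero>" a b,
          OF Ec[of Z, OF that(2)] _ Ec[of Y, OF that(1)] _ ab] E by simp
      also have "(\<Oplus>l\<in>{..<n}. (if a = l then \<one> else \<zero>) \<otimes> snd (E Z (l, b))) = snd (E Z (a, b))"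
        using ab that(2) by (intro id_sum(1)[OF ab(1)]) (auto simp: E)
      finally show "(E Y \<otimes>\<^bsub>mat_monoid n D\<^esub> E Z) (a, b) = \<one>\<^bsub>mat_monoid n D\<^esub> (a, b)"
        using ab that(3)[OF ab] by (simp add: E mat_one_entry dual_simps)
    qed
    let ?Y = "\<lambda>p. \<ominus> V p"
    have Yc: "?Y (a, b) \<in> carrier k" if "a < n" "b < n" for a b using Vc that by simp
    have M: "E V \<in> carrier (GL n D)"
      unfolding D.GL_carrier_iff
    proof (intro conjI bexI[of _ "E ?Y"])
      show "E V \<in> carrier (mat_monoid n D)" by (rule Ec) (rule Vc)
      show "E ?Y \<in> carrier (mat_monoid n D)" by (rule Ec) (rule Yc)
      show "E ?Y \<otimes>\<^bsub>mat_monoid n D\<^esub> E V = \<one>\<^bsub>mat_monoid n D\<^esub>" using Vc by (intro Emul) (auto simp: k.r_neg)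
      show "E V \<otimes>\<^bsub>mat_monoid n D\<^esub> E ?Y = \<one>\<^bsub>mat_monoid n D\<^esub>" using Vc by (intro Emul) (auto simp: k.l_neg)
    qed
    have M1: "fst (E V (a, b)) = (if a = b then \<one> else \<zero>)" if "a < n" "b < n" for a b using E that by simp
    have "GL_map n (residue D) (E V) = \<one>\<^bsub>GL n k\<^esub>"
      unfolding GL_one by (rule mat_eqI[OF GL_map_ext mat_one_ext]) (simp add: GL_map_entry mat_one_entry dual_simps M1)
    moreover have "\<sigma> g = E V \<otimes>\<^bsub>GL n D\<^esub> \<tau> g \<otimes>\<^bsub>GL n D\<^esub> inv\<^bsub>GL n D\<^esub> (E V)" if g: "g \<in> carrier \<Gamma>" for g
    proof -
      have 1: "(\<Oplus>l\<in>{..<n}. \<rho> g (a, l) \<otimes> snd (E V (l, b))) = (\<Oplus>l\<in>{..<n}. \<rho> g (a, l) \<otimes> V (l, b))"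
        "(\<Oplus>l\<in>{..<n}. snd (E V (a, l)) \<otimes> \<rho> g (l, b)) = (\<Oplus>l\<in>{..<n}. V (a, l) \<otimes> \<rho> g (l, b))" if "a < n" "b < n" for a b
        using that \<rho>[OF g] Vc by (auto simp: E intro!: k.finsum_cong')
      show ?thesis
        unfolding conj[OF \<sigma>[OF g] \<tau>[OF g] M]
        by (subst key[OF mat[OF M] _ g]) (use M1 V(2)[OF g] 1 in auto)
    qed
    ultimately show "strictly_equivalent k \<Gamma> n D \<tau> \<sigma>" unfolding strictly_equivalent_def using M by blast
  qed
qed

end

section \<open>Coefficient morphisms\<close>

lemma residue_compatible_imp_local:
  assumes k: "field k" "field k'" and A: "complete_local_noetherian k A" and B: "complete_local_noetherian k' B"
    and \<iota>: "\<iota> \<in> ring_hom k k'" and h: "h \<in> ring_hom A B"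
    and res: "\<And>a. a \<in> carrier A ==> residue B (h a) = \<iota> (residue A a)"
  shows "h ` max_ideal A \<subseteq> max_ideal B"
proof
  interpret k: field k by (rule k)
  interpret k': field k' by (rule k)
  have i0: "\<iota> \<zero>\<^bsub>k\<^esub> = \<zero>\<^bsub>k'\<^esub>" by (rule ring_hom_zero[OF \<iota> k.ring_axioms k'.ring_axioms])
  fix b assume "b \<in> h ` max_ideal A"
  then obtain a where a: "a \<in> max_ideal A" "b = h a" by blast
  hence "a \<in> carrier A" "residue A a = \<zero>\<^bsub>k\<^esub>"
    unfolding cln_elim(2)[OF k(1) A] a_kernel_mem by auto
  thus "b \<in> max_ideal B"
    unfolding cln_elim(2)[OF k(2) B] a_kernel_mem a(2)
    using res ring_hom_closed[OF h] i0 by simp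
qed

lemma topspace_adic:
  assumes "cring A" "ideal I A"
  shows "topspace (adic_topology A I) = carrier A"
proof -
  interpret A: cring A by fact
  note P = A.ideal_pow_ideal[OF assms(2)]
  have "a \<in> \<Union>{ideal_pow A I i +>\<^bsub>A\<^esub> a | i a. a \<in> carrier A}" if a: "a \<in> carrier A" for a
  proof -
    have "a \<in> ideal_pow A I 0 +>\<^bsub>A\<^esub> a"
      using A.mem_coset_iff[OF P a, of a 0] A.minus_self[OF a] A.ideal_simps(1)[OF P, of 0] a by metis
    thus ?thesis using a by blast
  qed
  moreover have "a \<in> carrier A" if "a \<in> \<Union>{ideal_pow A I i +>\<^bsub>A\<^esub> a | i a. a \<in> carrier A}" for a
    using that A.mem_coset_iff[OF P] by blast
  ultimately show ?thesis unfolding adic_topology_def topology_generated_by_topspace by blast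
qed

text \<open>A homomorphism that is compatible with the residue maps is local, hence continuous.\<close>

lemma coef_hom_iff:
  assumes k: "field k" and A: "coef_obj k W A" and B: "coef_obj k W B"
  shows "\<alpha> \<in> coef_hom W A B \<longleftrightarrow> \<alpha> \<in> extensional (carrier A) \<and> \<alpha> \<in> ring_hom A B \<and>
    (\<forall>w\<in>carrier W. \<alpha> (scalar A w) = scalar B w) \<and> (\<forall>a\<in>carrier A. residue B (\<alpha> a) = residue A a)"
proof -
  have A': "complete_local_noetherian k A" and B': "complete_local_noetherian k B"
    using A B by (auto simp: coef_obj_def)
  note eA = cln_elim[OF k A'] note eB = cln_elim[OF k B']
  interpret A: cring A by (rule eA(5))
  interpret B: cring B by (rule eB(5))
  have "continuous_map (adic_topology A (max_ideal A)) (adic_topology B (max_ideal B)) \<alpha>"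
    if h: "\<alpha> \<in> ring_hom A B" and res: "\<forall>a\<in>carrier A. residue B (\<alpha> a) = residue A a"
  proof -
    have loc: "\<alpha> ` max_ideal A \<subseteq> max_ideal B"
      using res by (intro residue_compatible_imp_local[OF k k A' B' _ h, of "\<lambda>x. x"]) (auto simp: ring_hom_def)
    note P = A.ideal_pow_ideal[OF eA(6)]
    show ?thesis unfolding B.continuous_map_adic_iff[OF eB(6)] topspace_adic[OF eA(5,6)]
    proof (intro conjI ballI allI)
      show "\<alpha> x \<in> carrier B" if "x \<in> carrier A" for x using ring_hom_closed[OF h that] .
      fix i x assume x: "x \<in> carrier A"
      let ?U = "mpow A i +>\<^bsub>A\<^esub> x"
      have "openin (adic_topology A (max_ideal A)) ?U"
        unfolding adic_topology_def using x by (intro topology_generated_by_Basis) blast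
      moreover have "x \<in> ?U" using A.mem_coset_iff[OF P x, of x] A.minus_self[OF x] A.ideal_simps(1)[OF P] x by metis
      moreover have "\<alpha> y \<ominus>\<^bsub>B\<^esub> \<alpha> x \<in> mpow B i" if "y \<in> ?U" for y
      proof -
        have y: "y \<in> carrier A" "y \<ominus>\<^bsub>A\<^esub> x \<in> mpow A i" using that A.mem_coset_iff[OF P x] by blast+
        have "\<alpha> (y \<ominus>\<^bsub>A\<^esub> x) \<in> mpow B i"
          using y(2) ideal_pow_image[OF eA(5) eB(5) h eA(6) eB(6) loc, of i] by blast
        thus ?thesis using ring_hom_minus[OF eA(5) eB(5) h y(1) x] by simp
      qed
      ultimately show "\<exists>U. openin (adic_topology A (max_ideal A)) U \<and> x \<in> U \<and>
          (\<forall>y\<in>U. \<alpha> y \<ominus>\<^bsub>B\<^esub> \<alpha> x \<in> mpow B i)" by blast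
    qed
  qed
  thus ?thesis unfolding coef_hom_def by blast
qed

lemma lifts_cong_rho:
  "(\<And>g. g \<in> carrier \<Gamma> ==> \<rho> g = \<rho>' g) ==> lifts \<Gamma> T n \<rho> A = lifts \<Gamma> T n \<rho>' A"
  unfolding lifts_def by auto

lemma strictly_equivalent_cong:
  assumes "\<And>g. g \<in> carrier \<Gamma> ==> \<tau> g = \<tau>' g" "\<And>g. g \<in> carrier \<Gamma> ==> \<sigma> g = \<sigma>' g"
  shows "strictly_equivalent k \<Gamma> n A \<tau> \<sigma> \<longleftrightarrow> strictly_equivalent k \<Gamma> n A \<tau>' \<sigma>'"
  unfolding strictly_equivalent_def using assms by auto

text \<open>The entries of the inverse of \<open>\<tau> g\<close> are entries of \<open>\<tau>\<close> at the inverse of \<open>g\<close>, so they lie in \<open>A\<close> as well.\<close>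

lemma hom_descend:
  assumes \<Gamma>: "group \<Gamma>" and A: "cring A" and B: "cring B" and h: "h \<in> ring_hom A B" "inj_on h (carrier A)"
    and \<tau>: "\<tau> \<in> hom \<Gamma> (GL n B)"
    and ent: "\<And>g a b. g \<in> carrier \<Gamma> ==> a < n ==> b < n ==> \<tau> g (a, b) \<in> h ` carrier A"
  shows "\<exists>\<sigma>\<in>hom \<Gamma> (GL n A). \<forall>g\<in>carrier \<Gamma>. GL_map n h (\<sigma> g) = \<tau> g"
proof -
  interpret \<Gamma>: group \<Gamma> by (rule \<Gamma>)
  interpret A: cring A by (rule A)
  interpret B: cring B by (rule B)
  interpret GB: group "GL n B" by (rule B.GL_group)
  interpret \<tau>: group_hom \<Gamma> "GL n B" \<tau> using \<tau> by (simp add: group_hom_def group_hom_axioms_def \<Gamma>.is_group GB.is_group)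
  define \<sigma> where "\<sigma> g = GL_map n (inv_into (carrier A) h) (\<tau> g)" for g
  have \<sigma>m: "\<sigma> g \<in> carrier (mat_monoid n A)" if "g \<in> carrier \<Gamma>" for g
    using ent[OF that] by (auto simp: mat_carrier PiE_iff \<sigma>_def GL_map_entry GL_map_ext inv_into_into)
  have h\<sigma>: "GL_map n h (\<sigma> g) = \<tau> g" if g: "g \<in> carrier \<Gamma>" for g
  proof (rule mat_eqI[OF GL_map_ext B.GL_ext[OF \<tau>.hom_closed[OF g]]])
    fix a b assume "a < n" "b < n"
    thus "GL_map n h (\<sigma> g) (a, b) = \<tau> g (a, b)"
      using f_inv_into_f[OF ent[OF g]] by (simp add: \<sigma>_def GL_map_entry)
  qed
  have "\<sigma> \<in> hom \<Gamma> (GL n A)"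
  proof (rule homI)
    fix g assume g: "g \<in> carrier \<Gamma>"
    have ig: "inv\<^bsub>\<Gamma>\<^esub> g \<in> carrier \<Gamma>" using g by simp
    have "\<tau> g \<otimes>\<^bsub>GL n B\<^esub> \<tau> (inv\<^bsub>\<Gamma>\<^esub> g) = \<one>\<^bsub>GL n B\<^esub>" "\<tau> (inv\<^bsub>\<Gamma>\<^esub> g) \<otimes>\<^bsub>GL n B\<^esub> \<tau> g = \<one>\<^bsub>GL n B\<^esub>"
      using \<tau>.hom_mult[OF g ig] \<tau>.hom_mult[OF ig g] g by simp_all
    thus "\<sigma> g \<in> carrier (GL n A)"
      using g ig by (intro GL_transfer[OF A B h \<sigma>m \<sigma>m, of g "inv\<^bsub>\<Gamma>\<^esub> g"]) (simp_all add: h\<sigma> GL_mult GL_one)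
    fix g' assume g': "g' \<in> carrier \<Gamma>"
    show "\<sigma> (g \<otimes>\<^bsub>\<Gamma>\<^esub> g') = \<sigma> g \<otimes>\<^bsub>GL n A\<^esub> \<sigma> g'"
      unfolding GL_mult
    proof (rule GL_map_inj[OF A h(2)])
      show "\<sigma> (g \<otimes>\<^bsub>\<Gamma>\<^esub> g') \<in> carrier (mat_monoid n A)" using \<sigma>m g g' by simp
      show "\<sigma> g \<otimes>\<^bsub>mat_monoid n A\<^esub> \<sigma> g' \<in> carrier (mat_monoid n A)" using \<sigma>m g g' A.mat_mult_closed by blast
      show "GL_map n h (\<sigma> (g \<otimes>\<^bsub>\<Gamma>\<^esub> g')) = GL_map n h (\<sigma> g \<otimes>\<^bsub>mat_monoid n A\<^esub> \<sigma> g')"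
        unfolding GL_map_mult[OF A B h(1) \<sigma>m[OF g] \<sigma>m[OF g']] h\<sigma>[OF g] h\<sigma>[OF g']
        using h\<sigma>[of "g \<otimes>\<^bsub>\<Gamma>\<^esub> g'"] \<tau>.hom_mult[OF g g'] g g' by (simp add: GL_mult)
    qed
  qed
  thus ?thesis using h\<sigma> by blast
qed

section \<open>The lifts over the dual numbers are detected on finitely many entries\<close>

lemma (in cring) finsum_cartesian:
  assumes "finite U" "finite V" "\<And>a b. a \<in> U ==> b \<in> V ==> f (a, b) \<in> carrier R"
  shows "(\<Oplus>p\<in>U \<times> V. f p) = (\<Oplus>a\<in>U. \<Oplus>b\<in>V. f (a, b))"
  using assms(1,3)
proof (induction U rule: finite_induct)
  case (insert a U)
  have e: "insert a U \<times> V = (Pair a ` V) \<union> U \<times> V" by auto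
  have "(\<Oplus>p\<in>insert a U \<times> V. f p) = (\<Oplus>p\<in>Pair a ` V. f p) \<oplus> (\<Oplus>p\<in>U \<times> V. f p)"
    unfolding e using insert.hyps insert.prems assms(2) by (intro finsum_Un_disjoint) auto
  also have "(\<Oplus>p\<in>Pair a ` V. f p) = (\<Oplus>b\<in>V. f (a, b))"
    using insert.prems by (subst finsum_reindex) (auto simp: inj_on_def)
  also have "(\<Oplus>p\<in>U \<times> V. f p) = (\<Oplus>a\<in>U. \<Oplus>b\<in>V. f (a, b))" using insert by auto
  also have "(\<Oplus>b\<in>V. f (a, b)) \<oplus> (\<Oplus>a\<in>U. \<Oplus>b\<in>V. f (a, b)) = (\<Oplus>a\<in>insert a U. \<Oplus>b\<in>V. f (a, b))"
    using insert.hyps insert.prems by (intro finsum_insert[symmetric]) (auto intro!: finsum_closed)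
  finally show ?case .
qed simp

lemma (in cring) finsum_uminus:
  assumes f: "\<And>x. x \<in> F ==> f x \<in> carrier R" and F: "finite F"
  shows "(\<Oplus>x\<in>F. \<ominus> f x) = \<ominus> (\<Oplus>x\<in>F. f x)"
proof -
  have "(\<Oplus>x\<in>F. \<ominus> f x) = (\<Oplus>x\<in>F. \<ominus> \<one> \<otimes> f x)" using f by (intro finsum_cong') (auto simp: l_minus)
  also have "\<dots> = \<ominus> \<one> \<otimes> (\<Oplus>x\<in>F. f x)" using f F by (intro finsum_rdistr[symmetric]) auto
  also have "\<dots> = \<ominus> (\<Oplus>x\<in>F. f x)" using finsum_closed[of f F] f by (simp add: l_minus Pi_iff)
  finally show ?thesis .
qed

text \<open>The entries of a commutator are linear in the entries of \<open>V\<close>, with coefficients that only depend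
  on \<open>r\<close>.\<close>

lemma (in cring) commutator_sum:
  fixes n :: nat
  assumes V: "\<And>a b. a < n ==> b < n ==> V (a, b) \<in> carrier R" and r: "\<And>a b. a < n ==> b < n ==> r (a, b) \<in> carrier R"
    and ab: "a < n" "b < n"
  shows "(\<Oplus>p\<in>{..<n} \<times> {..<n}. V p \<otimes> ((if fst p = a then r (snd p, b) else \<zero>) \<ominus> (if snd p = b then r (a, fst p) else \<zero>)))
    = (\<Oplus>l\<in>{..<n}. V (a, l) \<otimes> r (l, b)) \<ominus> (\<Oplus>l\<in>{..<n}. r (a, l) \<otimes> V (l, b))"
proof -
  let ?f = "\<lambda>p. V p \<otimes> (if fst p = a then r (snd p, b) else \<zero>)"
  let ?g = "\<lambda>p. V p \<otimes> (if snd p = b then r (a, fst p) else \<zero>)"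
  have fc: "?f (i, j) \<in> carrier R" "?g (i, j) \<in> carrier R" if "i < n" "j < n" for i j
    using V r ab that by auto
  have F: "(\<Oplus>p\<in>{..<n} \<times> {..<n}. ?f p) = (\<Oplus>l\<in>{..<n}. V (a, l) \<otimes> r (l, b))"
  proof -
    have "(\<Oplus>p\<in>{..<n} \<times> {..<n}. ?f p) = (\<Oplus>i\<in>{..<n}. \<Oplus>j\<in>{..<n}. ?f (i, j))"
      using fc by (intro finsum_cartesian) auto
    also have "\<dots> = (\<Oplus>i\<in>{..<n}. if a = i then (\<Oplus>j\<in>{..<n}. V (i, j) \<otimes> r (j, b)) else \<zero>)"
    proof (rule finsum_cong'[OF refl])
      show "(\<lambda>i. if a = i then (\<Oplus>j\<in>{..<n}. V (i, j) \<otimes> r (j, b)) else \<zero>) \<in> {..<n} \<rightarrow> carrier R"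
        using V r ab by (auto intro!: finsum_closed)
      fix i assume i: "i \<in> {..<n}"
      show "(\<Oplus>j\<in>{..<n}. ?f (i, j)) = (if a = i then (\<Oplus>j\<in>{..<n}. V (i, j) \<otimes> r (j, b)) else \<zero>)"
      proof (cases "a = i")
        case False
        have "(\<Oplus>j\<in>{..<n}. ?f (i, j)) = (\<Oplus>j\<in>{..<n}. \<zero>)" using False V i by (intro finsum_cong') auto
        thus ?thesis using False by simp
      qed simp
    qed
    also have "\<dots> = (\<Oplus>j\<in>{..<n}. V (a, j) \<otimes> r (j, b))"
      using V r ab by (intro finsum_singleton) (auto intro!: finsum_closed)
    finally show ?thesis .
  qed
  have G: "(\<Oplus>p\<in>{..<n} \<times> {..<n}. ?g p) = (\<Oplus>l\<in>{..<n}. r (a, l) \<otimes> V (l, b))"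
  proof -
    have "(\<Oplus>p\<in>{..<n} \<times> {..<n}. ?g p) = (\<Oplus>i\<in>{..<n}. \<Oplus>j\<in>{..<n}. ?g (i, j))"
      using fc by (intro finsum_cartesian) auto
    also have "\<dots> = (\<Oplus>i\<in>{..<n}. r (a, i) \<otimes> V (i, b))"
    proof (rule finsum_cong'[OF refl])
      show "(\<lambda>i. r (a, i) \<otimes> V (i, b)) \<in> {..<n} \<rightarrow> carrier R" using V r ab by auto
      fix i assume i: "i \<in> {..<n}"
      have "(\<Oplus>j\<in>{..<n}. ?g (i, j)) = (\<Oplus>j\<in>{..<n}. if b = j then V (i, j) \<otimes> r (a, i) else \<zero>)"
        using V r ab i by (intro finsum_cong') auto
      also have "\<dots> = V (i, b) \<otimes> r (a, i)" using V r ab i by (intro finsum_singleton) auto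
      finally show "(\<Oplus>j\<in>{..<n}. ?g (i, j)) = r (a, i) \<otimes> V (i, b)" using V r ab i by (simp add: m_comm)
    qed
    finally show ?thesis .
  qed
  have mg: "(\<Oplus>p\<in>{..<n} \<times> {..<n}. \<ominus> ?g p) = \<ominus> (\<Oplus>p\<in>{..<n} \<times> {..<n}. ?g p)"
    using V r ab by (intro finsum_uminus) auto
  have "(\<Oplus>p\<in>{..<n} \<times> {..<n}. V p \<otimes> ((if fst p = a then r (snd p, b) else \<zero>) \<ominus> (if snd p = b then r (a, fst p) else \<zero>)))
    = (\<Oplus>p\<in>{..<n} \<times> {..<n}. ?f p \<oplus> \<ominus> ?g p)"
    using V r ab by (intro finsum_cong') (auto simp: minus_eq r_distr r_minus)
  also have "\<dots> = (\<Oplus>p\<in>{..<n} \<times> {..<n}. ?f p) \<oplus> (\<Oplus>p\<in>{..<n} \<times> {..<n}. \<ominus> ?g p)"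
    using V r ab by (intro finsum_addf) auto
  finally show ?thesis unfolding mg F G by (simp add: minus_eq)
qed

locale versal_lift =
  fixes k :: "'k ring" and W :: "('w, 'k) res_ring" and \<Gamma> :: "'g monoid" and T :: "'g topology"
    and n :: nat and \<rho> :: "'g \<Rightarrow> nat \<times> nat \<Rightarrow> 'k" and R :: "('r, 'k, 'w) coef_alg" and \<nu>
  assumes k: "field k" and W: "complete_local_noetherian k W" and \<Gamma>: "group \<Gamma>" and T: "topspace T = carrier \<Gamma>"
    and \<rho>: "\<rho> \<in> hom \<Gamma> (GL n k)" and R: "coef_obj k W R" and \<nu>: "\<nu> \<in> lifts \<Gamma> T n \<rho> R"
    and versal: "\<And>A :: (nat \<Rightarrow> 'k, 'k, 'w) coef_alg. coef_obj k W A ==>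
           (\<lambda>\<alpha>. deformation_class k \<Gamma> T n \<rho> A (push_lift n \<alpha> \<nu>)) ` coef_hom W R A = deformations k \<Gamma> T n \<rho> A"
    and dual_bij: "bij_betw (\<lambda>\<alpha>. deformation_class k \<Gamma> T n \<rho> (dual_numbers k W) (push_lift n \<alpha> \<nu>))
          (coef_hom W R (dual_numbers k W)) (deformations k \<Gamma> T n \<rho> (dual_numbers k W))"
begin

sublocale k: field k by (rule k)

lemma cR: "complete_local_noetherian k R" "scalar R \<in> ring_hom W R"
  "w \<in> carrier W ==> residue R (scalar R w) = residue W w"
  using R by (auto simp: coef_obj_def)

lemmas eW = cln_elim[OF k W]
lemmas eR = cln_elim[OF k cR(1)]

sublocale rW: residual W k "residue W" by (rule eW(1))
sublocale rR: residual R k "residue R" by (rule eR(1))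

lemma \<rho>_closed: "g \<in> carrier \<Gamma> ==> a < n ==> b < n ==> \<rho> g (a, b) \<in> carrier k"
  using k.GL_entry_closed[OF hom_in_carrier[OF \<rho>]] .

lemma \<nu>_lift: "\<nu> \<in> hom \<Gamma> (GL n R)" "g \<in> carrier \<Gamma> ==> GL_map n (residue R) (\<nu> g) = \<rho> g"
  using \<nu> by (auto simp: lifts_def)

lemma \<nu>_closed: "g \<in> carrier \<Gamma> ==> a < n ==> b < n ==> \<nu> g (a, b) \<in> carrier R"
  using rR.A.GL_entry_closed[OF hom_in_carrier[OF \<nu>_lift(1)]] .

lemma \<nu>_residue: "g \<in> carrier \<Gamma> ==> a < n ==> b < n ==> residue R (\<nu> g (a, b)) = \<rho> g (a, b)"
  using fun_cong[OF \<nu>_lift(2), of g "(a, b)"] by (simp add: GL_map_entry)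

definition sec where "sec x = (SOME w. w \<in> carrier W \<and> residue W w = x)"

lemma sec: assumes "x \<in> carrier k" shows "sec x \<in> carrier W" "residue W (sec x) = x"
proof -
  have "\<exists>w. w \<in> carrier W \<and> residue W w = x" using rW.\<pi>_surj assms by (metis (no_types, lifting) imageE)
  from someI_ex[OF this] show "sec x \<in> carrier W" "residue W (sec x) = x" unfolding sec_def by auto
qed

lemma \<rho>_id: "g \<in> carrier \<Gamma> ==> push_lift n (\<lambda>x. x) \<rho> g = \<rho> g"
  unfolding push_lift_def
  by (rule mat_eqI[OF GL_map_ext k.GL_ext[OF hom_in_carrier[OF \<rho>]]]) (simp_all add: GL_map_entry)

lemma push_lift_in_lifts:
  assumes A: "coef_obj k W A" and \<alpha>: "\<alpha> \<in> coef_hom W R A"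
  shows "push_lift n \<alpha> \<nu> \<in> lifts \<Gamma> T n \<rho> A"
proof -
  have A': "complete_local_noetherian k A" using A by (simp add: coef_obj_def)
  note eA = cln_elim[OF k A']
  have h: "\<alpha> \<in> ring_hom R A" "\<And>r. r \<in> carrier R ==> residue A (\<alpha> r) = residue R r"
    using \<alpha> unfolding coef_hom_iff[OF k R A] by auto
  have "\<alpha> ` max_ideal R \<subseteq> max_ideal A"
    using h by (intro residue_compatible_imp_local[OF k k cR(1) A' _ h(1), of "\<lambda>x. x"]) (auto simp: ring_hom_def)
  hence "push_lift n \<alpha> \<nu> \<in> lifts \<Gamma> T n (push_lift n (\<lambda>x. x) \<rho>) A"
    using h(2) by (intro lifts_push[OF eR(5,6) eA(5,6) T h(1) _ _ \<nu>]) auto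
  thus ?thesis using lifts_cong_rho[of \<Gamma> "push_lift n (\<lambda>x. x) \<rho>" \<rho>, OF \<rho>_id] by blast
qed

lemma versal_ex:
  fixes A :: "('a, 'k, 'w) coef_alg"
  assumes A: "coef_obj k W A"
    and im: "(\<lambda>\<alpha>. deformation_class k \<Gamma> T n \<rho> A (push_lift n \<alpha> \<nu>)) ` coef_hom W R A = deformations k \<Gamma> T n \<rho> A"
    and \<tau>: "\<tau> \<in> lifts \<Gamma> T n \<rho> A"
  shows "\<exists>\<alpha>\<in>coef_hom W R A. strictly_equivalent k \<Gamma> n A (push_lift n \<alpha> \<nu>) \<tau>"
proof -
  have A': "complete_local_noetherian k A" using A by (simp add: coef_obj_def)
  note eA = cln_elim[OF k A']
  have "deformation_class k \<Gamma> T n \<rho> A \<tau> \<in> deformations k \<Gamma> T n \<rho> A" using \<tau> by (auto simp: deformations_def)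
  then obtain \<alpha> where \<alpha>: "\<alpha> \<in> coef_hom W R A"
    "deformation_class k \<Gamma> T n \<rho> A \<tau> = deformation_class k \<Gamma> T n \<rho> A (push_lift n \<alpha> \<nu>)" unfolding im[symmetric] by blast
  have "strictly_equivalent k \<Gamma> n A (push_lift n \<alpha> \<nu>) \<tau>"
    using deformation_class_eq_iff[OF k.is_cring eA(5) residual.\<pi>_hom[OF eA(1)] push_lift_in_lifts[OF A \<alpha>(1)] \<tau>] \<alpha>(2) by simp
  thus ?thesis using \<alpha>(1) by blast
qed

abbreviation D where "D \<equiv> dual_numbers k W"

lemmas D_coef = dual_coef(1)[OF k W]

lemma dual_lift_fst:
  assumes "\<sigma> \<in> lifts \<Gamma> T n \<rho> D" "g \<in> carrier \<Gamma>" "a < n" "b < n"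
  shows "fst (\<sigma> g (a, b)) = \<rho> g (a, b)" "snd (\<sigma> g (a, b)) \<in> carrier k"
proof -
  have "GL_map n (residue D) (\<sigma> g) (a, b) = \<rho> g (a, b)" using assms by (simp add: lifts_def)
  thus "fst (\<sigma> g (a, b)) = \<rho> g (a, b)" using assms(3,4) by (simp add: GL_map_entry dual_simps)
  have "\<sigma> g \<in> carrier (GL n D)" using assms(1,2) by (auto simp: lifts_def hom_def)
  from cring.GL_entry_closed[OF dual_cring[OF k W] this assms(3,4)]
  show "snd (\<sigma> g (a, b)) \<in> carrier k" by (auto simp: dual_simps mem_Times_iff)
qed

abbreviation E where "E \<equiv> carrier \<Gamma> \<times> ({..<n} \<times> {..<n})"

text \<open>A lift over \<open>k[\<epsilon>]\<close> is strictly equivalent to the image of \<open>\<nu>\<close> under some \<open>\<alpha> : R \<rightarrow> k[\<epsilon>]\<close>, and the \<open>\<epsilon>\<close>-part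
  of \<open>\<alpha>\<close> is determined by its values on the generators \<open>G\<close> of the maximal ideal of \<open>R\<close>. So the \<open>\<epsilon>\<close>-parts
  of the entries of the lift are linear combinations of finitely many functions, which depend on the
  entry alone: one for each generator, and one for each entry of the conjugating matrix.\<close>

theorem separating_entries:
  "\<exists>S\<subseteq>E. finite S \<and> (\<forall>\<sigma>\<in>lifts \<Gamma> T n \<rho> D.
     (\<forall>x\<in>S. snd (\<sigma> (fst x) (snd x)) = \<zero>\<^bsub>k\<^esub>) \<longrightarrow> (\<forall>x\<in>E. snd (\<sigma> (fst x) (snd x)) = \<zero>\<^bsub>k\<^esub>))"
proof -
  obtain G where G: "G \<subseteq> carrier R" "finite G" "max_ideal R = Idl\<^bsub>R\<^esub> G" using eR(4) by blast
  \<comment> \<open>coefficients of \<open>r\<close> with respect to \<open>G\<close>, after subtracting a scalar with the same residue\<close>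
  define \<beta> where "\<beta> r = (SOME c. c \<in> G \<rightarrow> carrier R \<and> r \<ominus>\<^bsub>R\<^esub> scalar R (sec (residue R r)) = (\<Oplus>\<^bsub>R\<^esub>y\<in>G. c y \<otimes>\<^bsub>R\<^esub> y))" for r
  have \<beta>: "\<beta> r \<in> G \<rightarrow> carrier R" "r \<ominus>\<^bsub>R\<^esub> scalar R (sec (residue R r)) = (\<Oplus>\<^bsub>R\<^esub>y\<in>G. \<beta> r y \<otimes>\<^bsub>R\<^esub> y)" and
    sc: "scalar R (sec (residue R r)) \<in> carrier R" if r: "r \<in> carrier R" for r
  proof -
    have s: "sec (residue R r) \<in> carrier W" "residue W (sec (residue R r)) = residue R r" using sec r by simp_all
    show c: "scalar R (sec (residue R r)) \<in> carrier R" using ring_hom_closed[OF cR(2) s(1)] .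
    have "residue R (r \<ominus>\<^bsub>R\<^esub> scalar R (sec (residue R r))) = \<zero>\<^bsub>k\<^esub>"
      using r c cR(3)[OF s(1)] s(2) by (simp add: rR.\<pi>_minus k.r_right_minus_eq)
    hence "r \<ominus>\<^bsub>R\<^esub> scalar R (sec (residue R r)) \<in> max_ideal R" unfolding eR(2) rR.m_iff using r c by simp
    hence "\<exists>c. c \<in> G \<rightarrow> carrier R \<and> r \<ominus>\<^bsub>R\<^esub> scalar R (sec (residue R r)) = (\<Oplus>\<^bsub>R\<^esub>y\<in>G. c y \<otimes>\<^bsub>R\<^esub> y)"
      unfolding G(3) rR.A.genideal_finite[OF G(1,2)] by blast
    from someI_ex[OF this] show "\<beta> r \<in> G \<rightarrow> carrier R" "r \<ominus>\<^bsub>R\<^esub> scalar R (sec (residue R r)) = (\<Oplus>\<^bsub>R\<^esub>y\<in>G. \<beta> r y \<otimes>\<^bsub>R\<^esub> y)"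
      unfolding \<beta>_def by auto
  qed
  define u where "u i x = (case x of (g, (a, b)) \<Rightarrow> (case i of Inl y \<Rightarrow> residue R (\<beta> (\<nu> g (a, b)) y) |
      Inr p \<Rightarrow> (if fst p = a then \<rho> g (snd p, b) else \<zero>\<^bsub>k\<^esub>) \<ominus>\<^bsub>k\<^esub> (if snd p = b then \<rho> g (a, fst p) else \<zero>\<^bsub>k\<^esub>)))"
    for i :: "'r + nat \<times> nat" and x
  let ?I = "Inl ` G \<union> Inr ` ({..<n} \<times> {..<n})"
  have uc: "u i x \<in> carrier k" if "i \<in> ?I" "x \<in> E" for i x
    using that \<beta>(1)[OF \<nu>_closed] \<rho>_closed by (auto simp: u_def Pi_iff)
  have fI: "finite ?I" using G(2) by simp
  have "\<exists>S\<subseteq>E. finite S \<and> (\<forall>c\<in>?I \<rightarrow> carrier k. (\<forall>x\<in>S. (\<Oplus>\<^bsub>k\<^esub>i\<in>?I. c i \<otimes>\<^bsub>k\<^esub> u i x) = \<zero>\<^bsub>k\<^esub>) \<longrightarrow>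
      (\<forall>x\<in>E. (\<Oplus>\<^bsub>k\<^esub>i\<in>?I. c i \<otimes>\<^bsub>k\<^esub> u i x) = \<zero>\<^bsub>k\<^esub>))"
    by (rule k.finite_separating_set[OF fI]) (rule uc)
  then obtain S where S: "S \<subseteq> E" "finite S" and Sep0: "\<forall>c\<in>?I \<rightarrow> carrier k. (\<forall>x\<in>S. (\<Oplus>\<^bsub>k\<^esub>i\<in>?I. c i \<otimes>\<^bsub>k\<^esub> u i x) = \<zero>\<^bsub>k\<^esub>) \<longrightarrow>
      (\<forall>x\<in>E. (\<Oplus>\<^bsub>k\<^esub>i\<in>?I. c i \<otimes>\<^bsub>k\<^esub> u i x) = \<zero>\<^bsub>k\<^esub>)" by (elim exE conjE)
  have Sep: "(\<Oplus>\<^bsub>k\<^esub>i\<in>?I. c i \<otimes>\<^bsub>k\<^esub> u i x) = \<zero>\<^bsub>k\<^esub>" if "c \<in> ?I \<rightarrow> carrier k"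
     "\<forall>x\<in>S. (\<Oplus>\<^bsub>k\<^esub>i\<in>?I. c i \<otimes>\<^bsub>k\<^esub> u i x) = \<zero>\<^bsub>k\<^esub>" "x \<in> E" for c x
    by (rule bspec[OF mp[OF bspec[OF Sep0 that(1)] that(2)] that(3)])
  have "snd (\<sigma> (fst e) (snd e)) = \<zero>\<^bsub>k\<^esub>"
    if \<sigma>: "\<sigma> \<in> lifts \<Gamma> T n \<rho> D" and z: "\<forall>x\<in>S. snd (\<sigma> (fst x) (snd x)) = \<zero>\<^bsub>k\<^esub>" and e: "e \<in> E" for \<sigma> e
  proof -
    have "(\<lambda>\<alpha>. deformation_class k \<Gamma> T n \<rho> D (push_lift n \<alpha> \<nu>)) ` coef_hom W R D = deformations k \<Gamma> T n \<rho> D"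
      using dual_bij by (simp add: bij_betw_def)
    from versal_ex[OF D_coef this \<sigma>] obtain \<alpha> where \<alpha>: "\<alpha> \<in> coef_hom W R D"
      "strictly_equivalent k \<Gamma> n D (push_lift n \<alpha> \<nu>) \<sigma>" by blast
    have \<alpha>h: "\<alpha> \<in> ring_hom R D" "\<And>w. w \<in> carrier W ==> \<alpha> (scalar R w) = (residue W w, \<zero>\<^bsub>k\<^esub>)"
      "\<And>r. r \<in> carrier R ==> fst (\<alpha> r) = residue R r"
      using \<alpha>(1) unfolding coef_hom_iff[OF k R D_coef] by (auto simp: dual_simps)
    have \<alpha>c: "snd (\<alpha> r) \<in> carrier k" if "r \<in> carrier R" for r
      using ring_hom_closed[OF \<alpha>h(1) that] by (auto simp: dual_simps mem_Times_iff)
    note pl = push_lift_in_lifts[OF D_coef \<alpha>(1)]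
    have GLc: "g \<in> carrier \<Gamma> ==> push_lift n \<alpha> \<nu> g \<in> carrier (GL n D)" "g \<in> carrier \<Gamma> ==> \<sigma> g \<in> carrier (GL n D)" for g
      using pl \<sigma> by (auto simp: lifts_def hom_def)
    obtain V where V: "V \<in> {..<n} \<times> {..<n} \<rightarrow> carrier k" "\<And>g a b. g \<in> carrier \<Gamma> ==> a < n ==> b < n ==>
       snd (\<sigma> g (a, b)) \<oplus>\<^bsub>k\<^esub> (\<Oplus>\<^bsub>k\<^esub>l\<in>{..<n}. \<rho> g (a, l) \<otimes>\<^bsub>k\<^esub> V (l, b)) =
       snd (push_lift n \<alpha> \<nu> g (a, b)) \<oplus>\<^bsub>k\<^esub> (\<Oplus>\<^bsub>k\<^esub>l\<in>{..<n}. V (a, l) \<otimes>\<^bsub>k\<^esub> \<rho> g (l, b))"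
      using \<alpha>(2) dual_strictly_equivalent_iff[OF k W, of \<Gamma> "push_lift n \<alpha> \<nu>" n \<sigma> \<rho>, OF GLc dual_lift_fst(1)[OF pl] dual_lift_fst(1)[OF \<sigma>]]
      by blast
    have Vc: "V (a, b) \<in> carrier k" if "a < n" "b < n" for a b using V(1) that by auto
    define c where "c i = (case i of Inl y \<Rightarrow> snd (\<alpha> y) | Inr p \<Rightarrow> V p)" for i
    have cc: "c \<in> ?I \<rightarrow> carrier k" using \<alpha>c G(1) V(1) by (auto simp: c_def Pi_iff)
    have snd\<alpha>: "snd (\<alpha> r) = (\<Oplus>\<^bsub>k\<^esub>y\<in>G. snd (\<alpha> y) \<otimes>\<^bsub>k\<^esub> residue R (\<beta> r y))" if r: "r \<in> carrier R" for r
    proof -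
      let ?s = "scalar R (sec (residue R r))" let ?t = "\<Oplus>\<^bsub>R\<^esub>y\<in>G. \<beta> r y \<otimes>\<^bsub>R\<^esub> y"
      have tc: "?t \<in> carrier R" using \<beta>(1)[OF r] G(1) by (intro rR.A.finsum_closed) auto
      have "r = ?s \<oplus>\<^bsub>R\<^esub> (r \<ominus>\<^bsub>R\<^esub> ?s)" using r sc[OF r] by algebra
      hence "\<alpha> r = \<alpha> ?s \<oplus>\<^bsub>D\<^esub> \<alpha> ?t" unfolding \<beta>(2)[OF r] using ring_hom_add[OF \<alpha>h(1) sc[OF r] tc] by simp
      moreover have "\<alpha> ?s = (residue R r, \<zero>\<^bsub>k\<^esub>)" using \<alpha>h(2)[OF sec(1)] sec(2) r by simp
      moreover have "\<alpha> ?t = (\<Oplus>\<^bsub>D\<^esub>y\<in>G. \<alpha> (\<beta> r y \<otimes>\<^bsub>R\<^esub> y))"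
        using ring_hom_cring.hom_finsum[OF ring_hom_cringI[OF eR(5) dual_cring[OF k W] \<alpha>h(1)], of "\<lambda>y. \<beta> r y \<otimes>\<^bsub>R\<^esub> y" G] \<beta>(1)[OF r] G(1)
        by (auto simp: o_def Pi_iff subset_iff)
      moreover have "snd (\<Oplus>\<^bsub>D\<^esub>y\<in>G. \<alpha> (\<beta> r y \<otimes>\<^bsub>R\<^esub> y)) = (\<Oplus>\<^bsub>k\<^esub>y\<in>G. snd (\<alpha> (\<beta> r y \<otimes>\<^bsub>R\<^esub> y)))"
        using \<beta>(1)[OF r] G(1) by (intro dual_finsum(2)[OF k W _ G(2)]) (auto intro!: ring_hom_closed[OF \<alpha>h(1)])
      ultimately have "snd (\<alpha> r) = \<zero>\<^bsub>k\<^esub> \<oplus>\<^bsub>k\<^esub> (\<Oplus>\<^bsub>k\<^esub>y\<in>G. snd (\<alpha> (\<beta> r y \<otimes>\<^bsub>R\<^esub> y)))"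
        by (cases "\<Oplus>\<^bsub>D\<^esub>y\<in>G. \<alpha> (\<beta> r y \<otimes>\<^bsub>R\<^esub> y)") (simp add: dual_simps)
      also have "\<dots> = (\<Oplus>\<^bsub>k\<^esub>y\<in>G. snd (\<alpha> (\<beta> r y \<otimes>\<^bsub>R\<^esub> y)))"
        using \<beta>(1)[OF r] G(1) by (intro k.l_zero k.finsum_closed) (auto intro!: \<alpha>c)
      also have "\<dots> = (\<Oplus>\<^bsub>k\<^esub>y\<in>G. snd (\<alpha> y) \<otimes>\<^bsub>k\<^esub> residue R (\<beta> r y))"
      proof (rule k.finsum_cong'[OF refl])
        show "(\<lambda>y. snd (\<alpha> y) \<otimes>\<^bsub>k\<^esub> residue R (\<beta> r y)) \<in> G \<rightarrow> carrier k" using \<alpha>c G(1) \<beta>(1)[OF r] by (auto simp: Pi_iff)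
        fix y assume y: "y \<in> G"
        have yc: "y \<in> carrier R" "\<beta> r y \<in> carrier R" using y G(1) \<beta>(1)[OF r] by auto
        have "y \<in> max_ideal R" using rR.A.genideal_self[OF G(1)] G(3) y by blast
        hence "residue R y = \<zero>\<^bsub>k\<^esub>" unfolding eR(2) rR.m_iff by blast
        hence fy: "fst (\<alpha> y) = \<zero>\<^bsub>k\<^esub>" using \<alpha>h(3)[OF yc(1)] by simp
        have "\<alpha> (\<beta> r y \<otimes>\<^bsub>R\<^esub> y) = (fst (\<alpha> (\<beta> r y)), snd (\<alpha> (\<beta> r y))) \<otimes>\<^bsub>D\<^esub> (fst (\<alpha> y), snd (\<alpha> y))"
          using ring_hom_mult[OF \<alpha>h(1) yc(2,1)] by simp
        hence "snd (\<alpha> (\<beta> r y \<otimes>\<^bsub>R\<^esub> y)) = residue R (\<beta> r y) \<otimes>\<^bsub>k\<^esub> snd (\<alpha> y) \<oplus>\<^bsub>k\<^esub> snd (\<alpha> (\<beta> r y)) \<otimes>\<^bsub>k\<^esub> \<zero>\<^bsub>k\<^esub>"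
          unfolding fy \<alpha>h(3)[OF yc(2)] by (simp add: dual_simps)
        thus "snd (\<alpha> (\<beta> r y \<otimes>\<^bsub>R\<^esub> y)) = snd (\<alpha> y) \<otimes>\<^bsub>k\<^esub> residue R (\<beta> r y)"
          using \<alpha>c yc by (simp add: k.m_comm)
      qed
      finally show ?thesis .
    qed
    have main: "snd (\<sigma> g (a, b)) = (\<Oplus>\<^bsub>k\<^esub>i\<in>?I. c i \<otimes>\<^bsub>k\<^esub> u i (g, (a, b)))" if g: "g \<in> carrier \<Gamma>" and ab: "a < n" "b < n" for g a b
    proof -
      let ?P = "\<Oplus>\<^bsub>k\<^esub>l\<in>{..<n}. \<rho> g (a, l) \<otimes>\<^bsub>k\<^esub> V (l, b)" let ?Q = "\<Oplus>\<^bsub>k\<^esub>l\<in>{..<n}. V (a, l) \<otimes>\<^bsub>k\<^esub> \<rho> g (l, b)"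
      let ?r = "\<nu> g (a, b)"
      have cl: "?P \<in> carrier k" "?Q \<in> carrier k" "snd (\<sigma> g (a, b)) \<in> carrier k" "snd (\<alpha> ?r) \<in> carrier k"
        using Vc \<rho>_closed[OF g] ab dual_lift_fst(2)[OF \<sigma> g ab] \<alpha>c[OF \<nu>_closed[OF g ab]] by (auto intro!: k.finsum_closed)
      have 1: "snd (\<sigma> g (a, b)) \<oplus>\<^bsub>k\<^esub> ?P = snd (\<alpha> ?r) \<oplus>\<^bsub>k\<^esub> ?Q"
        using V(2)[OF g ab] ab by (simp add: push_lift_def GL_map_entry)
      have cancel: "s = s \<oplus>\<^bsub>k\<^esub> p \<ominus>\<^bsub>k\<^esub> p" if "s \<in> carrier k" "p \<in> carrier k" for s p using that by algebra
      have "snd (\<sigma> g (a, b)) = snd (\<alpha> ?r) \<oplus>\<^bsub>k\<^esub> ?Q \<ominus>\<^bsub>k\<^esub> ?P"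
        by (subst cancel[OF cl(3,1)]) (simp only: 1)
      also have "\<dots> = snd (\<alpha> ?r) \<oplus>\<^bsub>k\<^esub> (?Q \<ominus>\<^bsub>k\<^esub> ?P)" using cl by (simp add: k.minus_eq k.a_assoc)
      also have "?Q \<ominus>\<^bsub>k\<^esub> ?P = (\<Oplus>\<^bsub>k\<^esub>p\<in>{..<n} \<times> {..<n}. V p \<otimes>\<^bsub>k\<^esub> u (Inr p) (g, (a, b)))"
        using k.commutator_sum[of n V "\<rho> g" a b, OF Vc \<rho>_closed[OF g] ab] by (simp add: u_def)
      also have "\<dots> = (\<Oplus>\<^bsub>k\<^esub>i\<in>Inr ` ({..<n} \<times> {..<n}). c i \<otimes>\<^bsub>k\<^esub> u i (g, (a, b)))"
      proof (subst k.finsum_reindex)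
        show "(\<lambda>i. c i \<otimes>\<^bsub>k\<^esub> u i (g, a, b)) \<in> Inr ` ({..<n} \<times> {..<n}) \<rightarrow> carrier k"
          using cc uc g ab by (auto simp: Pi_iff)
      qed (auto simp: c_def)
      also have "snd (\<alpha> ?r) = (\<Oplus>\<^bsub>k\<^esub>y\<in>G. snd (\<alpha> y) \<otimes>\<^bsub>k\<^esub> residue R (\<beta> ?r y))" by (rule snd\<alpha>[OF \<nu>_closed[OF g ab]])
      also have "\<dots> = (\<Oplus>\<^bsub>k\<^esub>i\<in>Inl ` G. c i \<otimes>\<^bsub>k\<^esub> u i (g, (a, b)))"
      proof (subst k.finsum_reindex)
        show "(\<lambda>i. c i \<otimes>\<^bsub>k\<^esub> u i (g, a, b)) \<in> Inl ` G \<rightarrow> carrier k"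
          using cc uc g ab by (auto simp: Pi_iff)
      qed (auto simp: c_def u_def)
      also have "(\<Oplus>\<^bsub>k\<^esub>i\<in>Inl ` G. c i \<otimes>\<^bsub>k\<^esub> u i (g, (a, b))) \<oplus>\<^bsub>k\<^esub> (\<Oplus>\<^bsub>k\<^esub>i\<in>Inr ` ({..<n} \<times> {..<n}). c i \<otimes>\<^bsub>k\<^esub> u i (g, (a, b))) =
          (\<Oplus>\<^bsub>k\<^esub>i\<in>?I. c i \<otimes>\<^bsub>k\<^esub> u i (g, (a, b)))"
        using cc uc g ab G(2) by (intro k.finsum_Un_disjoint[symmetric]) (auto simp: Pi_iff)
      finally show ?thesis .
    qed
    have "(\<Oplus>\<^bsub>k\<^esub>i\<in>?I. c i \<otimes>\<^bsub>k\<^esub> u i x) = \<zero>\<^bsub>k\<^esub>" if x: "x \<in> S" for x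
    proof -
      obtain g a b where gab: "x = (g, (a, b))" "g \<in> carrier \<Gamma>" "a < n" "b < n" using x S(1) by (cases x) auto
      show ?thesis using main[OF gab(2-4)] bspec[OF z x] gab(1) by simp
    qed
    hence "(\<Oplus>\<^bsub>k\<^esub>i\<in>?I. c i \<otimes>\<^bsub>k\<^esub> u i e) = \<zero>\<^bsub>k\<^esub>" by (intro Sep[OF cc _ e] ballI)
    thus ?thesis using main[of "fst e" "fst (snd e)" "snd (snd e)"] e by auto
  qed
  thus ?thesis using S by blast
qed

end

section \<open>Descent of lifts along an extension of residue fields\<close>

lemma (in cring) subring_simps:
  assumes "subring H R"
  shows "\<zero> \<in> H" "\<one> \<in> H" "x \<in> H ==> x \<in> carrier R" "x \<in> H ==> y \<in> H ==> x \<oplus> y \<in> H"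
    "x \<in> H ==> y \<in> H ==> x \<otimes> y \<in> H" "x \<in> H ==> \<ominus> x \<in> H" "x \<in> H ==> y \<in> H ==> x \<ominus> y \<in> H"
  using subringE[OF assms] by (auto simp: minus_eq)

lemma (in cring) subring_cring:
  assumes "subring H R" shows "cring (R\<lparr>carrier := H\<rparr>)"
  using subcring_iff[OF subringE(1)[OF assms]] subcringI'[OF assms] by blast

locale base_change = versal_lift k W \<Gamma> T n \<rho> R \<nu>
  for k :: "'k ring" and W :: "('w, 'k) res_ring" and \<Gamma> :: "'g monoid" and T :: "'g topology"
    and n :: nat and \<rho> :: "'g \<Rightarrow> nat \<times> nat \<Rightarrow> 'k" and R :: "('r, 'k, 'w) coef_alg" and \<nu> +
  fixes k' :: "'l ring" and W' :: "('v, 'l) res_ring" and \<iota> :: "'k \<Rightarrow> 'l" and \<phi> :: "'w \<Rightarrow> 'v"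
  assumes k': "field k'" and \<iota>: "\<iota> \<in> ring_hom k k'" and W': "complete_local_noetherian k' W'"
    and \<phi>: "\<phi> \<in> ring_hom W W'" and compat: "w \<in> carrier W ==> residue W' (\<phi> w) = \<iota> (residue W w)"
begin

sublocale k': field k' by (rule k')

lemma \<iota>_inj: "inj_on \<iota> (carrier k)" by (rule non_trivial_field_hom_is_inj[OF \<iota> k k'])

lemma \<iota>_zero: "\<iota> \<zero>\<^bsub>k\<^esub> = \<zero>\<^bsub>k'\<^esub>" by (rule ring_hom_zero[OF \<iota> k.ring_axioms k'.ring_axioms])

lemma \<iota>_zero_iff: "x \<in> carrier k ==> \<iota> x = \<zero>\<^bsub>k'\<^esub> \<longleftrightarrow> x = \<zero>\<^bsub>k\<^esub>"
  using inj_on_eq_iff[OF \<iota>_inj _ k.zero_closed] unfolding \<iota>_zero .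

end

locale descent = base_change k W \<Gamma> T n \<rho> R \<nu> k' W' \<iota> \<phi>
  for k :: "'k ring" and W :: "('w, 'k) res_ring" and \<Gamma> :: "'g monoid" and T :: "'g topology"
    and n :: nat and \<rho> :: "'g \<Rightarrow> nat \<times> nat \<Rightarrow> 'k" and R :: "('r, 'k, 'w) coef_alg" and \<nu>
    and k' :: "'l ring" and W' :: "('v, 'l) res_ring" and \<iota> :: "'k \<Rightarrow> 'l" and \<phi> :: "'w \<Rightarrow> 'v" +
  fixes B :: "('u, 'l, 'v) coef_alg" (structure) and \<tau> :: "'g \<Rightarrow> nat \<times> nat \<Rightarrow> 'u"
  assumes B: "coef_obj k' W' B" and \<tau>: "\<tau> \<in> lifts \<Gamma> T n (push_lift n \<iota> \<rho>) B"
begin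

lemma cB: "complete_local_noetherian k' B" "scalar B \<in> ring_hom W' B"
  "x \<in> carrier W' ==> residue B (scalar B x) = residue W' x"
  using B by (auto simp: coef_obj_def)

lemmas eB = cln_elim[OF k' cB(1)]

sublocale rB: residual B k' "residue B" by (rule eB(1))

abbreviation PB where "PB \<equiv> mpow B"

interpretation FB: complete_filtration B PB by (rule eB(3))

lemmas PB_ideal = rB.A.ideal_pow_ideal[OF eB(6)]
lemmas PB_simps = rB.A.ideal_simps[OF PB_ideal]
lemmas mB_simps = rB.A.ideal_simps[OF eB(6)]

lemma mB_iff: "x \<in> max_ideal B \<longleftrightarrow> x \<in> carrier B \<and> residue B x = \<zero>\<^bsub>k'\<^esub>"
  unfolding eB(2) by (rule rB.m_iff)

lemma PB_1: "PB (Suc 0) = max_ideal B" by (rule rB.A.ideal_pow_1[OF eB(6)])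

definition str where "str w = scalar B (\<phi> w)"

lemma str_hom: "str \<in> ring_hom W B"
  using ring_hom_trans[OF \<phi> cB(2)] by (simp add: str_def[abs_def] o_def)

lemma str_closed: "w \<in> carrier W ==> str w \<in> carrier B" using ring_hom_closed[OF str_hom] .
lemmas str_add = ring_hom_add[OF str_hom]
lemmas str_mult = ring_hom_mult[OF str_hom]
lemmas str_one = ring_hom_one[OF str_hom]
lemmas str_zero = ring_hom_zero[OF str_hom rW.A.ring_axioms rB.A.ring_axioms]
lemmas str_minus = ring_hom_minus[OF eW(5) eB(5) str_hom]

lemma str_residue: "w \<in> carrier W ==> residue B (str w) = \<iota> (residue W w)"
  using cB(3)[OF ring_hom_closed[OF \<phi>]] compat by (simp add: str_def)

lemma str_ker: "w \<in> carrier W ==> residue W w = \<zero>\<^bsub>k\<^esub> ==> str w \<in> max_ideal B"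
  unfolding mB_iff using str_closed str_residue \<iota>_zero by simp

lemma str_same_residue:
  assumes "w \<in> carrier W" "u \<in> carrier W" "e \<in> carrier B" "e \<ominus> str w \<in> max_ideal B" "e \<ominus> str u \<in> max_ideal B"
  shows "residue W w = residue W u"
proof -
  have "(e \<ominus> str u) \<ominus> (e \<ominus> str w) \<in> max_ideal B" using assms(5,4) by (rule mB_simps(4))
  moreover have "(e \<ominus> str u) \<ominus> (e \<ominus> str w) = str w \<ominus> str u"
    using assms(3) str_closed[OF assms(1)] str_closed[OF assms(2)] by algebra
  ultimately have "residue B (str w \<ominus> str u) = \<zero>\<^bsub>k'\<^esub>" unfolding mB_iff by simp
  hence "\<iota> (residue W w) = \<iota> (residue W u)"
    using rB.\<pi>_minus[OF str_closed[OF assms(1)] str_closed[OF assms(2)]] str_residue[OF assms(1)] str_residue[OF assms(2)]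
      rB.\<pi>_simps(1)[OF str_closed[OF assms(1)]] rB.\<pi>_simps(1)[OF str_closed[OF assms(2)]] k'.r_right_minus_eq by simp
  thus ?thesis using inj_onD[OF \<iota>_inj] rW.\<pi>_simps(1) assms(1,2) by blast
qed

text \<open>The elements of \<open>H\<close> will be entries of a lift, corrected by scalars to have residue zero.\<close>

definition Gr where "Gr H = generate_ring B (str ` carrier W \<union> H)"

lemma Gr_base:
  assumes "H \<subseteq> max_ideal B"
  shows "subring (Gr H) B" "w \<in> carrier W ==> str w \<in> Gr H" "H \<subseteq> Gr H"
proof -
  have "str ` carrier W \<union> H \<subseteq> carrier B" using str_closed assms mB_simps(2) by blast
  thus "subring (Gr H) B" unfolding Gr_def by (rule rB.A.generate_ring_is_subring)
  show "w \<in> carrier W ==> str w \<in> Gr H" "H \<subseteq> Gr H" unfolding Gr_def by (auto intro: generate_ring.incl)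
qed

lemma Gr_induct [consumes 2, case_names scalar gen add mult]:
  assumes H: "H \<subseteq> max_ideal B" "e \<in> Gr H"
    and scalar: "\<And>w. w \<in> carrier W ==> Q (str w)" and gen: "\<And>x. x \<in> H ==> Q x"
    and add: "\<And>x y. x \<in> Gr H ==> y \<in> Gr H ==> Q x ==> Q y ==> Q (x \<oplus> y)"
    and mult: "\<And>x y. x \<in> Gr H ==> y \<in> Gr H ==> Q x ==> Q y ==> Q (x \<otimes> y)"
  shows "Q e"
  using H(2) unfolding Gr_def
proof (induction rule: generate_ring.induct)
  case one
  show ?case using scalar[of "\<one>\<^bsub>W\<^esub>"] str_one by simp
next
  case (incl h)
  thus ?case using scalar gen by blast
next
  case (a_inv h)
  hence h: "h \<in> Gr H" by (simp add: Gr_def)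
  have "\<ominus> h = str (\<ominus>\<^bsub>W\<^esub> \<one>\<^bsub>W\<^esub>) \<otimes> h"
    using ring_hom_cring.hom_a_inv[OF ring_hom_cringI[OF eW(5) eB(5) str_hom], of "\<one>\<^bsub>W\<^esub>"] str_one
      rB.A.subring_simps(3)[OF Gr_base(1)[OF H(1)] h] by (simp add: rB.A.l_minus)
  moreover have "Q (str (\<ominus>\<^bsub>W\<^esub> \<one>\<^bsub>W\<^esub>) \<otimes> h)" using scalar Gr_base(2)[OF H(1)] h a_inv by (intro mult) auto
  ultimately show ?case by simp
qed (use add[unfolded Gr_def] mult[unfolded Gr_def] in blast)+

text \<open>The elements that are congruent to an element of \<open>W\<close> form a subring.\<close>

lemma Gr_decompose:
  assumes H: "H \<subseteq> max_ideal B" and e: "e \<in> Gr H" and J: "ideal J (B\<lparr>carrier := Gr H\<rparr>)" "H \<subseteq> J"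
  shows "\<exists>w\<in>carrier W. e \<ominus> str w \<in> J"
proof -
  note S = rB.A.subring_simps[OF Gr_base(1)[OF H]]
  interpret G: cring "B\<lparr>carrier := Gr H\<rparr>" by (rule rB.A.subring_cring[OF Gr_base(1)[OF H]])
  note JJ = G.ideal_simps[OF J(1), simplified]
  have Jc: "x \<in> carrier B" "x \<in> Gr H" if "x \<in> J" for x using JJ(2)[OF that] S(3) by auto
  note strG = Gr_base(2)[OF H]
  show ?thesis using H e
  proof (induction rule: Gr_induct)
    case (scalar w)
    thus ?case using JJ(1) str_closed by (intro bexI[of _ w]) auto
  next
    case (gen x)
    hence "x \<in> J" using J(2) by blast
    thus ?case using Jc str_zero by (intro bexI[of _ "\<zero>\<^bsub>W\<^esub>"]) (auto simp: rB.A.minus_eq)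
  next
    case (add x y)
    then obtain w u where w: "w \<in> carrier W" "x \<ominus> str w \<in> J" "u \<in> carrier W" "y \<ominus> str u \<in> J" by blast
    have c: "x \<in> carrier B" "str w \<in> carrier B" "y \<in> carrier B" "str u \<in> carrier B" using add S(3) str_closed w by auto
    have "(x \<ominus> str w) \<oplus> (y \<ominus> str u) \<in> J" by (rule JJ(3)[OF w(2,4)])
    moreover have "(x \<ominus> str w) \<oplus> (y \<ominus> str u) = (x \<oplus> y) \<ominus> (str w \<oplus> str u)" using c by algebra
    ultimately show ?case using w by (intro bexI[of _ "w \<oplus>\<^bsub>W\<^esub> u"]) (auto simp: str_add)
  next
    case (mult x y)
    then obtain w u where w: "w \<in> carrier W" "x \<ominus> str w \<in> J" "u \<in> carrier W" "y \<ominus> str u \<in> J" by blast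
    have c: "x \<in> carrier B" "str w \<in> carrier B" "y \<in> carrier B" "str u \<in> carrier B" using mult S(3) str_closed w by auto
    have "(x \<ominus> str w) \<otimes> y \<oplus> str w \<otimes> (y \<ominus> str u) \<in> J"
      using mult(2) strG[OF w(1)] by (intro JJ(3) JJ(6)[OF w(2)] JJ(7)[OF w(4)])
    moreover have "(x \<ominus> str w) \<otimes> y \<oplus> str w \<otimes> (y \<ominus> str u) = (x \<otimes> y) \<ominus> (str w \<otimes> str u)" using c by algebra
    ultimately show ?case using w by (intro bexI[of _ "w \<otimes>\<^bsub>W\<^esub> u"]) (auto simp: str_mult)
  qed
qed

lemma incl_hom: "subring H B ==> (\<lambda>x. x) \<in> ring_hom (B\<lparr>carrier := H\<rparr>) B"
  using subringE(1) by (auto simp: ring_hom_def)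

lemma Gr_max_ideal:
  assumes H: "H \<subseteq> max_ideal B"
  shows "ideal (Gr H \<inter> max_ideal B) (B\<lparr>carrier := Gr H\<rparr>)"
proof -
  have "ideal {a \<in> carrier (B\<lparr>carrier := Gr H\<rparr>). a \<in> max_ideal B} (B\<lparr>carrier := Gr H\<rparr>)"
    using ideal_preimage[OF rB.A.subring_cring[OF Gr_base(1)[OF H]] eB(5) incl_hom[OF Gr_base(1)[OF H]] eB(6)] .
  thus ?thesis by (simp add: Int_def)
qed

lemma Gr_dec_max:
  assumes H: "H \<subseteq> max_ideal B" and e: "e \<in> Gr H"
  shows "\<exists>w\<in>carrier W. e \<ominus> str w \<in> max_ideal B"
  using Gr_decompose[OF H e Gr_max_ideal[OF H]] H Gr_base(3)[OF H] by blast

subsection \<open>The entries of the lift\<close>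

text \<open>The correction makes this an element of the maximal ideal.\<close>

definition ent where "ent x = \<tau> (fst x) (snd x) \<ominus> str (sec (\<rho> (fst x) (snd x)))"

lemma \<tau>_hom: "\<tau> \<in> hom \<Gamma> (GL n B)"
  and \<tau>_cont: "adic_locally_constant T n B \<tau>"
  and \<tau>_res: "g \<in> carrier \<Gamma> ==> GL_map n (residue B) (\<tau> g) = push_lift n \<iota> \<rho> g"
  using \<tau> unfolding lifts_iff[OF eB(5,6) T] by blast+

lemma \<tau>_closed: "x \<in> E ==> \<tau> (fst x) (snd x) \<in> carrier B"
  using rB.A.GL_entry_closed[OF hom_in_carrier[OF \<tau>_hom]] by auto

lemma \<tau>_residue: "x \<in> E ==> residue B (\<tau> (fst x) (snd x)) = \<iota> (\<rho> (fst x) (snd x))"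
  using fun_cong[OF \<tau>_res, of "fst x" "snd x"] by (auto simp: GL_map_def push_lift_def)

lemma \<rho>_E: "x \<in> E ==> \<rho> (fst x) (snd x) \<in> carrier k" using \<rho>_closed by auto

lemma ent_mem: assumes x: "x \<in> E" shows "ent x \<in> max_ideal B"
proof -
  note s = sec[OF \<rho>_E[OF x]]
  have "residue B (ent x) = \<zero>\<^bsub>k'\<^esub>"
    unfolding ent_def rB.\<pi>_minus[OF \<tau>_closed[OF x] str_closed[OF s(1)]] \<tau>_residue[OF x] str_residue[OF s(1)] s(2)
    using ring_hom_closed[OF \<iota> \<rho>_E[OF x]] by (simp add: k'.r_right_minus_eq)
  thus ?thesis unfolding mB_iff ent_def using \<tau>_closed[OF x] str_closed[OF s(1)] by simp
qed

lemma entries_in_max: "S \<subseteq> E ==> ent ` S \<subseteq> max_ideal B" using ent_mem by blast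

abbreviation E0 where "E0 \<equiv> Gr (ent ` E)"

lemmas E0_max = entries_in_max[OF subset_refl]
lemmas E0_sub = Gr_base(1)[OF E0_max]
lemmas E0_simps = rB.A.subring_simps[OF E0_sub]
lemmas E0_str = Gr_base(2)[OF E0_max]

lemma \<tau>_in_E0: assumes x: "x \<in> E" shows "\<tau> (fst x) (snd x) \<in> E0"
proof -
  note s = sec[OF \<rho>_E[OF x]]
  have "ent x \<in> E0" using Gr_base(3)[OF E0_max] x by blast
  hence "ent x \<oplus> str (sec (\<rho> (fst x) (snd x))) \<in> E0" using E0_str[OF s(1)] by (rule E0_simps(4))
  moreover have "ent x \<oplus> str (sec (\<rho> (fst x) (snd x))) = \<tau> (fst x) (snd x)"
    unfolding ent_def using \<tau>_closed[OF x] str_closed[OF s(1)] by algebra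
  ultimately show ?thesis by simp
qed

lemma scaled_subgroup_max: "scaled_subgroup B W str (E0 \<inter> max_ideal B)"
  unfolding scaled_subgroup_def
proof (intro conjI ballI)
  show "(E0 \<inter> max_ideal B) \<subseteq> carrier B" using E0_simps(3) by blast
  show "\<zero> \<in> (E0 \<inter> max_ideal B)" using E0_simps(1) mB_simps(1) by blast
  show "x \<oplus> y \<in> (E0 \<inter> max_ideal B)" if "x \<in> (E0 \<inter> max_ideal B)" "y \<in> (E0 \<inter> max_ideal B)" for x y using that E0_simps(4) mB_simps(3) by blast
  show "str w \<otimes> x \<in> (E0 \<inter> max_ideal B)" if "w \<in> carrier W" "x \<in> (E0 \<inter> max_ideal B)" for w x
    using that E0_simps(5)[OF E0_str[OF that(1)]] mB_simps(7)[OF _ str_closed[OF that(1)]] by blast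
qed

text \<open>Let \<open>n\<close> be the maximal ideal of \<open>E0\<close>. If \<open>H\<close> were a proper subspace of \<open>n\<close>, there would be a functional
  \<open>l \<noteq> 0\<close> on \<open>n\<close> that vanishes on \<open>H\<close>. As \<open>H\<close> contains all products of elements of \<open>n\<close> and the image of the
  maximal ideal of \<open>W\<close>, the formula \<open>str w + x \<mapsto> (residue w, l x)\<close> defines a homomorphism \<open>lam : E0 \<rightarrow> k[\<epsilon>]\<close>,
  which is continuous as \<open>H\<close> is open. It turns \<open>\<tau>\<close> into a lift over \<open>k[\<epsilon>]\<close> with \<open>\<epsilon>\<close>-part \<open>l \<circ> ent\<close>. This
  vanishes on \<open>S\<close>, hence everywhere, so \<open>lam\<close> has \<open>\<epsilon>\<close>-part zero on the generators of \<open>E0\<close> and \<open>l = 0\<close>.\<close>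

lemma large_subspace:
  assumes S: "S \<subseteq> E"
    and sep: "\<And>\<sigma>. \<sigma> \<in> lifts \<Gamma> T n \<rho> D ==> \<forall>x\<in>S. snd (\<sigma> (fst x) (snd x)) = \<zero>\<^bsub>k\<^esub> ==> \<forall>x\<in>E. snd (\<sigma> (fst x) (snd x)) = \<zero>\<^bsub>k\<^esub>"
    and HN: "H \<subseteq> E0 \<inter> max_ideal B" and H: "scaled_subgroup B W str H"
    and prod: "\<And>x y. x \<in> E0 \<inter> max_ideal B ==> y \<in> E0 \<inter> max_ideal B ==> x \<otimes> y \<in> H"
    and kill: "\<And>w x. w \<in> carrier W ==> residue W w = \<zero>\<^bsub>k\<^esub> ==> x \<in> E0 \<inter> max_ideal B ==> str w \<otimes> x \<in> H"
    and ker: "\<And>w. w \<in> carrier W ==> residue W w = \<zero>\<^bsub>k\<^esub> ==> str w \<in> H"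
    and open_H: "E0 \<inter> PB i \<subseteq> H" and entS: "ent ` S \<subseteq> H"
  shows "E0 \<inter> max_ideal B \<subseteq> H"
proof (rule ccontr)
  let ?N = "E0 \<inter> max_ideal B"
  assume "\<not> ?N \<subseteq> H"
  then obtain v where v: "v \<in> ?N" "v \<notin> H" by blast
  note N = scaled_subgroup_max
  have lex: "\<exists>l. (\<forall>x\<in>?N. l x \<in> carrier k) \<and> (\<forall>x\<in>?N. \<forall>y\<in>?N. l (x \<oplus> y) = l x \<oplus>\<^bsub>k\<^esub> l y) \<and>
     (\<forall>w\<in>carrier W. \<forall>x\<in>?N. l (str w \<otimes> x) = residue W w \<otimes>\<^bsub>k\<^esub> l x) \<and> (\<forall>x\<in>H. l x = \<zero>\<^bsub>k\<^esub>) \<and> l v = \<one>\<^bsub>k\<^esub>"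
    by (rule exists_functional[OF eB(5) eW(5) k str_hom rW.\<pi>_hom rW.\<pi>_surj N H HN _ v]) (rule kill)
  obtain l where l: "\<forall>x\<in>?N. l x \<in> carrier k" "\<forall>x\<in>?N. \<forall>y\<in>?N. l (x \<oplus> y) = l x \<oplus>\<^bsub>k\<^esub> l y"
     "\<forall>w\<in>carrier W. \<forall>x\<in>?N. l (str w \<otimes> x) = residue W w \<otimes>\<^bsub>k\<^esub> l x" "\<forall>x\<in>H. l x = \<zero>\<^bsub>k\<^esub>" "l v = \<one>\<^bsub>k\<^esub>"
    using lex by (elim exE conjE)
  have lc: "l x \<in> carrier k" if "x \<in> ?N" for x using l(1) that by (rule bspec)
  have la: "l (x \<oplus> y) = l x \<oplus>\<^bsub>k\<^esub> l y" if "x \<in> ?N" "y \<in> ?N" for x y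
    using bspec[OF bspec[OF l(2) that(1)] that(2)] .
  have lm: "l (str w \<otimes> x) = residue W w \<otimes>\<^bsub>k\<^esub> l x" if "w \<in> carrier W" "x \<in> ?N" for w x
    using bspec[OF bspec[OF l(3) that(1)] that(2)] .
  have l0: "l x = \<zero>\<^bsub>k\<^esub>" if "x \<in> H" for x using l(4) that by (rule bspec)
  have l_zero: "l \<zero> = \<zero>\<^bsub>k\<^esub>" using l0 H unfolding scaled_subgroup_def by blast
  have in_N: "e \<ominus> str w \<in> ?N" if "e \<in> E0" "w \<in> carrier W" "e \<ominus> str w \<in> max_ideal B" for e w
    using that E0_simps(7)[OF that(1) E0_str[OF that(2)]] by blast
  define wt where "wt e = (SOME w. w \<in> carrier W \<and> e \<ominus> str w \<in> max_ideal B)" for e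
  have wt: "wt e \<in> carrier W" "e \<ominus> str (wt e) \<in> max_ideal B" if "e \<in> E0" for e
  proof -
    have "\<exists>w. w \<in> carrier W \<and> e \<ominus> str w \<in> max_ideal B" using Gr_dec_max[OF E0_max that] by blast
    from someI_ex[OF this] show "wt e \<in> carrier W" "e \<ominus> str (wt e) \<in> max_ideal B" unfolding wt_def by auto
  qed
  define lam where "lam e = (residue W (wt e), l (e \<ominus> str (wt e)))" for e
  have lam: "lam e = (residue W w, l (e \<ominus> str w))"
    if e: "e \<in> E0" and w: "w \<in> carrier W" "e \<ominus> str w \<in> max_ideal B" for e w
  proof -
    note u = wt[OF e]
    have ec: "e \<in> carrier B" using E0_simps(3) e by blast
    have r: "residue W (wt e) = residue W w" using str_same_residue[OF u(1) w(1) ec u(2) w(2)] .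
    have z: "w \<ominus>\<^bsub>W\<^esub> wt e \<in> carrier W" "residue W (w \<ominus>\<^bsub>W\<^esub> wt e) = \<zero>\<^bsub>k\<^esub>"
      using w(1) u(1) r by (simp_all add: rW.\<pi>_minus k.r_right_minus_eq)
    have "str (w \<ominus>\<^bsub>W\<^esub> wt e) \<in> H" by (rule ker[OF z])
    hence z': "str (w \<ominus>\<^bsub>W\<^esub> wt e) \<in> ?N" "l (str (w \<ominus>\<^bsub>W\<^esub> wt e)) = \<zero>\<^bsub>k\<^esub>" using HN l0 by blast+
    have "e \<ominus> str (wt e) = (e \<ominus> str w) \<oplus> str (w \<ominus>\<^bsub>W\<^esub> wt e)"
      unfolding str_minus[OF w(1) u(1)] using ec str_closed[OF w(1)] str_closed[OF u(1)] by algebra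
    hence "l (e \<ominus> str (wt e)) = l (e \<ominus> str w)"
      using la[OF in_N[OF e w] z'(1)] z'(2) lc[OF in_N[OF e w]] by simp
    thus ?thesis unfolding lam_def r by simp
  qed
  let ?A = "B\<lparr>carrier := E0\<rparr>"
  have Acr: "cring ?A" by (rule rB.A.subring_cring[OF E0_sub])
  have lam_hom: "lam \<in> ring_hom ?A D"
  proof (rule ring_hom_memI)
    fix x assume "x \<in> carrier ?A"
    hence x: "x \<in> E0" by simp
    show "lam x \<in> carrier D" using lc[OF in_N[OF x wt[OF x]]] wt(1)[OF x] by (simp add: lam_def dual_simps)
    fix y assume "y \<in> carrier ?A"
    hence y: "y \<in> E0" by simp
    let ?w = "wt x" let ?u = "wt y"
    note w = wt[OF x] note u = wt[OF y]
    note nx = in_N[OF x w] note ny = in_N[OF y u]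
    have c: "x \<in> carrier B" "y \<in> carrier B" "str ?w \<in> carrier B" "str ?u \<in> carrier B"
      using x y E0_simps(3) str_closed w(1) u(1) by auto
    have a: "(x \<oplus> y) \<ominus> str (?w \<oplus>\<^bsub>W\<^esub> ?u) = (x \<ominus> str ?w) \<oplus> (y \<ominus> str ?u)"
      unfolding str_add[OF w(1) u(1)] using c by algebra
    have "lam (x \<oplus> y) = (residue W (?w \<oplus>\<^bsub>W\<^esub> ?u), l ((x \<ominus> str ?w) \<oplus> (y \<ominus> str ?u)))"
      unfolding a[symmetric] using w u mB_simps(3)[OF w(2) u(2)]
      by (intro lam E0_simps(4) x y) (simp_all add: a)
    also have "\<dots> = lam x \<oplus>\<^bsub>D\<^esub> lam y" using la[OF nx ny] w(1) u(1) by (simp add: lam_def dual_simps)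
    finally show "lam (x \<oplus>\<^bsub>?A\<^esub> y) = lam x \<oplus>\<^bsub>D\<^esub> lam y" by simp
    have m: "(x \<otimes> y) \<ominus> str (?w \<otimes>\<^bsub>W\<^esub> ?u) = ((x \<ominus> str ?w) \<otimes> (y \<ominus> str ?u)) \<oplus> (str ?w \<otimes> (y \<ominus> str ?u) \<oplus> str ?u \<otimes> (x \<ominus> str ?w))"
      unfolding str_mult[OF w(1) u(1)] using c by algebra
    have n1: "(x \<ominus> str ?w) \<otimes> (y \<ominus> str ?u) \<in> H" by (rule prod[OF nx ny])
    have n2: "str ?w \<otimes> (y \<ominus> str ?u) \<in> ?N" "str ?u \<otimes> (x \<ominus> str ?w) \<in> ?N"
      using N nx ny w(1) u(1) unfolding scaled_subgroup_def by blast+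
    have n3: "str ?w \<otimes> (y \<ominus> str ?u) \<oplus> str ?u \<otimes> (x \<ominus> str ?w) \<in> ?N"
      using N n2 unfolding scaled_subgroup_def by blast
    have n1': "(x \<ominus> str ?w) \<otimes> (y \<ominus> str ?u) \<in> ?N" using n1 HN by blast
    have mm: "(x \<otimes> y) \<ominus> str (?w \<otimes>\<^bsub>W\<^esub> ?u) \<in> max_ideal B"
      unfolding m using n1' n3 mB_simps(3) by blast
    have "lam (x \<otimes> y) = (residue W (?w \<otimes>\<^bsub>W\<^esub> ?u), l ((x \<otimes> y) \<ominus> str (?w \<otimes>\<^bsub>W\<^esub> ?u)))"
      using w u mm by (intro lam E0_simps(5) x y) simp_all
    also have "l ((x \<otimes> y) \<ominus> str (?w \<otimes>\<^bsub>W\<^esub> ?u)) = residue W ?w \<otimes>\<^bsub>k\<^esub> l (y \<ominus> str ?u) \<oplus>\<^bsub>k\<^esub> residue W ?u \<otimes>\<^bsub>k\<^esub> l (x \<ominus> str ?w)"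
      unfolding m la[OF n1' n3] la[OF n2] l0[OF n1] lm[OF w(1) ny] lm[OF u(1) nx]
      using lc[OF nx] lc[OF ny] w(1) u(1) by simp
    also have "(residue W (?w \<otimes>\<^bsub>W\<^esub> ?u), \<dots>) = lam x \<otimes>\<^bsub>D\<^esub> lam y"
      using lc[OF nx] lc[OF ny] w(1) u(1) by (simp add: lam_def dual_simps k.m_comm)
    finally show "lam (x \<otimes>\<^bsub>?A\<^esub> y) = lam x \<otimes>\<^bsub>D\<^esub> lam y" by simp
  next
    have "\<one> \<ominus> str \<one>\<^bsub>W\<^esub> = \<zero>" unfolding str_one by simp
    hence "lam \<one> = (residue W \<one>\<^bsub>W\<^esub>, l \<zero>)" using lam[OF E0_simps(2), of "\<one>\<^bsub>W\<^esub>"] mB_simps(1) by simp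
    thus "lam \<one>\<^bsub>?A\<^esub> = \<one>\<^bsub>D\<^esub>" using l_zero by (simp add: dual_simps)
  qed
  have "\<exists>\<sigma>\<in>hom \<Gamma> (GL n ?A). \<forall>g\<in>carrier \<Gamma>. GL_map n (\<lambda>x. x) (\<sigma> g) = \<tau> g"
  proof (rule hom_descend[OF \<Gamma> Acr eB(5) incl_hom[OF E0_sub] _ \<tau>_hom])
    show "inj_on (\<lambda>x. x) (carrier ?A)" by (auto simp: inj_on_def)
    show "\<tau> g (a, b) \<in> (\<lambda>x. x) ` carrier ?A" if "g \<in> carrier \<Gamma>" "a < n" "b < n" for g a b
      using \<tau>_in_E0[of "(g, (a, b))"] that by simp
  qed
  then obtain \<sigma>0 where \<sigma>0: "\<sigma>0 \<in> hom \<Gamma> (GL n ?A)" "\<forall>g\<in>carrier \<Gamma>. GL_map n (\<lambda>x. x) (\<sigma>0 g) = \<tau> g" by blast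
  have \<sigma>0_eq: "\<sigma>0 g (a, b) = \<tau> g (a, b)" if "g \<in> carrier \<Gamma>" "a < n" "b < n" for g a b
    using bspec[OF \<sigma>0(2) that(1)] that(2,3) by (metis GL_map_entry)
  define \<sigma> where "\<sigma> g = GL_map n lam (\<sigma>0 g)" for g
  have \<sigma>_entry: "\<sigma> (fst x) (snd x) = lam (\<tau> (fst x) (snd x))" if "x \<in> E" for x
    using that \<sigma>0_eq by (auto simp: \<sigma>_def GL_map_entry)
  have lam\<tau>: "lam (\<tau> (fst x) (snd x)) = (\<rho> (fst x) (snd x), l (ent x))" if x: "x \<in> E" for x
    using lam[OF \<tau>_in_E0[OF x] sec(1)[OF \<rho>_E[OF x]]] ent_mem[OF x] sec(2)[OF \<rho>_E[OF x]] by (simp add: ent_def)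
  have \<sigma>_lift: "\<sigma> \<in> lifts \<Gamma> T n \<rho> D"
    unfolding lifts_iff[OF dual_cring[OF k W] _ T, OF cln_elim(6)[OF k], OF D_coef[unfolded coef_obj_def, THEN conjunct1]]
  proof (intro conjI ballI)
    show "\<sigma> \<in> hom \<Gamma> (GL n D)"
      using hom_compose[OF \<sigma>0(1) GL_map_hom[OF Acr dual_cring[OF k W] lam_hom]] by (simp add: \<sigma>_def[abs_def] o_def)
    show "GL_map n (residue D) (\<sigma> g) = \<rho> g" if g: "g \<in> carrier \<Gamma>" for g
    proof (rule mat_eqI[OF GL_map_ext k.GL_ext[OF hom_in_carrier[OF \<rho> g]]])
      fix a b assume ab: "a < n" "b < n"
      show "GL_map n (residue D) (\<sigma> g) (a, b) = \<rho> g (a, b)"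
        using \<sigma>_entry[of "(g, (a, b))"] lam\<tau>[of "(g, (a, b))"] g ab by (simp add: GL_map_entry dual_simps)
    qed
    show "adic_locally_constant T n D \<sigma>" unfolding adic_locally_constant_def
    proof (intro allI ballI)
      fix j x assume x: "x \<in> topspace T"
      obtain U where U: "openin T U" "x \<in> U" "\<forall>y\<in>U. \<forall>a<n. \<forall>b<n. \<tau> y (a, b) \<ominus> \<tau> x (a, b) \<in> PB i"
        using adic_locally_constantD[OF \<tau>_cont x, of i] by blast
      have "\<sigma> y (a, b) \<ominus>\<^bsub>D\<^esub> \<sigma> x (a, b) \<in> mpow D j" if y: "y \<in> U" and ab: "a < n" "b < n" for y a b
      proof -
        have yE: "(y, (a, b)) \<in> E" "(x, (a, b)) \<in> E" using y x openin_subset[OF U(1)] T ab by auto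
        let ?ty = "\<tau> y (a, b)" let ?tx = "\<tau> x (a, b)"
        have E0t: "?ty \<in> E0" "?tx \<in> E0" using \<tau>_in_E0[OF yE(1)] \<tau>_in_E0[OF yE(2)] by simp_all
        have c: "?ty \<in> carrier B" "?tx \<in> carrier B" using E0t E0_simps(3) by auto
        let ?w = "wt ?tx"
        note w = wt[OF E0t(2)]
        have wc: "str ?w \<in> carrier B" by (rule str_closed[OF w(1)])
        have "?ty \<ominus> ?tx \<in> E0 \<inter> PB i" using U(3) y ab E0_simps(7)[OF E0t] by blast
        hence d: "?ty \<ominus> ?tx \<in> H" using open_H by blast
        hence dN: "?ty \<ominus> ?tx \<in> ?N" using HN by blast
        have e: "?ty \<ominus> str ?w = (?ty \<ominus> ?tx) \<oplus> (?tx \<ominus> str ?w)" using c wc by algebra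
        have "?ty \<ominus> str ?w \<in> max_ideal B" unfolding e using dN w(2) mB_simps(3) by blast
        hence "lam ?ty = (residue W ?w, l (?ty \<ominus> str ?w))" by (rule lam[OF E0t(1) w(1)])
        also have "l (?ty \<ominus> str ?w) = l (?tx \<ominus> str ?w)"
          unfolding e la[OF dN in_N[OF E0t(2) w]] l0[OF d] using lc[OF in_N[OF E0t(2) w]] by simp
        finally have "lam ?ty = lam ?tx" unfolding lam_def[of ?tx] .
        hence eq: "\<sigma> y (a, b) = \<sigma> x (a, b)" using \<sigma>_entry[OF yE(1)] \<sigma>_entry[OF yE(2)] by simp
        have "\<sigma> x (a, b) \<in> carrier D"
          using \<sigma>_entry[OF yE(2)] ring_hom_closed[OF lam_hom, of ?tx] E0t(2) by simp
        hence "\<sigma> y (a, b) \<ominus>\<^bsub>D\<^esub> \<sigma> x (a, b) = \<zero>\<^bsub>D\<^esub>" unfolding eq by (rule cring.minus_self[OF dual_cring[OF k W]])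
        thus ?thesis
          using cring.ideal_simps(1)[OF dual_cring[OF k W] cring.ideal_pow_ideal[OF dual_cring[OF k W]
             cln_elim(6)[OF k, OF D_coef[unfolded coef_obj_def, THEN conjunct1]]]] by simp
      qed
      thus "\<exists>U. openin T U \<and> x \<in> U \<and> (\<forall>y\<in>U. \<forall>a<n. \<forall>b<n. \<sigma> y (a, b) \<ominus>\<^bsub>D\<^esub> \<sigma> x (a, b) \<in> mpow D j)"
        using U(1,2) by blast
    qed
  qed
  have "\<forall>x\<in>S. snd (\<sigma> (fst x) (snd x)) = \<zero>\<^bsub>k\<^esub>"
  proof
    fix x assume x: "x \<in> S"
    hence "ent x \<in> H" "x \<in> E" using entS S by auto
    thus "snd (\<sigma> (fst x) (snd x)) = \<zero>\<^bsub>k\<^esub>" using \<sigma>_entry[of x] lam\<tau>[of x] l0 by simp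
  qed
  note \<sigma>0 = sep[OF \<sigma>_lift this]
  have ent0: "l (ent x) = \<zero>\<^bsub>k\<^esub>" if x: "x \<in> E" for x
    using bspec[OF \<sigma>0 x] unfolding \<sigma>_entry[OF x] lam\<tau>[OF x] by simp
  have "snd (lam e) = \<zero>\<^bsub>k\<^esub>" if "e \<in> E0" for e
    using E0_max that
  proof (induction rule: Gr_induct)
    case (scalar w)
    have "str w \<ominus> str w = \<zero>" using str_closed[OF scalar] by simp
    hence "lam (str w) = (residue W w, l \<zero>)" using lam[OF E0_str[OF scalar] scalar] mB_simps(1) by simp
    thus ?case using l_zero by simp
  next
    case (gen x)
    then obtain y where y: "y \<in> E" "x = ent y" by blast
    have x: "x \<in> max_ideal B" "x \<in> E0" "x \<in> carrier B" using ent_mem[OF y(1)] y(2) Gr_base(3)[OF E0_max] y(1) mB_simps(2) by auto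
    have "x \<ominus> str \<zero>\<^bsub>W\<^esub> = x" using x(3) str_zero by (simp add: rB.A.minus_eq)
    hence "lam x = (residue W \<zero>\<^bsub>W\<^esub>, l x)" using lam[OF x(2), of "\<zero>\<^bsub>W\<^esub>"] x(1) by simp
    thus ?case using ent0[OF y(1)] y(2) by simp
  next
    case (add x y)
    have "lam x \<in> carrier D" "lam y \<in> carrier D"
      using ring_hom_closed[OF lam_hom, of x] ring_hom_closed[OF lam_hom, of y] add(1,2) by simp_all
    thus ?case using ring_hom_add[OF lam_hom, of x y] add by (cases "lam x"; cases "lam y") (simp add: dual_simps)
  next
    case (mult x y)
    have "lam x \<in> carrier D" "lam y \<in> carrier D"
      using ring_hom_closed[OF lam_hom, of x] ring_hom_closed[OF lam_hom, of y] mult(1,2) by simp_all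
    thus ?case using ring_hom_mult[OF lam_hom, of x y] mult by (cases "lam x"; cases "lam y") (simp add: dual_simps)
  qed
  hence "snd (lam v) = \<zero>\<^bsub>k\<^esub>" using v by blast
  moreover have "v \<ominus> str \<zero>\<^bsub>W\<^esub> = v" using v mB_simps(2) str_zero by (simp add: rB.A.minus_eq)
  hence "lam v = (residue W \<zero>\<^bsub>W\<^esub>, l v)" using lam[of v "\<zero>\<^bsub>W\<^esub>"] v by simp
  ultimately show False using l(5) k.one_not_zero by simp
qed

text \<open>The elements of the maximal ideal that lie in the subring generated by \<open>S\<close> up to the next power of
  the maximal ideal of \<open>B\<close> form a subspace \<open>H\<close> as in \<open>large_subspace\<close>: for a product of two elements of the
  maximal ideal, the errors in the factors gain one power.\<close>

lemma approximation:
  assumes S: "S \<subseteq> E"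
    and sep: "\<And>\<sigma>. \<sigma> \<in> lifts \<Gamma> T n \<rho> D ==> \<forall>x\<in>S. snd (\<sigma> (fst x) (snd x)) = \<zero>\<^bsub>k\<^esub> ==> \<forall>x\<in>E. snd (\<sigma> (fst x) (snd x)) = \<zero>\<^bsub>k\<^esub>"
  shows "\<forall>e\<in>E0. \<exists>a\<in>Gr (ent ` S). e \<ominus> a \<in> PB (Suc j)"
proof (induction j)
  case 0
  note Smax = entries_in_max[OF S]
  show ?case
  proof
    fix e assume "e \<in> E0"
    then obtain w where "w \<in> carrier W" "e \<ominus> str w \<in> max_ideal B" using Gr_dec_max[OF E0_max] by blast
    thus "\<exists>a\<in>Gr (ent ` S). e \<ominus> a \<in> PB (Suc 0)" unfolding PB_1 using Gr_base(2)[OF Smax] by blast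
  qed
next
  case (Suc j)
  note Smax = entries_in_max[OF S]
  let ?A0 = "Gr (ent ` S)"
  note A0 = rB.A.subring_simps[OF Gr_base(1)[OF Smax]]
  let ?N = "E0 \<inter> max_ideal B"
  define H where "H = {x \<in> ?N. \<exists>a\<in>?A0. x \<ominus> a \<in> PB (Suc (Suc j))}"
  have PBm: "PB (Suc i) \<subseteq> max_ideal B" for i
    using rB.A.ideal_pow_antimono[OF eB(6), of "Suc 0" "Suc i"] PB_1 by (simp del: ideal_pow.simps)
  have HI: "x \<in> H" if "x \<in> ?N" "a \<in> ?A0" "x \<ominus> a \<in> PB (Suc (Suc j))" for x a using that unfolding H_def by blast
  have A0H: "x \<in> H" if "x \<in> ?N" "x \<in> ?A0" for x
  proof (rule HI[OF that])
    show "x \<ominus> x \<in> PB (Suc (Suc j))"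
      unfolding rB.A.minus_self[OF A0(3)[OF that(2)]] by (rule PB_simps(1))
  qed
  have SE: "ent ` S \<subseteq> E0" using Gr_base(3)[OF E0_max] S by blast
  have mulm: "x \<otimes> y \<in> PB (Suc (Suc j))" if "x \<in> max_ideal B" "y \<in> PB (Suc j)" for x y
    using rB.A.ideal_pow_mult[OF eB(6), of x "Suc 0" y "Suc j"] that PB_1 by (simp del: ideal_pow.simps)
  have "?N \<subseteq> H"
  proof (rule large_subspace[OF S sep])
    show "H \<subseteq> ?N" unfolding H_def by blast
    show "scaled_subgroup B W str H" unfolding scaled_subgroup_def
    proof (intro conjI ballI)
      show "H \<subseteq> carrier B" using E0_simps(3) unfolding H_def by blast
      show "\<zero> \<in> H" using E0_simps(1) mB_simps(1) A0(1) by (intro A0H) auto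
    next
      fix x y assume "x \<in> H" "y \<in> H"
      then obtain a b where ab: "x \<in> ?N" "a \<in> ?A0" "x \<ominus> a \<in> PB (Suc (Suc j))" "y \<in> ?N" "b \<in> ?A0" "y \<ominus> b \<in> PB (Suc (Suc j))"
        unfolding H_def by blast
      have c: "x \<in> carrier B" "y \<in> carrier B" "a \<in> carrier B" "b \<in> carrier B" using ab E0_simps(3) A0(3) by blast+
      have "(x \<ominus> a) \<oplus> (y \<ominus> b) \<in> PB (Suc (Suc j))" by (rule PB_simps(3)[OF ab(3,6)])
      moreover have "(x \<ominus> a) \<oplus> (y \<ominus> b) = (x \<oplus> y) \<ominus> (a \<oplus> b)" using c by algebra
      ultimately have "(x \<oplus> y) \<ominus> (a \<oplus> b) \<in> PB (Suc (Suc j))" by (simp only:)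
      moreover have "x \<oplus> y \<in> ?N" using scaled_subgroup_max ab(1,4) unfolding scaled_subgroup_def by blast
      ultimately show "x \<oplus> y \<in> H" using A0(4)[OF ab(2,5)] HI by blast
    next
      fix w x assume w: "w \<in> carrier W" and "x \<in> H"
      then obtain a where ab: "x \<in> ?N" "a \<in> ?A0" "x \<ominus> a \<in> PB (Suc (Suc j))" unfolding H_def by blast
      have c: "x \<in> carrier B" "a \<in> carrier B" "str w \<in> carrier B" using ab E0_simps(3) A0(3) str_closed[OF w] by blast+
      have "str w \<otimes> (x \<ominus> a) \<in> PB (Suc (Suc j))" by (rule PB_simps(7)[OF ab(3) c(3)])
      moreover have "str w \<otimes> (x \<ominus> a) = str w \<otimes> x \<ominus> str w \<otimes> a" using c by algebra
      ultimately have "str w \<otimes> x \<ominus> str w \<otimes> a \<in> PB (Suc (Suc j))" by (simp only:)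
      moreover have "str w \<otimes> x \<in> ?N" using scaled_subgroup_max ab(1) w unfolding scaled_subgroup_def by blast
      ultimately show "str w \<otimes> x \<in> H" using A0(5)[OF Gr_base(2)[OF Smax w] ab(2)] HI by blast
    qed
    fix x y assume xy: "x \<in> ?N" "y \<in> ?N"
    obtain a b where ab: "a \<in> ?A0" "x \<ominus> a \<in> PB (Suc j)" "b \<in> ?A0" "y \<ominus> b \<in> PB (Suc j)"
      using Suc xy by blast
    have c: "x \<in> carrier B" "y \<in> carrier B" "a \<in> carrier B" "b \<in> carrier B" using ab xy E0_simps(3) A0(3) by blast+
    have "y \<ominus> b \<in> max_ideal B" using ab(4) PBm by blast
    hence "y \<ominus> (y \<ominus> b) \<in> max_ideal B" using xy mB_simps(4)[of y "y \<ominus> b"] by blast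
    hence bm: "b \<in> max_ideal B" unfolding rB.A.minus_minus_cancel[OF c(2,4)] .
    have "x \<otimes> (y \<ominus> b) \<oplus> b \<otimes> (x \<ominus> a) \<in> PB (Suc (Suc j))"
      using xy mulm[OF _ ab(4)] mulm[OF bm ab(2)] PB_simps(3) by blast
    moreover have "x \<otimes> (y \<ominus> b) \<oplus> b \<otimes> (x \<ominus> a) = x \<otimes> y \<ominus> a \<otimes> b" using c by algebra
    ultimately have "x \<otimes> y \<ominus> a \<otimes> b \<in> PB (Suc (Suc j))" by (simp only:)
    moreover have "x \<otimes> y \<in> ?N" using xy E0_simps(5) mB_simps(6) c by blast
    ultimately show "x \<otimes> y \<in> H" using A0(5)[OF ab(1,3)] HI by blast
  next
    fix w x assume w: "w \<in> carrier W" "residue W w = \<zero>\<^bsub>k\<^esub>" and x: "x \<in> ?N"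
    obtain a where a: "a \<in> ?A0" "x \<ominus> a \<in> PB (Suc j)" using Suc x by blast
    have c: "x \<in> carrier B" "a \<in> carrier B" "str w \<in> carrier B" using a x E0_simps(3) A0(3) str_closed[OF w(1)] by blast+
    have "str w \<otimes> (x \<ominus> a) \<in> PB (Suc (Suc j))" by (rule mulm[OF str_ker[OF w] a(2)])
    moreover have "str w \<otimes> (x \<ominus> a) = str w \<otimes> x \<ominus> str w \<otimes> a" using c by algebra
    ultimately have "str w \<otimes> x \<ominus> str w \<otimes> a \<in> PB (Suc (Suc j))" by (simp only:)
    moreover have "str w \<otimes> x \<in> ?N" using scaled_subgroup_max x w(1) unfolding scaled_subgroup_def by blast
    ultimately show "str w \<otimes> x \<in> H" using A0(5)[OF Gr_base(2)[OF Smax w(1)] a(1)] HI by blast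
  next
    fix w assume w: "w \<in> carrier W" "residue W w = \<zero>\<^bsub>k\<^esub>"
    show "str w \<in> H" using str_ker[OF w] E0_str[OF w(1)] Gr_base(2)[OF Smax w(1)] by (intro A0H) auto
  next
    show "E0 \<inter> PB (Suc (Suc j)) \<subseteq> H"
    proof
      fix x assume x: "x \<in> E0 \<inter> PB (Suc (Suc j))"
      hence xP: "x \<in> PB (Suc (Suc j))" "x \<in> E0" by blast+
      have "x \<ominus> \<zero> = x" using E0_simps(3)[OF xP(2)] by (simp add: rB.A.minus_eq)
      hence "x \<ominus> \<zero> \<in> PB (Suc (Suc j))" using xP(1) by (simp only:)
      thus "x \<in> H" using xP PBm A0(1) HI[of x "\<zero>"] by blast
    qed
    show "ent ` S \<subseteq> H" using SE Smax Gr_base(3)[OF Smax] A0H by blast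
  qed
  show ?case
  proof
    fix e assume e: "e \<in> E0"
    then obtain w where w: "w \<in> carrier W" "e \<ominus> str w \<in> max_ideal B" using Gr_dec_max[OF E0_max] by blast
    have "e \<ominus> str w \<in> ?N" using w E0_simps(7)[OF e E0_str[OF w(1)]] by blast
    hence "e \<ominus> str w \<in> H" using \<open>?N \<subseteq> H\<close> by blast
    then obtain a where a: "a \<in> ?A0" "(e \<ominus> str w) \<ominus> a \<in> PB (Suc (Suc j))" unfolding H_def by blast
    have c: "e \<in> carrier B" "str w \<in> carrier B" "a \<in> carrier B" using e E0_simps(3) str_closed w a A0(3) by auto
    have "(e \<ominus> str w) \<ominus> a = e \<ominus> (str w \<oplus> a)" using c by algebra
    hence "e \<ominus> (str w \<oplus> a) \<in> PB (Suc (Suc j))" using a(2) by (simp only:)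
    thus "\<exists>a\<in>?A0. e \<ominus> a \<in> PB (Suc (Suc j))" using A0(4)[OF Gr_base(2)[OF Smax w(1)] a(1)] by blast
  qed
qed

end

lemma (in complete_filtration) limit_unique:
  assumes x: "x \<in> carrier R" "a \<in> carrier R" and s: "\<And>l. s l \<in> carrier R" "\<And>l. x \<ominus> s l \<in> K l" "\<And>l. a \<ominus> s l \<in> K l"
  shows "x = a"
proof -
  have "x \<ominus> a \<in> K l" for l
  proof -
    have "(x \<ominus> s l) \<ominus> (a \<ominus> s l) \<in> K l" using s(2,3) by (rule ideal_simps(4)[OF K_ideal])
    moreover have "(x \<ominus> s l) \<ominus> (a \<ominus> s l) = x \<ominus> a" using x s(1)[of l] by algebra
    ultimately show ?thesis by simp
  qed
  hence "x \<ominus> a = \<zero>" using x by (intro K_separated) auto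
  thus ?thesis using x by simp
qed

context descent
begin

interpretation FB: complete_filtration B PB by (rule eB(3))

text \<open>The residue map of \<open>B\<close>, with its values pulled back to \<open>k\<close>.\<close>

definition res0 where "res0 x = inv_into (carrier k) \<iota> (residue B x)"

lemma res0:
  assumes "residue B x = \<iota> c" "c \<in> carrier k"
  shows "res0 x = c"
  unfolding res0_def assms(1) using inv_into_f_f[OF \<iota>_inj assms(2)] .

lemma Gr_residue:
  assumes H: "H \<subseteq> max_ideal B" and e: "e \<in> Gr H"
  shows "\<exists>w\<in>carrier W. e \<ominus> str w \<in> max_ideal B \<and> residue B e = \<iota> (residue W w)"
proof -
  obtain w where w: "w \<in> carrier W" "e \<ominus> str w \<in> max_ideal B" using Gr_dec_max[OF H e] by blast
  have ec: "e \<in> carrier B" using rB.A.subring_simps(3)[OF Gr_base(1)[OF H] e] .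
  have "residue B e \<ominus>\<^bsub>k'\<^esub> residue B (str w) = \<zero>\<^bsub>k'\<^esub>"
    using w(2) unfolding mB_iff rB.\<pi>_minus[OF ec str_closed[OF w(1)]] by blast
  hence "residue B e = residue B (str w)"
    using rB.\<pi>_simps(1)[OF ec] rB.\<pi>_simps(1)[OF str_closed[OF w(1)]] k'.r_right_minus_eq by simp
  thus ?thesis using w str_residue[OF w(1)] by auto
qed

lemma Gr_residual:
  assumes H: "H \<subseteq> max_ideal B"
  shows "residual (B\<lparr>carrier := Gr H\<rparr>) k res0" "a_kernel (B\<lparr>carrier := Gr H\<rparr>) k res0 = Gr H \<inter> max_ideal B"
proof -
  let ?A = "B\<lparr>carrier := Gr H\<rparr>"
  note S = rB.A.subring_simps[OF Gr_base(1)[OF H]]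
  have A: "cring ?A" by (rule rB.A.subring_cring[OF Gr_base(1)[OF H]])
  have r: "residue B e = \<iota> (res0 e)" "res0 e \<in> carrier k" if "e \<in> Gr H" for e
  proof -
    from Gr_residue[OF H that] obtain w where w: "w \<in> carrier W" "residue B e = \<iota> (residue W w)" by blast
    have c: "residue W w \<in> carrier k" using w(1) by simp
    show "residue B e = \<iota> (res0 e)" "res0 e \<in> carrier k" unfolding res0[OF w(2) c] using w(2) c by auto
  qed
  have "res0 \<in> ring_hom ?A k"
  proof (rule ring_hom_memI)
    fix x y assume "x \<in> carrier ?A"
    hence x: "x \<in> Gr H" by simp
    show "res0 x \<in> carrier k" by (rule r(2)[OF x])
    assume "y \<in> carrier ?A"
    hence y: "y \<in> Gr H" by simp
    have "residue B (x \<otimes> y) = \<iota> (res0 x \<otimes>\<^bsub>k\<^esub> res0 y)"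
      using S(3)[OF x] S(3)[OF y] r[OF x] r[OF y] by (simp add: ring_hom_mult[OF \<iota>])
    from res0[OF this] show "res0 (x \<otimes>\<^bsub>?A\<^esub> y) = res0 x \<otimes>\<^bsub>k\<^esub> res0 y" using r(2)[OF x] r(2)[OF y] by simp
    have "residue B (x \<oplus> y) = \<iota> (res0 x \<oplus>\<^bsub>k\<^esub> res0 y)"
      using S(3)[OF x] S(3)[OF y] r[OF x] r[OF y] by (simp add: ring_hom_add[OF \<iota>])
    from res0[OF this] show "res0 (x \<oplus>\<^bsub>?A\<^esub> y) = res0 x \<oplus>\<^bsub>k\<^esub> res0 y" using r(2)[OF x] r(2)[OF y] by simp
  next
    have "residue B \<one> = \<iota> \<one>\<^bsub>k\<^esub>" by (simp add: ring_hom_one[OF \<iota>])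
    from res0[OF this] show "res0 \<one>\<^bsub>?A\<^esub> = \<one>\<^bsub>k\<^esub>" by simp
  qed
  moreover have "res0 ` carrier ?A = carrier k"
  proof
    show "res0 ` carrier ?A \<subseteq> carrier k" using r(2) by auto
    show "carrier k \<subseteq> res0 ` carrier ?A"
    proof
      fix c assume c: "c \<in> carrier k"
      have "res0 (str (sec c)) = c" using str_residue[OF sec(1)[OF c]] sec(2)[OF c] c by (intro res0) auto
      thus "c \<in> res0 ` carrier ?A" using Gr_base(2)[OF H sec(1)[OF c]] by force
    qed
  qed
  ultimately show "residual ?A k res0" using A k by (simp add: residual_def residual_axioms_def)
  have "e \<in> max_ideal B \<longleftrightarrow> res0 e = \<zero>\<^bsub>k\<^esub>" if e: "e \<in> Gr H" for e
    unfolding mB_iff r(1)[OF e] using \<iota>_zero_iff[OF r(2)[OF e]] S(3)[OF e] by simp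
  thus "a_kernel ?A k res0 = Gr H \<inter> max_ideal B" by (auto simp: a_kernel_def')
qed

text \<open>Modulo the ideal generated by these elements, an element of the kernel comes from \<open>W\<close>, and then
  from the maximal ideal of \<open>W\<close>.\<close>

lemma Gr_max_ideal_generated:
  assumes H: "H \<subseteq> max_ideal B" and G: "G \<subseteq> carrier W" "max_ideal W = Idl\<^bsub>W\<^esub> G"
  shows "Gr H \<inter> max_ideal B = Idl\<^bsub>B\<lparr>carrier := Gr H\<rparr>\<^esub> (str ` G \<union> H)" "str ` G \<union> H \<subseteq> Gr H"
proof -
  let ?A = "B\<lparr>carrier := Gr H\<rparr>"
  interpret A: cring ?A by (rule rB.A.subring_cring[OF Gr_base(1)[OF H]])
  note S = rB.A.subring_simps[OF Gr_base(1)[OF H]]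
  show F: "str ` G \<union> H \<subseteq> Gr H" using G(1) Gr_base(2,3)[OF H] by blast
  hence F': "str ` G \<union> H \<subseteq> carrier ?A" by simp
  let ?J = "Idl\<^bsub>?A\<^esub> (str ` G \<union> H)"
  have Ji: "ideal ?J ?A" by (rule A.genideal_ideal[OF F'])
  have FJ: "str ` G \<union> H \<subseteq> ?J" by (rule A.genideal_self[OF F'])
  have GW: "w \<in> max_ideal W \<longleftrightarrow> w \<in> carrier W \<and> residue W w = \<zero>\<^bsub>k\<^esub>" for w unfolding eW(2) by (rule rW.m_iff)
  have "G \<subseteq> max_ideal W" unfolding G(2) by (rule rW.A.genideal_self[OF G(1)])
  hence "str ` G \<subseteq> max_ideal B" using str_ker GW by blast
  hence Jm: "?J \<subseteq> Gr H \<inter> max_ideal B" using F H by (intro A.genideal_minimal[OF Gr_max_ideal[OF H]]) blast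
  have strhom: "str \<in> ring_hom W ?A"
    using Gr_base(2)[OF H] str_add str_mult str_one by (intro ring_hom_memI) auto
  have WJ: "str w \<in> ?J" if "w \<in> max_ideal W" for w
  proof -
    have "Idl\<^bsub>W\<^esub> G \<subseteq> {w \<in> carrier W. str w \<in> ?J}"
      using G(1) FJ by (intro rW.A.genideal_minimal ideal_preimage[OF eW(5) A.is_cring strhom Ji]) blast
    thus ?thesis using that G(2) by blast
  qed
  show "Gr H \<inter> max_ideal B = ?J"
  proof (rule antisym[OF _ Jm], rule subsetI)
    fix e assume e: "e \<in> Gr H \<inter> max_ideal B"
    have "\<exists>w\<in>carrier W. e \<ominus> str w \<in> ?J" using e FJ by (intro Gr_decompose[OF H _ Ji]) auto
    then obtain w where w: "w \<in> carrier W" "e \<ominus> str w \<in> ?J" by blast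
    have ec: "e \<in> carrier B" "str w \<in> carrier B" using S(3) e str_closed[OF w(1)] by auto
    have "e \<ominus> (e \<ominus> str w) \<in> max_ideal B" using e w(2) Jm mB_simps(4)[of e "e \<ominus> str w"] by blast
    hence "str w \<in> max_ideal B" unfolding rB.A.minus_minus_cancel[OF ec] .
    hence "\<iota> (residue W w) = \<zero>\<^bsub>k'\<^esub>" unfolding mB_iff using str_residue[OF w(1)] by simp
    hence "w \<in> max_ideal W" unfolding GW using w(1) \<iota>_zero_iff[of "residue W w"] by simp
    hence "str w \<oplus>\<^bsub>?A\<^esub> (e \<ominus> str w) \<in> ?J" by (intro A.ideal_simps(3)[OF Ji] WJ w(2))
    moreover have "str w \<oplus> (e \<ominus> str w) = e" using ec by algebra
    ultimately show "e \<in> ?J" by simp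
  qed
qed

text \<open>The algebra \<open>A\<close> is the image in \<open>B\<close> of the completion of \<open>Gr H\<close>, whose maximal ideal is finitely
  generated. Chevalley's theorem for the ideals \<open>A \<inter> PB i\<close> shows that the topology of \<open>A\<close> is induced
  from \<open>B\<close>.\<close>

theorem descent_ring:
  assumes H: "H \<subseteq> max_ideal B" "finite H"
  shows "\<exists>A :: ('u, 'k, 'w) coef_alg. coef_obj k W A \<and> (\<lambda>x. x) \<in> ring_hom A B \<and> Gr H \<subseteq> carrier A \<and>
    (\<forall>x\<in>carrier A. residue B x = \<iota> (residue A x)) \<and> (\<forall>w\<in>carrier W. scalar A w = str w) \<and>
    (\<forall>i. mpow A i \<subseteq> PB i) \<and> (\<forall>l. \<exists>i. carrier A \<inter> PB i \<subseteq> mpow A l)"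
proof -
  let ?A0 = "B\<lparr>carrier := Gr H\<rparr>"
  obtain G where G: "G \<subseteq> carrier W" "finite G" "max_ideal W = Idl\<^bsub>W\<^esub> G" using eW(4) by blast
  note gen = Gr_max_ideal_generated[OF H(1) G(1,3)]
  interpret Q: residual_completion ?A0 k res0 "str ` G \<union> H" str
    using Gr_residual[OF H(1)] gen H(2) G(2)
    by (intro residual_completion.intro residual_completion_axioms.intro) (simp_all del: Un_subset_iff)
  note Gs = rB.A.subring_simps[OF Gr_base(1)[OF H(1)]]
  have "(\<lambda>x. x) ` ideal_pow ?A0 (a_kernel ?A0 k res0) i \<subseteq> PB i" for i
    using Gr_residual(2)[OF H(1)]
    by (intro ideal_pow_image[OF Q.A.is_cring eB(5) incl_hom[OF Gr_base(1)[OF H(1)]] Q.m_ideal eB(6)]) auto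
  from Q.completion_extend[OF eB(3) incl_hom[OF Gr_base(1)[OF H(1)]] this]
  obtain h where h: "h \<in> ring_hom Q.C B" "\<And>a. a \<in> Gr H ==> h (Q.j a) = a" "\<And>i. h ` Q.K i \<subseteq> PB i" by auto
  define A :: "('u, 'k, 'w) coef_alg" where
    "A = \<lparr>carrier = h ` carrier Q.C, monoid.mult = monoid.mult B, monoid.one = \<one>, ring.zero = \<zero>,
      ring.add = add B, residue = res0, scalar = str\<rparr>"
  note C = Q.completion_complete_local_noetherian
  note eC = cln_elim[OF k C(1)]
  interpret rC: residual Q.C k "residue Q.C" by (rule eC(1))
  interpret KC: complete_filtration Q.C Q.K by (rule Q.K_complete)
  have hres: "residue B (h f) = \<iota> (residue Q.C f)" if f: "f \<in> carrier Q.C" for f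
  proof -
    obtain a where a: "a \<in> carrier ?A0" "f \<ominus>\<^bsub>Q.C\<^esub> Q.j a \<in> Q.K 1" using Q.j_dense[OF f] by blast
    have ja: "Q.j a \<in> carrier Q.C" using ring_hom_closed[OF Q.j_hom a(1)] .
    have aB: "a \<in> Gr H" "a \<in> carrier B" using a(1) Gs(3) by auto
    have "residue Q.C (f \<ominus>\<^bsub>Q.C\<^esub> Q.j a) = \<zero>\<^bsub>k\<^esub>" using a(2) unfolding Q.C_kernel[symmetric] rC.m_iff by blast
    hence "residue Q.C f = residue Q.C (Q.j a)" using f ja by (simp add: rC.\<pi>_minus k.r_right_minus_eq)
    hence 1: "residue Q.C f = res0 a" using Q.C_residue_j[OF a(1)] by simp
    have hf: "h f \<in> carrier B" using ring_hom_closed[OF h(1) f] .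
    have "h (f \<ominus>\<^bsub>Q.C\<^esub> Q.j a) \<in> PB (Suc 0)" using h(3)[of 1] a(2) by auto
    hence "h f \<ominus> a \<in> max_ideal B" unfolding ring_hom_minus[OF eC(5) eB(5) h(1) f ja] h(2)[OF aB(1)] PB_1 .
    hence "residue B (h f) = residue B a" unfolding mB_iff using hf aB(2) by (simp add: rB.\<pi>_minus k'.r_right_minus_eq)
    moreover obtain w where w: "w \<in> carrier W" "residue B a = \<iota> (residue W w)" using Gr_residue[OF H(1) aB(1)] by blast
    moreover have "res0 a = residue W w" using w by (intro res0) auto
    ultimately show ?thesis using 1 by simp
  qed
  have hres0: "res0 (h f) = residue Q.C f" if "f \<in> carrier Q.C" for f
    using hres[OF that] that by (intro res0) auto
  have "subring (h ` carrier Q.C) B"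
    by (rule ring_hom_ring.img_is_subring[OF ring_hom_ringI2[OF cring.axioms(1)[OF eC(5)] rB.A.ring_axioms h(1)] ring.carrier_is_subring[OF cring.axioms(1)[OF eC(5)]]])
  note Ss = this
  note S = rB.A.subring_simps[OF Ss]
  have cA: "cring A"
    by (rule cring_image[OF rB.A.subring_cring[OF Ss], of "\<lambda>x. x"]) (simp_all add: A_def)
  have hA: "h \<in> ring_hom Q.C A" "h ` carrier Q.C = carrier A"
    using ring_hom_closed[OF h(1)] ring_hom_add[OF h(1)] ring_hom_mult[OF h(1)] ring_hom_one[OF h(1)]
    by (auto simp: A_def intro!: ring_hom_memI)
  have rA: "residue A \<in> ring_hom A k"
  proof (rule ring_hom_memI)
    fix x y assume "x \<in> carrier A"
    then obtain f where f: "f \<in> carrier Q.C" "x = h f" by (auto simp: A_def)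
    show "residue A x \<in> carrier k" using f by (simp add: A_def hres0)
    assume "y \<in> carrier A"
    then obtain g where g: "g \<in> carrier Q.C" "y = h g" by (auto simp: A_def)
    show "residue A (x \<otimes>\<^bsub>A\<^esub> y) = residue A x \<otimes>\<^bsub>k\<^esub> residue A y"
      using hres0[of "f \<otimes>\<^bsub>Q.C\<^esub> g"] ring_hom_mult[OF h(1) f(1) g(1)] f g by (simp add: A_def hres0)
    show "residue A (x \<oplus>\<^bsub>A\<^esub> y) = residue A x \<oplus>\<^bsub>k\<^esub> residue A y"
      using hres0[of "f \<oplus>\<^bsub>Q.C\<^esub> g"] ring_hom_add[OF h(1) f(1) g(1)] f g by (simp add: A_def hres0)
  next
    show "residue A \<one>\<^bsub>A\<^esub> = \<one>\<^bsub>k\<^esub>"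
      using hres0[of "\<one>\<^bsub>Q.C\<^esub>"] ring_hom_one[OF h(1)] by (simp add: A_def)
  qed
  have incl: "(\<lambda>x. x) \<in> ring_hom A B" using S(3) by (intro ring_hom_memI) (simp_all add: A_def)
  have im: "complete_local_noetherian k A" "mpow A i = h ` Q.K i" for i
  proof -
    have res: "residue A (h f) = residue Q.C f" if "f \<in> carrier Q.C" for f using hres0[OF that] by (simp add: A_def)
    have sep: "b = \<zero>\<^bsub>A\<^esub>" if "b \<in> carrier A" "\<And>i. b \<in> h ` mpow Q.C i" for b
    proof -
      have "b \<in> PB i" for i using that(2)[of i] h(3)[of i] unfolding C(3) by blast
      moreover have "b \<in> carrier B" using ring_hom_closed[OF incl that(1)] .
      ultimately have "b = \<zero>" by (intro FB.K_separated)
      thus ?thesis by (simp add: A_def)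
    qed
    show "complete_local_noetherian k A"
      by (rule cln_image(1)[OF k C(1) cA hA rA res sep])
    show "mpow A i = h ` Q.K i"
      using cln_image(3)[OF k C(1) cA hA rA res sep, of i] unfolding C(3) .
  qed
  have GA: "Gr H \<subseteq> carrier A"
  proof
    fix x assume x: "x \<in> Gr H"
    have "h (Q.j x) \<in> carrier A" using ring_hom_closed[OF hA(1) ring_hom_closed[OF Q.j_hom]] x by simp
    thus "x \<in> carrier A" using h(2)[OF x] by simp
  qed
  have resA: "residue B x = \<iota> (residue A x)" if "x \<in> carrier A" for x
    using that hres hres0 by (auto simp: A_def)
  have "scalar A \<in> ring_hom W A"
    using GA Gr_base(2)[OF H(1)] str_add str_mult str_one by (intro ring_hom_memI) (auto simp: A_def)
  moreover have "residue A (scalar A w) = residue W w" if "w \<in> carrier W" for w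
    using res0[OF str_residue[OF that]] that by (simp add: A_def)
  ultimately have cobj: "coef_obj k W A" using im(1) by (simp add: coef_obj_def)
  have sub: "mpow A i \<subseteq> PB i" for i unfolding im(2) by (rule h(3))
  note eA = cln_elim[OF k im(1)]
  have "\<exists>i. carrier A \<inter> PB i \<subseteq> mpow A l" for l
  proof -
    interpret rA: residual A k "residue A" by (rule eA(1))
    have "\<exists>i. carrier A \<inter> PB i \<subseteq> ideal_pow A (a_kernel A k (residue A)) l"
    proof (rule rA.chevalley)
      show "complete_filtration A (ideal_pow A (a_kernel A k (residue A)))" using eA(3) unfolding eA(2) .
      show "noetherian_ring A" using im(1) by (simp add: complete_local_noetherian_def)
      show "ideal (carrier A \<inter> PB i) A" for i
        using ideal_preimage[OF cA eB(5) incl PB_ideal[of i]] by (simp add: Int_def)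
      show "carrier A \<inter> PB (Suc i) \<subseteq> carrier A \<inter> PB i" for i using FB.K_Suc by blast
      show "ideal_pow A (a_kernel A k (residue A)) i \<subseteq> carrier A \<inter> PB i" for i
        using sub[of i] rA.A.ideal_simps(2)[OF rA.A.ideal_pow_ideal[OF eA(6)]] unfolding eA(2) by blast
      show "x = \<zero>\<^bsub>A\<^esub>" if x: "x \<in> carrier A" "\<And>i. x \<in> carrier A \<inter> PB i" for x
      proof -
        have "x = \<zero>" using x ring_hom_closed[OF incl x(1)] by (intro FB.K_separated) auto
        thus ?thesis by (simp add: A_def)
      qed
    qed
    thus ?thesis unfolding eA(2) .
  qed
  thus ?thesis using cobj incl GA resA sub by (intro exI[of _ A]) (auto simp: A_def)
qed

text \<open>For the separating entries, the elements of \<open>E0\<close> are limits of elements of \<open>A\<close>, and \<open>A\<close> is complete for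
  the topology induced from \<open>B\<close>. So the entries of \<open>\<tau>\<close> lie in \<open>A\<close>, and \<open>\<tau>\<close> is the image of a lift of \<open>\<rho>\<close> over
  an isomorphic copy \<open>B1\<close> of \<open>A\<close>, to which versality applies.\<close>

theorem lift_from_versal:
  "\<exists>\<beta>\<in>ring_hom R B. (\<forall>w\<in>carrier W. \<beta> (scalar R w) = str w) \<and> (\<forall>r\<in>carrier R. residue B (\<beta> r) = \<iota> (residue R r)) \<and>
     strictly_equivalent k' \<Gamma> n B (push_lift n \<beta> \<nu>) \<tau>"
proof -
  obtain S where S: "S \<subseteq> E" "finite S" and sep0: "\<forall>\<sigma>\<in>lifts \<Gamma> T n \<rho> D.
     (\<forall>x\<in>S. snd (\<sigma> (fst x) (snd x)) = \<zero>\<^bsub>k\<^esub>) \<longrightarrow> (\<forall>x\<in>E. snd (\<sigma> (fst x) (snd x)) = \<zero>\<^bsub>k\<^esub>)"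
    using separating_entries by (elim exE conjE)
  have sep: "\<forall>x\<in>E. snd (\<sigma> (fst x) (snd x)) = \<zero>\<^bsub>k\<^esub>"
    if "\<sigma> \<in> lifts \<Gamma> T n \<rho> D" "\<forall>x\<in>S. snd (\<sigma> (fst x) (snd x)) = \<zero>\<^bsub>k\<^esub>" for \<sigma>
    by (rule mp[OF bspec[OF sep0 that(1)] that(2)])
  have approx: "\<exists>a\<in>Gr (ent ` S). e \<ominus> a \<in> PB (Suc l)" if "e \<in> E0" for e l
    by (rule bspec[OF approximation[OF S(1) sep] that])
  have fin: "finite (ent ` S)" using S(2) by simp
  obtain A :: "('u, 'k, 'w) coef_alg" where A: "coef_obj k W A" and incl: "(\<lambda>x. x) \<in> ring_hom A B"
    and GA: "Gr (ent ` S) \<subseteq> carrier A" and resA: "\<forall>x\<in>carrier A. residue B x = \<iota> (residue A x)"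
    and scA: "\<forall>w\<in>carrier W. scalar A w = str w"
    and powA: "\<forall>i. mpow A i \<subseteq> PB i" "\<forall>l. \<exists>i. carrier A \<inter> PB i \<subseteq> mpow A l"
    using descent_ring[OF entries_in_max[OF S(1)] fin] by (elim exE conjE)
  have cA: "complete_local_noetherian k A" using A by (simp add: coef_obj_def)
  note eA = cln_elim[OF k cA]
  interpret FA: complete_filtration A "mpow A" by (rule eA(3))
  have AB: "x \<in> carrier B" if "x \<in> carrier A" for x using ring_hom_closed[OF incl that] .
  have minusA: "x \<ominus>\<^bsub>A\<^esub> y = x \<ominus> y" if "x \<in> carrier A" "y \<in> carrier A" for x y
    using ring_hom_minus[OF eA(5) eB(5) incl that] .
  obtain N where N: "\<And>l. carrier A \<inter> PB (N l) \<subseteq> mpow A l" using powA(2) by metis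
  \<comment> \<open>an increasing bound for \<open>N\<close>, so that approximations to order \<open>M\<close> are Cauchy in \<open>A\<close>\<close>
  define M where "M l = (\<Sum>i\<le>l. N i) + l" for l
  have MN: "N l \<le> M l" for l unfolding M_def by (rule trans_le_add1) (rule member_le_sum, auto)
  have MS: "M l \<le> M (Suc l)" "l \<le> M l" for l by (auto simp: M_def)
  have mono: "PB i' \<subseteq> PB i" if "i \<le> i'" for i i' by (rule rB.A.ideal_pow_antimono[OF eB(6) that])
  have E0A: "e \<in> carrier A" if e: "e \<in> E0" for e
  proof -
    have ec: "e \<in> carrier B" by (rule E0_simps(3)[OF e])
    have "\<exists>a. a \<in> carrier A \<and> e \<ominus> a \<in> PB (M l)" for l
    proof -
      obtain a where a: "a \<in> Gr (ent ` S)" "e \<ominus> a \<in> PB (Suc (M l))" using approx[OF e, of "M l"] by (elim bexE)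
      have "PB (Suc (M l)) \<subseteq> PB (M l)" by (rule FB.K_Suc)
      thus ?thesis using subsetD[OF GA a(1)] subsetD[OF _ a(2)] by (intro exI[of _ a] conjI)
    qed
    hence "\<forall>l. \<exists>a. a \<in> carrier A \<and> e \<ominus> a \<in> PB (M l)" by (rule allI)
    from choice[OF this] obtain s where s0: "\<forall>l. s l \<in> carrier A \<and> e \<ominus> s l \<in> PB (M l)" by (elim exE)
    have s: "s l \<in> carrier A" "e \<ominus> s l \<in> PB (M l)" for l using spec[OF s0, of l] by simp_all
    have "s (Suc l) \<ominus>\<^bsub>A\<^esub> s l \<in> mpow A l" for l
    proof -
      have "(e \<ominus> s l) \<ominus> (e \<ominus> s (Suc l)) \<in> PB (M l)"
        by (rule PB_simps(4)[OF s(2)[of l] subsetD[OF mono[OF MS(1)[of l]] s(2)[of "Suc l"]]])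
      moreover have "(e \<ominus> s l) \<ominus> (e \<ominus> s (Suc l)) = s (Suc l) \<ominus> s l"
        using ec AB[OF s(1)[of l]] AB[OF s(1)[of "Suc l"]] by algebra
      ultimately have "s (Suc l) \<ominus>\<^bsub>A\<^esub> s l \<in> PB (M l)" using minusA[OF s(1) s(1)] by simp
      moreover have "s (Suc l) \<ominus>\<^bsub>A\<^esub> s l \<in> carrier A" by (intro FA.minus_closed s(1))
      ultimately show ?thesis using N[of l] mono[OF MN[of l]] by blast
    qed
    from FA.K_limit[OF s(1) this] obtain a where a: "a \<in> carrier A" "\<And>l. a \<ominus>\<^bsub>A\<^esub> s l \<in> mpow A l" by blast
    have "e = a"
    proof (rule FB.limit_unique[OF ec AB[OF a(1)] AB[OF s(1)]])
      show "e \<ominus> s l \<in> PB l" for l using s(2) mono[OF MS(2)] by blast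
      show "a \<ominus> s l \<in> PB l" for l using a(2)[of l] powA(1) unfolding minusA[OF a(1) s(1)] by blast
    qed
    thus ?thesis using a(1) by simp
  qed
  obtain B1 :: "(nat \<Rightarrow> 'k, 'k, 'w) coef_alg" and h where B1: "coef_obj k W B1" and hA: "h \<in> ring_hom B1 A"
    "inj_on h (carrier B1)" "h ` carrier B1 = carrier A"
    and hpow: "\<forall>i. h ` mpow B1 i = mpow A i"
    and hres: "\<forall>b\<in>carrier B1. residue A (h b) = residue B1 b" and hsc: "\<forall>w\<in>carrier W. h (scalar B1 w) = scalar A w"
    using coef_obj_transport[OF k A] by (elim exE conjE)
  have cB1: "complete_local_noetherian k B1" using B1 by (simp add: coef_obj_def)
  note e1 = cln_elim[OF k cB1]
  interpret r1: residual B1 k "residue B1" by (rule e1(1))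
  have hB: "h \<in> ring_hom B1 B" using ring_hom_trans[OF hA(1) incl] by (simp add: o_def)
  have hc: "h b \<in> carrier A" if "b \<in> carrier B1" for b using ring_hom_closed[OF hA(1) that] .
  have hresB: "residue B (h b) = \<iota> (residue B1 b)" if "b \<in> carrier B1" for b
    using bspec[OF resA hc[OF that]] bspec[OF hres that] by simp
  have ent1: "\<tau> g (a, b) \<in> h ` carrier B1" if "g \<in> carrier \<Gamma>" "a < n" "b < n" for g a b
    using E0A[OF \<tau>_in_E0[of "(g, (a, b))"]] that unfolding hA(3) by simp
  have "\<exists>\<sigma>\<in>hom \<Gamma> (GL n B1). \<forall>g\<in>carrier \<Gamma>. GL_map n h (\<sigma> g) = \<tau> g"
    by (rule hom_descend[OF \<Gamma> e1(5) eB(5) hB hA(2) \<tau>_hom]) (rule ent1)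
  then obtain \<tau>1 where \<tau>1: "\<tau>1 \<in> hom \<Gamma> (GL n B1)" "\<And>g. g \<in> carrier \<Gamma> ==> GL_map n h (\<tau>1 g) = \<tau> g" by blast
  have \<tau>1c: "\<tau>1 g (a, b) \<in> carrier B1" if "g \<in> carrier \<Gamma>" "a < n" "b < n" for g a b
    using r1.A.GL_entry_closed[OF hom_in_carrier[OF \<tau>1(1) that(1)] that(2,3)] .
  have \<tau>1e: "h (\<tau>1 g (a, b)) = \<tau> g (a, b)" if "g \<in> carrier \<Gamma>" "a < n" "b < n" for g a b
    using fun_cong[OF \<tau>1(2)[OF that(1)], of "(a, b)"] that(2,3) by (simp add: GL_map_entry)
  have lift1: "\<tau>1 \<in> lifts \<Gamma> T n \<rho> B1"
    unfolding lifts_iff[OF e1(5,6) T]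
  proof (intro conjI ballI)
    show "\<tau>1 \<in> hom \<Gamma> (GL n B1)" by (rule \<tau>1(1))
    show "GL_map n (residue B1) (\<tau>1 g) = \<rho> g" if g: "g \<in> carrier \<Gamma>" for g
    proof (rule mat_eqI[OF GL_map_ext k.GL_ext[OF hom_in_carrier[OF \<rho> g]]])
      fix a b assume ab: "a < n" "b < n"
      have "\<iota> (residue B1 (\<tau>1 g (a, b))) = \<iota> (\<rho> g (a, b))"
        using hresB[OF \<tau>1c[OF g ab]] \<tau>_residue[of "(g, (a, b))"] g ab by (simp add: \<tau>1e)
      hence "residue B1 (\<tau>1 g (a, b)) = \<rho> g (a, b)"
        by (rule inj_onD[OF \<iota>_inj]) (use \<tau>1c[OF g ab] \<rho>_closed[OF g ab] in simp_all)
      thus "GL_map n (residue B1) (\<tau>1 g) (a, b) = \<rho> g (a, b)" using ab by (simp add: GL_map_entry)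
    qed
    show "adic_locally_constant T n B1 \<tau>1" unfolding adic_locally_constant_def
    proof (intro allI ballI)
      fix i x assume x: "x \<in> topspace T"
      obtain U where U: "openin T U" "x \<in> U" "\<forall>y\<in>U. \<forall>a<n. \<forall>b<n. \<tau> y (a, b) \<ominus> \<tau> x (a, b) \<in> PB (N i)"
        using adic_locally_constantD[OF \<tau>_cont x, of "N i"] by blast
      have "\<tau>1 y (a, b) \<ominus>\<^bsub>B1\<^esub> \<tau>1 x (a, b) \<in> mpow B1 i" if y: "y \<in> U" and ab: "a < n" "b < n" for y a b
      proof -
        have g: "y \<in> carrier \<Gamma>" "x \<in> carrier \<Gamma>" using y x openin_subset[OF U(1)] T by auto
        let ?d = "\<tau>1 y (a, b) \<ominus>\<^bsub>B1\<^esub> \<tau>1 x (a, b)"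
        have dc: "?d \<in> carrier B1" by (intro r1.A.minus_closed \<tau>1c g ab)
        have "h ?d = \<tau> y (a, b) \<ominus> \<tau> x (a, b)"
          unfolding ring_hom_minus[OF e1(5) eB(5) hB \<tau>1c[OF g(1) ab] \<tau>1c[OF g(2) ab]] \<tau>1e[OF g(1) ab] \<tau>1e[OF g(2) ab] ..
        hence "h ?d \<in> carrier A \<inter> PB (N i)" using U(3) y ab hc[OF dc] by simp
        hence "h ?d \<in> h ` mpow B1 i" using N hpow by blast
        then obtain z where z: "z \<in> mpow B1 i" "h ?d = h z" by blast
        have "z \<in> carrier B1" using r1.A.ideal_simps(2)[OF r1.A.ideal_pow_ideal[OF e1(6)] z(1)] .
        thus ?thesis using inj_onD[OF hA(2) z(2) dc] z(1) by simp
      qed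
      thus "\<exists>U. openin T U \<and> x \<in> U \<and> (\<forall>y\<in>U. \<forall>a<n. \<forall>b<n. \<tau>1 y (a, b) \<ominus>\<^bsub>B1\<^esub> \<tau>1 x (a, b) \<in> mpow B1 i)"
        using U(1,2) by blast
    qed
  qed
  obtain \<alpha> where \<alpha>: "\<alpha> \<in> coef_hom W R B1" "strictly_equivalent k \<Gamma> n B1 (push_lift n \<alpha> \<nu>) \<tau>1"
    using versal_ex[OF B1 versal[OF B1] lift1] by blast
  have \<alpha>h: "\<alpha> \<in> ring_hom R B1" "\<forall>w\<in>carrier W. \<alpha> (scalar R w) = scalar B1 w" "\<forall>r\<in>carrier R. residue B1 (\<alpha> r) = residue R r"
    using \<alpha>(1) unfolding coef_hom_iff[OF k R B1] by auto
  have plc: "push_lift n \<alpha> \<nu> g \<in> carrier (GL n B1)" if "g \<in> carrier \<Gamma>" for g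
    using push_lift_in_lifts[OF B1 \<alpha>(1)] that by (auto simp: lifts_def hom_def)
  have "strictly_equivalent k' \<Gamma> n B (push_lift n h (push_lift n \<alpha> \<nu>)) (push_lift n h \<tau>1)"
    by (rule strictly_equivalent_push[OF e1(5) eB(5) hB hresB k.is_cring k'.is_cring \<iota> plc \<alpha>(2)])
  hence "strictly_equivalent k' \<Gamma> n B (push_lift n (\<lambda>r. h (\<alpha> r)) \<nu>) \<tau>"
    by (subst (asm) strictly_equivalent_cong[where \<tau>' = "push_lift n (\<lambda>r. h (\<alpha> r)) \<nu>" and \<sigma>' = \<tau>])
       (simp_all add: push_lift_def GL_map_comp \<tau>1(2))
  moreover have "(\<lambda>r. h (\<alpha> r)) \<in> ring_hom R B" using ring_hom_trans[OF \<alpha>h(1) hB] by (simp add: o_def)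
  moreover have "h (\<alpha> (scalar R w)) = str w" if "w \<in> carrier W" for w
    using \<alpha>h(2) hsc scA that by simp
  moreover have "residue B (h (\<alpha> r)) = \<iota> (residue R r)" if "r \<in> carrier R" for r
    using hresB[OF ring_hom_closed[OF \<alpha>h(1) that]] \<alpha>h(3) that by simp
  ultimately show ?thesis by (intro bexI[of _ "\<lambda>r. h (\<alpha> r)"]) auto
qed

end

section \<open>The completed tensor product is versal\<close>

context base_change
begin

abbreviation \<rho>' where "\<rho>' \<equiv> push_lift n \<iota> \<rho>"

lemmas tres = tensor_residual[OF k k' W W' R \<iota> \<phi> compat]

sublocale t: tensor W W' R \<phi> "scalar R" by (rule tres(1))

abbreviation \<omega> where "\<omega> \<equiv> tensor_residue k' \<iota> W' R"

text \<open>A choice of generators lets the results on completions apply; the completion does not depend on it.\<close>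

definition gens where "gens = (SOME F. F \<subseteq> carrier t.\<Omega> \<and> finite F \<and> tensor_max_ideal W k' \<iota> W' \<phi> R = Idl\<^bsub>t.\<Omega>\<^esub> F)"

sublocale Q: residual_completion t.\<Omega> k' \<omega> gens "\<lambda>x. t.pure x \<one>\<^bsub>R\<^esub>"
proof (intro residual_completion.intro residual_completion_axioms.intro tres(2))
  have "\<exists>F. F \<subseteq> carrier t.\<Omega> \<and> finite F \<and> tensor_max_ideal W k' \<iota> W' \<phi> R = Idl\<^bsub>t.\<Omega>\<^esub> F" using tres(4) by blast
  from someI_ex[OF this]
  show "a_kernel t.\<Omega> k' \<omega> = Idl\<^bsub>t.\<Omega>\<^esub> gens" "gens \<subseteq> carrier t.\<Omega>" "finite gens"
    unfolding gens_def tensor_max_ideal_def by auto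
qed

lemma completed_tensor_eq: "completed_tensor W k' \<iota> W' \<phi> R = Q.C"
  by (simp add: completed_tensor_def Q.C_def completion_alg_def Let_def tensor_max_ideal_def)

lemmas eW' = cln_elim[OF k' W']
sublocale rW': residual W' k' "residue W'" by (rule eW'(1))

lemmas clnC = Q.completion_complete_local_noetherian
lemmas eC = cln_elim[OF k' clnC(1)]

lemma C_scalar: "scalar Q.C x = Q.j (t.pure x \<one>\<^bsub>R\<^esub>)"
  by (simp add: Q.C_def completion_alg_def Q.j_def)

lemma pure_residue: "x \<in> carrier W' ==> r \<in> carrier R ==> \<omega> (t.pure x r) = residue W' x \<otimes>\<^bsub>k'\<^esub> \<iota> (residue R r)"
  by (rule tres(3))

lemma \<iota>_one: "\<iota> \<one>\<^bsub>k\<^esub> = \<one>\<^bsub>k'\<^esub>" by (rule ring_hom_one[OF \<iota>])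

lemma C_coef: "coef_obj k' W' Q.C"
  unfolding coef_obj_def
proof (intro conjI ballI clnC(1))
  show "scalar Q.C \<in> ring_hom W' Q.C"
    using ring_hom_trans[OF t.left_hom Q.j_hom] by (simp add: C_scalar[abs_def] o_def)
  show "residue Q.C (scalar Q.C x) = residue W' x" if "x \<in> carrier W'" for x
    using that by (simp add: C_scalar Q.C_residue_j t.pure_closed pure_residue \<iota>_one)
qed

definition \<psi> where "\<psi> r = Q.j (t.pure \<one>\<^bsub>W'\<^esub> r)"

lemma \<psi>_hom: "\<psi> \<in> ring_hom R Q.C"
  using ring_hom_trans[OF t.right_hom Q.j_hom] by (simp add: \<psi>_def[abs_def] o_def)

lemma \<psi>_closed: "r \<in> carrier R ==> \<psi> r \<in> carrier Q.C" using ring_hom_closed[OF \<psi>_hom] .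

lemma \<psi>_residue: "r \<in> carrier R ==> residue Q.C (\<psi> r) = \<iota> (residue R r)"
  using ring_hom_closed[OF \<iota>] by (simp add: \<psi>_def Q.C_residue_j t.pure_closed pure_residue)

lemma j_pure: "x \<in> carrier W' ==> r \<in> carrier R ==> Q.j (t.pure x r) = scalar Q.C x \<otimes>\<^bsub>Q.C\<^esub> \<psi> r"
  by (simp add: t.left_right[of x r] ring_hom_mult[OF Q.j_hom] t.pure_closed C_scalar \<psi>_def)

definition \<nu>' where "\<nu>' = push_lift n \<psi> \<nu>"

lemma \<nu>'_lift: "\<nu>' \<in> lifts \<Gamma> T n \<rho>' Q.C"
  unfolding \<nu>'_def
  by (rule lifts_push[OF eR(5,6) eC(5,6) T \<psi>_hom
        residue_compatible_imp_local[OF k k' cR(1) clnC(1) \<iota> \<psi>_hom] _ \<nu>]) (simp_all add: \<psi>_residue)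

lemma push_\<nu>': "g \<in> carrier \<Gamma> ==> push_lift n \<alpha> \<nu>' g = push_lift n (\<lambda>r. \<alpha> (\<psi> r)) \<nu> g"
  by (simp add: \<nu>'_def push_lift_def GL_map_comp)

lemma \<nu>'_push_lift:
  assumes B: "coef_obj k' W' B" and \<alpha>: "\<alpha> \<in> coef_hom W' Q.C B"
  shows "push_lift n \<alpha> \<nu>' \<in> lifts \<Gamma> T n \<rho>' B"
proof -
  have B': "complete_local_noetherian k' B" using B by (simp add: coef_obj_def)
  note eB = cln_elim[OF k' B']
  have h: "\<alpha> \<in> ring_hom Q.C B" "\<And>f. f \<in> carrier Q.C ==> residue B (\<alpha> f) = residue Q.C f"
    using \<alpha> unfolding coef_hom_iff[OF k' C_coef B] by auto
  have "\<alpha> ` max_ideal Q.C \<subseteq> max_ideal B"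
    by (rule residue_compatible_imp_local[OF k' k' clnC(1) B' _ h(1), of "\<lambda>x. x"]) (auto simp: ring_hom_def h(2))
  hence "push_lift n \<alpha> \<nu>' \<in> lifts \<Gamma> T n (push_lift n (\<lambda>x. x) \<rho>') B"
    by (intro lifts_push[OF eC(5,6) eB(5,6) T h(1) _ _ \<nu>'_lift] h(2))
  thus ?thesis
    using lifts_cong_rho[of \<Gamma> "push_lift n (\<lambda>x. x) \<rho>'" \<rho>'] by (simp add: push_lift_def GL_map_comp)
qed

abbreviation cls' where "cls' B \<alpha> \<equiv> deformation_class k' \<Gamma> T n \<rho>' B (push_lift n \<alpha> \<nu>')"

text \<open>The maps \<open>scalar B\<close> and \<open>\<beta>\<close> agree on \<open>W\<close> and induce a map on the tensor product. It sends the kernel of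
  the residue map to the maximal ideal of \<open>B\<close>, so it extends to the completion.\<close>

lemma completed_tensor_extend:
  assumes B: "coef_obj k' W' B" and \<beta>: "\<beta> \<in> ring_hom R B"
    and sc: "\<And>w. w \<in> carrier W ==> \<beta> (scalar R w) = scalar B (\<phi> w)"
    and res: "\<And>r. r \<in> carrier R ==> residue B (\<beta> r) = \<iota> (residue R r)"
  shows "\<exists>\<alpha>\<in>coef_hom W' Q.C B. \<forall>r\<in>carrier R. \<alpha> (\<psi> r) = \<beta> r"
proof -
  have B': "complete_local_noetherian k' B" and s: "scalar B \<in> ring_hom W' B"
    and sres: "\<And>x. x \<in> carrier W' ==> residue B (scalar B x) = residue W' x" using B by (auto simp: coef_obj_def)
  note eB = cln_elim[OF k' B']
  interpret rB: residual B k' "residue B" by (rule eB(1))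
  have mB: "x \<in> max_ideal B \<longleftrightarrow> x \<in> carrier B \<and> residue B x = \<zero>\<^bsub>k'\<^esub>" for x unfolding eB(2) by (rule rB.m_iff)
  have sc': "\<And>w. w \<in> carrier W ==> scalar B (\<phi> w) = \<beta> (scalar R w)" using sc by simp
  let ?L = "tensor_lift B (scalar B) \<beta>"
  note L = t.tensor_lift_hom[OF eB(5) s \<beta> sc']
  have Lhom: "?L \<in> ring_hom t.\<Omega> B" by (rule L(1))
  have Lpure: "?L (t.pure x r) = scalar B x \<otimes>\<^bsub>B\<^esub> \<beta> r" if "x \<in> carrier W'" "r \<in> carrier R" for x r
    by (rule L(2)[OF _ that])
  have scl: "scalar B x \<in> carrier B" if "x \<in> carrier W'" for x using ring_hom_closed[OF s that] .
  have \<beta>c: "\<beta> r \<in> carrier B" if "r \<in> carrier R" for r using ring_hom_closed[OF \<beta> that] .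
  have Lc: "?L z \<in> carrier B" if "z \<in> carrier t.\<Omega>" for z using ring_hom_closed[OF Lhom that] .
  have Lres: "residue B (?L z) = \<omega> z" if "z \<in> carrier t.\<Omega>" for z
    using that
  proof (induction rule: t.\<Omega>_induct)
    case zero
    show ?case
      using ring_hom_zero[OF Lhom Q.A.ring_axioms rB.A.ring_axioms] by simp
  next
    case (pure x r)
    thus ?case by (simp add: Lpure pure_residue scl \<beta>c sres res)
  next
    case (diff x y)
    thus ?case by (simp add: ring_hom_minus[OF t.\<Omega>_cring eB(5) Lhom] rB.\<pi>_minus Lc Q.\<pi>_minus)
  qed
  have "?L ` a_kernel t.\<Omega> k' \<omega> \<subseteq> max_ideal B"
    using Lres Lc by (auto simp: mB Q.m_iff)
  hence "?L ` ideal_pow t.\<Omega> (a_kernel t.\<Omega> k' \<omega>) i \<subseteq> mpow B i" for i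
    by (rule ideal_pow_image[OF t.\<Omega>_cring eB(5) Lhom Q.m_ideal eB(6)])
  from Q.completion_extend[OF eB(3) Lhom this]
  obtain H where H: "H \<in> ring_hom Q.C B" "\<And>a. a \<in> carrier t.\<Omega> ==> H (Q.j a) = ?L a"
    "\<And>i. H ` Q.K i \<subseteq> mpow B i" by auto
  have Hc: "H f \<in> carrier B" if "f \<in> carrier Q.C" for f using ring_hom_closed[OF H(1) that] .
  interpret rC: residual Q.C k' "residue Q.C" by (rule eC(1))
  have Hres: "residue B (H f) = residue Q.C f" if f: "f \<in> carrier Q.C" for f
  proof -
    obtain a where a: "a \<in> carrier t.\<Omega>" "f \<ominus>\<^bsub>Q.C\<^esub> Q.j a \<in> Q.K 1" using Q.j_dense[OF f] by blast
    have ja: "Q.j a \<in> carrier Q.C" using ring_hom_closed[OF Q.j_hom a(1)] .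
    have "residue Q.C (f \<ominus>\<^bsub>Q.C\<^esub> Q.j a) = \<zero>\<^bsub>k'\<^esub>" using a(2) unfolding Q.C_kernel[symmetric] rC.m_iff by blast
    hence 1: "residue Q.C f = \<omega> a"
      using f ja Q.C_residue_j[OF a(1)] by (simp add: rC.\<pi>_minus k'.r_right_minus_eq a(1))
    have "H (f \<ominus>\<^bsub>Q.C\<^esub> Q.j a) \<in> mpow B (Suc 0)" using H(3)[of 1] a(2) by auto
    hence "residue B (H f \<ominus>\<^bsub>B\<^esub> ?L a) = \<zero>\<^bsub>k'\<^esub>"
      unfolding rB.A.ideal_pow_1[OF eB(6)] mB ring_hom_minus[OF eC(5) eB(5) H(1) f ja] H(2)[OF a(1)] by blast
    hence "residue B (H f) = residue B (?L a)"
      using Hc[OF f] Lc[OF a(1)] by (simp add: rB.\<pi>_minus k'.r_right_minus_eq)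
    thus ?thesis using 1 Lres[OF a(1)] by simp
  qed
  let ?\<alpha> = "restrict H (carrier Q.C)"
  have "?\<alpha> \<in> coef_hom W' Q.C B"
    unfolding coef_hom_iff[OF k' C_coef B]
  proof (intro conjI ballI)
    show "?\<alpha> \<in> ring_hom Q.C B"
    proof (rule ring_hom_memI)
      fix x y assume xy: "x \<in> carrier Q.C" "y \<in> carrier Q.C"
      show "?\<alpha> (x \<otimes>\<^bsub>Q.C\<^esub> y) = ?\<alpha> x \<otimes>\<^bsub>B\<^esub> ?\<alpha> y" "?\<alpha> (x \<oplus>\<^bsub>Q.C\<^esub> y) = ?\<alpha> x \<oplus>\<^bsub>B\<^esub> ?\<alpha> y"
        using xy Q.C.m_closed[OF xy] Q.C.a_closed[OF xy] by (simp_all add: ring_hom_mult[OF H(1)] ring_hom_add[OF H(1)])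
    qed (use Hc Q.C.one_closed ring_hom_one[OF H(1)] in simp_all)
    show "?\<alpha> (scalar Q.C x) = scalar B x" if "x \<in> carrier W'" for x
    proof -
      have p: "t.pure x \<one>\<^bsub>R\<^esub> \<in> carrier t.\<Omega>" using that by (simp add: t.pure_closed)
      have "H (scalar Q.C x) = scalar B x"
        unfolding C_scalar H(2)[OF p] using that scl by (simp add: Lpure ring_hom_one[OF \<beta>])
      thus ?thesis unfolding C_scalar using ring_hom_closed[OF Q.j_hom p] by simp
    qed
  qed (use Hres in simp_all)
  moreover have "?\<alpha> (\<psi> r) = \<beta> r" if "r \<in> carrier R" for r
  proof -
    have p: "t.pure \<one>\<^bsub>W'\<^esub> r \<in> carrier t.\<Omega>" using that by (simp add: t.pure_closed)
    have "H (\<psi> r) = \<beta> r"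
      unfolding \<psi>_def H(2)[OF p] using that \<beta>c by (simp add: Lpure ring_hom_one[OF s])
    thus ?thesis using \<psi>_closed[OF that] by simp
  qed
  ultimately show ?thesis by blast
qed

theorem completed_tensor_versal:
  assumes B: "coef_obj k' W' B"
  shows "cls' B ` coef_hom W' Q.C B = deformations k' \<Gamma> T n \<rho>' B"
proof
  have B': "complete_local_noetherian k' B" using B by (simp add: coef_obj_def)
  note eB = cln_elim[OF k' B']
  show "cls' B ` coef_hom W' Q.C B \<subseteq> deformations k' \<Gamma> T n \<rho>' B"
    unfolding deformations_def using \<nu>'_push_lift[OF B] by blast
  show "deformations k' \<Gamma> T n \<rho>' B \<subseteq> cls' B ` coef_hom W' Q.C B"
  proof
    fix c assume "c \<in> deformations k' \<Gamma> T n \<rho>' B"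
    then obtain \<tau> where \<tau>: "\<tau> \<in> lifts \<Gamma> T n \<rho>' B" "c = deformation_class k' \<Gamma> T n \<rho>' B \<tau>"
      unfolding deformations_def by blast
    interpret d: descent k W \<Gamma> T n \<rho> R \<nu> k' W' \<iota> \<phi> B \<tau>
      by (intro descent.intro descent_axioms.intro base_change_axioms B \<tau>(1))
    obtain \<beta> where \<beta>: "\<beta> \<in> ring_hom R B" "\<forall>w\<in>carrier W. \<beta> (scalar R w) = d.str w"
      "\<forall>r\<in>carrier R. residue B (\<beta> r) = \<iota> (residue R r)"
      "strictly_equivalent k' \<Gamma> n B (push_lift n \<beta> \<nu>) \<tau>"
      using d.lift_from_versal by blast
    have "\<exists>\<alpha>\<in>coef_hom W' Q.C B. \<forall>r\<in>carrier R. \<alpha> (\<psi> r) = \<beta> r"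
      using \<beta>(2,3) by (intro completed_tensor_extend[OF B \<beta>(1)]) (auto simp: d.str_def)
    then obtain \<alpha> where \<alpha>: "\<alpha> \<in> coef_hom W' Q.C B" "\<And>r. r \<in> carrier R ==> \<alpha> (\<psi> r) = \<beta> r" by blast
    have "push_lift n \<alpha> \<nu>' g = push_lift n \<beta> \<nu> g" if "g \<in> carrier \<Gamma>" for g
      unfolding push_\<nu>'[OF that] unfolding push_lift_def using \<alpha>(2) \<nu>_closed[OF that] by (intro GL_map_cong) auto
    hence "strictly_equivalent k' \<Gamma> n B (push_lift n \<alpha> \<nu>') \<tau>"
      using \<beta>(4) by (subst strictly_equivalent_cong[where \<tau>' = "push_lift n \<beta> \<nu>" and \<sigma>' = \<tau>]) simp_all
    hence "cls' B \<alpha> = c"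
      unfolding \<tau>(2) deformation_class_eq_iff[OF k'.is_cring eB(5) residual.\<pi>_hom[OF eB(1)] \<nu>'_push_lift[OF B \<alpha>(1)] \<tau>(1)] .
    thus "c \<in> cls' B ` coef_hom W' Q.C B" using \<alpha>(1) by blast
  qed
qed

abbreviation D' where "D' \<equiv> dual_numbers k' W'"

lemmas D'_coef = dual_coef(1)[OF k' W']

text \<open>If \<open>d r0 \<noteq> 0\<close>, let \<open>l\<close> be a \<open>k\<close>-linear map \<open>k' \<rightarrow> k\<close> with \<open>l (d r0) = 1\<close>. Then \<open>r \<mapsto> (residue r, l (d r))\<close>
  is a morphism \<open>R \<rightarrow> k[\<epsilon>]\<close>, and the image of \<open>\<nu>\<close> under it is conjugate to the trivial lift, by the matrix
  \<open>1 + \<epsilon> l(V)\<close>. This contradicts injectivity for \<open>R\<close>.\<close>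

lemma inner_derivation_zero:
  assumes d: "\<And>r. r \<in> carrier R ==> d r \<in> carrier k'"
    and add: "\<And>r s. r \<in> carrier R ==> s \<in> carrier R ==> d (r \<oplus>\<^bsub>R\<^esub> s) = d r \<oplus>\<^bsub>k'\<^esub> d s"
    and mult: "\<And>r s. r \<in> carrier R ==> s \<in> carrier R ==> d (r \<otimes>\<^bsub>R\<^esub> s) = \<iota> (residue R r) \<otimes>\<^bsub>k'\<^esub> d s \<oplus>\<^bsub>k'\<^esub> \<iota> (residue R s) \<otimes>\<^bsub>k'\<^esub> d r"
    and scal: "\<And>w. w \<in> carrier W ==> d (scalar R w) = \<zero>\<^bsub>k'\<^esub>"
    and V: "\<And>a b. a < n ==> b < n ==> V (a, b) \<in> carrier k'"
    and inner: "\<And>g a b. g \<in> carrier \<Gamma> ==> a < n ==> b < n ==>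
      (\<Oplus>\<^bsub>k'\<^esub>l\<in>{..<n}. \<iota> (\<rho> g (a, l)) \<otimes>\<^bsub>k'\<^esub> V (l, b)) = d (\<nu> g (a, b)) \<oplus>\<^bsub>k'\<^esub> (\<Oplus>\<^bsub>k'\<^esub>l\<in>{..<n}. \<iota> (\<rho> g (l, b)) \<otimes>\<^bsub>k'\<^esub> V (a, l))"
    and r0: "r0 \<in> carrier R"
  shows "d r0 = \<zero>\<^bsub>k'\<^esub>"
proof (rule ccontr)
  assume nz: "d r0 \<noteq> \<zero>\<^bsub>k'\<^esub>"
  have \<iota>c: "\<iota> c \<in> carrier k'" if "c \<in> carrier k" for c using ring_hom_closed[OF \<iota> that] .
  have idk: "(\<lambda>x. x) \<in> ring_hom k k" by (auto simp: ring_hom_def)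
  have N: "scaled_subgroup k' k \<iota> (carrier k')" "scaled_subgroup k' k \<iota> {\<zero>\<^bsub>k'\<^esub>}"
    using \<iota>c by (auto simp: scaled_subgroup_def)
  have "\<exists>l. (\<forall>x\<in>carrier k'. l x \<in> carrier k) \<and> (\<forall>x\<in>carrier k'. \<forall>y\<in>carrier k'. l (x \<oplus>\<^bsub>k'\<^esub> y) = l x \<oplus>\<^bsub>k\<^esub> l y) \<and>
     (\<forall>w\<in>carrier k. \<forall>x\<in>carrier k'. l (\<iota> w \<otimes>\<^bsub>k'\<^esub> x) = w \<otimes>\<^bsub>k\<^esub> l x) \<and> (\<forall>x\<in>{\<zero>\<^bsub>k'\<^esub>}. l x = \<zero>\<^bsub>k\<^esub>) \<and> l (d r0) = \<one>\<^bsub>k\<^esub>"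
    by (rule exists_functional[OF k'.is_cring k.is_cring k \<iota> idk _ N]) (use nz d[OF r0] \<iota>_zero in auto)
  then obtain l where l: "\<forall>x\<in>carrier k'. l x \<in> carrier k" "\<forall>x\<in>carrier k'. \<forall>y\<in>carrier k'. l (x \<oplus>\<^bsub>k'\<^esub> y) = l x \<oplus>\<^bsub>k\<^esub> l y"
     "\<forall>w\<in>carrier k. \<forall>x\<in>carrier k'. l (\<iota> w \<otimes>\<^bsub>k'\<^esub> x) = w \<otimes>\<^bsub>k\<^esub> l x" "l \<zero>\<^bsub>k'\<^esub> = \<zero>\<^bsub>k\<^esub>" "l (d r0) = \<one>\<^bsub>k\<^esub>"
    by (elim exE conjE) simp
  have lsum: "l (\<Oplus>\<^bsub>k'\<^esub>i\<in>F. f i) = (\<Oplus>\<^bsub>k\<^esub>i\<in>F. l (f i))" if "finite F" "\<And>i. i \<in> F ==> f i \<in> carrier k'" for f and F :: "nat set"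
    using that
  proof (induction F rule: finite_induct)
    case (insert i F)
    have "(\<Oplus>\<^bsub>k'\<^esub>i\<in>insert i F. f i) = f i \<oplus>\<^bsub>k'\<^esub> (\<Oplus>\<^bsub>k'\<^esub>i\<in>F. f i)"
      using insert by (intro k'.finsum_insert) auto
    moreover have "(\<Oplus>\<^bsub>k\<^esub>i\<in>insert i F. l (f i)) = l (f i) \<oplus>\<^bsub>k\<^esub> (\<Oplus>\<^bsub>k\<^esub>i\<in>F. l (f i))"
      using insert l(1) by (intro k.finsum_insert) auto
    moreover have "(\<Oplus>\<^bsub>k'\<^esub>i\<in>F. f i) \<in> carrier k'" "f i \<in> carrier k'" using insert by (auto intro!: k'.finsum_closed)
    ultimately show ?case using l(2) insert by simp
  qed (simp add: l(4))
  have hom: "restrict (\<lambda>r. (residue R r, c r)) (carrier R) \<in> coef_hom W R D"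
    if c: "\<And>r. r \<in> carrier R ==> c r \<in> carrier k"
      "\<And>r s. r \<in> carrier R ==> s \<in> carrier R ==> c (r \<oplus>\<^bsub>R\<^esub> s) = c r \<oplus>\<^bsub>k\<^esub> c s"
      "\<And>r s. r \<in> carrier R ==> s \<in> carrier R ==> c (r \<otimes>\<^bsub>R\<^esub> s) = residue R r \<otimes>\<^bsub>k\<^esub> c s \<oplus>\<^bsub>k\<^esub> c r \<otimes>\<^bsub>k\<^esub> residue R s"
      "\<And>w. w \<in> carrier W ==> c (scalar R w) = \<zero>\<^bsub>k\<^esub>" for c
    unfolding coef_hom_iff[OF k R D_coef]
  proof (intro conjI ballI)
    have "\<one>\<^bsub>R\<^esub> = scalar R \<one>\<^bsub>W\<^esub>" using ring_hom_one[OF cR(2)] by simp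
    hence c1: "c \<one>\<^bsub>R\<^esub> = \<zero>\<^bsub>k\<^esub>" using c(4)[of "\<one>\<^bsub>W\<^esub>"] by simp
    show "restrict (\<lambda>r. (residue R r, c r)) (carrier R) \<in> ring_hom R D"
      by (rule ring_hom_memI) (simp_all add: dual_simps c(1-3) c1)
    show "restrict (\<lambda>r. (residue R r, c r)) (carrier R) (scalar R w) = scalar D w" if "w \<in> carrier W" for w
      using that cR(3)[OF that] ring_hom_closed[OF cR(2) that] by (simp add: dual_simps c(4))
  qed (simp_all add: dual_simps)
  let ?\<gamma> = "restrict (\<lambda>r. (residue R r, l (d r))) (carrier R)"
  let ?\<kappa> = "restrict (\<lambda>r. (residue R r, \<zero>\<^bsub>k\<^esub>)) (carrier R)"
  have \<gamma>: "?\<gamma> \<in> coef_hom W R D"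
  proof (rule hom[of "\<lambda>r. l (d r)"])
    show "l (d r) \<in> carrier k" if "r \<in> carrier R" for r using l(1) d[OF that] by blast
    fix r s assume rs: "r \<in> carrier R" "s \<in> carrier R"
    show "l (d (r \<oplus>\<^bsub>R\<^esub> s)) = l (d r) \<oplus>\<^bsub>k\<^esub> l (d s)" unfolding add[OF rs] using l(2) d rs by blast
    have "l (d (r \<otimes>\<^bsub>R\<^esub> s)) = l (\<iota> (residue R r) \<otimes>\<^bsub>k'\<^esub> d s) \<oplus>\<^bsub>k\<^esub> l (\<iota> (residue R s) \<otimes>\<^bsub>k'\<^esub> d r)"
      unfolding mult[OF rs] using l(2) d rs \<iota>c by simp
    thus "l (d (r \<otimes>\<^bsub>R\<^esub> s)) = residue R r \<otimes>\<^bsub>k\<^esub> l (d s) \<oplus>\<^bsub>k\<^esub> l (d r) \<otimes>\<^bsub>k\<^esub> residue R s"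
      using l(1,3) d rs by (simp add: k.m_comm)
  qed (simp add: scal l(4))
  have \<gamma>0: "?\<kappa> \<in> coef_hom W R D" by (rule hom[of "\<lambda>_. \<zero>\<^bsub>k\<^esub>"]) simp_all
  note pl = push_lift_in_lifts[OF D_coef \<gamma>] push_lift_in_lifts[OF D_coef \<gamma>0]
  have GLc: "push_lift n ?\<gamma> \<nu> g \<in> carrier (GL n D)" "push_lift n ?\<kappa> \<nu> g \<in> carrier (GL n D)" if "g \<in> carrier \<Gamma>" for g
    using pl that by (auto simp: lifts_def hom_def)
  have eq: "\<zero>\<^bsub>k\<^esub> \<oplus>\<^bsub>k\<^esub> (\<Oplus>\<^bsub>k\<^esub>i\<in>{..<n}. \<rho> g (a, i) \<otimes>\<^bsub>k\<^esub> l (V (i, b))) =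
       l (d (\<nu> g (a, b))) \<oplus>\<^bsub>k\<^esub> (\<Oplus>\<^bsub>k\<^esub>i\<in>{..<n}. l (V (a, i)) \<otimes>\<^bsub>k\<^esub> \<rho> g (i, b))"
    if g: "g \<in> carrier \<Gamma>" and ab: "a < n" "b < n" for g a b
  proof -
    have 1: "l (\<Oplus>\<^bsub>k'\<^esub>i\<in>{..<n}. \<iota> (\<rho> g (a, i)) \<otimes>\<^bsub>k'\<^esub> V (i, b)) = (\<Oplus>\<^bsub>k\<^esub>i\<in>{..<n}. \<rho> g (a, i) \<otimes>\<^bsub>k\<^esub> l (V (i, b)))"
      using \<iota>c \<rho>_closed[OF g] V ab l(1,3) by (subst lsum) (auto intro!: k.finsum_cong')
    have 2: "l (\<Oplus>\<^bsub>k'\<^esub>i\<in>{..<n}. \<iota> (\<rho> g (i, b)) \<otimes>\<^bsub>k'\<^esub> V (a, i)) = (\<Oplus>\<^bsub>k\<^esub>i\<in>{..<n}. l (V (a, i)) \<otimes>\<^bsub>k\<^esub> \<rho> g (i, b))"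
      using \<iota>c \<rho>_closed[OF g] V ab l(1,3) by (subst lsum) (auto intro!: k.finsum_cong' simp: k.m_comm)
    have c: "(\<Oplus>\<^bsub>k'\<^esub>i\<in>{..<n}. \<iota> (\<rho> g (i, b)) \<otimes>\<^bsub>k'\<^esub> V (a, i)) \<in> carrier k'" "d (\<nu> g (a, b)) \<in> carrier k'"
      using \<iota>c \<rho>_closed[OF g] V ab d[OF \<nu>_closed[OF g ab]] by (auto intro!: k'.finsum_closed)
    have "(\<Oplus>\<^bsub>k\<^esub>i\<in>{..<n}. \<rho> g (a, i) \<otimes>\<^bsub>k\<^esub> l (V (i, b))) \<in> carrier k"
      using \<rho>_closed[OF g] V ab l(1) by (intro k.finsum_closed) auto
    thus ?thesis using l(2) c unfolding 1[symmetric] 2[symmetric] inner[OF g ab] by simp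
  qed
  have "strictly_equivalent k \<Gamma> n D (push_lift n ?\<gamma> \<nu>) (push_lift n ?\<kappa> \<nu>)"
    unfolding dual_strictly_equivalent_iff[OF k W, of \<Gamma> "push_lift n ?\<gamma> \<nu>" n "push_lift n ?\<kappa> \<nu>" \<rho>,
      OF GLc dual_lift_fst(1)[OF pl(1)] dual_lift_fst(1)[OF pl(2)], simplified]
  proof (intro bexI[of _ "\<lambda>p. l (V p)"] ballI allI impI)
    show "(\<lambda>p. l (V p)) \<in> {..<n} \<times> {..<n} \<rightarrow> carrier k" using V l(1) by auto
    show "snd (push_lift n ?\<kappa> \<nu> g (a, b)) \<oplus>\<^bsub>k\<^esub> (\<Oplus>\<^bsub>k\<^esub>i\<in>{..<n}. \<rho> g (a, i) \<otimes>\<^bsub>k\<^esub> l (V (i, b))) =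
       snd (push_lift n ?\<gamma> \<nu> g (a, b)) \<oplus>\<^bsub>k\<^esub> (\<Oplus>\<^bsub>k\<^esub>i\<in>{..<n}. l (V (a, i)) \<otimes>\<^bsub>k\<^esub> \<rho> g (i, b))"
      if "g \<in> carrier \<Gamma>" "a < n" "b < n" for g a b
      using eq[OF that] \<nu>_closed[OF that] that by (simp add: push_lift_def GL_map_entry)
  qed
  hence "deformation_class k \<Gamma> T n \<rho> D (push_lift n ?\<gamma> \<nu>) = deformation_class k \<Gamma> T n \<rho> D (push_lift n ?\<kappa> \<nu>)"
    unfolding deformation_class_eq_iff[OF k.is_cring dual_cring[OF k W] residual.\<pi>_hom[OF dual_residual[OF k W]] pl] .
  hence "?\<gamma> = ?\<kappa>" by (rule inj_onD[OF bij_betw_imp_inj_on[OF dual_bij] _ \<gamma> \<gamma>0])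
  hence "?\<gamma> r0 = ?\<kappa> r0" by simp
  thus False using l(5) r0 k.one_not_zero by simp
qed

text \<open>A morphism into the dual numbers is determined by a derivation, the \<open>\<epsilon>\<close>-part of its restriction
  to \<open>R\<close>.\<close>

lemma dual_point:
  fixes \<alpha> defines "s \<equiv> \<lambda>r. snd (\<alpha> (\<psi> r))"
  assumes \<alpha>: "\<alpha> \<in> coef_hom W' Q.C D'"
  shows "\<alpha> \<in> extensional (carrier Q.C)" "\<alpha> \<in> ring_hom Q.C D'"
    "\<And>x. x \<in> carrier W' ==> \<alpha> (scalar Q.C x) = (residue W' x, \<zero>\<^bsub>k'\<^esub>)"
    "\<And>f. f \<in> carrier Q.C ==> fst (\<alpha> f) = residue Q.C f"
    "\<And>r. r \<in> carrier R ==> \<alpha> (\<psi> r) = (\<iota> (residue R r), s r)" "\<And>r. r \<in> carrier R ==> s r \<in> carrier k'"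
    "\<And>q r. q \<in> carrier R ==> r \<in> carrier R ==> s (q \<oplus>\<^bsub>R\<^esub> r) = s q \<oplus>\<^bsub>k'\<^esub> s r"
    "\<And>q r. q \<in> carrier R ==> r \<in> carrier R ==>
       s (q \<otimes>\<^bsub>R\<^esub> r) = \<iota> (residue R q) \<otimes>\<^bsub>k'\<^esub> s r \<oplus>\<^bsub>k'\<^esub> s q \<otimes>\<^bsub>k'\<^esub> \<iota> (residue R r)"
    "\<And>w. w \<in> carrier W ==> s (scalar R w) = \<zero>\<^bsub>k'\<^esub>"
    "\<And>g a b. g \<in> carrier \<Gamma> ==> a < n ==> b < n ==> push_lift n \<alpha> \<nu>' g (a, b) = (\<iota> (\<rho> g (a, b)), s (\<nu> g (a, b)))"
proof -
  show "\<alpha> \<in> extensional (carrier Q.C)" and hom: "\<alpha> \<in> ring_hom Q.C D'"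
    using \<alpha> unfolding coef_hom_iff[OF k' C_coef D'_coef] by auto
  show "\<alpha> (scalar Q.C x) = (residue W' x, \<zero>\<^bsub>k'\<^esub>)" if "x \<in> carrier W'" for x
    using \<alpha> that unfolding coef_hom_iff[OF k' C_coef D'_coef] by (auto simp: dual_simps)
  show res: "fst (\<alpha> f) = residue Q.C f" if "f \<in> carrier Q.C" for f
    using \<alpha> that unfolding coef_hom_iff[OF k' C_coef D'_coef] by (auto simp: dual_simps)
  show a: "\<alpha> (\<psi> r) = (\<iota> (residue R r), s r)" "s r \<in> carrier k'" if "r \<in> carrier R" for r
    using res[OF \<psi>_closed[OF that]] \<psi>_residue[OF that] ring_hom_closed[OF hom \<psi>_closed[OF that]]
    by (auto simp: s_def dual_simps prod_eq_iff)
  have homR: "(\<lambda>r. \<alpha> (\<psi> r)) \<in> ring_hom R D'" using ring_hom_trans[OF \<psi>_hom hom] by (simp add: o_def)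
  fix q r assume "q \<in> carrier R" "r \<in> carrier R"
  thus "s (q \<oplus>\<^bsub>R\<^esub> r) = s q \<oplus>\<^bsub>k'\<^esub> s r"
    "s (q \<otimes>\<^bsub>R\<^esub> r) = \<iota> (residue R q) \<otimes>\<^bsub>k'\<^esub> s r \<oplus>\<^bsub>k'\<^esub> s q \<otimes>\<^bsub>k'\<^esub> \<iota> (residue R r)"
    using ring_hom_add[OF homR, of q r] ring_hom_mult[OF homR, of q r] by (simp_all add: a(1) dual_simps)
next
  fix w assume w: "w \<in> carrier W"
  have "\<psi> (scalar R w) = scalar Q.C (\<phi> w)" using t.left_right_scalar[OF w] by (simp add: \<psi>_def C_scalar)
  thus "s (scalar R w) = \<zero>\<^bsub>k'\<^esub>"
    using \<alpha> ring_hom_closed[OF \<phi> w] unfolding coef_hom_iff[OF k' C_coef D'_coef] by (auto simp: s_def dual_simps)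
next
  fix g a b assume g: "g \<in> carrier \<Gamma>" and ab: "a < n" "b < n"
  have "fst (\<alpha> (\<psi> (\<nu> g (a, b)))) = \<iota> (\<rho> g (a, b))"
    using \<alpha> \<nu>_closed[OF g ab] \<nu>_residue[OF g ab] \<psi>_closed \<psi>_residue
    unfolding coef_hom_iff[OF k' C_coef D'_coef] by (auto simp: dual_simps)
  thus "push_lift n \<alpha> \<nu>' g (a, b) = (\<iota> (\<rho> g (a, b)), s (\<nu> g (a, b)))"
    unfolding push_\<nu>'[OF g] using ab by (simp add: push_lift_def GL_map_entry s_def prod_eq_iff)
qed

text \<open>The \<open>\<epsilon>\<close>-parts of the two morphisms differ on \<open>R\<close> by a derivation as in \<open>inner_derivation_zero\<close>. So the
  morphisms agree on \<open>R\<close> and on \<open>W'\<close>, hence on the dense image of the tensor product.\<close>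

lemma completed_tensor_dual_inj:
  "inj_on (cls' D') (coef_hom W' Q.C D')"
proof (rule inj_onI)
  fix \<alpha>1 \<alpha>2 assume \<alpha>: "\<alpha>1 \<in> coef_hom W' Q.C D'" "\<alpha>2 \<in> coef_hom W' Q.C D'"
    and eq: "cls' D' \<alpha>1 = cls' D' \<alpha>2"
  note pl = \<nu>'_push_lift[OF D'_coef \<alpha>(1)] \<nu>'_push_lift[OF D'_coef \<alpha>(2)]
  have \<iota>c: "\<iota> c \<in> carrier k'" if "c \<in> carrier k" for c using ring_hom_closed[OF \<iota> that] .
  define s1 where "s1 r = snd (\<alpha>1 (\<psi> r))" for r
  define s2 where "s2 r = snd (\<alpha>2 (\<psi> r))" for r
  note P1 = dual_point[OF \<alpha>(1), folded s1_def] and P2 = dual_point[OF \<alpha>(2), folded s2_def]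
  note h1 = P1(1-4) and h2 = P2(1-4) and a1 = P1(5,6) and a2 = P2(5,6)
  have GLc: "push_lift n \<alpha>1 \<nu>' g \<in> carrier (GL n D')" "push_lift n \<alpha>2 \<nu>' g \<in> carrier (GL n D')" if "g \<in> carrier \<Gamma>" for g
    using pl that by (auto simp: lifts_def hom_def)
  note ent = P1(10) P2(10)
  have \<rho>'e: "\<rho>' g (a, b) = \<iota> (\<rho> g (a, b))" if "a < n" "b < n" for g a b
    using that by (simp add: push_lift_def GL_map_entry)
  have "strictly_equivalent k' \<Gamma> n D' (push_lift n \<alpha>1 \<nu>') (push_lift n \<alpha>2 \<nu>')"
    using eq deformation_class_eq_iff[OF k'.is_cring dual_cring[OF k' W'] residual.\<pi>_hom[OF dual_residual[OF k' W']] pl] by simp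
  hence "\<exists>V\<in>{..<n} \<times> {..<n} \<rightarrow> carrier k'. \<forall>g\<in>carrier \<Gamma>. \<forall>a<n. \<forall>b<n.
       snd (push_lift n \<alpha>2 \<nu>' g (a, b)) \<oplus>\<^bsub>k'\<^esub> (\<Oplus>\<^bsub>k'\<^esub>l\<in>{..<n}. \<rho>' g (a, l) \<otimes>\<^bsub>k'\<^esub> V (l, b)) =
       snd (push_lift n \<alpha>1 \<nu>' g (a, b)) \<oplus>\<^bsub>k'\<^esub> (\<Oplus>\<^bsub>k'\<^esub>l\<in>{..<n}. V (a, l) \<otimes>\<^bsub>k'\<^esub> \<rho>' g (l, b))"
    by (subst (asm) dual_strictly_equivalent_iff[OF k' W', of \<Gamma> "push_lift n \<alpha>1 \<nu>'" n "push_lift n \<alpha>2 \<nu>'" \<rho>'])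
       (simp_all add: GLc ent \<rho>'e)
  then obtain V where V: "V \<in> {..<n} \<times> {..<n} \<rightarrow> carrier k'" and V2: "\<And>g a b. g \<in> carrier \<Gamma> ==> a < n ==> b < n ==>
       snd (push_lift n \<alpha>2 \<nu>' g (a, b)) \<oplus>\<^bsub>k'\<^esub> (\<Oplus>\<^bsub>k'\<^esub>l\<in>{..<n}. \<rho>' g (a, l) \<otimes>\<^bsub>k'\<^esub> V (l, b)) =
       snd (push_lift n \<alpha>1 \<nu>' g (a, b)) \<oplus>\<^bsub>k'\<^esub> (\<Oplus>\<^bsub>k'\<^esub>l\<in>{..<n}. V (a, l) \<otimes>\<^bsub>k'\<^esub> \<rho>' g (l, b))" by blast
  have Vc: "V (a, b) \<in> carrier k'" if "a < n" "b < n" for a b using V that by auto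
  define d where "d r = s1 r \<ominus>\<^bsub>k'\<^esub> s2 r" for r
  have dz: "d r = \<zero>\<^bsub>k'\<^esub>" if r: "r \<in> carrier R" for r
  proof (rule inner_derivation_zero[where d = d and V = V, OF _ _ _ _ _ _ r])
    show "V (a, b) \<in> carrier k'" if "a < n" "b < n" for a b using Vc[OF that] .
    show "d r \<in> carrier k'" if "r \<in> carrier R" for r using a1(2)[OF that] a2(2)[OF that] by (simp add: d_def)
    show "d (r \<oplus>\<^bsub>R\<^esub> s) = d r \<oplus>\<^bsub>k'\<^esub> d s" if rs: "r \<in> carrier R" "s \<in> carrier R" for r s
      unfolding d_def P1(7)[OF rs] P2(7)[OF rs] using a1(2)[OF rs(1)] a2(2)[OF rs(1)] a1(2)[OF rs(2)] a2(2)[OF rs(2)] by algebra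
    show "d (r \<otimes>\<^bsub>R\<^esub> s) = \<iota> (residue R r) \<otimes>\<^bsub>k'\<^esub> d s \<oplus>\<^bsub>k'\<^esub> \<iota> (residue R s) \<otimes>\<^bsub>k'\<^esub> d r"
      if rs: "r \<in> carrier R" "s \<in> carrier R" for r s
    proof -
      have c: "\<iota> (residue R r) \<in> carrier k'" "\<iota> (residue R s) \<in> carrier k'" using \<iota>c rs by simp_all
      show ?thesis
        unfolding d_def P1(8)[OF rs] P2(8)[OF rs] using c a1(2)[OF rs(1)] a2(2)[OF rs(1)] a1(2)[OF rs(2)] a2(2)[OF rs(2)] by algebra
    qed
    show "d (scalar R w) = \<zero>\<^bsub>k'\<^esub>" if "w \<in> carrier W" for w using P1(9)[OF that] P2(9)[OF that] by (simp add: d_def k'.minus_eq)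
    fix g a b assume g: "g \<in> carrier \<Gamma>" and ab: "a < n" "b < n"
    let ?P = "\<Oplus>\<^bsub>k'\<^esub>l\<in>{..<n}. \<iota> (\<rho> g (a, l)) \<otimes>\<^bsub>k'\<^esub> V (l, b)" let ?Q = "\<Oplus>\<^bsub>k'\<^esub>l\<in>{..<n}. \<iota> (\<rho> g (l, b)) \<otimes>\<^bsub>k'\<^esub> V (a, l)"
    let ?r = "\<nu> g (a, b)"
    have c: "?P \<in> carrier k'" "?Q \<in> carrier k'" "s1 ?r \<in> carrier k'" "s2 ?r \<in> carrier k'"
      using \<iota>c \<rho>_closed[OF g] Vc ab a1(2)[OF \<nu>_closed[OF g ab]] a2(2)[OF \<nu>_closed[OF g ab]] by (auto intro!: k'.finsum_closed)
    have P: "(\<Oplus>\<^bsub>k'\<^esub>l\<in>{..<n}. \<rho>' g (a, l) \<otimes>\<^bsub>k'\<^esub> V (l, b)) = ?P"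
      using ab \<iota>c \<rho>_closed[OF g] Vc by (intro k'.finsum_cong') (auto simp: \<rho>'e)
    have Q: "(\<Oplus>\<^bsub>k'\<^esub>l\<in>{..<n}. V (a, l) \<otimes>\<^bsub>k'\<^esub> \<rho>' g (l, b)) = ?Q"
      using ab \<iota>c \<rho>_closed[OF g] Vc by (intro k'.finsum_cong') (auto simp: \<rho>'e k'.m_comm)
    have e: "s2 ?r \<oplus>\<^bsub>k'\<^esub> ?P = s1 ?r \<oplus>\<^bsub>k'\<^esub> ?Q"
      using V2[OF g ab] unfolding P Q ent[OF g ab] by simp
    have cancel: "p = (s \<oplus>\<^bsub>k'\<^esub> p) \<ominus>\<^bsub>k'\<^esub> s" if "s \<in> carrier k'" "p \<in> carrier k'" for s p using that by algebra
    have swap: "(s \<oplus>\<^bsub>k'\<^esub> q) \<ominus>\<^bsub>k'\<^esub> u = (s \<ominus>\<^bsub>k'\<^esub> u) \<oplus>\<^bsub>k'\<^esub> q" if "s \<in> carrier k'" "q \<in> carrier k'" "u \<in> carrier k'" for s q u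
      using that by algebra
    have "?P = (s1 ?r \<oplus>\<^bsub>k'\<^esub> ?Q) \<ominus>\<^bsub>k'\<^esub> s2 ?r" by (subst cancel[OF c(4,1)]) (simp only: e)
    also have "\<dots> = d ?r \<oplus>\<^bsub>k'\<^esub> ?Q" unfolding d_def by (rule swap[OF c(3,2,4)])
    finally show "?P = d ?r \<oplus>\<^bsub>k'\<^esub> ?Q" .
  qed
  have \<psi>eq: "\<alpha>1 (\<psi> r) = \<alpha>2 (\<psi> r)" if "r \<in> carrier R" for r
    using dz[OF that] a1[OF that] a2[OF that] by (simp add: d_def k'.r_right_minus_eq)
  have jc: "Q.j z \<in> carrier Q.C" if "z \<in> carrier t.\<Omega>" for z using ring_hom_closed[OF Q.j_hom that] .
  have jeq: "\<alpha>1 (Q.j z) = \<alpha>2 (Q.j z)" if "z \<in> carrier t.\<Omega>" for z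
    using that
  proof (induction rule: t.\<Omega>_induct)
    case zero
    show ?case
      using ring_hom_zero[OF Q.j_hom Q.A.ring_axioms cring.axioms(1)[OF eC(5)]]
        ring_hom_zero[OF h1(2) cring.axioms(1)[OF eC(5)] cring.axioms(1)[OF dual_cring[OF k' W']]]
        ring_hom_zero[OF h2(2) cring.axioms(1)[OF eC(5)] cring.axioms(1)[OF dual_cring[OF k' W']]] by simp
  next
    case (pure x r)
    have "scalar Q.C x \<in> carrier Q.C" unfolding C_scalar using pure by (intro jc t.pure_closed) simp_all
    thus ?case
      using pure \<psi>_closed[of r] by (simp add: j_pure ring_hom_mult[OF h1(2)] ring_hom_mult[OF h2(2)] h1(3) h2(3) \<psi>eq)
  next
    case (diff x y)
    thus ?case
      by (simp add: ring_hom_minus[OF t.\<Omega>_cring eC(5) Q.j_hom] ring_hom_minus[OF eC(5) dual_cring[OF k' W'] h1(2)]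
          ring_hom_minus[OF eC(5) dual_cring[OF k' W'] h2(2)] jc)
  qed
  have D'cln: "complete_local_noetherian k' D'" using D'_coef by (simp add: coef_obj_def)
  note eD = cln_elim[OF k' D'cln]
  have K: "\<alpha> ` Q.K i \<subseteq> mpow D' i"
    if "\<alpha> \<in> ring_hom Q.C D'" "\<And>f. f \<in> carrier Q.C ==> fst (\<alpha> f) = residue Q.C f" for \<alpha> i
  proof -
    have "\<alpha> ` max_ideal Q.C \<subseteq> max_ideal D'"
      by (rule residue_compatible_imp_local[OF k' k' clnC(1) D'cln _ that(1), of "\<lambda>x. x"])
         (auto simp: ring_hom_def that(2) dual_simps)
    from ideal_pow_image[OF eC(5) eD(5) that(1) eC(6) eD(6) this, of i] show ?thesis unfolding clnC(3) .
  qed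
  have "\<alpha>1 f = \<alpha>2 f" if f: "f \<in> carrier Q.C" for f
    by (rule Q.completion_hom_unique[OF eD(3) h1(2) h2(2) K[OF h1(2,4)] K[OF h2(2,4)] jeq f])
  thus "\<alpha>1 = \<alpha>2" by (rule extensionalityI[OF h1(1) h2(1)])
qed

theorem completed_tensor_versal_deformation_ring:
  "versal_deformation_ring TYPE('u) k' W' \<Gamma> T n \<rho>' Q.C"
  unfolding versal_deformation_ring_def
proof (intro conjI bexI[OF _ \<nu>'_lift] allI impI C_coef)
  show "cls' A ` coef_hom W' Q.C A = deformations k' \<Gamma> T n \<rho>' A"
    if "coef_obj k' W' A" for A :: "('u, 'l, 'v) coef_alg"
    by (rule completed_tensor_versal[OF that])
  show "bij_betw (cls' D') (coef_hom W' Q.C D') (deformations k' \<Gamma> T n \<rho>' D')"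
    using completed_tensor_dual_inj completed_tensor_versal[OF D'_coef] by (simp add: bij_betw_def)
qed

lemma tensor_max_ideal_maximal: "maximalideal (tensor_max_ideal W k' \<iota> W' \<phi> R) t.\<Omega>"
  unfolding tensor_max_ideal_def by (rule Q.m_max)

lemma tensor_max_ideal_unique:
  assumes M: "maximalideal M t.\<Omega>" and "\<forall>x\<in>max_ideal W'. t.pure x \<one>\<^bsub>R\<^esub> \<in> M" "\<forall>r\<in>max_ideal R. t.pure \<one>\<^bsub>W'\<^esub> r \<in> M"
  shows "M = tensor_max_ideal W k' \<iota> W' \<phi> R"
proof -
  have "tensor_max_ideal W k' \<iota> W' \<phi> R \<subseteq> M"
    by (rule tres(5)[OF _ maximalideal.axioms(1)[OF M]]) (use assms in auto)
  thus ?thesis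
    using maximalideal.I_maximal[OF tensor_max_ideal_maximal maximalideal.axioms(1)[OF M]]
      maximalideal.I_notcarr[OF M] ideal.axioms(1)[OF maximalideal.axioms(1)[OF M], THEN additive_subgroup.a_subset] by blast
qed

end

theorem theorem2p2:
  fixes k :: "'k ring" and W :: "('w, 'k) res_ring"
    and k' :: "'l ring" and W' :: "('v, 'l) res_ring"
    and \<Gamma> :: "'g monoid" and T :: "'g topology"
    and p n :: nat and \<rho> :: "'g \<Rightarrow> nat \<times> nat \<Rightarrow> 'k"
    and \<iota> :: "'k \<Rightarrow> 'l" and \<phi> :: "'w \<Rightarrow> 'v"
    and R :: "('r, 'k, 'w) coef_alg"
  assumes "field k" and "p > 0" and "char_is k p"
    and "complete_local_noetherian k W"
    and "profinite_group \<Gamma> T" and "p_finite \<Gamma> T p"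
    and "n > 0"
    and "\<rho> \<in> hom \<Gamma> (GL n k)"
    and "continuous_map T (discrete_topology (carrier (GL n k))) \<rho>"
    and "field k'" and "\<iota> \<in> ring_hom k k'"
    and "complete_local_noetherian k' W'"
    and "\<phi> \<in> local_hom W W'"
    and "\<forall>w\<in>carrier W. residue W' (\<phi> w) = \<iota> (residue W w)"
    and "versal_deformation_ring TYPE(nat \<Rightarrow> 'k) k W \<Gamma> T n \<rho> R"
  shows "let \<Omega> = tensor_ring W W' \<phi> R (scalar R);
             m\<^sub>\<Omega> = tensor_max_ideal W k' \<iota> W' \<phi> R;
             R' = completed_tensor W k' \<iota> W' \<phi> R;
             \<rho>' = push_lift n \<iota> \<rho>
         in maximalideal m\<^sub>\<Omega> \<Omega> \<and>
            (\<forall>M. maximalideal M \<Omega> \<and>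
                 (\<forall>x\<in>max_ideal W'. pure_tensor W W' \<phi> R (scalar R) x \<one>\<^bsub>R\<^esub> \<in> M) \<and>
                 (\<forall>r\<in>max_ideal R. pure_tensor W W' \<phi> R (scalar R) \<one>\<^bsub>W'\<^esub> r \<in> M)
               \<longrightarrow> M = m\<^sub>\<Omega>) \<and>
            versal_deformation_ring TYPE('u) k' W' \<Gamma> T n \<rho>' R'"
proof -
  obtain \<nu> where R: "coef_obj k W R" and \<nu>: "\<nu> \<in> lifts \<Gamma> T n \<rho> R"
    and v: "\<forall>A :: (nat \<Rightarrow> 'k, 'k, 'w) coef_alg. coef_obj k W A \<longrightarrow>
           (\<lambda>\<alpha>. deformation_class k \<Gamma> T n \<rho> A (push_lift n \<alpha> \<nu>)) ` coef_hom W R A = deformations k \<Gamma> T n \<rho> A"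
    and b: "bij_betw (\<lambda>\<alpha>. deformation_class k \<Gamma> T n \<rho> (dual_numbers k W) (push_lift n \<alpha> \<nu>))
          (coef_hom W R (dual_numbers k W)) (deformations k \<Gamma> T n \<rho> (dual_numbers k W))"
    using assms(15) unfolding versal_deformation_ring_def by blast
  interpret base_change k W \<Gamma> T n \<rho> R \<nu> k' W' \<iota> \<phi>
  proof (intro base_change.intro versal_lift.intro base_change_axioms.intro)
    show "group \<Gamma>" "topspace T = carrier \<Gamma>" using assms(5) by (simp_all add: profinite_group_def)
    show "\<phi> \<in> ring_hom W W'" using assms(13) by (simp add: local_hom_def)
    show "residue W' (\<phi> w) = \<iota> (residue W w)" if "w \<in> carrier W" for w using assms(14) that by blast
    show "(\<lambda>\<alpha>. deformation_class k \<Gamma> T n \<rho> A (push_lift n \<alpha> \<nu>)) ` coef_hom W R A = deformations k \<Gamma> T n \<rho> A"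
      if "coef_obj k W A" for A :: "(nat \<Rightarrow> 'k, 'k, 'w) coef_alg" using v that by blast
  qed (fact assms R \<nu> b)+
  show ?thesis
    unfolding Let_def completed_tensor_eq
    using tensor_max_ideal_maximal tensor_max_ideal_unique completed_tensor_versal_deformation_ring by blast
qed

end
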